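(* Let $f$ be the restriction to a compact invariant set $X$ of a $C^1$ random map of an $m$-dimensional Riemannian manifold satisfying $\int(\log^+\|Df_\omega\|_\infty+\log^+\|(Df_\omega)^{-1}\|_\infty)\,d\mathbb P<\infty$. Let $\mu\in\mathcal I(f)$ be ergodic. (i) If $\lambda_1(\mu)=\lambda_m(\mu)$, then $\mu$ is quasi-irreducible and coquasi-irreducible. (ii) If $\mu$ is quasi-irreducible, then $\mu$ has no coequator of dimension $m-1$. (iii) If $\mu$ is coquasi-irreducible, then $\mu$ has no equator of dimension $m-1$. (iv) If $m=2$, then $\mu$ is quasi-irreducible if and only if $\mu$ is coquasi-irreducible.
   Context: Setting. $M$ is a Riemannian manifold of dimension $m$. $(T,\mathscr A,p)$ is a probability space and $(\Omega,\mathscr F,\mathbb P)=(T^{\mathbb N},\mathscr A^{\mathbb N},p^{\mathbb N})$. A $C^1$ random map is a measurable map $f:\Omega\times M\to M$ such that $f_\omega:=f(\omega,\cdot)=f_{\omega_0}$ depends only on the coordinate $\omega_0$ of $\omega$ and is a $C^1$ local diffeomorphism for $\mathbb P$-a.e. $\omega$. Put $f^0_\omega=\mathrm{id}$, $f^n_\omega=f_{\omega_{n-1}}\circ\dots\circ f_{\omega_0}$. $X\subset M$ is compact with $f_\omega(X)\subset X$ for $\mathbb P$-a.e. $\omega$; $f$ also denotes the restriction to $\Omega\times X$. $\|Df_\omega\|_\infty=\sup_{x\in X}\|Df_\omega(x)\|$, $\|(Df_\omega)^{-1}\|_\infty=\sup_{x\in X}\|Df_\omega(x)^{-1}\|$.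 $\mathcal I(f)$ is the set of $f$-stationary Borel probability measures on $X$ ($\mu=\int (f_\omega)_*\mu\,d\mathbb P$); ergodic means extreme point of $\mathcal I(f)$. Lyapunov exponents $\lambda_1(\mu)\ge\dots\ge\lambda_m(\mu)$ are defined by $\sum_{i=1}^k\lambda_i(\mu)=\lim_n\frac1n\int\log\|\wedge^kDf^n_\omega(x)\|\,d\mathbb P\,d\mu$ for $k=1,\dots,m$. Tangent side: $\hat X=P(T_XM)$, points $(x,\hat v)$ with $v\in T_xM$ unit; $\hat f_\omega(x,\hat v)=(f_\omega(x),Df_\omega(x)\hat v)$; $\mathcal I_\mu(\hat f)$ is the set of $\hat f$-stationary probability measures projecting to $\mu$; $\phi_f(x,\hat v)=\int\log\|Df_\omega(x)v\|\,d\mathbb P$. $\mu$ is quasi-irreducible if $\int\phi_f\,d\nu=\lambda_1(\mu)$ for all $\nu\in\mathcal I_\mu(\hat f)$. The equator of an ergodic $\mu$ is the largest (mod $\mu$-null sets) measurable subbundle $\mathcal L\subset T_XM$ with $Df_\omega(x)\mathcal L_x=\mathcal L_{f_\omega(x)}$ for $(\mathbb P\times\mu)$-a.e. $(\omega,x)$ and $\lambda_1(\mu|_{\mathcal L}):=\lim_n\frac1n\int\log\|Df^n_\omega(x)|_{\mathcal L_x}\|\,d\mathbb P\,d\mu<\lambda_1(\mu)$ (the zero bundle has exponent $-\infty$). Cotangent side: $(Df_\omega(x)^{-1})^*\xi=\xi\circ Df_\omega(x)^{-1}$; $\tilde X=P(T_X^*M)$; $\tilde f_\omega(x,[\xi])=(f_\omega(x),[(Df_\omega(x)^{-1})^*\xi])$;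 $\mathcal I_\mu(\tilde f)$ is the set of $\tilde f$-stationary probability measures projecting to $\mu$; $\tilde\phi_f(x,[\xi])=\int\log\|(Df_\omega(x)^{-1})^*\xi\|\,d\mathbb P$ ($\xi$ unit). $\mu$ is coquasi-irreducible if $\int\tilde\phi_f\,d\tilde\mu=-\lambda_m(\mu)$ for all $\tilde\mu\in\mathcal I_\mu(\tilde f)$. The coequator of an ergodic $\mu$ is the largest (mod $\mu$-null sets) measurable subbundle $\tilde{\mathcal L}\subset T_X^*M$ with $(Df_\omega(x)^{-1})^*\tilde{\mathcal L}_x=\tilde{\mathcal L}_{f_\omega(x)}$ for $(\mathbb P\times\mu)$-a.e. $(\omega,x)$ and $\tilde\lambda_1(\mu|_{\tilde{\mathcal L}}):=\lim_n\frac1n\int\log\|(Df^n_\omega(x)^{-1})^*|_{\tilde{\mathcal L}_x}\|\,d\mathbb P\,d\mu<-\lambda_m(\mu)$ (the zero bundle again having exponent $-\infty$). The dimension of an equator or coequator is its $\mu$-a.e. constant fibre dimension.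
   Formalization: Parts (ii) and (iii) are stated for m ≥ 2 only: when m = 1 the zero bundle, with exponent −∞, is always the equator and the coequator, of dimension 0 = m−1, while μ is always quasi-irreducible and coquasi-irreducible, so both claims fail there. *)

theory Defs
  imports "HOL-Probability.Probability"
begin

text \<open>The manifold is the whole (Hausdorff, second countable) type \<open>'a\<close>, modelled on \<open>'e\<close>; its
  dimension is \<open>DIM('e)\<close>. A chart is a pair of an open domain and a coordinate map, whose values
  outside the domain are irrelevant.\<close>

type_synonym ('a, 'e) chart = "'a set \<times> ('a \<Rightarrow> 'e)"

text \<open>\<open>metric M x\<close> is the inner product of the tangent space at \<open>x\<close>, which is identified with
  \<open>'e\<close> as explained at \<open>chart_at\<close>.\<close>

record ('a, 'e) rmanifold =
  charts :: "('a, 'e) chart set"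
  metric :: "'a \<Rightarrow> 'e \<Rightarrow> 'e \<Rightarrow> real"

primrec C_k_on :: "nat \<Rightarrow> 'e::euclidean_space set \<Rightarrow> ('e \<Rightarrow> 'b::real_normed_vector) \<Rightarrow> bool" where
  "C_k_on 0 S h \<longleftrightarrow> continuous_on S h"
| "C_k_on (Suc k) S h \<longleftrightarrow>
     (\<forall>y\<in>S. h differentiable (at y)) \<and> (\<forall>v. C_k_on k S (\<lambda>y. frechet_derivative h (at y) v))"

definition chart_inv :: "('a, 'e) chart \<Rightarrow> 'e \<Rightarrow> 'a" where
  "chart_inv c = inv_into (fst c) (snd c)"

definition is_chart :: "('a::topological_space, 'e::euclidean_space) chart \<Rightarrow> bool" where
  "is_chart c \<longleftrightarrow> open (fst c) \<and> open (snd c ` fst c) \<and>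
     homeomorphism (fst c) (snd c ` fst c) (snd c) (chart_inv c)"

definition smooth_atlas :: "('a::topological_space, 'e::euclidean_space) chart set \<Rightarrow> bool" where
  "smooth_atlas \<A> \<longleftrightarrow> (\<forall>c\<in>\<A>. is_chart c) \<and> (\<Union>c\<in>\<A>. fst c) = UNIV \<and>
     (\<forall>c\<in>\<A>. \<forall>d\<in>\<A>. \<forall>k. C_k_on k (snd c ` (fst c \<inter> fst d)) (snd d \<circ> chart_inv c))"

text \<open>The tangent space at \<open>x\<close> is identified with \<open>'e\<close> by means of the chosen chart
  \<open>chart_at M x\<close>. The choice need not depend on \<open>x\<close> in a measurable way, so every measurability or
  smoothness condition on objects of the tangent bundle is expressed in the charts of the atlas.\<close>

definition chart_at :: "('a, 'e) rmanifold \<Rightarrow> 'a \<Rightarrow> ('a, 'e) chart" where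
  "chart_at M x = (SOME c. c \<in> charts M \<and> x \<in> fst c)"

definition coord_change :: "('a, 'e::euclidean_space) chart \<Rightarrow> ('a, 'e) chart \<Rightarrow> 'a \<Rightarrow> 'e \<Rightarrow> 'e" where
  "coord_change c d x = frechet_derivative (snd d \<circ> chart_inv c) (at (snd c x))"

text \<open>From the coordinates in the chart \<open>c\<close> to the tangent space, respectively to the cotangent space.
  A covector \<open>\<xi> :: 'e\<close> stands for the functional \<open>\<lambda>v. \<xi> \<bullet> v\<close>; in these terms
  \<open>\<xi> \<circ> B\<close> is \<open>adjoint B \<xi>\<close>.\<close>

definition tangent_frame :: "('a, 'e::euclidean_space) rmanifold \<Rightarrow> ('a, 'e) chart \<Rightarrow> 'a \<Rightarrow> 'e \<Rightarrow> 'e" where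
  "tangent_frame M c x = coord_change c (chart_at M x) x"

definition cotangent_frame :: "('a, 'e::euclidean_space) rmanifold \<Rightarrow> ('a, 'e) chart \<Rightarrow> 'a \<Rightarrow> 'e \<Rightarrow> 'e" where
  "cotangent_frame M c x = adjoint (inv (tangent_frame M c x))"

definition inner_product :: "('e::euclidean_space \<Rightarrow> 'e \<Rightarrow> real) \<Rightarrow> bool" where
  "inner_product b \<longleftrightarrow>
     bilinear b \<and> (\<forall>v w. b v w = b w v) \<and> (\<forall>v. v \<noteq> 0 \<longrightarrow> b v v > 0)"

definition riemannian_manifold ::
    "('a::{t2_space,second_countable_topology}, 'e::euclidean_space) rmanifold \<Rightarrow> bool" where
  "riemannian_manifold M \<longleftrightarrow> smooth_atlas (charts M) \<and> (\<forall>x. inner_product (metric M x)) \<and>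
     (\<forall>c\<in>charts M. \<forall>v w k. C_k_on k (snd c ` fst c)
        (\<lambda>y. let x = chart_inv c y
             in metric M x (tangent_frame M c x v) (tangent_frame M c x w)))"

definition C1_map_on ::
    "('a::topological_space, 'e::euclidean_space) rmanifold \<Rightarrow> 'a set \<Rightarrow> ('a \<Rightarrow> 'a) \<Rightarrow> bool" where
  "C1_map_on M U h \<longleftrightarrow> continuous_on U h \<and>
     (\<forall>c\<in>charts M. \<forall>d\<in>charts M.
        C_k_on 1 (snd c ` (U \<inter> fst c \<inter> h -` fst d)) (snd d \<circ> h \<circ> chart_inv c))"

definition C1_local_diffeo ::
    "('a::topological_space, 'e::euclidean_space) rmanifold \<Rightarrow> ('a \<Rightarrow> 'a) \<Rightarrow> bool" where
  "C1_local_diffeo M h \<longleftrightarrow>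
     (\<forall>x. \<exists>U. open U \<and> x \<in> U \<and> open (h ` U) \<and> inj_on h U \<and>
        C1_map_on M U h \<and> C1_map_on M (h ` U) (inv_into U h))"

definition tderiv :: "('a, 'e::euclidean_space) rmanifold \<Rightarrow> ('a \<Rightarrow> 'a) \<Rightarrow> 'a \<Rightarrow> 'e \<Rightarrow> 'e" where
  "tderiv M h x = frechet_derivative (snd (chart_at M (h x)) \<circ> h \<circ> chart_inv (chart_at M x))
     (at (snd (chart_at M x) x))"

definition coderiv :: "('a, 'e::euclidean_space) rmanifold \<Rightarrow> ('a \<Rightarrow> 'a) \<Rightarrow> 'a \<Rightarrow> 'e \<Rightarrow> 'e" where
  "coderiv M h x = adjoint (inv (tderiv M h x))"

definition tnorm :: "('a, 'e) rmanifold \<Rightarrow> 'a \<Rightarrow> 'e \<Rightarrow> real" where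
  "tnorm M x v = sqrt (metric M x v v)"

definition conorm :: "('a, 'e::euclidean_space) rmanifold \<Rightarrow> 'a \<Rightarrow> 'e \<Rightarrow> real" where
  "conorm M x \<xi> = (SUP v\<in>{v. tnorm M x v \<le> 1}. \<bar>\<xi> \<bullet> v\<bar>)"

definition opnorm_on :: "'e set \<Rightarrow> ('e \<Rightarrow> real) \<Rightarrow> ('e \<Rightarrow> real) \<Rightarrow> ('e \<Rightarrow> 'e) \<Rightarrow> real" where
  "opnorm_on L N N' A = (SUP v\<in>{v\<in>L. N v \<le> 1}. N' (A v))"

text \<open>A list of pairs \<open>(c, v)\<close> stands for the sum of the \<open>k\<close>-vectors
  \<open>c v\<^sub>0 \<and> \<dots> \<and> v\<^sub>k\<^sub>-\<^sub>1\<close>. The norm is that of the inner product on the exterior power induced by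
  \<open>b\<close>, for which \<open>v\<^sub>0 \<and> \<dots> \<and> v\<^sub>k\<^sub>-\<^sub>1\<close> and \<open>w\<^sub>0 \<and> \<dots> \<and> w\<^sub>k\<^sub>-\<^sub>1\<close> have the inner product
  \<open>det (b v\<^sub>i w\<^sub>j)\<close>; lists at distance \<open>0\<close> represent the same element.\<close>

definition nat_det :: "nat \<Rightarrow> (nat \<Rightarrow> nat \<Rightarrow> real) \<Rightarrow> real" where
  "nat_det k a = (\<Sum>q | q permutes {..<k}. of_int (sign q) * (\<Prod>i<k. a i (q i)))"

definition kvec_norm :: "nat \<Rightarrow> ('e \<Rightarrow> 'e \<Rightarrow> real) \<Rightarrow> (real \<times> (nat \<Rightarrow> 'e)) list \<Rightarrow> real" where
  "kvec_norm k b \<xi> =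
     sqrt (\<Sum>(c, v)\<leftarrow>\<xi>. \<Sum>(d, w)\<leftarrow>\<xi>. c * d * nat_det k (\<lambda>i j. b (v i) (w j)))"

definition kvec_map :: "('e \<Rightarrow> 'e) \<Rightarrow> (real \<times> (nat \<Rightarrow> 'e)) list \<Rightarrow> (real \<times> (nat \<Rightarrow> 'e)) list" where
  "kvec_map A = map (\<lambda>(c, v). (c, A \<circ> v))"

definition wedge_opnorm ::
    "nat \<Rightarrow> ('e \<Rightarrow> 'e \<Rightarrow> real) \<Rightarrow> ('e \<Rightarrow> 'e \<Rightarrow> real) \<Rightarrow> ('e \<Rightarrow> 'e) \<Rightarrow> real" where
  "wedge_opnorm k b b' A = (SUP \<xi>\<in>{\<xi>. kvec_norm k b \<xi> \<le> 1}. kvec_norm k b' (kvec_map A \<xi>))"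

text \<open>A random map is given by \<open>f :: 't \<Rightarrow> 'a \<Rightarrow> 'a\<close>; the map at \<open>\<omega>\<close> is \<open>f (\<omega> 0)\<close>.

  Derivatives are only meaningful for almost every \<open>\<omega>\<close>, and the exceptional set need not be
  measurable. Bochner integrals are therefore taken with respect to the completed measure.\<close>

definition path_measure :: "'t measure \<Rightarrow> (nat \<Rightarrow> 't) measure" where
  "path_measure p = (\<Pi>\<^sub>M n\<in>UNIV. p)"

primrec orbit_map :: "('t \<Rightarrow> 'a \<Rightarrow> 'a) \<Rightarrow> nat \<Rightarrow> (nat \<Rightarrow> 't) \<Rightarrow> 'a \<Rightarrow> 'a" where
  "orbit_map f 0 \<omega> = id"
| "orbit_map f (Suc n) \<omega> = f (\<omega> n) \<circ> orbit_map f n \<omega>"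

definition C1_random_map :: "('a::topological_space, 'e::euclidean_space) rmanifold \<Rightarrow> 't measure \<Rightarrow>
    ('t \<Rightarrow> 'a \<Rightarrow> 'a) \<Rightarrow> bool" where
  "C1_random_map M p f \<longleftrightarrow> case_prod f \<in> p \<Otimes>\<^sub>M borel \<rightarrow>\<^sub>M borel \<and>
     (AE \<omega> in path_measure p. C1_local_diffeo M (f (\<omega> 0)))"

definition log_plus :: "real \<Rightarrow> real" where
  "log_plus r = max 0 (ln r)"

definition deriv_sup :: "('a, 'e::euclidean_space) rmanifold \<Rightarrow> 'a set \<Rightarrow> ('a \<Rightarrow> 'a) \<Rightarrow> real" where
  "deriv_sup M X h = (SUP x\<in>X. opnorm_on UNIV (tnorm M x) (tnorm M (h x)) (tderiv M h x))"

definition deriv_inv_sup :: "('a, 'e::euclidean_space) rmanifold \<Rightarrow> 'a set \<Rightarrow> ('a \<Rightarrow> 'a) \<Rightarrow> real" where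
  "deriv_inv_sup M X h = (SUP x\<in>X. opnorm_on UNIV (tnorm M (h x)) (tnorm M x) (inv (tderiv M h x)))"

definition stationary :: "'t measure \<Rightarrow> ('t \<Rightarrow> 'b \<Rightarrow> 'b) \<Rightarrow> 'b measure \<Rightarrow> bool" where
  "stationary p F \<nu> \<longleftrightarrow>
     (\<forall>B\<in>sets \<nu>. emeasure \<nu> B = (\<integral>\<^sup>+\<omega>. emeasure (distr \<nu> \<nu> (F (\<omega> 0))) B \<partial>path_measure p))"

text \<open>Measures on \<open>X\<close> are represented by Borel measures on \<open>'a\<close> concentrated on \<open>X\<close>.\<close>

definition stationary_on ::
    "'t measure \<Rightarrow> ('t \<Rightarrow> 'a \<Rightarrow> 'a) \<Rightarrow> 'a::topological_space set \<Rightarrow> 'a measure set" where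
  "stationary_on p f X =
     {\<mu>. sets \<mu> = sets borel \<and> prob_space \<mu> \<and> emeasure \<mu> X = 1 \<and> stationary p f \<mu>}"

definition ergodic_on ::
    "'t measure \<Rightarrow> ('t \<Rightarrow> 'a \<Rightarrow> 'a) \<Rightarrow> 'a::topological_space set \<Rightarrow> 'a measure \<Rightarrow> bool" where
  "ergodic_on p f X \<mu> \<longleftrightarrow> \<mu> \<in> stationary_on p f X \<and>
     (\<forall>\<mu>\<^sub>1\<in>stationary_on p f X. \<forall>\<mu>\<^sub>2\<in>stationary_on p f X. \<forall>s\<in>{0<..<1}.
        (\<forall>B\<in>sets borel. measure \<mu> B = s * measure \<mu>\<^sub>1 B + (1 - s) * measure \<mu>\<^sub>2 B) \<longrightarrow>
        \<mu>\<^sub>1 = \<mu> \<and> \<mu>\<^sub>2 = \<mu>)"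

text \<open>For \<open>k = 0\<close> the limit is \<open>0\<close>, so that \<open>lyap_sum\<close> at \<open>k\<close> is the sum of the first \<open>k\<close>
  exponents.\<close>

definition lyap_sum :: "('a, 'e::euclidean_space) rmanifold \<Rightarrow> 't measure \<Rightarrow> ('t \<Rightarrow> 'a \<Rightarrow> 'a) \<Rightarrow>
    'a measure \<Rightarrow> nat \<Rightarrow> real" where
  "lyap_sum M p f \<mu> k = lim (\<lambda>n. 1 / real n *
     (\<integral>(\<omega>, x). ln (wedge_opnorm k (metric M x) (metric M (orbit_map f n \<omega> x))
                   (tderiv M (orbit_map f n \<omega>) x)) \<partial>completion (path_measure p \<Otimes>\<^sub>M \<mu>)))"

definition lyapunov :: "('a, 'e::euclidean_space) rmanifold \<Rightarrow> 't measure \<Rightarrow> ('t \<Rightarrow> 'a \<Rightarrow> 'a) \<Rightarrow>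
    'a measure \<Rightarrow> nat \<Rightarrow> real" where
  "lyapunov M p f \<mu> i = lyap_sum M p f \<mu> i - lyap_sum M p f \<mu> (i - 1)"

text \<open>A point of a projective bundle is a pair of a base point and a line through the origin of the
  fibre. A set is measurable if, in the trivialization over each chart, its cone is a Borel set;
  \<open>\<theta>\<close> is \<open>tangent_frame M\<close> or \<open>cotangent_frame M\<close>.\<close>

definition proj_bundle :: "('a::topological_space, 'e::euclidean_space) rmanifold \<Rightarrow>
    (('a, 'e) chart \<Rightarrow> 'a \<Rightarrow> 'e \<Rightarrow> 'e) \<Rightarrow> ('a \<times> 'e set) measure" where
  "proj_bundle M \<theta> = sigma {(x, l). subspace l \<and> dim l = 1}
     {B. B \<subseteq> {(x, l). subspace l \<and> dim l = 1} \<and>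
         (\<forall>c\<in>charts M. {(x, w). x \<in> fst c \<and> w \<noteq> 0 \<and> (x, span {\<theta> c x w}) \<in> B} \<in> sets borel)}"

definition proj_map :: "(('a \<Rightarrow> 'a) \<Rightarrow> 'a \<Rightarrow> 'e \<Rightarrow> 'e) \<Rightarrow> ('a \<Rightarrow> 'a) \<Rightarrow> 'a \<times> 'e set \<Rightarrow> 'a \<times> 'e set" where
  "proj_map D h = (\<lambda>(x, l). (h x, D h x ` l))"

definition stationary_lifts :: "('a::topological_space, 'e::euclidean_space) rmanifold \<Rightarrow>
    (('a, 'e) chart \<Rightarrow> 'a \<Rightarrow> 'e \<Rightarrow> 'e) \<Rightarrow> (('a \<Rightarrow> 'a) \<Rightarrow> 'a \<Rightarrow> 'e \<Rightarrow> 'e) \<Rightarrow> 't measure \<Rightarrow>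
    ('t \<Rightarrow> 'a \<Rightarrow> 'a) \<Rightarrow> 'a measure \<Rightarrow> ('a \<times> 'e set) measure set" where
  "stationary_lifts M \<theta> D p f \<mu> =
     {\<nu>. sets \<nu> = sets (proj_bundle M \<theta>) \<and> prob_space \<nu> \<and>
         stationary p (\<lambda>t. proj_map D (f t)) \<nu> \<and> distr \<nu> borel fst = \<mu>}"

text \<open>\<open>N x\<close> is the norm of the fibre over \<open>x\<close>; the integrand does not depend on the choice between
  the two unit vectors of the line.\<close>

definition log_growth :: "('a \<Rightarrow> 'e \<Rightarrow> real) \<Rightarrow> (('a \<Rightarrow> 'a) \<Rightarrow> 'a \<Rightarrow> 'e \<Rightarrow> 'e) \<Rightarrow> 't measure \<Rightarrow>
    ('t \<Rightarrow> 'a \<Rightarrow> 'a) \<Rightarrow> 'a \<times> 'e set \<Rightarrow> real" where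
  "log_growth N D p f = (\<lambda>(x, l).
     let v = (SOME v. v \<in> l \<and> N x v = 1)
     in \<integral>\<omega>. ln (N (f (\<omega> 0) x) (D (f (\<omega> 0)) x v)) \<partial>completion (path_measure p))"

definition quasi_irreducible :: "('a::topological_space, 'e::euclidean_space) rmanifold \<Rightarrow>
    't measure \<Rightarrow> ('t \<Rightarrow> 'a \<Rightarrow> 'a) \<Rightarrow> 'a measure \<Rightarrow> bool" where
  "quasi_irreducible M p f \<mu> \<longleftrightarrow>
     (\<forall>\<nu>\<in>stationary_lifts M (tangent_frame M) (tderiv M) p f \<mu>.
        (\<integral>z. log_growth (tnorm M) (tderiv M) p f z \<partial>\<nu>) = lyapunov M p f \<mu> 1)"

definition coquasi_irreducible :: "('a::topological_space, 'e::euclidean_space) rmanifold \<Rightarrow>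
    't measure \<Rightarrow> ('t \<Rightarrow> 'a \<Rightarrow> 'a) \<Rightarrow> 'a measure \<Rightarrow> bool" where
  "coquasi_irreducible M p f \<mu> \<longleftrightarrow>
     (\<forall>\<nu>\<in>stationary_lifts M (cotangent_frame M) (coderiv M) p f \<mu>.
        (\<integral>z. log_growth (conorm M) (coderiv M) p f z \<partial>\<nu>) = - lyapunov M p f \<mu> DIM('e))"

definition measurable_section :: "('a::topological_space, 'e::euclidean_space) rmanifold \<Rightarrow>
    (('a, 'e) chart \<Rightarrow> 'a \<Rightarrow> 'e \<Rightarrow> 'e) \<Rightarrow> ('a \<Rightarrow> 'e) \<Rightarrow> bool" where
  "measurable_section M \<theta> s \<longleftrightarrow>
     (\<forall>c\<in>charts M. (\<lambda>x. inv (\<theta> c x) (s x)) \<in> borel_measurable (restrict_space borel (fst c)))"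

definition measurable_subbundle :: "('a::topological_space, 'e::euclidean_space) rmanifold \<Rightarrow>
    (('a, 'e) chart \<Rightarrow> 'a \<Rightarrow> 'e \<Rightarrow> 'e) \<Rightarrow> 'a set \<Rightarrow> ('a \<Rightarrow> 'e set) \<Rightarrow> bool" where
  "measurable_subbundle M \<theta> X L \<longleftrightarrow>
     (\<exists>s :: nat \<Rightarrow> 'a \<Rightarrow> 'e. (\<forall>i. measurable_section M \<theta> (s i)) \<and>
        (\<forall>x\<in>X. L x = span ((\<lambda>i. s i x) ` {..<DIM('e)})))"

definition invariant_subbundle :: "(('a \<Rightarrow> 'a) \<Rightarrow> 'a \<Rightarrow> 'e \<Rightarrow> 'e) \<Rightarrow> 't measure \<Rightarrow>
    ('t \<Rightarrow> 'a \<Rightarrow> 'a) \<Rightarrow> 'a measure \<Rightarrow> ('a \<Rightarrow> 'e set) \<Rightarrow> bool" where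
  "invariant_subbundle D p f \<mu> L \<longleftrightarrow>
     (AE (\<omega>, x) in path_measure p \<Otimes>\<^sub>M \<mu>. D (f (\<omega> 0)) x ` L x = L (f (\<omega> 0) x))"

definition subbundle_exponent :: "('a \<Rightarrow> 'e::euclidean_space \<Rightarrow> real) \<Rightarrow>
    (('a \<Rightarrow> 'a) \<Rightarrow> 'a \<Rightarrow> 'e \<Rightarrow> 'e) \<Rightarrow> 't measure \<Rightarrow> ('t \<Rightarrow> 'a \<Rightarrow> 'a) \<Rightarrow> 'a measure \<Rightarrow>
    ('a \<Rightarrow> 'e set) \<Rightarrow> ereal" where
  "subbundle_exponent N D p f \<mu> L =
     (if AE x in \<mu>. L x = {0} then - \<infinity>
      else ereal (lim (\<lambda>n. 1 / real n *
        (\<integral>(\<omega>, x). ln (opnorm_on (L x) (N x) (N (orbit_map f n \<omega> x)) (D (orbit_map f n \<omega>) x))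
           \<partial>completion (path_measure p \<Otimes>\<^sub>M \<mu>)))))"

definition slow_subbundle :: "('a::topological_space, 'e::euclidean_space) rmanifold \<Rightarrow>
    (('a, 'e) chart \<Rightarrow> 'a \<Rightarrow> 'e \<Rightarrow> 'e) \<Rightarrow> ('a \<Rightarrow> 'e \<Rightarrow> real) \<Rightarrow> (('a \<Rightarrow> 'a) \<Rightarrow> 'a \<Rightarrow> 'e \<Rightarrow> 'e) \<Rightarrow>
    't measure \<Rightarrow> ('t \<Rightarrow> 'a \<Rightarrow> 'a) \<Rightarrow> 'a set \<Rightarrow> 'a measure \<Rightarrow> real \<Rightarrow> ('a \<Rightarrow> 'e set) \<Rightarrow> bool" where
  "slow_subbundle M \<theta> N D p f X \<mu> r L \<longleftrightarrow>
     measurable_subbundle M \<theta> X L \<and> invariant_subbundle D p f \<mu> L \<and>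
     subbundle_exponent N D p f \<mu> L < ereal r"

definition is_equator :: "('a::topological_space, 'e::euclidean_space) rmanifold \<Rightarrow> 't measure \<Rightarrow>
    ('t \<Rightarrow> 'a \<Rightarrow> 'a) \<Rightarrow> 'a set \<Rightarrow> 'a measure \<Rightarrow> ('a \<Rightarrow> 'e set) \<Rightarrow> bool" where
  "is_equator M p f X \<mu> L \<longleftrightarrow>
     (let slow = slow_subbundle M (tangent_frame M) (tnorm M) (tderiv M) p f X \<mu> (lyapunov M p f \<mu> 1)
      in slow L \<and> (\<forall>L'. slow L' \<longrightarrow> (AE x in \<mu>. L' x \<subseteq> L x)))"

definition is_coequator :: "('a::topological_space, 'e::euclidean_space) rmanifold \<Rightarrow> 't measure \<Rightarrow>
    ('t \<Rightarrow> 'a \<Rightarrow> 'a) \<Rightarrow> 'a set \<Rightarrow> 'a measure \<Rightarrow> ('a \<Rightarrow> 'e set) \<Rightarrow> bool" where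
  "is_coequator M p f X \<mu> L \<longleftrightarrow>
     (let slow = slow_subbundle M (cotangent_frame M) (conorm M) (coderiv M) p f X \<mu>
                   (- lyapunov M p f \<mu> DIM('e))
      in slow L \<and> (\<forall>L'. slow L' \<longrightarrow> (AE x in \<mu>. L' x \<subseteq> L x)))"

end

theory Submission
  imports Defs
begin

text \<open>In a measurable orthonormal frame the derivative is a matrix cocycle \<open>A\<close>, and its action on
  covectors is the contragredient cocycle \<open>B = (A\<^sup>-\<^sup>1)\<^sup>*\<close>. The Hodge star identifies
  \<open>\<Lambda>\<^sup>m\<^sup>-\<^sup>1 A\<close> with \<open>det A \<cdot> B\<close>, so \<open>\<lambda>\<^sub>1\<close> and \<open>- \<lambda>\<^sub>m\<close> are the growth rates of
  \<open>\<integral> log \<parallel>A\<^sup>n\<parallel>\<close> and \<open>\<integral> log \<parallel>(A\<^sup>n)\<^sup>-\<^sup>1\<parallel>\<close>.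

  For a stationary lift \<open>\<nu>\<close>, the integral of \<open>\<phi>\<close> is \<open>1/n \<integral> log \<parallel>A\<^sup>n v\<parallel>\<close> for every \<open>n\<close>. It lies between
  \<open>\<lambda>\<^sub>m\<close> and \<open>\<lambda>\<^sub>1\<close>, whence (i). For (ii), the annihilator of a \<open>B\<close>-invariant hyperplane bundle \<open>L\<close> is
  an \<open>A\<close>-invariant line field \<open>e\<close>, and pointwise
  \<open>\<parallel>(A\<^sup>n)\<^sup>-\<^sup>1\<parallel> \<parallel>A\<^sup>n e\<parallel> \<le> \<parallel>B\<^sup>n restricted to L\<parallel> \<parallel>A\<^sup>n\<parallel>\<close>. If \<open>\<mu>\<close> is quasi-irreducible, then \<open>e\<close> grows
  at the rate \<open>\<lambda>\<^sub>1\<close>, the factors \<open>\<parallel>A\<^sup>n e\<parallel>\<close> and \<open>\<parallel>A\<^sup>n\<parallel>\<close> cancel in the limit, and the exponent of \<open>B\<close> on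
  \<open>L\<close> is at least \<open>- \<lambda>\<^sub>m\<close>. Exchanging \<open>A\<close> and \<open>B\<close> gives (iii). In dimension two a rotation by a right
  angle conjugates \<open>A\<close> to \<open>det A \<cdot> B\<close>, so the lifts on both sides correspond, and their growth rates
  differ by \<open>\<lambda>\<^sub>1 + \<lambda>\<^sub>2\<close>. This is (iv).\<close>

section \<open>Determinants and exterior powers\<close>

text \<open>Three features of the definitions shape the work. The charts \<open>chart_at\<close>
  that identify the tangent spaces are chosen without any measurability, so a Borel orthonormal
  frame is built from a countable chart cover and every bundle object is transported to it. The
  operator \<open>lim\<close> is informative only for convergent sequences, so each exponent needs
  integrable bounds and Fekete's lemma before it can enter an inequality. Derivatives are meaningful
  only off a null set of \<omega>; there the maps are replaced by the identity, which makes every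
  matrix invertible.

  The integrated growth of an invariant line field is exactly linear in n, whereas the norms of A^n
  and of its inverse are only submultiplicative. Comparisons are therefore pointwise matrix
  inequalities at time n, integrated, divided by n and passed to the limit. Of the exterior powers
  only the orders 0, 1, m - 1 and m occur, since \<lambda>_m is the difference of the last two sums.
  The condition m \<ge> 2 in (ii) and (iii) excludes the zero bundle, which for m = 1 has dimension
  m - 1 and exponent -\<infinity>.\<close>

lemma nat_det_identical_rows:
  assumes "i < n" "j < n" "i \<noteq> j" "a i = a j"
  shows "nat_det n a = 0"
proof -
  let ?t = "Transposition.transpose i j"
  let ?P = "{q. q permutes {..<n}}"
  have t: "?t permutes {..<n}"
    using assms by (intro permutes_swap_id) auto
  have row: "a (?t k) = a k" for k
    using assms(4) by (auto simp: Transposition.transpose_def)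
  have "nat_det n a = (\<Sum>q\<in>?P. of_int (sign (q \<circ> ?t)) * (\<Prod>k<n. a k ((q \<circ> ?t) k)))"
    unfolding nat_det_def using sum_permutations_compose_right[OF t, of "\<lambda>q. of_int (sign q) * (\<Prod>k<n. a k (q k))"]
    by (simp add: comp_def)
  \<comment> \<open>Rows i and j agree, so the transposition leaves each product unchanged and flips
    only the sign; the determinant equals its own negative.\<close>
  also have "\<dots> = (\<Sum>q\<in>?P. - (of_int (sign q) * (\<Prod>k<n. a k (q k))))"
  proof (rule sum.cong[OF refl])
    fix q assume "q \<in> ?P"
    then have q: "q permutes {..<n}" by simp
    have "sign (q \<circ> ?t) = - sign q"
      using q t assms(3) by (subst sign_compose) (auto simp: sign_swap_id permutation_swap_id dest: permutes_imp_permutation[OF finite_lessThan])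
    moreover have "(\<Prod>k<n. a k ((q \<circ> ?t) k)) = (\<Prod>k<n. a (?t k) (q (?t k)))"
      by (simp add: row)
    moreover have "\<dots> = (\<Prod>k<n. a k (q k))"
      using permutes_imp_bij[OF t] by (rule prod.reindex_bij_betw[where g = "\<lambda>k. a k (q k)"])
    ultimately show "of_int (sign (q \<circ> ?t)) * (\<Prod>k<n. a k ((q \<circ> ?t) k)) = - (of_int (sign q) * (\<Prod>k<n. a k (q k)))"
      by simp
  qed
  also have "\<dots> = - nat_det n a"
    by (simp add: nat_det_def sum_negf)
  finally show ?thesis by simp
qed

lemma nat_det_permute_rows:
  assumes p: "p permutes {..<n}"
  shows "nat_det n (\<lambda>i. a (p i)) = of_int (sign p) * nat_det n a"
proof -
  let ?P = "{q. q permutes {..<n}}"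
  have "nat_det n (\<lambda>i. a (p i)) = (\<Sum>q\<in>?P. of_int (sign (q \<circ> p)) * (\<Prod>k<n. a (p k) ((q \<circ> p) k)))"
    unfolding nat_det_def using sum_permutations_compose_right[OF p, of "\<lambda>q. of_int (sign q) * (\<Prod>k<n. a (p k) (q k))"]
    by (simp add: comp_def)
  also have "\<dots> = (\<Sum>q\<in>?P. of_int (sign p) * (of_int (sign q) * (\<Prod>k<n. a k (q k))))"
  proof (rule sum.cong[OF refl])
    fix q assume "q \<in> ?P"
    then have q: "q permutes {..<n}" by simp
    have "sign (q \<circ> p) = sign q * sign p"
      using p q by (intro sign_compose) (auto dest: permutes_imp_permutation[OF finite_lessThan])
    moreover have "(\<Prod>k<n. a (p k) ((q \<circ> p) k)) = (\<Prod>k<n. a k (q k))"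
      using permutes_imp_bij[OF p] by (simp add: prod.reindex_bij_betw[where g = "\<lambda>k. a k (q k)"])
    ultimately show "of_int (sign (q \<circ> p)) * (\<Prod>k<n. a (p k) ((q \<circ> p) k)) = of_int (sign p) * (of_int (sign q) * (\<Prod>k<n. a k (q k)))"
      by simp
  qed
  finally show ?thesis
    by (simp add: nat_det_def sum_distrib_left)
qed

text \<open>After expanding the product of row sums over all functions g, a non-injective g repeats
  a row of b and contributes nothing; the injective ones are the permutations.\<close>

lemma nat_det_mult:
  "nat_det n (\<lambda>i j. \<Sum>l<n. a i l * b l j) = nat_det n a * nat_det n b"
proof -
  let ?P = "{q. q permutes {..<n}}"
  let ?F = "Pi\<^sub>E {..<n} (\<lambda>_. {..<n})"
  have "nat_det n (\<lambda>i j. \<Sum>l<n. a i l * b l j)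
      = (\<Sum>q\<in>?P. \<Sum>g\<in>?F. of_int (sign q) * (\<Prod>i<n. a i (g i) * b (g i) (q i)))"
    unfolding nat_det_def by (subst prod_sum_PiE) (auto simp: sum_distrib_left)
  also have "\<dots> = (\<Sum>g\<in>?F. (\<Prod>i<n. a i (g i)) * nat_det n (\<lambda>i. b (g i)))"
    by (subst sum.swap) (simp add: nat_det_def sum_distrib_left prod.distrib mult_ac)
  \<comment> \<open>Members of \<open>?F\<close> are undefined off {..<n}, so a permutation occurs
    there as its restriction. Conversely, an injective g extends by the identity to a
    permutation.\<close>
  also have "\<dots> = (\<Sum>g\<in>(\<lambda>q. restrict q {..<n}) ` ?P. (\<Prod>i<n. a i (g i)) * nat_det n (\<lambda>i. b (g i)))"
  proof (rule sum.mono_neutral_right)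
    show "finite ?F" by (intro finite_PiE) auto
    show "(\<lambda>q. restrict q {..<n}) ` ?P \<subseteq> ?F"
      using permutes_in_image[of _ "{..<n}"] by fastforce
    show "\<forall>g\<in>?F - (\<lambda>q. restrict q {..<n}) ` ?P. (\<Prod>i<n. a i (g i)) * nat_det n (\<lambda>i. b (g i)) = 0"
    proof
      fix g assume g: "g \<in> ?F - (\<lambda>q. restrict q {..<n}) ` ?P"
      have "\<not> inj_on g {..<n}"
      proof
        assume inj: "inj_on g {..<n}"
        have "g ` {..<n} \<subseteq> {..<n}" using g by auto
        then have "bij_betw g {..<n} {..<n}"
          using inj endo_inj_surj[of "{..<n}" g] by (auto simp: bij_betw_def)
        then have "(\<lambda>i. if i < n then g i else i) permutes {..<n}"
          by (intro bij_imp_permutes) (auto simp: bij_betw_def inj_on_def)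
        moreover have "restrict (\<lambda>i. if i < n then g i else i) {..<n} = g"
          using g by (auto simp: fun_eq_iff restrict_def PiE_def extensional_def)
        ultimately show False using g by (metis (no_types, lifting) DiffD2 image_eqI mem_Collect_eq)
      qed
      then obtain i j where "i < n" "j < n" "i \<noteq> j" "g i = g j"
        by (auto simp: inj_on_def)
      then have "nat_det n (\<lambda>i. b (g i)) = 0"
        by (intro nat_det_identical_rows[of i n j]) auto
      then show "(\<Prod>i<n. a i (g i)) * nat_det n (\<lambda>i. b (g i)) = 0" by simp
    qed
  qed
  also have "\<dots> = (\<Sum>q\<in>?P. (\<Prod>i<n. a i (q i)) * nat_det n (\<lambda>i. b (q i)))"
  proof (subst sum.reindex)
    show "inj_on (\<lambda>q. restrict q {..<n}) ?P"
    proof (rule inj_onI)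
      fix q r :: "nat \<Rightarrow> nat" assume "q \<in> ?P" "r \<in> ?P" and eq: "restrict q {..<n} = restrict r {..<n}"
      then have "q k = r k" for k
        by (cases "k < n") (metis lessThan_iff restrict_apply, simp add: permutes_not_in)
      then show "q = r" by auto
    qed
    have "nat_det n (\<lambda>i. b (restrict q {..<n} i)) = nat_det n (\<lambda>i. b (q i))" for q
      by (auto simp: nat_det_def intro!: sum.cong prod.cong)
    then show "sum ((\<lambda>g. (\<Prod>i<n. a i (g i)) * nat_det n (\<lambda>i. b (g i))) \<circ> (\<lambda>q. restrict q {..<n})) ?P =
        (\<Sum>q\<in>?P. (\<Prod>i<n. a i (q i)) * nat_det n (\<lambda>i. b (q i)))"
      by (auto intro!: sum.cong prod.cong)
  qed
  also have "\<dots> = (\<Sum>q\<in>?P. of_int (sign q) * (\<Prod>i<n. a i (q i)) * nat_det n b)"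
    by (intro sum.cong) (auto simp: nat_det_permute_rows)
  also have "\<dots> = nat_det n a * nat_det n b"
    by (simp add: nat_det_def sum_distrib_right)
  finally show ?thesis .
qed

lemma nat_det_transpose: "nat_det n (\<lambda>i j. a j i) = nat_det n a"
proof -
  let ?P = "{q. q permutes {..<n}}"
  have "nat_det n (\<lambda>i j. a j i) = (\<Sum>q\<in>?P. of_int (sign (inv q)) * (\<Prod>i<n. a (inv q i) i))"
    unfolding nat_det_def
    using sum_permutations_inverse[of "\<lambda>q. of_int (sign q) * (\<Prod>i<n. a (q i) i)" "{..<n}"] by simp
  also have "\<dots> = (\<Sum>q\<in>?P. of_int (sign q) * (\<Prod>i<n. a i (q i)))"
  proof (rule sum.cong[OF refl])
    fix q assume "q \<in> ?P"
    then have q: "q permutes {..<n}" by simp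
    have "(\<Prod>i<n. a (inv q i) i) = (\<Prod>i<n. a (inv q (q i)) (q i))"
      using permutes_imp_bij[OF q] by (simp add: prod.reindex_bij_betw[where g = "\<lambda>i. a (inv q i) i"])
    then show "of_int (sign (inv q)) * (\<Prod>i<n. a (inv q i) i) = of_int (sign q) * (\<Prod>i<n. a i (q i))"
      using q by (simp add: permutes_inverses sign_inverse permutes_imp_permutation[OF finite_lessThan])
  qed
  finally show ?thesis by (simp add: nat_det_def)
qed

lemma nat_det_identity: "nat_det n (\<lambda>i j. if i = j then 1 else 0) = 1"
proof -
  have "nat_det n (\<lambda>i j. if i = j then 1 else 0) = (\<Sum>q\<in>{id}. of_int (sign q) * (\<Prod>i<n. if i = q i then 1 else 0))"
    unfolding nat_det_def
  proof (rule sum.mono_neutral_right)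
    show "\<forall>q\<in>{q. q permutes {..<n}} - {id}. of_int (sign q) * (\<Prod>i<n. if i = q i then 1 else 0) = (0::real)"
    proof
      fix q assume q: "q \<in> {q. q permutes {..<n}} - {id}"
      then obtain i where "q i \<noteq> i" by (auto simp: fun_eq_iff)
      moreover from this q have "i < n" using permutes_not_in by fastforce
      ultimately have "(\<Prod>i<n. if i = q i then 1 else 0) = (0::real)"
        by (intro prod_zero) (auto intro!: bexI[of _ i])
      then show "of_int (sign q) * (\<Prod>i<n. if i = q i then 1 else 0) = (0::real)" by simp
    qed
  qed (auto simp: finite_permutations permutes_id)
  then show ?thesis by (simp add: sign_id)
qed

text \<open>A permutation that moves n meets a zero entry of the last column. Those that fix n are
  the permutations of {..<n}, with the same sign.\<close>

lemma nat_det_last_column: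
  assumes "\<And>i. i < n \<Longrightarrow> a i n = 0"
  shows "nat_det (Suc n) a = nat_det n a * a n n"
proof -
  have "nat_det (Suc n) a = (\<Sum>q\<in>{q. q permutes {..<n}}. of_int (sign q) * (\<Prod>i<Suc n. a i (q i)))"
    unfolding nat_det_def
  proof (rule sum.mono_neutral_right)
    show "finite {q. q permutes {..<Suc n}}" by (simp add: finite_permutations)
    show "{q. q permutes {..<n}} \<subseteq> {q. q permutes {..<Suc n}}"
      by (auto intro: permutes_subset)
    show "\<forall>q\<in>{q. q permutes {..<Suc n}} - {q. q permutes {..<n}}. of_int (sign q) * (\<Prod>i<Suc n. a i (q i)) = 0"
    proof
      fix q assume q: "q \<in> {q. q permutes {..<Suc n}} - {q. q permutes {..<n}}"
      have "q n \<noteq> n"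
      proof
        assume "q n = n"
        have "q permutes {..<n}"
        proof (rule permutes_superset[of q "{..<Suc n}"])
          show "q permutes {..<Suc n}" using q by simp
          fix x assume "x \<in> {..<Suc n} - {..<n}"
          then have "x = n" by auto
          with \<open>q n = n\<close> show "q x = x" by simp
        qed
        then show False using q by simp
      qed
      have "n \<in> q ` {..<Suc n}" using q permutes_image[of q "{..<Suc n}"] by simp
      then obtain i where i: "i < Suc n" "q i = n" by auto
      then have "i < n" using \<open>q n \<noteq> n\<close> by (metis less_Suc_eq)
      then have "(\<Prod>i<Suc n. a i (q i)) = 0"
        using i assms by (intro prod_zero) (auto intro!: bexI[of _ i])
      then show "of_int (sign q) * (\<Prod>i<Suc n. a i (q i)) = 0" by simp
    qed
  qed
  also have "\<dots> = nat_det n a * a n n"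
    by (auto simp: nat_det_def sum_distrib_right intro!: sum.cong dest: permutes_not_in)
  finally show ?thesis .
qed

text \<open>Determinants are indexed by natural numbers, so the orthonormal \<open>Basis\<close> is
  numbered once and for all. Only the values below \<open>DIM('e)\<close> are specified.\<close>

definition basis_enum :: "nat \<Rightarrow> 'e::euclidean_space" where
  "basis_enum = (SOME b. bij_betw b {..<DIM('e)} Basis)"

lemma bij_betw_basis_enum: "bij_betw (basis_enum :: nat \<Rightarrow> 'e::euclidean_space) {..<DIM('e)} Basis"
proof -
  obtain h :: "nat \<Rightarrow> 'e" where "bij_betw h {0..<DIM('e)} Basis"
    using ex_bij_betw_nat_finite[OF finite_Basis] by blast
  then show ?thesis
    unfolding basis_enum_def lessThan_atLeast0
    by (rule someI[where P = "\<lambda>b. bij_betw b {0..<DIM('e)} Basis"])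
qed

lemma basis_enum_in_Basis: "i < DIM('e) \<Longrightarrow> (basis_enum i :: 'e::euclidean_space) \<in> Basis"
  using bij_betw_basis_enum by (auto simp: bij_betw_def)

lemma inner_basis_enum:
  "i < DIM('e) \<Longrightarrow> j < DIM('e) \<Longrightarrow>
     (basis_enum i :: 'e::euclidean_space) \<bullet> basis_enum j = (if i = j then 1 else 0)"
  using bij_betw_basis_enum[where 'e = 'e]
  by (auto simp: inner_Basis basis_enum_in_Basis bij_betw_def inj_on_def)

lemma sum_basis_enum: "(\<Sum>i<DIM('e). h (basis_enum i :: 'e::euclidean_space)) = (\<Sum>b\<in>Basis. h b)"
  using bij_betw_basis_enum by (rule sum.reindex_bij_betw)

lemma basis_enum_expansion: "(\<Sum>i<DIM('e). (v \<bullet> basis_enum i) *\<^sub>R basis_enum i) = (v :: 'e::euclidean_space)"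
  by (simp add: sum_basis_enum[of "\<lambda>b. (v \<bullet> b) *\<^sub>R b"] euclidean_representation)

lemma inner_basis_enum_sum:
  "(v :: 'e::euclidean_space) \<bullet> w = (\<Sum>i<DIM('e). (v \<bullet> basis_enum i) * (w \<bullet> basis_enum i))"
  by (subst sum_basis_enum[of "\<lambda>b. (v \<bullet> b) * (w \<bullet> b)"]) (rule euclidean_inner)

lemma linear_basis_enum_expansion:
  fixes A :: "'e::euclidean_space \<Rightarrow> 'b::real_vector"
  assumes "linear A"
  shows "A v = (\<Sum>i<DIM('e). (v \<bullet> basis_enum i) *\<^sub>R A (basis_enum i))"
proof -
  have "A v = A (\<Sum>i<DIM('e). (v \<bullet> basis_enum i) *\<^sub>R basis_enum i)"
    by (simp only: basis_enum_expansion)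
  also have "\<dots> = (\<Sum>i<DIM('e). (v \<bullet> basis_enum i) *\<^sub>R A (basis_enum i))"
    by (simp add: linear_sum[OF assms] linear_scale[OF assms])
  finally show ?thesis .
qed

section \<open>Volume, determinant of a linear map, and the Hodge star in codimension one\<close>

definition vol :: "(nat \<Rightarrow> 'e::euclidean_space) \<Rightarrow> real" where
  "vol V = nat_det DIM('e) (\<lambda>i j. V i \<bullet> basis_enum j)"

definition lin_det :: "('e::euclidean_space \<Rightarrow> 'e) \<Rightarrow> real" where
  "lin_det A = vol (A \<circ> basis_enum)"

text \<open>The Gram matrix is the coordinate matrix of V times the transpose of that of W.\<close>

lemma nat_det_gram: "nat_det DIM('e) (\<lambda>i j. V i \<bullet> W j) = vol V * vol (W :: nat \<Rightarrow> 'e::euclidean_space)"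
proof -
  have "nat_det DIM('e) (\<lambda>i j. V i \<bullet> W j) = nat_det DIM('e) (\<lambda>i j. \<Sum>l<DIM('e). (V i \<bullet> basis_enum l) * (W j \<bullet> basis_enum l))"
    by (subst inner_basis_enum_sum) simp
  also have "\<dots> = vol V * nat_det DIM('e) (\<lambda>l j. W j \<bullet> basis_enum l)"
    unfolding vol_def by (rule nat_det_mult)
  also have "nat_det DIM('e) (\<lambda>l j. W j \<bullet> basis_enum l) = vol W"
    unfolding vol_def by (rule nat_det_transpose)
  finally show ?thesis .
qed

lemma vol_linear:
  fixes A :: "'e::euclidean_space \<Rightarrow> 'e"
  assumes "linear A"
  shows "vol (A \<circ> V) = lin_det A * vol V"
proof -
  have "A (V i) \<bullet> basis_enum j = (\<Sum>l<DIM('e). (V i \<bullet> basis_enum l) * (A (basis_enum l) \<bullet> basis_enum j))" for i j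
    by (subst linear_basis_enum_expansion[OF assms]) (simp add: inner_sum_left)
  then show ?thesis
    unfolding vol_def lin_det_def by (simp add: nat_det_mult mult.commute)
qed

lemma nat_det_cong: "(\<And>i j. i < n \<Longrightarrow> j < n \<Longrightarrow> a i j = b i j) \<Longrightarrow> nat_det n a = nat_det n b"
  unfolding nat_det_def by (intro sum.cong prod.cong arg_cong2[where f = "(*)"]) (auto simp: permutes_in_image[of _ "{..<n}", simplified])

lemma vol_basis_enum: "vol (basis_enum :: nat \<Rightarrow> 'e::euclidean_space) = 1"
  unfolding vol_def
  by (subst nat_det_cong[of _ _ "\<lambda>i j. if i = j then 1 else 0"])
    (simp_all add: inner_basis_enum nat_det_identity)

lemma lin_det_id: "lin_det (id :: 'e::euclidean_space \<Rightarrow> 'e) = 1"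
  by (simp add: lin_det_def vol_basis_enum)

lemma lin_det_comp:
  assumes "linear A" "linear B"
  shows "lin_det (A \<circ> B) = lin_det A * lin_det (B :: 'e::euclidean_space \<Rightarrow> 'e)"
  using vol_linear[OF assms(1), of "B \<circ> basis_enum"] by (simp add: lin_det_def comp_assoc)

lemma linear_inv_bij:
  assumes "linear A" "bij (A :: 'e::euclidean_space \<Rightarrow> 'e)"
  shows "linear (inv A)"
  using assms by (metis bij_is_inj bij_is_surj inj_linear_imp_inv_linear)

lemma lin_det_nonzero:
  assumes "linear A" "bij (A :: 'e::euclidean_space \<Rightarrow> 'e)"
  shows "lin_det A \<noteq> 0"
  using lin_det_comp[OF assms(1) linear_inv_bij[OF assms]] assms(2) lin_det_id
  by (metis bij_is_surj mult_zero_left surj_iff zero_neq_one)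

text \<open>The Hodge star of \<open>V\<^sub>0 \<and> \<cdots> \<and> V\<^sub>k\<^sub>-\<^sub>1\<close> in dimension \<open>k + 1\<close>.\<close>

definition hodge :: "(nat \<Rightarrow> 'e::euclidean_space) \<Rightarrow> 'e" where
  "hodge V = (let k = DIM('e) - 1 in
     \<Sum>q | q permutes {..<Suc k}. (of_int (sign q) * (\<Prod>i<k. V i \<bullet> basis_enum (q i))) *\<^sub>R basis_enum (q k))"

text \<open>The sum in \<open>hodge_def\<close> is the Leibniz formula with the last row left open.
  Orthogonality, the Gram identity and equivariance are all read off from this pairing.\<close>

lemma inner_hodge: "hodge V \<bullet> u = vol (V(DIM('e) - 1 := u :: 'e::euclidean_space))"
proof -
  define k where "k = DIM('e) - 1"
  have m: "DIM('e) = Suc k" using DIM_positive[where 'a = 'e] by (simp add: k_def)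
  show ?thesis
    unfolding vol_def nat_det_def hodge_def Let_def m diff_Suc_1
    by (simp add: inner_sum_left inner_commute[of u] mult.assoc)
qed

lemma hodge_orthogonal:
  fixes V :: "nat \<Rightarrow> 'e::euclidean_space"
  assumes "i < DIM('e) - 1"
  shows "hodge V \<bullet> V i = 0"
  unfolding inner_hodge vol_def
  using assms by (intro nat_det_identical_rows[of i _ "DIM('e) - 1"]) auto

text \<open>The Hodge star is isometric. Append u to V and z to W, with z orthogonal to all V_i: the
  last column of the Gram matrix becomes (0, ..., 0, u . z), while \<open>nat_det_gram\<close>
  evaluates the same determinant as (hodge V . u)(hodge W . z). The choice u = z = hodge V gives the
  claim unless this vector vanishes.\<close>

lemma hodge_gram:
  fixes V W :: "nat \<Rightarrow> 'e::euclidean_space"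
  shows "nat_det (DIM('e) - 1) (\<lambda>i j. V i \<bullet> W j) = hodge V \<bullet> hodge W"
proof -
  define k where "k = DIM('e) - 1"
  have m: "DIM('e) = Suc k" using DIM_positive[where 'a = 'e] by (simp add: k_def)
  have *: "nat_det k (\<lambda>i j. V i \<bullet> W j) * (u \<bullet> z) = (hodge V \<bullet> u) * (hodge W \<bullet> z)"
    if z: "\<And>i. i < k \<Longrightarrow> V i \<bullet> z = 0" for u z
  proof -
    have "(hodge V \<bullet> u) * (hodge W \<bullet> z) = nat_det (Suc k) (\<lambda>i j. (V(k := u)) i \<bullet> (W(k := z)) j)"
      unfolding inner_hodge m[symmetric] nat_det_gram unfolding k_def ..
    also have "\<dots> = nat_det k (\<lambda>i j. (V(k := u)) i \<bullet> (W(k := z)) j) * (u \<bullet> z)"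
      using z by (subst nat_det_last_column) auto
    also have "nat_det k (\<lambda>i j. (V(k := u)) i \<bullet> (W(k := z)) j) = nat_det k (\<lambda>i j. V i \<bullet> W j)"
      by (rule nat_det_cong) auto
    finally show ?thesis by simp
  qed
  show ?thesis
  proof (cases "hodge V = 0")
    case False
    have "nat_det k (\<lambda>i j. V i \<bullet> W j) * (hodge V \<bullet> hodge V) = (hodge V \<bullet> hodge V) * (hodge W \<bullet> hodge V)"
      by (rule *) (simp add: hodge_orthogonal k_def inner_commute)
    then show ?thesis using False by (simp add: k_def inner_commute)
  next
    case True
    \<comment> \<open>If \<open>hodge V\<close> vanishes, some other nonzero z orthogonal to the V_i
      is required. It exists because m - 1 vectors do not span, and it shows that the left side
      vanishes too.\<close>
    have "dim (V ` {..<k}) < DIM('e)"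
      using dim_le_card'[of "V ` {..<k}"] card_image_le[of "{..<k}" V] by (simp add: m)
    then obtain z where z: "z \<noteq> 0" "\<And>y. y \<in> span (V ` {..<k}) \<Longrightarrow> orthogonal z y"
      using orthogonal_to_subspace_exists[of "V ` {..<k}"] by (auto simp: )
    have "nat_det k (\<lambda>i j. V i \<bullet> W j) * (z \<bullet> z) = (hodge V \<bullet> z) * (hodge W \<bullet> z)"
      by (rule *) (metis z(2) imageI inner_commute lessThan_iff orthogonal_def span_base)
    then show ?thesis using True z(1) by (simp add: k_def)
  qed
qed

lemma bij_adjoint:
  assumes "linear A" "bij (A :: 'e::euclidean_space \<Rightarrow> 'e)"
  shows "bij (adjoint A)" "inv (adjoint A) = adjoint (inv A)"
proof -
  note l = linear_inv_bij[OF assms]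
  have 1: "adjoint A (adjoint (inv A) v) = v" for v
    by (rule vector_eq_ldot[THEN iffD1])
       (use assms in \<open>simp add: adjoint_works[OF assms(1)] adjoint_works[OF l] bij_is_inj inv_f_f\<close>)
  have 2: "adjoint (inv A) (adjoint A v) = v" for v
    by (rule vector_eq_ldot[THEN iffD1])
       (use assms in \<open>simp add: adjoint_works[OF assms(1)] adjoint_works[OF l] bij_is_surj surj_f_inv_f\<close>)
  show "bij (adjoint A)" by (rule o_bij[of "adjoint (inv A)"]) (auto simp: 1 2)
  show "inv (adjoint A) = adjoint (inv A)" by (rule inv_equality) (auto simp: 1 2)
qed

text \<open>This is the cofactor formula: up to the Hodge star, the exterior power of order m - 1 is
  the determinant times the contragredient map. Pairing with \<open>A u\<close> reduces it to the
  multiplicativity of \<open>vol\<close>.\<close>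

lemma hodge_linear:
  assumes A: "linear A" "bij (A :: 'e::euclidean_space \<Rightarrow> 'e)"
  shows "hodge (A \<circ> V) = lin_det A *\<^sub>R adjoint (inv A) (hodge V)"
proof (rule vector_eq_rdot[THEN iffD1], rule allI)
  fix z
  obtain u where u: "z = A u" using A(2) by (metis bij_is_surj surj_f_inv_f)
  have "hodge (A \<circ> V) \<bullet> z = vol (A \<circ> V(DIM('e) - 1 := u))"
    unfolding inner_hodge u by (rule arg_cong[where f = vol]) auto
  also have "\<dots> = lin_det A * (hodge V \<bullet> u)"
    by (simp add: vol_linear[OF A(1)] inner_hodge)
  also have "hodge V \<bullet> u = adjoint (inv A) (hodge V) \<bullet> z"
    using A by (simp add: u inner_commute adjoint_works[OF linear_inv_bij[OF A]] bij_is_inj inv_f_f)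
  finally show "hodge (A \<circ> V) \<bullet> z = lin_det A *\<^sub>R adjoint (inv A) (hodge V) \<bullet> z"
    by (simp only: inner_scaleR_left)
qed

text \<open>Supplies the spanning hypothesis of \<open>wedge_opnorm_eq\<close>. V is the basis with
  the l-th vector moved to the last place, and s = \<plusminus>1 is its orientation.\<close>

lemma hodge_basis:
  assumes l: "l < DIM('e)"
  obtains V s where "hodge V = s *\<^sub>R (basis_enum l :: 'e::euclidean_space)" "s * s = 1"
proof -
  define k where "k = DIM('e) - 1"
  have m: "DIM('e) = Suc k" using DIM_positive[where 'a = 'e] by (simp add: k_def)
  define V :: "nat \<Rightarrow> 'e" where "V = basis_enum \<circ> Transposition.transpose l k"
  have Vk: "V k = basis_enum l" by (simp add: V_def)
  have tr: "Transposition.transpose l k i < DIM('e)" if "i < DIM('e)" for i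
    using that l by (auto simp: m Transposition.transpose_def)
  have "vol V * vol V = nat_det DIM('e) (\<lambda>i j. if i = j then 1 else 0)"
    unfolding nat_det_gram[symmetric] V_def
    by (rule nat_det_cong) (simp add: inner_basis_enum tr inj_eq[OF inj_transpose])
  then have s: "vol V * vol V = 1" by (simp add: nat_det_identity)
  have "hodge V = vol V *\<^sub>R basis_enum l"
  proof (rule euclidean_eqI)
    fix b :: 'e assume "b \<in> Basis"
    then obtain j where j: "j < DIM('e)" "b = basis_enum j"
      using bij_betw_basis_enum[where 'e = 'e] by (auto simp: bij_betw_def image_iff)
    show "hodge V \<bullet> b = vol V *\<^sub>R basis_enum l \<bullet> b"
    proof (cases "j = l")
      case True
      have "V(k := basis_enum l) = V" using Vk by auto
      then show ?thesis using l True unfolding inner_hodge k_def[symmetric] by (simp add: j inner_basis_enum)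
    next
      case False
      define i where "i = Transposition.transpose l k j"
      have "i < k" using False j(1) l by (auto simp: m i_def Transposition.transpose_def)
      moreover have "V i = b" by (simp add: V_def i_def j)
      ultimately have "hodge V \<bullet> b = 0" using hodge_orthogonal[of i V] by (simp add: k_def)
      then show ?thesis using False l j by (simp add: inner_basis_enum)
    qed
  qed
  then show ?thesis using s that by blast
qed

section \<open>Operator norms\<close>

lemma linear_imp_bounded_linear: "linear A \<Longrightarrow> bounded_linear (A :: 'e::euclidean_space \<Rightarrow> 'b::real_normed_vector)"
  by (simp add: linear_conv_bounded_linear)

lemma SUP_unit_ball_onorm:
  fixes B :: "'e::euclidean_space \<Rightarrow> 'b::real_normed_vector"
  assumes "linear B"
  shows "(SUP v\<in>{v. norm v \<le> 1}. norm (B v)) = onorm B"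
proof (rule antisym)
  note bl = linear_imp_bounded_linear[OF assms]
  have le: "norm (B v) \<le> onorm B" if "norm v \<le> 1" for v
    using onorm[OF bl, of v] mult_left_mono[OF that onorm_pos_le[OF bl]] by simp
  show "(SUP v\<in>{v. norm v \<le> 1}. norm (B v)) \<le> onorm B"
    by (rule cSUP_least) (use le in \<open>auto intro: exI[of _ 0]\<close>)
  show "onorm B \<le> (SUP v\<in>{v. norm v \<le> 1}. norm (B v))"
  proof (rule onorm_le)
    fix v
    have "norm (B (v /\<^sub>R norm v)) \<le> (SUP v\<in>{v. norm v \<le> 1}. norm (B v))"
      by (rule cSUP_upper) (use le in \<open>auto simp: bdd_above_def divide_simps\<close>)
    then show "norm (B v) \<le> (SUP v\<in>{v. norm v \<le> 1}. norm (B v)) * norm v"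
      by (cases "v = 0") (auto simp: linear_scale[OF assms] linear_0[OF assms] field_simps)
  qed
qed

lemma opnorm_on_UNIV: "linear A \<Longrightarrow> opnorm_on UNIV norm norm A = onorm A" for A :: "'e::euclidean_space \<Rightarrow> 'e"
  by (simp add: opnorm_on_def SUP_unit_ball_onorm)

text \<open>A contraction onto L that fixes L maps the unit ball onto the unit ball of L. The norm
  of a restriction thus becomes the norm of a map on the whole space, for which measurability and
  submultiplicativity are at hand.\<close>

lemma opnorm_on_projection:
  fixes A :: "'e::euclidean_space \<Rightarrow> 'e"
  assumes "linear A" "linear P" "\<And>v. P v \<in> L" "\<And>v. v \<in> L \<Longrightarrow> P v = v" "\<And>v. norm (P v) \<le> norm v"
  shows "opnorm_on L norm norm A = onorm (A \<circ> P)"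
proof -
  have "(\<lambda>v. norm (A v)) ` {v \<in> L. norm v \<le> 1} = (\<lambda>v. norm ((A \<circ> P) v)) ` {v. norm v \<le> 1}"
    using assms(3-5) by (force simp: image_iff intro: order_trans)
  then show ?thesis
    using SUP_unit_ball_onorm[OF linear_compose[OF assms(2,1)]] by (simp add: opnorm_on_def)
qed

lemma opnorm_on_frame:
  assumes "bij F" "\<And>v. N (F v) = norm v" "\<And>v. N' (F' v) = norm v" "bij F'"
  shows "opnorm_on L N N' A = opnorm_on (inv F ` L) norm norm (inv F' \<circ> A \<circ> F)"
proof -
  have "(\<lambda>v. N' (A v)) ` {v \<in> L. N v \<le> 1} = (\<lambda>v. norm ((inv F' \<circ> A \<circ> F) v)) ` {v \<in> inv F ` L. norm v \<le> 1}"
  proof -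
    have *: "norm (inv F' w) = N' w" "norm (inv F w) = N w" "F (inv F w) = w" for w
      using assms by (metis bij_inv_eq_iff)+
    show ?thesis
      by (force simp: image_iff * )
  qed
  then show ?thesis by (simp add: opnorm_on_def)
qed

lemma norm_le_onorm_inv:
  assumes "linear A" "bij (A :: 'e::euclidean_space \<Rightarrow> 'e)"
  shows "norm v \<le> onorm (inv A) * norm (A v)"
  using onorm[OF linear_imp_bounded_linear[OF linear_inv_bij[OF assms]], of "A v"] assms(2)
  by (simp add: bij_is_inj inv_f_f)

lemma onorm_inv_ge_1:
  assumes "linear A" "bij (A :: 'e::euclidean_space \<Rightarrow> 'e)"
  shows "1 \<le> onorm A * onorm (inv A)"
proof -
  obtain b :: 'e where b: "norm b = 1" using vector_choose_size[of 1] by auto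
  have "1 \<le> onorm (inv A) * norm (A b)" using norm_le_onorm_inv[OF assms, of b] b by simp
  also have "\<dots> \<le> onorm (inv A) * (onorm A * norm b)"
    by (intro mult_left_mono onorm linear_imp_bounded_linear onorm_pos_le linear_inv_bij assms)
  finally show ?thesis by (simp add: b mult.commute)
qed

lemma onorm_bij_pos:
  assumes "linear A" "bij (A :: 'e::euclidean_space \<Rightarrow> 'e)"
  shows "0 < onorm A" "0 < onorm (inv A)"
proof -
  have "0 \<le> onorm A" "0 \<le> onorm (inv A)"
    using assms by (auto intro: onorm_pos_le linear_imp_bounded_linear linear_inv_bij)
  moreover have "onorm A * onorm (inv A) \<noteq> 0" using onorm_inv_ge_1[OF assms] by linarith
  ultimately show "0 < onorm A" "0 < onorm (inv A)" by auto
qed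

lemma onorm_adjoint_le:
  assumes "linear (A :: 'e::euclidean_space \<Rightarrow> 'e)"
  shows "onorm (adjoint A) \<le> onorm A"
proof (rule onorm_le)
  fix v
  note bl = linear_imp_bounded_linear[OF assms]
  have "norm (adjoint A v) * norm (adjoint A v) = A (adjoint A v) \<bullet> v"
    using adjoint_works[OF assms, of "adjoint A v" v]
    by (simp add: power2_eq_square flip: power2_norm_eq_inner)
  also have "\<dots> \<le> norm (A (adjoint A v)) * norm v" by (rule norm_cauchy_schwarz)
  also have "\<dots> \<le> (onorm A * norm (adjoint A v)) * norm v"
    by (intro mult_right_mono onorm bl) simp
  finally show "norm (adjoint A v) \<le> onorm A * norm v"
    by (cases "adjoint A v = 0") (auto simp: onorm_pos_le[OF bl] mult_ac)
qed

lemma onorm_adjoint: "linear (A :: 'e::euclidean_space \<Rightarrow> 'e) \<Longrightarrow> onorm (adjoint A) = onorm A"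
  using onorm_adjoint_le[of A] onorm_adjoint_le[of "adjoint A"]
  by (simp add: adjoint_adjoint adjoint_linear)

lemma adjoint_comp:
  assumes "linear A" "linear (B :: 'e::euclidean_space \<Rightarrow> 'e)"
  shows "adjoint (A \<circ> B) = adjoint B \<circ> adjoint (A :: 'e \<Rightarrow> 'e)"
  by (rule adjoint_unique) (simp add: adjoint_works assms)

lemma gram_det_2:
  fixes v w :: "'e::real_inner"
  shows "norm (v - ((v \<bullet> w) / (w \<bullet> w)) *\<^sub>R w) ^ 2 * (w \<bullet> w) = (v \<bullet> v) * (w \<bullet> w) - (v \<bullet> w) ^ 2"
proof (cases "w = 0")
  case False
  then have "w \<bullet> w \<noteq> 0" by simp
  then show ?thesis
    by (simp add: power2_norm_eq_inner inner_diff_left inner_diff_right inner_commute[of w v])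
      (simp add: field_simps power2_eq_square)
qed simp

text \<open>Both sides are the area of the parallelogram spanned by v and w, as height over base w
  and as height over base v.\<close>

lemma sin_symmetric:
  fixes v w :: "'e::real_inner"
  shows "norm (v - ((v \<bullet> w) / (w \<bullet> w)) *\<^sub>R w) * norm w = norm (w - ((w \<bullet> v) / (v \<bullet> v)) *\<^sub>R v) * norm v"
proof (rule power2_eq_imp_eq)
  show "(norm (v - ((v \<bullet> w) / (w \<bullet> w)) *\<^sub>R w) * norm w)\<^sup>2 = (norm (w - ((w \<bullet> v) / (v \<bullet> v)) *\<^sub>R v) * norm v)\<^sup>2"
    using gram_det_2[of v w] gram_det_2[of w v]
    by (simp add: power_mult_distrib power2_norm_eq_inner[of v] power2_norm_eq_inner[of w] inner_commute[of w v] mult.commute)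
qed auto

lemma norm_diff_projection_le:
  fixes v w :: "'e::real_inner"
  shows "norm (v - ((v \<bullet> w) / (w \<bullet> w)) *\<^sub>R w) \<le> norm (v - c *\<^sub>R w)"
proof (cases "w = 0")
  case False
  define u where "u = v - ((v \<bullet> w) / (w \<bullet> w)) *\<^sub>R w"
  have "u \<bullet> w = 0" using False by (simp add: u_def inner_diff_left)
  then have pyth: "(norm (u + d *\<^sub>R w))\<^sup>2 = (norm u)\<^sup>2 + (norm (d *\<^sub>R w))\<^sup>2" for d
    by (intro norm_add_Pythagorean) (simp add: orthogonal_def)
  have "norm u \<le> norm (u + d *\<^sub>R w)" for d
    by (rule power2_le_imp_le) (simp_all add: pyth)
  from this[of "(v \<bullet> w) / (w \<bullet> w) - c"] show ?thesis
    unfolding u_def scaleR_left_diff_distrib by (simp only: diff_add_eq diff_diff_eq2 add_diff_cancel_right' add_diff_eq)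
qed simp

text \<open>Restricting the contragredient map to the annihilator \<open>e\<^sup>\<bottom>\<close> loses nothing against its full
  norm \<open>onorm (inv D)\<close> beyond the defect by which \<open>e\<close> fails to be a direction of maximal growth of
  \<open>D\<close>. On planes containing \<open>e\<close> this is the comparison of two expressions of the area distortion.\<close>

lemma onorm_inv_le_annihilator:
  fixes D :: "'e::euclidean_space \<Rightarrow> 'e"
  assumes D: "linear D" "bij D" and e: "norm e = 1" and dim: "2 \<le> DIM('e)"
    and t: "\<And>\<xi>. \<xi> \<bullet> e = 0 \<Longrightarrow> norm (adjoint (inv D) \<xi>) \<le> t * norm \<xi>"
  shows "onorm (inv D) * norm (D e) \<le> t * onorm D"
proof -
  define A where "A = adjoint (inv D)"
  have A: "A \<xi> \<bullet> D v = \<xi> \<bullet> v" for \<xi> v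
    using D by (simp add: A_def inner_commute[of "adjoint (inv D) \<xi>"] adjoint_works[OF linear_inv_bij[OF D]]
        bij_is_inj inv_f_f inner_commute)
  note onD = onorm[OF linear_imp_bounded_linear[OF D(1)]]
  have De: "D e \<noteq> 0"
    using D e by (metis bij_is_inj linear_injective_0 norm_zero zero_neq_one)
  \<comment> \<open>Such a covector exists because m \<ge> 2. It yields \<open>0 \<le> t\<close> and
    \<open>1 \<le> t * onorm D\<close>; the latter settles the degenerate case in which z is
    parallel to e.\<close>
  obtain \<xi> :: 'e where \<xi>: "\<xi> \<noteq> 0" "\<xi> \<bullet> e = 0"
    using vector_in_orthogonal_basis orthogonal_to_vector_exists[OF dim, of e]
    by (auto simp: orthogonal_def inner_commute)
  have "0 \<le> t * norm \<xi>" using t[OF \<xi>(2)] norm_ge_zero order_trans by blast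
  then have t0: "0 \<le> t" using \<xi>(1) by (simp add: zero_le_mult_iff)
  have "norm \<xi> * norm \<xi> \<le> norm (A \<xi>) * norm (D \<xi>)"
    using A[of \<xi> \<xi>] norm_cauchy_schwarz[of "A \<xi>" "D \<xi>"] by (simp flip: power2_eq_square power2_norm_eq_inner)
  also have "\<dots> \<le> (t * norm \<xi>) * (onorm D * norm \<xi>)"
    using t[OF \<xi>(2)] onD by (intro mult_mono) (auto simp: A_def intro: order_trans[OF norm_ge_zero])
  finally have "(norm \<xi> * norm \<xi>) * 1 \<le> (norm \<xi> * norm \<xi>) * (t * onorm D)" by (simp add: mult_ac)
  then have t1: "1 \<le> t * onorm D"
    using \<xi>(1) by (subst (asm) mult_le_cancel_left_pos) auto
  have "norm (inv D y) \<le> (t * onorm D / norm (D e)) * norm y" for y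
  proof -
    define z where "z = inv D y"
    have y: "D z = y" using D by (simp add: z_def bij_is_surj surj_f_inv_f)
    \<comment> \<open>r is the part of z orthogonal to e, s the part of D z orthogonal to D e, and q
      the part of e orthogonal to z.\<close>
    define r where "r = z - ((z \<bullet> e) / (e \<bullet> e)) *\<^sub>R e"
    define s where "s = D z - ((D z \<bullet> D e) / (D e \<bullet> D e)) *\<^sub>R D e"
    define q where "q = e - ((e \<bullet> z) / (z \<bullet> z)) *\<^sub>R z"
    have ee: "e \<bullet> e = 1" using e by (simp add: norm_eq_1)
    have re: "r \<bullet> e = 0" by (simp add: r_def inner_diff_left ee)
    have rz: "r \<bullet> z = norm r * norm r"
      using re by (simp add: r_def inner_diff_right inner_diff_left ee power2_norm_eq_inner flip: power2_eq_square)
    \<comment> \<open>Since r annihilates e, its image A r annihilates D e. Pairing A r with D z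
      therefore sees only s.\<close>
    have "A r \<bullet> s = r \<bullet> z"
      by (simp add: s_def inner_diff_right A re)
    then have "norm r * norm r \<le> norm (A r) * norm s" using norm_cauchy_schwarz[of "A r" s] rz by simp
    also have "\<dots> \<le> (t * norm r) * norm s"
      using t[OF re] by (intro mult_right_mono) (auto simp: A_def)
    finally have rs: "norm r \<le> t * norm s"
      using t0 by (cases "r = 0") (auto simp: mult_ac)
    have "norm s * norm (D e) = norm (D e - ((D e \<bullet> D z) / (D z \<bullet> D z)) *\<^sub>R D z) * norm (D z)"
      unfolding s_def by (rule sin_symmetric)
    \<comment> \<open>D q differs from D e by a multiple of D z, hence is at least as long as the
      distance from D e to the line of D z.\<close>
    also have "\<dots> \<le> norm (D q) * norm (D z)"
      unfolding q_def by (intro mult_right_mono) (simp_all add: linear_diff[OF D(1)] linear_scale[OF D(1)] norm_diff_projection_le)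
    also have "\<dots> \<le> (onorm D * norm q) * norm (D z)"
      by (intro mult_right_mono onD) simp
    finally have "(norm s * norm (D e)) * norm z \<le> (onorm D * norm q) * norm (D z) * norm z"
      by (intro mult_right_mono) simp_all
    also have "norm q * norm z = norm r"
      using sin_symmetric[of e z] e by (simp add: q_def r_def)
    then have "(onorm D * norm q) * norm (D z) * norm z = onorm D * norm (D z) * norm r"
      by (simp add: mult_ac)
    also have "\<dots> \<le> onorm D * norm (D z) * (t * norm s)"
      by (intro mult_left_mono rs) (simp add: onorm_pos_le linear_imp_bounded_linear D)
    finally have area: "norm s * (norm (D e) * norm z) \<le> norm s * (t * onorm D * norm (D z))"
      by (simp add: mult_ac)
    have "norm (D e) * norm z \<le> t * onorm D * norm (D z)"
    proof (cases "s = 0")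
      case False
      then show ?thesis using area by (subst (asm) mult_le_cancel_left_pos) auto
    next
      case True
      then have "r = 0" using rs by simp
      then have "z = (z \<bullet> e) *\<^sub>R e" by (simp add: r_def ee)
      then have "norm (D e) * norm z = 1 * norm (D z)"
        using e by (metis abs_mult_pos' linear_scale[OF D(1)] mult.commute mult.right_neutral norm_ge_zero norm_scaleR mult.left_neutral)
      also have "\<dots> \<le> (t * onorm D) * norm (D z)" by (intro mult_right_mono t1) simp
      finally show ?thesis .
    qed
    then show ?thesis using De by (simp add: y z_def[symmetric] field_simps)
  qed
  then have "onorm (inv D) \<le> t * onorm D / norm (D e)" by (rule onorm_le)
  then show ?thesis using De by (simp add: field_simps)
qed

section \<open>Norms on exterior powers\<close>

lemma inner_sum_list:
  "(\<Sum>x\<leftarrow>xs. h x) \<bullet> (\<Sum>y\<leftarrow>ys. k y) = (\<Sum>x\<leftarrow>xs. \<Sum>y\<leftarrow>ys. h x \<bullet> (k y :: 'b::real_inner))"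
proof -
  have "v \<bullet> (\<Sum>y\<leftarrow>ys. k y) = (\<Sum>y\<leftarrow>ys. v \<bullet> k y)" for v by (induction ys) (auto simp: inner_add_right)
  then show ?thesis by (induction xs) (auto simp: inner_add_left sum_list_addf)
qed

text \<open>Realizes the exterior power in a Euclidean space. If s reproduces the Gram determinants,
  intertwines A with B and has spanning values, then evaluating a formal sum through s preserves
  norms and is surjective, so the two unit balls correspond. It is applied with s constant, s =
  first vector, s = \<open>hodge\<close> and s = \<open>vol\<close>.\<close>

lemma wedge_opnorm_eq:
  fixes s :: "(nat \<Rightarrow> 'e::euclidean_space) \<Rightarrow> 'b::euclidean_space"
  assumes gram: "\<And>v w. nat_det k (\<lambda>i j. v i \<bullet> w j) = s v \<bullet> s w"
    and B: "linear B" "\<And>v. s (A \<circ> v) = B (s v)"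
    and span: "\<And>b. b \<in> Basis \<Longrightarrow> \<exists>c v. c *\<^sub>R s v = b"
  shows "wedge_opnorm k (\<bullet>) (\<bullet>) A = onorm B"
proof -
  define \<phi> where "\<phi> \<xi> = (\<Sum>(c, v)\<leftarrow>\<xi>. c *\<^sub>R s v)" for \<xi>
  have norm: "kvec_norm k (\<bullet>) \<xi> = norm (\<phi> \<xi>)" for \<xi>
    unfolding kvec_norm_def \<phi>_def norm_eq_sqrt_inner inner_sum_list
    by (intro arg_cong[where f = sqrt] arg_cong[where f = sum_list] map_cong refl)
       (auto simp: gram intro!: arg_cong[where f = sum_list] map_cong)
  have map: "\<phi> (kvec_map A \<xi>) = B (\<phi> \<xi>)" for \<xi>
    by (induction \<xi>) (auto simp: \<phi>_def kvec_map_def B linear_add[OF B(1)] linear_scale[OF B(1)] linear_0[OF B(1)])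
  have "subspace (range \<phi>)"
  proof (rule subspaceI)
    show "0 \<in> range \<phi>" by (rule image_eqI[of _ _ "[]"]) (auto simp: \<phi>_def)
    show "x + y \<in> range \<phi>" if "x \<in> range \<phi>" "y \<in> range \<phi>" for x y
    proof -
      from that obtain \<xi> \<eta> where "x = \<phi> \<xi>" "y = \<phi> \<eta>" by auto
      then have "x + y = \<phi> (\<xi> @ \<eta>)" by (simp add: \<phi>_def)
      then show ?thesis by blast
    qed
    show "c *\<^sub>R x \<in> range \<phi>" if x: "x \<in> range \<phi>" for c x
    proof -
      from x obtain \<xi> where x: "x = \<phi> \<xi>" by auto
      have "c *\<^sub>R \<phi> \<xi> = \<phi> (map (\<lambda>(d, v). (c * d, v)) \<xi>)"
        by (induction \<xi>) (auto simp: \<phi>_def scaleR_add_right)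
      then show ?thesis using x by auto
    qed
  qed
  moreover have "Basis \<subseteq> range \<phi>"
  proof
    fix b :: 'b assume "b \<in> Basis"
    then obtain c v where "c *\<^sub>R s v = b" using span by blast
    then have "\<phi> [(c, v)] = b" by (simp add: \<phi>_def)
    then show "b \<in> range \<phi>" by blast
  qed
  ultimately have "surj \<phi>"
    using span_minimal[of Basis "range \<phi>"] by (simp add: span_Basis UNIV_eq_I top.extremum_unique)
  then have "\<phi> ` {\<xi>. norm (\<phi> \<xi>) \<le> 1} = {v. norm v \<le> 1}"
  proof (intro equalityI subsetI)
    fix y :: 'b assume y: "y \<in> {v. norm v \<le> 1}"
    obtain \<xi> where "y = \<phi> \<xi>" using \<open>surj \<phi>\<close> by (rule surjE)
    then show "y \<in> \<phi> ` {\<xi>. norm (\<phi> \<xi>) \<le> 1}" using y by simp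
  qed auto
  moreover have "(\<lambda>\<xi>. norm (B (\<phi> \<xi>))) ` {\<xi>. norm (\<phi> \<xi>) \<le> 1} = (\<lambda>v. norm (B v)) ` \<phi> ` {\<xi>. norm (\<phi> \<xi>) \<le> 1}"
    by (simp only: image_image)
  ultimately show ?thesis
    by (simp add: wedge_opnorm_def norm map SUP_unit_ball_onorm[OF B(1)])
qed

lemma wedge_opnorm_0: "wedge_opnorm 0 (\<bullet>) (\<bullet>) (A :: 'e::euclidean_space \<Rightarrow> 'e) = 1"
proof -
  have "wedge_opnorm 0 (\<bullet>) (\<bullet>) A = onorm (\<lambda>x::real. x)"
    by (rule wedge_opnorm_eq[where s = "\<lambda>_. 1"]) (auto simp: nat_det_def sign_id intro: bounded_linear.linear[OF bounded_linear_ident])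
  also have "\<dots> = 1" by (rule onorm_id)
  finally show ?thesis .
qed

lemma nat_det_1: "nat_det (Suc 0) a = a 0 0"
proof -
  have "{q. q permutes {..<Suc 0}} = {id}"
    using permutes_sing[of _ 0] by (auto simp: lessThan_Suc)
  then show ?thesis by (simp add: nat_det_def sign_id)
qed

lemma wedge_opnorm_1:
  assumes "linear (A :: 'e::euclidean_space \<Rightarrow> 'e)"
  shows "wedge_opnorm (Suc 0) (\<bullet>) (\<bullet>) A = onorm A"
proof (rule wedge_opnorm_eq[where s = "\<lambda>v. v 0"])
  fix b :: 'e
  show "\<exists>c v. c *\<^sub>R v (0::nat) = b" by (intro exI[of _ 1] exI[of _ "\<lambda>_. b"]) simp
qed (use assms in \<open>auto simp: nat_det_1\<close>)

lemma wedge_opnorm_top: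
  assumes "linear (A :: 'e::euclidean_space \<Rightarrow> 'e)"
  shows "wedge_opnorm DIM('e) (\<bullet>) (\<bullet>) A = \<bar>lin_det A\<bar>"
proof -
  have "wedge_opnorm DIM('e) (\<bullet>) (\<bullet>) A = onorm (\<lambda>x::real. lin_det A * x)"
  proof (rule wedge_opnorm_eq[where s = vol])
    show "\<exists>c v. c *\<^sub>R vol (v :: nat \<Rightarrow> 'e) = b" for b
      by (intro exI[of _ b] exI[of _ basis_enum]) (simp add: vol_basis_enum)
  qed (auto simp: nat_det_gram vol_linear[OF assms] linear_times)
  also have "\<dots> = \<bar>lin_det A\<bar>"
    using onorm_scaleR[of "\<lambda>x::real. x" "lin_det A"] by (simp add: onorm_id)
  finally show ?thesis .
qed

lemma wedge_opnorm_cotop: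
  assumes "linear A" "bij (A :: 'e::euclidean_space \<Rightarrow> 'e)"
  shows "wedge_opnorm (DIM('e) - 1) (\<bullet>) (\<bullet>) A = \<bar>lin_det A\<bar> * onorm (inv A)"
proof -
  note lin = adjoint_linear[OF linear_inv_bij[OF assms]]
  have "wedge_opnorm (DIM('e) - 1) (\<bullet>) (\<bullet>) A = onorm (\<lambda>v. lin_det A *\<^sub>R adjoint (inv A) v)"
  proof (rule wedge_opnorm_eq[where s = hodge])
    fix b :: 'e assume "b \<in> Basis"
    then obtain l where l: "l < DIM('e)" "b = basis_enum l"
      using bij_betw_basis_enum[where 'e = 'e] by (auto simp: bij_betw_def image_iff)
    obtain V s where "hodge V = s *\<^sub>R b" "s * s = 1" using hodge_basis[OF l(1)] l(2) by metis
    then show "\<exists>c v. c *\<^sub>R hodge v = b" by (intro exI[of _ s] exI[of _ V]) simp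
  qed (auto simp: hodge_gram[unfolded One_nat_def] hodge_linear[OF assms] intro!: linear_compose_scale_right lin)
  also have "\<dots> = \<bar>lin_det A\<bar> * onorm (inv A)"
    by (simp add: onorm_scaleR linear_imp_bounded_linear lin onorm_adjoint linear_inv_bij assms)
  finally show ?thesis .
qed

lemma wedge_opnorm_frame:
  fixes F F' A :: "'e::euclidean_space \<Rightarrow> 'e"
  assumes "bij F" "\<And>v w. g (F v) (F w) = v \<bullet> w" "\<And>v w. g' (F' v) (F' w) = v \<bullet> w" "bij F'"
  shows "wedge_opnorm k g g' A = wedge_opnorm k (\<bullet>) (\<bullet>) (inv F' \<circ> A \<circ> F)"
proof -
  have g: "g v w = inv F v \<bullet> inv F w" "g' v w = inv F' v \<bullet> inv F' w" for v w
    using assms by (metis bij_inv_eq_iff)+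
  have norm: "kvec_norm k g' \<xi> = kvec_norm k (\<bullet>) (kvec_map (inv F') \<xi>)"
      "kvec_norm k g (kvec_map F \<xi>) = kvec_norm k (\<bullet>) \<xi>" for \<xi>
    by (auto simp: kvec_norm_def kvec_map_def g(2) assms(2) comp_def case_prod_unfold)
  have comp: "kvec_map C (kvec_map D \<xi>) = kvec_map (C \<circ> D) \<xi>" for C D \<xi>
    by (auto simp: kvec_map_def comp_def case_prod_unfold)
  have "\<xi> = kvec_map F (kvec_map (inv F) \<xi>)" for \<xi>
  proof -
    have "F \<circ> (inv F \<circ> v) = v" for v :: "nat \<Rightarrow> 'e"
      using assms(1) by (simp add: fun_eq_iff bij_is_surj surj_f_inv_f)
    then show ?thesis by (simp add: kvec_map_def comp_def case_prod_unfold)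
  qed
  then have im: "kvec_map F ` {\<xi>. kvec_norm k (\<bullet>) \<xi> \<le> 1} = {\<xi>. kvec_norm k g \<xi> \<le> 1}"
    by (auto simp: norm) (metis (mono_tags) image_eqI mem_Collect_eq norm(2))
  have "(\<lambda>\<xi>. kvec_norm k g' (kvec_map A \<xi>)) ` {\<xi>. kvec_norm k g \<xi> \<le> 1}
      = (\<lambda>\<xi>. kvec_norm k g' (kvec_map A (kvec_map F \<xi>))) ` {\<xi>. kvec_norm k (\<bullet>) \<xi> \<le> 1}"
    by (simp only: image_image flip: im)
  then show ?thesis
    by (simp add: wedge_opnorm_def norm(1) comp comp_assoc)
qed

section \<open>Rotation in dimension two\<close>

text \<open>For m = 2 the Hodge star reads only the vector with index 0 and turns it by a right
  angle.\<close>

definition rot :: "'e::euclidean_space \<Rightarrow> 'e" where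
  "rot v = hodge (\<lambda>_. v)"

context
  assumes dim2: "DIM('e::euclidean_space) = 2"
begin

lemma inner_rot: "rot v \<bullet> rot (w :: 'e) = v \<bullet> w"
  using hodge_gram[of "\<lambda>_. v" "\<lambda>_. w"] by (simp add: rot_def dim2 nat_det_1)

lemma linear_rot: "linear (rot :: 'e \<Rightarrow> 'e)"
  by (rule linearI)
     (simp_all add: rot_def hodge_def dim2 inner_add_left sum.distrib[symmetric] algebra_simps scaleR_sum_right)

lemma norm_rot: "norm (rot (v :: 'e)) = norm v"
  by (simp add: norm_eq_sqrt_inner inner_rot)

lemma rot_linear:
  assumes "linear A" "bij (A :: 'e \<Rightarrow> 'e)"
  shows "rot (A v) = lin_det A *\<^sub>R adjoint (inv A) (rot v)"
  using hodge_linear[OF assms, of "\<lambda>_. v"] by (simp add: rot_def comp_def)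

end

section \<open>Gram--Schmidt orthonormalization\<close>

text \<open>Vectors that depend linearly on their predecessors are turned into \<open>0\<close>.\<close>

fun gram_schmidt :: "('e::euclidean_space \<Rightarrow> 'e \<Rightarrow> real) \<Rightarrow> (nat \<Rightarrow> 'e) \<Rightarrow> nat \<Rightarrow> 'e" where
  "gram_schmidt g b k =
     (let u = b k - (\<Sum>j<k. g (b k) (gram_schmidt g b j) *\<^sub>R gram_schmidt g b j) in u /\<^sub>R sqrt (g u u))"

declare gram_schmidt.simps [simp del]

lemma inner_product_inner: "inner_product ((\<bullet>) :: 'e::euclidean_space \<Rightarrow> 'e \<Rightarrow> real)"
  by (auto simp: inner_product_def inner_commute bilinear_def linear_iff inner_add_left inner_add_right)

definition orthonormal_frame :: "('e::euclidean_space \<Rightarrow> 'e \<Rightarrow> real) \<Rightarrow> 'e \<Rightarrow> 'e" where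
  "orthonormal_frame g v = (\<Sum>k<DIM('e). (v \<bullet> basis_enum k) *\<^sub>R gram_schmidt g basis_enum k)"

context
  fixes g :: "'e::euclidean_space \<Rightarrow> 'e \<Rightarrow> real"
  assumes g: "inner_product g"
begin

lemma inner_product_linear: "linear (g v)" "linear (\<lambda>v. g v w)"
  using g by (auto simp: inner_product_def bilinear_def)

lemma gram_schmidt_orthonormal:
  "i < n \<Longrightarrow> j < n \<Longrightarrow> g (gram_schmidt g b i) (gram_schmidt g b j) =
     (if i = j \<and> gram_schmidt g b i \<noteq> 0 then 1 else 0)"
proof (induction n arbitrary: i j)
  case (Suc n)
  note lin = inner_product_linear
  have sym: "g v w = g w v" for v w using g by (auto simp: inner_product_def)
  have pos: "v \<noteq> 0 \<Longrightarrow> g v v > 0" for v using g by (auto simp: inner_product_def)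
  define u where "u = b n - (\<Sum>j<n. g (b n) (gram_schmidt g b j) *\<^sub>R gram_schmidt g b j)"
  have o: "gram_schmidt g b n = u /\<^sub>R sqrt (g u u)"
    by (subst gram_schmidt.simps) (simp add: u_def Let_def)
  have ortho: "g (gram_schmidt g b n) (gram_schmidt g b l) = 0" if l: "l < n" for l
  proof -
    have "g u (gram_schmidt g b l) = g (b n) (gram_schmidt g b l)
        - (\<Sum>j<n. g (b n) (gram_schmidt g b j) * g (gram_schmidt g b j) (gram_schmidt g b l))"
      by (simp add: u_def linear_diff[OF lin(2)] linear_sum[OF lin(2)] linear_scale[OF lin(2)])
    also have "(\<Sum>j<n. g (b n) (gram_schmidt g b j) * g (gram_schmidt g b j) (gram_schmidt g b l))
        = (\<Sum>j<n. if j = l then g (b n) (gram_schmidt g b l) else 0)"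
      using l by (intro sum.cong refl) (auto simp: Suc.IH linear_0[OF lin(1)])
    also have "\<dots> = g (b n) (gram_schmidt g b l)" using l by simp
    finally show ?thesis by (simp add: o linear_scale[OF lin(2)])
  qed
  have norm: "g (gram_schmidt g b n) (gram_schmidt g b n) = (if gram_schmidt g b n \<noteq> 0 then 1 else 0)"
  proof (cases "u = 0")
    case True
    then show ?thesis by (simp add: o linear_0[OF lin(1)])
  next
    case False
    then have "g u u > 0" by (rule pos)
    then show ?thesis
      using False by (simp add: o linear_scale[OF lin(1)] linear_scale[OF lin(2)] field_simps)
  qed
  consider "i < n" "j < n" | "i = n" "j < n" | "i < n" "j = n" | "i = n" "j = n"
    using Suc.prems by linarith
  then show ?case
    using Suc.IH ortho norm sym by cases auto
qed simp

lemma span_gram_schmidt: "span (gram_schmidt g b ` {..<n}) = span (b ` {..<n})"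
proof (induction n)
  case (Suc n)
  define s where "s = (\<Sum>j<n. g (b n) (gram_schmidt g b j) *\<^sub>R gram_schmidt g b j)"
  define u where "u = b n - s"
  have o: "gram_schmidt g b n = u /\<^sub>R sqrt (g u u)"
    by (subst gram_schmidt.simps) (simp add: u_def s_def Let_def)
  have s: "s \<in> span (gram_schmidt g b ` {..<n})"
    unfolding s_def by (intro span_sum span_scale span_base) auto
  have mono: "span (gram_schmidt g b ` {..<n}) \<subseteq> span (gram_schmidt g b ` {..<Suc n})"
      "span (b ` {..<n}) \<subseteq> span (b ` {..<Suc n})"
    by (intro span_mono image_mono; simp)+
  have "b n = s + sqrt (g u u) *\<^sub>R gram_schmidt g b n"
  proof (cases "u = 0")
    case False
    then have "g u u > 0" using g by (auto simp: inner_product_def)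
    then show ?thesis by (simp add: o) (simp add: u_def)
  qed (simp add: o u_def)
  also have "\<dots> \<in> span (gram_schmidt g b ` {..<Suc n})"
    by (rule span_add) (use s mono in blast, intro span_scale span_base, auto)
  finally have 1: "b n \<in> span (gram_schmidt g b ` {..<Suc n})" .
  have "gram_schmidt g b n \<in> span (b ` {..<Suc n})"
    unfolding o u_def by (intro span_scale span_diff, intro span_base) (use s mono in \<open>auto simp: Suc\<close>)
  moreover have "gram_schmidt g b ` {..<n} \<subseteq> span (b ` {..<Suc n})"
    using span_superset[of "gram_schmidt g b ` {..<n}"] mono(2)
    by (auto simp: Suc)
  ultimately have "gram_schmidt g b ` {..<Suc n} \<subseteq> span (b ` {..<Suc n})"
    by (auto simp: lessThan_Suc)
  moreover have "b ` {..<n} \<subseteq> span (gram_schmidt g b ` {..<Suc n})"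
    using span_superset[of "b ` {..<n}"] mono(1)
    by (auto simp: Suc)
  then have "b ` {..<Suc n} \<subseteq> span (gram_schmidt g b ` {..<Suc n})"
    using 1 by (auto simp: lessThan_Suc)
  ultimately show ?case
    by (intro antisym span_minimal) auto
qed simp

text \<open>The second claim keeps the normalizing denominator away from zero, which is what
  continuity of the frames in the base point rests on.\<close>

lemma gram_schmidt_basis_nonzero:
  assumes k: "k < DIM('e)"
  shows "gram_schmidt g basis_enum k \<noteq> 0"
    "basis_enum k - (\<Sum>j<k. g (basis_enum k) (gram_schmidt g basis_enum j) *\<^sub>R gram_schmidt g basis_enum j) \<noteq> 0"
proof -
  define s where "s = (\<Sum>j<k. g (basis_enum k) (gram_schmidt g basis_enum j) *\<^sub>R gram_schmidt g basis_enum j)"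
  show ne: "basis_enum k - s \<noteq> 0"
  proof
    assume "basis_enum k - s = 0"
    moreover have "s \<in> span (gram_schmidt g basis_enum ` {..<k})"
      unfolding s_def by (intro span_sum span_scale span_base) auto
    ultimately have "basis_enum k \<in> span (basis_enum ` {..<k} :: 'e set)"
      by (simp add: span_gram_schmidt)
    moreover have "basis_enum ` {..<k} \<subseteq> Basis - {basis_enum k :: 'e}"
      using k bij_betw_basis_enum[where 'e = 'e] by (auto simp: bij_betw_def inj_on_def)
    ultimately have "basis_enum k \<in> span (Basis - {basis_enum k :: 'e})"
      using span_mono by blast
    then show False
      using independent_Basis[where 'a = 'e] basis_enum_in_Basis[OF k] by (auto simp: dependent_def)
  qed
  then have "g (basis_enum k - s) (basis_enum k - s) > 0" using g by (auto simp: inner_product_def)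
  then show "gram_schmidt g basis_enum k \<noteq> 0"
    using ne by (subst gram_schmidt.simps) (simp add: s_def[symmetric] Let_def)
qed

lemma linear_orthonormal_frame: "linear (orthonormal_frame g)"
  by (rule linearI)
     (simp_all add: orthonormal_frame_def inner_add_left scaleR_left_distrib sum.distrib scaleR_sum_right)

lemma orthonormal_frame: "g (orthonormal_frame g v) (orthonormal_frame g w) = v \<bullet> w"
proof -
  note lin = inner_product_linear
  have l: "g (orthonormal_frame g v) z = (\<Sum>k<DIM('e). (v \<bullet> basis_enum k) * g (gram_schmidt g basis_enum k) z)" for v z
    by (simp add: orthonormal_frame_def linear_sum[OF lin(2)] linear_scale[OF lin(2)])
  have "g (gram_schmidt g basis_enum k) (orthonormal_frame g w) = w \<bullet> basis_enum k" if k: "k < DIM('e)" for k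
  proof -
    have "g (gram_schmidt g basis_enum k) (orthonormal_frame g w)
        = (\<Sum>l<DIM('e). (w \<bullet> basis_enum l) * g (gram_schmidt g basis_enum k) (gram_schmidt g basis_enum l))"
      by (simp add: orthonormal_frame_def linear_sum[OF lin(1)] linear_scale[OF lin(1)])
    also have "\<dots> = (\<Sum>l<DIM('e). if l = k then w \<bullet> basis_enum k else 0)"
      using k by (intro sum.cong refl) (auto simp: gram_schmidt_orthonormal[of _ "DIM('e)"] gram_schmidt_basis_nonzero)
    finally show ?thesis using k by simp
  qed
  then show ?thesis
    by (simp add: l inner_basis_enum_sum[of v w])
qed

lemma bij_orthonormal_frame: "bij (orthonormal_frame g)"
proof -
  have "orthonormal_frame g v = 0 \<Longrightarrow> v = 0" for v
    using orthonormal_frame[of v v] by (simp add: linear_0[OF inner_product_linear(1)])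
  then have "inj (orthonormal_frame g)"
    unfolding linear_injective_0[OF linear_orthonormal_frame] by blast
  then show ?thesis
    using linear_injective_imp_surjective[OF linear_orthonormal_frame] by (simp add: bij_def)
qed

end

text \<open>The orthogonal projection onto the span of b_0, ..., b_(n-1). Written through
  \<open>gram_schmidt\<close> it depends measurably on b, even where the vectors are dependent and
  the dimension of the span jumps.\<close>

definition span_projection :: "(nat \<Rightarrow> 'e::euclidean_space) \<Rightarrow> nat \<Rightarrow> 'e \<Rightarrow> 'e" where
  "span_projection b n v = (\<Sum>j<n. (v \<bullet> gram_schmidt (\<bullet>) b j) *\<^sub>R gram_schmidt (\<bullet>) b j)"

lemma linear_span_projection: "linear (span_projection b n)"
  by (rule linearI)
     (simp_all add: span_projection_def inner_add_left scaleR_left_distrib sum.distrib scaleR_sum_right)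

lemma span_projection_in_span: "span_projection b n v \<in> span (b ` {..<n})"
proof -
  have "span_projection b n v \<in> span (gram_schmidt (\<bullet>) b ` {..<n})"
    unfolding span_projection_def by (intro span_sum span_scale span_base) auto
  then show ?thesis by (simp add: span_gram_schmidt[OF inner_product_inner])
qed

lemma span_projection_orthogonal:
  assumes "w \<in> span (b ` {..<n})"
  shows "(v - span_projection b n v) \<bullet> w = 0"
proof -
  have "span (gram_schmidt (\<bullet>) b ` {..<n}) \<subseteq> {w. (v - span_projection b n v) \<bullet> w = 0}"
  proof (intro span_minimal subsetI subspace_hyperplane)
    fix w assume "w \<in> gram_schmidt (\<bullet>) b ` {..<n}"
    then obtain l where l: "l < n" "w = gram_schmidt (\<bullet>) b l" by auto
    have "span_projection b n v \<bullet> w = (\<Sum>j<n. if j = l then v \<bullet> w else 0)"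
      unfolding span_projection_def inner_sum_left using l(1)
      by (intro sum.cong refl)
        (auto simp: l(2) gram_schmidt_orthonormal[OF inner_product_inner, of _ n])
    then show "w \<in> {w. (v - span_projection b n v) \<bullet> w = 0}"
      using l(1) by (simp add: inner_diff_left)
  qed
  then show ?thesis using assms by (auto simp: span_gram_schmidt[OF inner_product_inner])
qed

lemma span_projection_id:
  assumes "v \<in> span (b ` {..<n})"
  shows "span_projection b n v = v"
proof -
  have "(v - span_projection b n v) \<bullet> (v - span_projection b n v) = 0"
    by (intro span_projection_orthogonal span_diff assms span_projection_in_span)
  then show ?thesis by simp
qed

lemma norm_span_projection: "norm (span_projection b n v) \<le> norm v"
proof -
  have "(norm (span_projection b n v + (v - span_projection b n v)))\<^sup>2
      = (norm (span_projection b n v))\<^sup>2 + (norm (v - span_projection b n v))\<^sup>2"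
    by (rule norm_add_Pythagorean)
      (simp add: orthogonal_def inner_commute[of "span_projection b n v"] span_projection_orthogonal span_projection_in_span)
  then have "(norm (span_projection b n v))\<^sup>2 \<le> (norm v)\<^sup>2" by simp
  then show ?thesis by (rule power2_le_imp_le) simp
qed

section \<open>Measurable families of linear maps\<close>

text \<open>Linearity reduces joint measurability in the point and the vector to finitely many fixed
  vectors.\<close>

lemma borel_measurable_linear_apply:
  fixes A :: "'x \<Rightarrow> 'e::euclidean_space \<Rightarrow> 'b::euclidean_space"
  assumes "\<And>v. (\<lambda>x. A x v) \<in> borel_measurable M" "\<And>x. x \<in> space M \<Longrightarrow> linear (A x)"
    and h: "h \<in> borel_measurable M"
  shows "(\<lambda>x. A x (h x)) \<in> borel_measurable M"
proof -
  note [measurable] = assms(1) h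
  have "(\<lambda>x. \<Sum>i<DIM('e). (h x \<bullet> basis_enum i) *\<^sub>R A x (basis_enum i)) \<in> borel_measurable M"
    by measurable
  then show ?thesis
    by (rule measurable_cong[THEN iffD1, rotated]) (simp add: linear_basis_enum_expansion[OF assms(2), symmetric])
qed

text \<open>By continuity, a bound on the norm need only be tested on a countable dense set of
  vectors.\<close>

lemma borel_measurable_onorm:
  fixes A :: "'x \<Rightarrow> 'e::euclidean_space \<Rightarrow> 'b::euclidean_space"
  assumes meas: "\<And>v. (\<lambda>x. A x v) \<in> borel_measurable M" and lin: "\<And>x. x \<in> space M \<Longrightarrow> linear (A x)"
  shows "(\<lambda>x. onorm (A x)) \<in> borel_measurable M"
proof (rule borel_measurable_iff_le[THEN iffD2], rule allI)
  fix r :: real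
  note [measurable] = meas
  obtain D :: "'e set" where D: "countable D" "closure D = UNIV"
    using separable[of "UNIV :: 'e set"] by (metis top.extremum_uniqueI)
  have "onorm (A x) \<le> r \<longleftrightarrow> (\<forall>v\<in>D. norm (A x v) \<le> r * norm v)" if x: "x \<in> space M" for x
  proof
    assume "onorm (A x) \<le> r"
    then show "\<forall>v\<in>D. norm (A x v) \<le> r * norm v"
      using onorm[OF linear_imp_bounded_linear[OF lin[OF x]]]
      by (meson mult_right_mono norm_ge_zero order_trans)
  next
    assume le: "\<forall>v\<in>D. norm (A x v) \<le> r * norm v"
    have cont: "continuous_on UNIV (A x)"
      by (simp add: linear_continuous_on linear_imp_bounded_linear lin x)
    have "closed {v. norm (A x v) \<le> r * norm v}"
      by (intro closed_Collect_le continuous_intros cont)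
    then have "closure D \<subseteq> {v. norm (A x v) \<le> r * norm v}"
      using le by (intro closure_minimal) auto
    then show "onorm (A x) \<le> r"
      unfolding D by (intro onorm_le) auto
  qed
  then have "{x \<in> space M. onorm (A x) \<le> r} = {x \<in> space M. \<forall>v\<in>D. norm (A x v) \<le> r * norm v}"
    by auto
  also have "\<dots> \<in> sets M"
    using D(1) by measurable
  finally show "{x \<in> space M. onorm (A x) \<le> r} \<in> sets M" .
qed

lemma borel_measurable_gram_schmidt:
  assumes "\<And>i. (\<lambda>x. s x i) \<in> borel_measurable M"
  shows "(\<lambda>x. gram_schmidt (\<bullet>) (s x) k) \<in> borel_measurable M"
proof (induction k rule: less_induct)
  case (less k)
  note [measurable] = assms
  have [measurable]: "(\<lambda>x. \<Sum>j<k. (s x k \<bullet> gram_schmidt (\<bullet>) (s x) j) *\<^sub>R gram_schmidt (\<bullet>) (s x) j) \<in> borel_measurable M"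
    by (intro borel_measurable_sum borel_measurable_scaleR borel_measurable_inner less assms) auto
  show ?case
    by (subst gram_schmidt.simps) (simp add: Let_def)
qed

lemma borel_measurable_span_projection:
  assumes "\<And>i. (\<lambda>x. s x i) \<in> borel_measurable M" "h \<in> borel_measurable M"
  shows "(\<lambda>x. span_projection (s x) n (h x)) \<in> borel_measurable M"
  unfolding span_projection_def
  by (intro borel_measurable_sum borel_measurable_scaleR borel_measurable_inner
      borel_measurable_gram_schmidt assms)

lemma borel_measurable_adjoint:
  fixes A :: "'x \<Rightarrow> 'e::euclidean_space \<Rightarrow> 'e"
  assumes meas: "\<And>v. (\<lambda>x. A x v) \<in> borel_measurable M" and lin: "\<And>x. x \<in> space M \<Longrightarrow> linear (A x)"
  shows "(\<lambda>x. adjoint (A x) w) \<in> borel_measurable M"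
proof -
  note [measurable] = meas
  have "(\<lambda>x. \<Sum>i<DIM('e). (w \<bullet> A x (basis_enum i)) *\<^sub>R (basis_enum i :: 'e)) \<in> borel_measurable M"
    by measurable
  moreover have "(\<Sum>i<DIM('e). (w \<bullet> A x (basis_enum i)) *\<^sub>R (basis_enum i :: 'e)) = adjoint (A x) w"
    if "x \<in> space M" for x
    using basis_enum_expansion[of "adjoint (A x) w"]
    by (simp add: inner_commute[of "adjoint (A x) w"] adjoint_works[OF lin[OF that]] inner_commute[of w])
  ultimately show ?thesis by (simp cong: measurable_cong)
qed

text \<open>n_i is the part of the i-th column orthogonal to all other columns. Pairing n_i with w =
  A u isolates the i-th coordinate of u and scales it by n_i . n_i. The formula uses only
  projections, so it shows that the inverse depends measurably on A.\<close>

lemma inverse_formula: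
  fixes A :: "'e::euclidean_space \<Rightarrow> 'e"
  assumes A: "linear A" "bij A"
  defines "n \<equiv> \<lambda>i. A (basis_enum i) - span_projection (\<lambda>j. if j = i then 0 else A (basis_enum j)) DIM('e) (A (basis_enum i))"
  shows "inv A w = (\<Sum>i<DIM('e). ((n i \<bullet> w) / (n i \<bullet> n i)) *\<^sub>R basis_enum i)"
proof -
  have "((n i \<bullet> w) / (n i \<bullet> n i)) = inv A w \<bullet> basis_enum i" if i: "i < DIM('e)" for i
  proof -
    let ?b = "\<lambda>j. if j = i then 0 else A (basis_enum j)"
    let ?P = "span_projection ?b DIM('e) (A (basis_enum i))"
    have n: "n i = A (basis_enum i) - ?P" by (simp add: n_def)
    define \<zeta> where "\<zeta> = adjoint (inv A) (basis_enum i)"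
    have \<zeta>: "\<zeta> \<bullet> A v = basis_enum i \<bullet> v" for v
      using A by (simp add: \<zeta>_def inner_commute[of "adjoint (inv A) _"] adjoint_works[OF linear_inv_bij[OF A]]
        bij_is_inj inv_f_f inner_commute)
    have "span (?b ` {..<DIM('e)}) \<subseteq> {v. \<zeta> \<bullet> v = 0}"
      using i by (intro span_minimal subspace_hyperplane) (auto simp: \<zeta> inner_basis_enum)
    then have "\<zeta> \<bullet> n i = 1"
      using span_projection_in_span[of ?b "DIM('e)" "A (basis_enum i)"] i
      by (auto simp: n inner_diff_right \<zeta> inner_basis_enum)
    then have n0: "n i \<noteq> 0" by auto
    have nj: "n i \<bullet> A (basis_enum j) = 0" if "j < DIM('e)" "j \<noteq> i" for j
      unfolding n using that by (intro span_projection_orthogonal span_base) (auto intro!: image_eqI[of _ _ j])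
    have ni: "n i \<bullet> n i = n i \<bullet> A (basis_enum i)"
      using span_projection_orthogonal[OF span_projection_in_span[of ?b "DIM('e)" "A (basis_enum i)"], of "A (basis_enum i)"]
      by (simp add: inner_diff_right n)
    have "n i \<bullet> w = n i \<bullet> A (inv A w)" using A by (simp add: bij_is_surj surj_f_inv_f)
    also have "\<dots> = (\<Sum>j<DIM('e). (inv A w \<bullet> basis_enum j) * (n i \<bullet> A (basis_enum j)))"
      by (subst linear_basis_enum_expansion[OF A(1)]) (simp add: inner_sum_right)
    also have "\<dots> = (\<Sum>j<DIM('e). if j = i then (inv A w \<bullet> basis_enum i) * (n i \<bullet> n i) else 0)"
      by (intro sum.cong refl) (auto simp: nj ni)
    also have "\<dots> = (inv A w \<bullet> basis_enum i) * (n i \<bullet> n i)" using i by simp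
    finally show ?thesis using n0 by simp
  qed
  then show ?thesis
    using basis_enum_expansion[of "inv A w"] by simp
qed

lemma borel_measurable_linear_inv:
  fixes A :: "'x \<Rightarrow> 'e::euclidean_space \<Rightarrow> 'e"
  assumes meas: "\<And>v. (\<lambda>x. A x v) \<in> borel_measurable M"
    and lin: "\<And>x. x \<in> space M \<Longrightarrow> linear (A x)" and bij: "\<And>x. x \<in> space M \<Longrightarrow> bij (A x)"
  shows "(\<lambda>x. inv (A x) w) \<in> borel_measurable M"
proof -
  define n where "n x i = A x (basis_enum i) - span_projection (\<lambda>j. if j = i then 0 else A x (basis_enum j)) DIM('e) (A x (basis_enum i))" for x i
  have [measurable]: "(\<lambda>x. n x i) \<in> borel_measurable M" for i
  proof -
    have "(\<lambda>x. if j = i then 0 else A x (basis_enum j)) \<in> borel_measurable M" for j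
      by (cases "j = i") (simp_all add: meas)
    then show ?thesis
      unfolding n_def by (intro borel_measurable_diff borel_measurable_span_projection meas)
  qed
  have "(\<lambda>x. \<Sum>i<DIM('e). ((n x i \<bullet> w) / (n x i \<bullet> n x i)) *\<^sub>R (basis_enum i :: 'e)) \<in> borel_measurable M"
    by measurable
  then show ?thesis
    by (rule measurable_cong[THEN iffD1, rotated]) (simp add: inverse_formula[OF lin bij] n_def)
qed

lemma borel_measurable_lin_det:
  fixes A :: "'x \<Rightarrow> 'e::euclidean_space \<Rightarrow> 'e"
  assumes [measurable]: "\<And>v. (\<lambda>x. A x v) \<in> borel_measurable M"
  shows "(\<lambda>x. lin_det (A x)) \<in> borel_measurable M"
  unfolding lin_det_def vol_def nat_det_def comp_def by measurable

text \<open>A Borel choice of a nonzero vector on each line. It is invariant under scaling, in contrast to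
  a choice of unit vectors.\<close>

definition line_rep :: "'e::euclidean_space \<Rightarrow> 'e" where
  "line_rep w = w /\<^sub>R (w \<bullet> basis_enum (LEAST i. w \<bullet> basis_enum i \<noteq> 0))"

lemma line_rep_coordinate:
  assumes "w \<noteq> (0 :: 'e::euclidean_space)"
  shows "w \<bullet> basis_enum (LEAST i. w \<bullet> basis_enum i \<noteq> 0) \<noteq> 0"
proof (rule LeastI_ex, rule ccontr)
  assume "\<not> (\<exists>i. w \<bullet> basis_enum i \<noteq> 0)"
  then have "w = 0" using basis_enum_expansion[of w] by simp
  then show False using assms by simp
qed

lemma line_rep_scaleR: "c \<noteq> 0 \<Longrightarrow> line_rep (c *\<^sub>R w) = line_rep w"
  by (simp add: line_rep_def)

lemma line_rep_nonzero: "w \<noteq> 0 \<Longrightarrow> line_rep w \<noteq> 0"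
  using line_rep_coordinate[of w] by (simp add: line_rep_def)

lemma borel_measurable_line_rep [measurable]: "line_rep \<in> borel_measurable borel"
  unfolding line_rep_def by measurable

lemma span_singleton_scaleR: "c \<noteq> 0 \<Longrightarrow> span {c *\<^sub>R w} = span {w :: 'e::real_vector}"
  by (rule span_image_scale[of "{w}" "\<lambda>_. c", simplified])

lemma span_line_rep: "w \<noteq> 0 \<Longrightarrow> span {line_rep w} = span {w}"
  using line_rep_coordinate[of w] by (simp add: line_rep_def span_singleton_scaleR)

section \<open>Subadditive sequences\<close>

text \<open>The limit is the infimum of a_n / n over n \<ge> 1. The linear lower bound makes this
  infimum finite.\<close>

lemma fekete:
  fixes a :: "nat \<Rightarrow> real"
  assumes sub: "\<And>m n. a (m + n) \<le> a m + a n" and bound: "\<And>n. - (c * real n) \<le> a n"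
  shows "convergent (\<lambda>n. a n / real n)"
proof -
  define L where "L = (INF n\<in>{1..}. a n / real n)"
  have bdd: "bdd_below ((\<lambda>n. a n / real n) ` {1..})"
    unfolding bdd_below_def
  proof (intro exI ballI)
    fix y assume "y \<in> (\<lambda>n. a n / real n) ` {1..}"
    then show "- c \<le> y" using bound by (auto simp: field_simps)
  qed
  have "(\<lambda>n. a n / real n) \<longlonglongrightarrow> L"
  proof (rule LIMSEQ_I)
    fix \<epsilon> :: real assume \<epsilon>: "0 < \<epsilon>"
    have "\<exists>n\<in>{1..}. a n / real n < L + \<epsilon> / 2"
      using cINF_less_iff[OF _ bdd, of "L + \<epsilon> / 2"] \<epsilon> unfolding L_def by auto
    then obtain N where N: "1 \<le> N" "a N / real N < L + \<epsilon> / 2" by auto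
    \<comment> \<open>With n = q N + r, this constant absorbs both the remainder a_r and the
      fraction r/N of a_N by which q a_N differs from n (a_N / N).\<close>
    define C where "C = (\<Sum>r<N. \<bar>a r\<bar>) + \<bar>a N\<bar>"
    have mult: "a (q * N + r) \<le> real q * a N + a r" for q r
    proof (induction q)
      case (Suc q)
      have "a (Suc q * N + r) \<le> a N + a (q * N + r)" using sub[of N "q * N + r"] by (simp add: add.assoc)
      then show ?case using Suc by (simp add: algebra_simps)
    qed simp
    have le: "a n \<le> real n * (a N / real N) + C" for n
    proof -
      define q where "q = n div N"
      define r where "r = n mod N"
      have n: "n = q * N + r" by (simp add: q_def r_def)
      have r: "r < N" using N(1) by (simp add: r_def)
      have "\<bar>a r\<bar> \<le> (\<Sum>r<N. \<bar>a r\<bar>)" using r by (intro member_le_sum) auto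
      moreover have "real q * a N = real n * (a N / real N) - (real r / real N) * a N"
        using N(1) by (simp add: n field_simps)
      moreover have "\<bar>(real r / real N) * a N\<bar> \<le> 1 * \<bar>a N\<bar>"
        unfolding abs_mult using r by (intro mult_right_mono) auto
      ultimately show ?thesis using mult[of q r] unfolding n[symmetric] C_def by linarith
    qed
    obtain n0 :: nat where n0: "2 * C / \<epsilon> < real n0" using reals_Archimedean2 by blast
    have "norm (a n / real n - L) < \<epsilon>" if n: "Suc n0 \<le> n" for n
    proof -
      have n1: "0 < real n" using n by simp
      have "L \<le> a n / real n" unfolding L_def using n by (intro cINF_lower bdd) auto
      moreover have "C / real n < \<epsilon> / 2"
        using n0 n \<epsilon> n1 by (auto simp: field_simps intro: less_le_trans order_less_trans)
      moreover have "a n / real n \<le> a N / real N + C / real n"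
        using divide_right_mono[OF le[of n], of "real n"] n1 by (simp add: add_divide_distrib)
      ultimately show ?thesis using N(2) unfolding real_norm_def by linarith
    qed
    then show "\<exists>n0. \<forall>n\<ge>n0. norm (a n / real n - L) < \<epsilon>" by blast
  qed
  then show ?thesis by (rule convergentI)
qed

section \<open>Stationary measures and the skew product\<close>

text \<open>Left general in the state space because it serves twice: for the maps on the manifold
  with \<mu>, and for the projective maps with a stationary lift.\<close>

locale stationary_system =
  fixes p :: "'t measure" and F :: "'t \<Rightarrow> 'b \<Rightarrow> 'b" and \<nu> :: "'b measure"
  assumes prob_p: "prob_space p" and prob_nu: "prob_space \<nu>"
    and measurable_F: "(\<lambda>(t, x). F t x) \<in> p \<Otimes>\<^sub>M \<nu> \<rightarrow>\<^sub>M \<nu>"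
    and stationary: "stationary p F \<nu>"
begin

sublocale P: prob_space p by (rule prob_p)
sublocale N: prob_space \<nu> by (rule prob_nu)
sublocale S: sequence_space p by unfold_locales

abbreviation \<Omega> :: "(nat \<Rightarrow> 't) measure" where "\<Omega> \<equiv> path_measure p"

sublocale O: prob_space \<Omega>
  unfolding path_measure_def by (rule S.P.prob_space_axioms)
sublocale ON: pair_prob_space \<Omega> \<nu> ..
sublocale PN: pair_prob_space p \<nu> ..
sublocale OP: pair_prob_space \<Omega> p ..

lemma measurable_coordinate [measurable]: "(\<lambda>\<omega>. \<omega> n) \<in> \<Omega> \<rightarrow>\<^sub>M p"
  unfolding path_measure_def by measurable

lemma nn_integral_coordinate:
  assumes "h \<in> borel_measurable p"
  shows "(\<integral>\<^sup>+\<omega>. h (\<omega> n) \<partial>\<Omega>) = (\<integral>\<^sup>+t. h t \<partial>p)"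
proof -
  have "distr \<Omega> p (\<lambda>\<omega>. \<omega> n) = p"
    using S.PiM_component[of n] by (simp add: path_measure_def)
  then show ?thesis
    using nn_integral_distr[of "\<lambda>\<omega>. \<omega> n" \<Omega> p h] assms by simp
qed

lemma measurable_F_apply [measurable (raw)]:
  "g \<in> K \<rightarrow>\<^sub>M p \<Longrightarrow> h \<in> K \<rightarrow>\<^sub>M \<nu> \<Longrightarrow> (\<lambda>y. F (g y) (h y)) \<in> K \<rightarrow>\<^sub>M \<nu>"
  using measurable_compose[OF measurable_Pair measurable_F] by simp

text \<open>Stationarity says that (t, x) \<mapsto> F t x carries the product measure to \<nu>;
  integrating h against both measures gives the formula.\<close>

lemma nn_integral_stationary:
  assumes [measurable]: "h \<in> borel_measurable \<nu>"
  shows "(\<integral>\<^sup>+t. \<integral>\<^sup>+x. h (F t x) \<partial>\<nu> \<partial>p) = (\<integral>\<^sup>+x. h x \<partial>\<nu>)"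
proof -
  have "distr (p \<Otimes>\<^sub>M \<nu>) \<nu> (\<lambda>(t, x). F t x) = \<nu>"
  proof (rule measure_eqI)
    fix B assume "B \<in> sets (distr (p \<Otimes>\<^sub>M \<nu>) \<nu> (\<lambda>(t, x). F t x))"
    then have B [measurable]: "B \<in> sets \<nu>" by simp
    have "emeasure (distr (p \<Otimes>\<^sub>M \<nu>) \<nu> (\<lambda>(t, x). F t x)) B = (\<integral>\<^sup>+z. indicator B (case z of (t, x) \<Rightarrow> F t x) \<partial>(p \<Otimes>\<^sub>M \<nu>))"
      by (simp add: nn_integral_indicator[symmetric] nn_integral_distr measurable_F del: nn_integral_indicator)
    also have "\<dots> = (\<integral>\<^sup>+t. \<integral>\<^sup>+x. indicator B (F t x) \<partial>\<nu> \<partial>p)"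
      by (subst N.nn_integral_fst[symmetric]) simp_all
    also have "\<dots> = (\<integral>\<^sup>+t. emeasure (distr \<nu> \<nu> (F t)) B \<partial>p)"
    proof (rule nn_integral_cong)
      fix t assume [measurable]: "t \<in> space p"
      have [measurable]: "F t \<in> \<nu> \<rightarrow>\<^sub>M \<nu>" by measurable
      show "(\<integral>\<^sup>+x. indicator B (F t x) \<partial>\<nu>) = emeasure (distr \<nu> \<nu> (F t)) B"
        by (simp add: nn_integral_indicator[symmetric] nn_integral_distr del: nn_integral_indicator)
    qed
    also have "\<dots> = (\<integral>\<^sup>+\<omega>. emeasure (distr \<nu> \<nu> (F (\<omega> 0))) B \<partial>\<Omega>)"
    proof (rule nn_integral_coordinate[symmetric])
      have "(\<lambda>t. \<integral>\<^sup>+x. indicator B (F t x) \<partial>\<nu>) \<in> borel_measurable p" by measurable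
      moreover have "(\<integral>\<^sup>+x. indicator B (F t x) \<partial>\<nu>) = emeasure (distr \<nu> \<nu> (F t)) B" if [measurable]: "t \<in> space p" for t
      proof -
        have [measurable]: "F t \<in> \<nu> \<rightarrow>\<^sub>M \<nu>" by measurable
        show ?thesis
          by (simp add: nn_integral_indicator[symmetric] nn_integral_distr del: nn_integral_indicator)
      qed
      ultimately show "(\<lambda>t. emeasure (distr \<nu> \<nu> (F t)) B) \<in> borel_measurable p"
        by (simp cong: measurable_cong)
    qed
    also have "\<dots> = emeasure \<nu> B"
      using stationary B by (simp add: stationary_def)
    finally show "emeasure (distr (p \<Otimes>\<^sub>M \<nu>) \<nu> (\<lambda>(t, x). F t x)) B = emeasure \<nu> B" .
  qed simp
  then have "(\<integral>\<^sup>+x. h x \<partial>\<nu>) = (\<integral>\<^sup>+z. h (case z of (t, x) \<Rightarrow> F t x) \<partial>(p \<Otimes>\<^sub>M \<nu>))"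
    using nn_integral_distr[OF measurable_F, of h] by simp
  also have "\<dots> = (\<integral>\<^sup>+t. \<integral>\<^sup>+x. h (F t x) \<partial>\<nu> \<partial>p)"
    by (subst N.nn_integral_fst[symmetric]) simp_all
  finally show ?thesis by simp
qed

text \<open>The skew product over the one-sided shift. By \<open>skew_pow\<close> its iterates carry
  \<open>orbit_map\<close>.\<close>

definition skew :: "(nat \<Rightarrow> 't) \<times> 'b \<Rightarrow> (nat \<Rightarrow> 't) \<times> 'b" where
  "skew z = ((\<lambda>n. fst z (Suc n)), F (fst z 0) (snd z))"

lemma measurable_shift [measurable]: "(\<lambda>\<omega> n. \<omega> (Suc n)) \<in> \<Omega> \<rightarrow>\<^sub>M \<Omega>"
  unfolding path_measure_def by (rule measurable_PiM_single') (auto simp: space_PiM PiE_iff)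

lemma measurable_skew [measurable]: "skew \<in> \<Omega> \<Otimes>\<^sub>M \<nu> \<rightarrow>\<^sub>M \<Omega> \<Otimes>\<^sub>M \<nu>"
  unfolding skew_def by measurable

text \<open>The coordinate \<omega>_0 is independent of the shifted sequence. Splitting it off and
  integrating it together with x leaves \<nu> in the second factor, by stationarity.\<close>

lemma distr_skew: "distr (\<Omega> \<Otimes>\<^sub>M \<nu>) (\<Omega> \<Otimes>\<^sub>M \<nu>) skew = \<Omega> \<Otimes>\<^sub>M \<nu>"
proof (rule measure_eqI)
  fix C assume "C \<in> sets (distr (\<Omega> \<Otimes>\<^sub>M \<nu>) (\<Omega> \<Otimes>\<^sub>M \<nu>) skew)"
  then have [measurable]: "C \<in> sets (\<Omega> \<Otimes>\<^sub>M \<nu>)" by simp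
  have iter: "\<Omega> = distr (p \<Otimes>\<^sub>M \<Omega>) \<Omega> (\<lambda>(s, \<omega>). case_nat s \<omega>)"
    using S.PiM_iter by (simp add: path_measure_def)
  have [measurable]: "(\<lambda>(s, \<omega>). case_nat s \<omega>) \<in> p \<Otimes>\<^sub>M \<Omega> \<rightarrow>\<^sub>M \<Omega>"
    unfolding path_measure_def by measurable
  have "emeasure (distr (\<Omega> \<Otimes>\<^sub>M \<nu>) (\<Omega> \<Otimes>\<^sub>M \<nu>) skew) C = (\<integral>\<^sup>+z. indicator C (skew z) \<partial>(\<Omega> \<Otimes>\<^sub>M \<nu>))"
    by (simp add: nn_integral_indicator[symmetric] nn_integral_distr del: nn_integral_indicator)
  also have "\<dots> = (\<integral>\<^sup>+\<omega>. \<integral>\<^sup>+x. indicator C (skew (\<omega>, x)) \<partial>\<nu> \<partial>\<Omega>)"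
    by (subst N.nn_integral_fst[symmetric]) simp_all
  also have "\<dots> = (\<integral>\<^sup>+\<omega>. \<integral>\<^sup>+x. indicator C (skew (\<omega>, x)) \<partial>\<nu> \<partial>(distr (p \<Otimes>\<^sub>M \<Omega>) \<Omega> (\<lambda>(s, \<omega>). case_nat s \<omega>)))"
    by (simp flip: iter)
  also have "\<dots> = (\<integral>\<^sup>+y. \<integral>\<^sup>+x. indicator C (skew (case y of (s, \<omega>) \<Rightarrow> case_nat s \<omega>, x)) \<partial>\<nu> \<partial>(p \<Otimes>\<^sub>M \<Omega>))"
    by (subst nn_integral_distr) simp_all
  also have "\<dots> = (\<integral>\<^sup>+y. \<integral>\<^sup>+x. indicator C (snd y, F (fst y) x) \<partial>\<nu> \<partial>(p \<Otimes>\<^sub>M \<Omega>))"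
    by (simp add: skew_def case_prod_unfold)
  also have "\<dots> = (\<integral>\<^sup>+t. \<integral>\<^sup>+\<omega>. \<integral>\<^sup>+x. indicator C (\<omega>, F t x) \<partial>\<nu> \<partial>\<Omega> \<partial>p)"
    by (subst O.nn_integral_fst[symmetric]) simp_all
  also have "\<dots> = (\<integral>\<^sup>+\<omega>. \<integral>\<^sup>+t. \<integral>\<^sup>+x. indicator C (\<omega>, F t x) \<partial>\<nu> \<partial>p \<partial>\<Omega>)"
    by (rule OP.Fubini') measurable
  also have "\<dots> = (\<integral>\<^sup>+\<omega>. \<integral>\<^sup>+x. indicator C (\<omega>, x) \<partial>\<nu> \<partial>\<Omega>)"
    by (intro nn_integral_cong nn_integral_stationary) measurable
  also have "\<dots> = emeasure (\<Omega> \<Otimes>\<^sub>M \<nu>) C"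
    by (subst N.nn_integral_fst) simp_all
  finally show "emeasure (distr (\<Omega> \<Otimes>\<^sub>M \<nu>) (\<Omega> \<Otimes>\<^sub>M \<nu>) skew) C = emeasure (\<Omega> \<Otimes>\<^sub>M \<nu>) C" .
qed simp

lemma measurable_skew_pow [measurable]: "(skew ^^ n) \<in> \<Omega> \<Otimes>\<^sub>M \<nu> \<rightarrow>\<^sub>M \<Omega> \<Otimes>\<^sub>M \<nu>"
  by (induction n) (auto intro: measurable_comp simp: measurable_id)

lemma distr_skew_pow: "distr (\<Omega> \<Otimes>\<^sub>M \<nu>) (\<Omega> \<Otimes>\<^sub>M \<nu>) (skew ^^ n) = \<Omega> \<Otimes>\<^sub>M \<nu>"
proof (induction n)
  case (Suc n)
  have "distr (\<Omega> \<Otimes>\<^sub>M \<nu>) (\<Omega> \<Otimes>\<^sub>M \<nu>) (skew ^^ Suc n) =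
      distr (distr (\<Omega> \<Otimes>\<^sub>M \<nu>) (\<Omega> \<Otimes>\<^sub>M \<nu>) (skew ^^ n)) (\<Omega> \<Otimes>\<^sub>M \<nu>) skew"
    by (subst distr_distr) (auto simp: comp_def)
  then show ?case by (simp add: Suc distr_skew comp_def)
qed (simp add: id_def)

lemma skew_pow: "(skew ^^ n) (\<omega>, x) = ((\<lambda>k. \<omega> (n + k)), orbit_map F n \<omega> x)"
  by (induction n) (auto simp: skew_def)

lemma integrable_skew_pow:
  fixes h :: "_ \<Rightarrow> real"
  assumes "integrable (\<Omega> \<Otimes>\<^sub>M \<nu>) h"
  shows "integrable (\<Omega> \<Otimes>\<^sub>M \<nu>) (\<lambda>z. h ((skew ^^ n) z))"
  using integrable_distr[of "skew ^^ n" "\<Omega> \<Otimes>\<^sub>M \<nu>" "\<Omega> \<Otimes>\<^sub>M \<nu>" h] assms by (simp add: distr_skew_pow)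

lemma integral_skew_pow:
  fixes h :: "_ \<Rightarrow> real"
  assumes "h \<in> borel_measurable (\<Omega> \<Otimes>\<^sub>M \<nu>)"
  shows "(\<integral>z. h ((skew ^^ n) z) \<partial>(\<Omega> \<Otimes>\<^sub>M \<nu>)) = (\<integral>z. h z \<partial>(\<Omega> \<Otimes>\<^sub>M \<nu>))"
  using integral_distr[of "skew ^^ n" "\<Omega> \<Otimes>\<^sub>M \<nu>" "\<Omega> \<Otimes>\<^sub>M \<nu>" h] assms by (simp add: distr_skew_pow)

lemma AE_skew_pow:
  assumes "AE z in \<Omega> \<Otimes>\<^sub>M \<nu>. Q z"
  shows "AE z in \<Omega> \<Otimes>\<^sub>M \<nu>. \<forall>n. Q ((skew ^^ n) z)"
proof (rule AE_all_countable[THEN iffD2], rule allI)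
  fix n
  have "AE z in distr (\<Omega> \<Otimes>\<^sub>M \<nu>) (\<Omega> \<Otimes>\<^sub>M \<nu>) (skew ^^ n). Q z"
    unfolding distr_skew_pow by (rule assms)
  then show "AE z in \<Omega> \<Otimes>\<^sub>M \<nu>. Q ((skew ^^ n) z)"
    by (rule AE_distrD[rotated]) measurable
qed

lemma AE_snd:
  assumes "AE x in \<nu>. Q x"
  shows "AE z in \<Omega> \<Otimes>\<^sub>M \<nu>. Q (snd z)"
proof -
  obtain Z where Z: "{x \<in> space \<nu>. \<not> Q x} \<subseteq> Z" "Z \<in> null_sets \<nu>"
    using assms unfolding eventually_ae_filter by auto
  have "space \<Omega> \<times> Z \<in> null_sets (\<Omega> \<Otimes>\<^sub>M \<nu>)"
  proof (rule null_setsI)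
    have "emeasure (\<Omega> \<Otimes>\<^sub>M \<nu>) (space \<Omega> \<times> Z) = emeasure \<Omega> (space \<Omega>) * emeasure \<nu> Z"
      using Z(2) by (intro N.emeasure_pair_measure_Times sets.top null_setsD2)
    then show "emeasure (\<Omega> \<Otimes>\<^sub>M \<nu>) (space \<Omega> \<times> Z) = 0" using null_setsD1[OF Z(2)] by simp
  qed (use Z(2) in \<open>intro pair_measureI sets.top null_setsD2\<close>)
  moreover have "{z \<in> space (\<Omega> \<Otimes>\<^sub>M \<nu>). \<not> Q (snd z)} \<subseteq> space \<Omega> \<times> Z"
    using Z(1) unfolding space_pair_measure by force
  ultimately show ?thesis by (rule AE_I')
qed

text \<open>Invariance of the measure under \<open>skew\<close> turns the pointwise subadditivity
  into subadditivity of the integrals, and the Birkhoff sums of K bound these linearly from below,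
  as \<open>fekete\<close> requires.\<close>

lemma convergent_subadditive:
  fixes \<phi> :: "nat \<Rightarrow> (nat \<Rightarrow> 't) \<times> 'b \<Rightarrow> real"
  assumes meas: "\<And>n. \<phi> n \<in> borel_measurable (\<Omega> \<Otimes>\<^sub>M \<nu>)"
    and K: "integrable (\<Omega> \<Otimes>\<^sub>M \<nu>) K"
    and bound: "\<And>n. AE z in \<Omega> \<Otimes>\<^sub>M \<nu>. \<bar>\<phi> n z\<bar> \<le> (\<Sum>k<n. K ((skew ^^ k) z))"
    and sub: "\<And>n k. AE z in \<Omega> \<Otimes>\<^sub>M \<nu>. \<phi> (n + k) z \<le> \<phi> n z + \<phi> k ((skew ^^ n) z)"
  shows "integrable (\<Omega> \<Otimes>\<^sub>M \<nu>) (\<phi> n)"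
    and "convergent (\<lambda>n. 1 / real n * (\<integral>z. \<phi> n z \<partial>(\<Omega> \<Otimes>\<^sub>M \<nu>)))"
proof -
  let ?a = "\<lambda>n. \<integral>z. \<phi> n z \<partial>(\<Omega> \<Otimes>\<^sub>M \<nu>)"
  have iS: "integrable (\<Omega> \<Otimes>\<^sub>M \<nu>) (\<lambda>z. \<Sum>k<n. K ((skew ^^ k) z))" for n
    by (intro Bochner_Integration.integrable_sum integrable_skew_pow K)
  show int: "integrable (\<Omega> \<Otimes>\<^sub>M \<nu>) (\<phi> n)" for n
    by (rule Bochner_Integration.integrable_bound[OF iS[of n] meas]) (use bound[of n] in \<open>auto intro: order_trans\<close>)
  have "convergent (\<lambda>n. ?a n / real n)"
  proof (rule fekete)
    fix n k
    have "?a (n + k) \<le> (\<integral>z. \<phi> n z + \<phi> k ((skew ^^ n) z) \<partial>(\<Omega> \<Otimes>\<^sub>M \<nu>))"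
      by (intro integral_mono_AE int Bochner_Integration.integrable_add integrable_skew_pow sub)
    also have "\<dots> = ?a n + ?a k"
      by (subst Bochner_Integration.integral_add) (auto intro!: int integrable_skew_pow simp: integral_skew_pow meas)
    finally show "?a (n + k) \<le> ?a n + ?a k" .
  next
    fix n
    have "(\<integral>z. - \<phi> n z \<partial>(\<Omega> \<Otimes>\<^sub>M \<nu>)) \<le> (\<integral>z. (\<Sum>k<n. K ((skew ^^ k) z)) \<partial>(\<Omega> \<Otimes>\<^sub>M \<nu>))"
      by (intro integral_mono_AE integrable_minus int iS) (use bound[of n] in auto)
    also have "\<dots> = (\<Sum>k<n. \<integral>z. K ((skew ^^ k) z) \<partial>(\<Omega> \<Otimes>\<^sub>M \<nu>))"
      by (intro Bochner_Integration.integral_sum integrable_skew_pow K)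
    also have "\<dots> = (\<integral>z. K z \<partial>(\<Omega> \<Otimes>\<^sub>M \<nu>)) * real n"
      using K by (simp add: integral_skew_pow borel_measurable_integrable)
    finally show "- ((\<integral>z. K z \<partial>(\<Omega> \<Otimes>\<^sub>M \<nu>)) * real n) \<le> ?a n" by simp
  qed
  then show "convergent (\<lambda>n. 1 / real n * ?a n)" by simp
qed

end

section \<open>Linear cocycles and their exponents\<close>

lemma log_plus_nonneg: "0 \<le> log_plus r"
  by (simp add: log_plus_def)

lemma ln_le_log_plus: "ln r \<le> log_plus r"
  by (simp add: log_plus_def)

text \<open>The matrices are required to be invertible at every (t, x), without exceptional set.
  This is possible because the random map is corrected on a null set before a cocycle is
  formed.\<close>

locale linear_cocycle = stationary_system p f \<mu>
  for p :: "'t measure" and f :: "'t \<Rightarrow> 'a \<Rightarrow> 'a" and \<mu> :: "'a measure" +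
  fixes A :: "'t \<Rightarrow> 'a \<Rightarrow> 'e::euclidean_space \<Rightarrow> 'e"
  assumes linear_A: "linear (A t x)" and bij_A: "bij (A t x)"
    and measurable_A: "(\<lambda>(t, x). A t x v) \<in> borel_measurable (p \<Otimes>\<^sub>M \<mu>)"
    and log_integrable: "(\<integral>\<^sup>+z. ennreal (case z of (t, x) \<Rightarrow> log_plus (onorm (A t x)) + log_plus (onorm (inv (A t x)))) \<partial>(p \<Otimes>\<^sub>M \<mu>)) < \<infinity>"
begin

definition gen :: "(nat \<Rightarrow> 't) \<times> 'a \<Rightarrow> 'e \<Rightarrow> 'e" where
  "gen z = A (fst z 0) (snd z)"

definition cyc :: "nat \<Rightarrow> (nat \<Rightarrow> 't) \<times> 'a \<Rightarrow> 'e \<Rightarrow> 'e" where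
  "cyc n z = rec_nat id (\<lambda>k B. gen ((skew ^^ k) z) \<circ> B) n"

lemma cyc_simps: "cyc 0 z = id" "cyc (Suc n) z = gen ((skew ^^ n) z) \<circ> cyc n z"
  by (simp_all add: cyc_def)

definition log_size :: "(nat \<Rightarrow> 't) \<times> 'a \<Rightarrow> real" where
  "log_size z = log_plus (onorm (gen z)) + log_plus (onorm (inv (gen z)))"

lemma linear_gen: "linear (gen z)" and bij_gen: "bij (gen z)"
  by (simp_all add: gen_def linear_A bij_A)

lemma linear_cyc: "linear (cyc n z)"
  by (induction n; unfold cyc_simps) (rule linear_id, erule linear_compose[OF _ linear_gen])

lemma bij_cyc: "bij (cyc n z)"
  by (induction n; unfold cyc_simps) (rule bij_id, erule bij_comp[OF _ bij_gen])

lemma cyc_add: "cyc (n + k) z = cyc k ((skew ^^ n) z) \<circ> cyc n z"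
proof (induction k)
  case (Suc k)
  have "(skew ^^ (n + k)) z = (skew ^^ k) ((skew ^^ n) z)"
    by (metis add.commute comp_apply funpow_add)
  then show ?case using Suc by (metis add_Suc_right comp_assoc cyc_simps(2))
qed (simp add: cyc_simps(1)[of "(skew ^^ n) z"])

lemma measurable_gen: "(\<lambda>z. gen z v) \<in> borel_measurable (\<Omega> \<Otimes>\<^sub>M \<mu>)"
proof -
  have "(\<lambda>z. (fst z 0, snd z)) \<in> \<Omega> \<Otimes>\<^sub>M \<mu> \<rightarrow>\<^sub>M p \<Otimes>\<^sub>M \<mu>" by measurable
  from measurable_compose[OF this measurable_A[of v]] show ?thesis by (simp add: gen_def)
qed

lemma measurable_cyc: "(\<lambda>z. cyc n z v) \<in> borel_measurable (\<Omega> \<Otimes>\<^sub>M \<mu>)"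
proof (induction n)
  case (Suc n)
  have "(\<lambda>z. gen ((skew ^^ n) z) (cyc n z v)) \<in> borel_measurable (\<Omega> \<Otimes>\<^sub>M \<mu>)"
  proof (rule borel_measurable_linear_apply[OF _ linear_gen Suc])
    show "(\<lambda>z. gen ((skew ^^ n) z) w) \<in> borel_measurable (\<Omega> \<Otimes>\<^sub>M \<mu>)" for w
      using measurable_compose[OF measurable_skew_pow measurable_gen] .
  qed
  then show ?case unfolding cyc_simps by simp
qed (simp add: cyc_simps)

lemma measurable_inv_cyc: "(\<lambda>z. inv (cyc n z) v) \<in> borel_measurable (\<Omega> \<Otimes>\<^sub>M \<mu>)"
  by (intro borel_measurable_linear_inv measurable_cyc linear_cyc bij_cyc)

lemma measurable_inv_gen: "(\<lambda>z. inv (gen z) v) \<in> borel_measurable (\<Omega> \<Otimes>\<^sub>M \<mu>)"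
  by (intro borel_measurable_linear_inv measurable_gen linear_gen bij_gen)

lemma linear_inv_cyc: "linear (inv (cyc n z))"
  by (intro linear_inv_bij linear_cyc bij_cyc)

lemma linear_inv_gen: "linear (inv (gen z))"
  by (intro linear_inv_bij linear_gen bij_gen)

lemma log_size_nonneg: "0 \<le> log_size z"
  by (simp add: log_size_def log_plus_nonneg)

lemma measurable_log_size: "log_size \<in> borel_measurable (\<Omega> \<Otimes>\<^sub>M \<mu>)"
proof -
  have [measurable]: "(\<lambda>z. onorm (gen z)) \<in> borel_measurable (\<Omega> \<Otimes>\<^sub>M \<mu>)"
    "(\<lambda>z. onorm (inv (gen z))) \<in> borel_measurable (\<Omega> \<Otimes>\<^sub>M \<mu>)"
    by (intro borel_measurable_onorm measurable_gen measurable_inv_gen linear_gen linear_inv_gen)+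
  show ?thesis unfolding log_size_def[abs_def] log_plus_def by measurable
qed

lemma integrable_log_size: "integrable (\<Omega> \<Otimes>\<^sub>M \<mu>) log_size"
proof (rule integrableI_nonneg)
  let ?k = "\<lambda>t x. log_plus (onorm (A t x)) + log_plus (onorm (inv (A t x)))"
  have inv_meas: "(\<lambda>z. inv (case z of (t, x) \<Rightarrow> A t x) v) \<in> borel_measurable (p \<Otimes>\<^sub>M \<mu>)" for v
    using measurable_A by (intro borel_measurable_linear_inv) (auto simp: linear_A bij_A case_prod_unfold)
  have [measurable]: "(\<lambda>z. onorm (case z of (t, x) \<Rightarrow> A t x)) \<in> borel_measurable (p \<Otimes>\<^sub>M \<mu>)"
    "(\<lambda>z. onorm (inv (case z of (t, x) \<Rightarrow> A t x))) \<in> borel_measurable (p \<Otimes>\<^sub>M \<mu>)"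
    using measurable_A inv_meas
    by (auto intro!: borel_measurable_onorm linear_inv_bij simp: linear_A bij_A case_prod_unfold)
  have k_meas: "(\<lambda>z. ?k (fst z) (snd z)) \<in> borel_measurable (p \<Otimes>\<^sub>M \<mu>)"
    using \<open>(\<lambda>z. onorm (case z of (t, x) \<Rightarrow> A t x)) \<in> _\<close> \<open>(\<lambda>z. onorm (inv (case z of (t, x) \<Rightarrow> A t x))) \<in> _\<close>
    unfolding log_plus_def case_prod_unfold by measurable
  note [measurable] = measurable_compose[OF measurable_Pair k_meas, simplified]
  have "(\<integral>\<^sup>+z. ennreal (log_size z) \<partial>(\<Omega> \<Otimes>\<^sub>M \<mu>)) = (\<integral>\<^sup>+\<omega>. (\<integral>\<^sup>+x. ennreal (log_size (\<omega>, x)) \<partial>\<mu>) \<partial>\<Omega>)"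
    using measurable_log_size by (subst N.nn_integral_fst[symmetric]) simp_all
  also have "\<dots> = (\<integral>\<^sup>+\<omega>. (\<integral>\<^sup>+x. ennreal (?k (\<omega> 0) x) \<partial>\<mu>) \<partial>\<Omega>)"
    by (simp add: log_size_def gen_def)
  also have "\<dots> = (\<integral>\<^sup>+t. (\<integral>\<^sup>+x. ennreal (?k t x) \<partial>\<mu>) \<partial>p)"
    by (rule nn_integral_coordinate[where h = "\<lambda>t. \<integral>\<^sup>+x. ennreal (?k t x) \<partial>\<mu>"]) measurable
  also have "\<dots> = (\<integral>\<^sup>+z. ennreal (case z of (t, x) \<Rightarrow> ?k t x) \<partial>(p \<Otimes>\<^sub>M \<mu>))"
    by (subst N.nn_integral_fst[symmetric]) (use k_meas in \<open>simp_all add: case_prod_unfold\<close>)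
  finally show "(\<integral>\<^sup>+z. ennreal (log_size z) \<partial>(\<Omega> \<Otimes>\<^sub>M \<mu>)) < \<infinity>" using log_integrable by simp
qed (auto simp: log_size_nonneg measurable_log_size)

lemma onorm_cyc_pos: "0 < onorm (cyc n z)" "0 < onorm (inv (cyc n z))"
  by (intro onorm_bij_pos linear_cyc bij_cyc)+

lemma onorm_cyc_add: "onorm (cyc (n + k) z) \<le> onorm (cyc k ((skew ^^ n) z)) * onorm (cyc n z)"
  unfolding cyc_add by (intro onorm_compose linear_imp_bounded_linear linear_cyc)

lemma onorm_inv_cyc_add: "onorm (inv (cyc (n + k) z)) \<le> onorm (inv (cyc n z)) * onorm (inv (cyc k ((skew ^^ n) z)))"
  unfolding cyc_add o_inv_distrib[OF bij_cyc bij_cyc]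
  by (intro onorm_compose linear_imp_bounded_linear linear_inv_cyc)

lemma ln_onorm_cyc_add: "ln (onorm (cyc (n + k) z)) \<le> ln (onorm (cyc n z)) + ln (onorm (cyc k ((skew ^^ n) z)))"
  using onorm_cyc_add[of n k z] onorm_cyc_pos by (subst ln_mult_pos[symmetric]) (simp_all add: mult.commute)

lemma ln_onorm_inv_cyc_add:
  "ln (onorm (inv (cyc (n + k) z))) \<le> ln (onorm (inv (cyc n z))) + ln (onorm (inv (cyc k ((skew ^^ n) z))))"
  using onorm_inv_cyc_add[of n k z] onorm_cyc_pos by (subst ln_mult_pos[symmetric]) simp_all

lemma ln_onorm_cyc_le:
  "ln (onorm (cyc n z)) \<le> (\<Sum>k<n. log_size ((skew ^^ k) z))"
  "ln (onorm (inv (cyc n z))) \<le> (\<Sum>k<n. log_size ((skew ^^ k) z))"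
proof (induction n)
  case 0
  case 1 show ?case using onorm_id[where 'a = 'e] unfolding cyc_simps by (simp add: id_def)
  case 2 show ?case using onorm_id[where 'a = 'e] unfolding cyc_simps inv_id by (simp add: id_def)
next
  case (Suc n)
  have one: "cyc (Suc 0) y = gen y" for y unfolding cyc_simps by simp
  have *: "ln (onorm (gen y)) \<le> log_size y" "ln (onorm (inv (gen y))) \<le> log_size y" for y
    using ln_le_log_plus[of "onorm (gen y)"] log_plus_nonneg[of "onorm (gen y)"]
      ln_le_log_plus[of "onorm (inv (gen y))"] log_plus_nonneg[of "onorm (inv (gen y))"]
    by (auto simp: log_size_def)
  case 1 show ?case
    using ln_onorm_cyc_add[of n "Suc 0" z] Suc(1) *(1)[of "(skew ^^ n) z"] by (simp only: one add_Suc_right add_0_right sum.lessThan_Suc)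
  case 2 show ?case
    using ln_onorm_inv_cyc_add[of n "Suc 0" z] Suc(2) *(2)[of "(skew ^^ n) z"] by (simp only: one add_Suc_right add_0_right sum.lessThan_Suc)
qed

text \<open>Turns the upper bound for the norm of A^n into a lower bound for that of its inverse,
  and conversely.\<close>

lemma ln_onorm_cyc_nonneg: "0 \<le> ln (onorm (cyc n z)) + ln (onorm (inv (cyc n z)))"
  using onorm_inv_ge_1[OF linear_cyc bij_cyc, of n z] onorm_cyc_pos[of n z]
  by (subst ln_mult_pos[symmetric]) simp_all

lemma abs_ln_onorm_cyc:
  "\<bar>ln (onorm (cyc n z))\<bar> \<le> (\<Sum>k<n. log_size ((skew ^^ k) z))"
  "\<bar>ln (onorm (inv (cyc n z)))\<bar> \<le> (\<Sum>k<n. log_size ((skew ^^ k) z))"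
  using ln_onorm_cyc_le[of n z] ln_onorm_cyc_nonneg[of n z] by linarith+

lemma measurable_ln_onorm_cyc:
  "(\<lambda>z. ln (onorm (cyc n z))) \<in> borel_measurable (\<Omega> \<Otimes>\<^sub>M \<mu>)"
  "(\<lambda>z. ln (onorm (inv (cyc n z)))) \<in> borel_measurable (\<Omega> \<Otimes>\<^sub>M \<mu>)"
  by (intro borel_measurable_ln borel_measurable_onorm measurable_cyc measurable_inv_cyc linear_cyc linear_inv_cyc)+

definition top_exponent :: real where
  "top_exponent = lim (\<lambda>n. 1 / real n * (\<integral>z. ln (onorm (cyc n z)) \<partial>(\<Omega> \<Otimes>\<^sub>M \<mu>)))"

definition inv_exponent :: real where
  "inv_exponent = lim (\<lambda>n. 1 / real n * (\<integral>z. ln (onorm (inv (cyc n z))) \<partial>(\<Omega> \<Otimes>\<^sub>M \<mu>)))"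

lemma integrable_ln_onorm_cyc:
  "integrable (\<Omega> \<Otimes>\<^sub>M \<mu>) (\<lambda>z. ln (onorm (cyc n z)))"
  "integrable (\<Omega> \<Otimes>\<^sub>M \<mu>) (\<lambda>z. ln (onorm (inv (cyc n z))))"
  by (rule convergent_subadditive(1)[OF _ integrable_log_size];
      simp add: measurable_ln_onorm_cyc abs_ln_onorm_cyc ln_onorm_cyc_add ln_onorm_inv_cyc_add)+

lemma LIMSEQ_top_exponent:
  "(\<lambda>n. 1 / real n * (\<integral>z. ln (onorm (cyc n z)) \<partial>(\<Omega> \<Otimes>\<^sub>M \<mu>))) \<longlonglongrightarrow> top_exponent"
  unfolding top_exponent_def convergent_LIMSEQ_iff[symmetric]
  by (rule convergent_subadditive(2)[OF _ integrable_log_size];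
      simp add: measurable_ln_onorm_cyc abs_ln_onorm_cyc ln_onorm_cyc_add)

lemma LIMSEQ_inv_exponent:
  "(\<lambda>n. 1 / real n * (\<integral>z. ln (onorm (inv (cyc n z))) \<partial>(\<Omega> \<Otimes>\<^sub>M \<mu>))) \<longlonglongrightarrow> inv_exponent"
  unfolding inv_exponent_def convergent_LIMSEQ_iff[symmetric]
  by (rule convergent_subadditive(2)[OF _ integrable_log_size];
      simp add: measurable_ln_onorm_cyc abs_ln_onorm_cyc ln_onorm_inv_cyc_add)

subsection \<open>Determinants\<close>

lemma measurable_ln_det_cyc: "(\<lambda>z. ln \<bar>lin_det (cyc n z)\<bar>) \<in> borel_measurable (\<Omega> \<Otimes>\<^sub>M \<mu>)"
  by (intro borel_measurable_ln borel_measurable_abs borel_measurable_lin_det measurable_cyc)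

text \<open>The Leibniz sum has m! terms, each at most the m-th power of the norm. The crude factor
  m! is harmless, since only integrability is at stake. The lower bound is the upper bound for the
  inverse.\<close>

lemma abs_ln_lin_det_le:
  fixes B :: "'e \<Rightarrow> 'e"
  assumes "linear B" "bij B"
  shows "\<bar>ln \<bar>lin_det B\<bar>\<bar> \<le> ln (fact DIM('e)) + real DIM('e) * (log_plus (onorm B) + log_plus (onorm (inv B)))"
proof -
  have *: "ln \<bar>lin_det B\<bar> \<le> ln (fact DIM('e)) + real DIM('e) * log_plus (onorm B)"
    if B: "linear B" "bij B" for B :: "'e \<Rightarrow> 'e"
  proof -
    have pos: "0 < onorm B" by (rule onorm_bij_pos[OF B])
    have "\<bar>lin_det B\<bar> \<le> (\<Sum>q | q permutes {..<DIM('e)}. \<bar>of_int (sign q) * (\<Prod>i<DIM('e). B (basis_enum i) \<bullet> basis_enum (q i))\<bar>)"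
      unfolding lin_det_def vol_def nat_det_def comp_def by (rule sum_abs)
    also have "\<dots> \<le> (\<Sum>q | q permutes {..<DIM('e)}. (onorm B) ^ DIM('e))"
    proof (rule sum_mono)
      fix q assume "q \<in> {q. q permutes {..<DIM('e)}}"
      then have q: "q i < DIM('e)" if "i < DIM('e)" for i
        using that permutes_in_image[of q "{..<DIM('e)}" i] by simp
      have "\<bar>of_int (sign q) * (\<Prod>i<DIM('e). B (basis_enum i) \<bullet> basis_enum (q i))\<bar> = (\<Prod>i<DIM('e). \<bar>B (basis_enum i) \<bullet> basis_enum (q i)\<bar>)"
        by (simp add: abs_mult abs_prod sign_def)
      also have "\<dots> \<le> (\<Prod>i<DIM('e). onorm B)"
      proof (rule prod_mono)
        fix i assume "i \<in> {..<DIM('e)}"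
        then have "\<bar>B (basis_enum i) \<bullet> basis_enum (q i)\<bar> \<le> norm (B (basis_enum i))" 
          using Cauchy_Schwarz_ineq2[of "B (basis_enum i)" "basis_enum (q i)"] q[of i]
          by (simp add: basis_enum_in_Basis)
        also have "\<dots> \<le> onorm B" 
          using onorm[OF linear_imp_bounded_linear[OF B(1)], of "basis_enum i"] \<open>i \<in> _\<close> by (simp add: basis_enum_in_Basis)
        finally show "0 \<le> \<bar>B (basis_enum i) \<bullet> basis_enum (q i)\<bar> \<and> \<bar>B (basis_enum i) \<bullet> basis_enum (q i)\<bar> \<le> onorm B" by simp
      qed
      finally show "\<bar>of_int (sign q) * (\<Prod>i<DIM('e). B (basis_enum i) \<bullet> basis_enum (q i))\<bar> \<le> (onorm B) ^ DIM('e)" by simp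
    qed
    also have "\<dots> = fact DIM('e) * onorm B ^ DIM('e)"
      by (simp add: card_permutations)
    finally have "ln \<bar>lin_det B\<bar> \<le> ln (fact DIM('e) * onorm B ^ DIM('e))"
      using lin_det_nonzero[OF B] pos by (subst ln_le_cancel_iff) auto
    also have "\<dots> = ln (fact DIM('e)) + real DIM('e) * ln (onorm B)"
      using pos by (simp add: ln_mult_pos ln_realpow)
    also have "\<dots> \<le> ln (fact DIM('e)) + real DIM('e) * log_plus (onorm B)"
      by (intro add_left_mono mult_left_mono ln_le_log_plus) simp
    finally show ?thesis .
  qed
  have inv: "linear (inv B)" "bij (inv B)" using assms by (auto intro: linear_inv_bij bij_imp_bij_inv)
  have "lin_det B * lin_det (inv B) = 1"
    using lin_det_comp[OF assms(1) inv(1)] assms(2) by (metis bij_is_surj lin_det_id surj_iff)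
  then have "ln \<bar>lin_det B\<bar> + ln \<bar>lin_det (inv B)\<bar> = 0"
    using lin_det_nonzero[OF assms] lin_det_nonzero[OF inv]
    by (subst ln_mult_pos[symmetric]) (auto simp flip: abs_mult)
  moreover have "0 \<le> real DIM('e) * log_plus (onorm B)" "0 \<le> real DIM('e) * log_plus (onorm (inv B))"
    by (simp_all add: log_plus_nonneg)
  ultimately show ?thesis
    using *[OF assms] *[OF inv] by (simp add: distrib_left)
qed

lemma integrable_ln_det_gen: "integrable (\<Omega> \<Otimes>\<^sub>M \<mu>) (\<lambda>z. ln \<bar>lin_det (gen z)\<bar>)"
proof (rule Bochner_Integration.integrable_bound)
  show "integrable (\<Omega> \<Otimes>\<^sub>M \<mu>) (\<lambda>z. ln (fact DIM('e)) + real DIM('e) * log_size z)"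
    using integrable_log_size by simp
  show "(\<lambda>z. ln \<bar>lin_det (gen z)\<bar>) \<in> borel_measurable (\<Omega> \<Otimes>\<^sub>M \<mu>)"
    by (intro borel_measurable_ln borel_measurable_abs borel_measurable_lin_det measurable_gen)
  show "AE z in \<Omega> \<Otimes>\<^sub>M \<mu>. norm (ln \<bar>lin_det (gen z)\<bar>) \<le> norm (ln (fact DIM('e)) + real DIM('e) * log_size z)"
    using abs_ln_lin_det_le[OF linear_gen bij_gen] by (auto simp: log_size_def intro!: AE_I2 order_trans[OF _ abs_ge_self])
qed

lemma ln_det_cyc:
  "integrable (\<Omega> \<Otimes>\<^sub>M \<mu>) (\<lambda>z. ln \<bar>lin_det (cyc n z)\<bar>)"
  "(\<integral>z. ln \<bar>lin_det (cyc n z)\<bar> \<partial>(\<Omega> \<Otimes>\<^sub>M \<mu>)) = real n * (\<integral>z. ln \<bar>lin_det (gen z)\<bar> \<partial>(\<Omega> \<Otimes>\<^sub>M \<mu>))"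
proof -
  have sum: "ln \<bar>lin_det (cyc n z)\<bar> = (\<Sum>k<n. ln \<bar>lin_det (gen ((skew ^^ k) z))\<bar>)" for z
  proof (induction n)
    case (Suc n)
    have "lin_det (gen ((skew ^^ n) z)) \<noteq> 0" "lin_det (cyc n z) \<noteq> 0"
      by (intro lin_det_nonzero linear_gen bij_gen linear_cyc bij_cyc)+
    then show ?case
      using Suc unfolding cyc_simps lin_det_comp[OF linear_gen linear_cyc] by (simp add: abs_mult ln_mult_pos)
  qed (unfold cyc_simps lin_det_id, simp)
  note int = integrable_skew_pow[OF integrable_ln_det_gen]
  show "integrable (\<Omega> \<Otimes>\<^sub>M \<mu>) (\<lambda>z. ln \<bar>lin_det (cyc n z)\<bar>)"
    unfolding sum by (intro Bochner_Integration.integrable_sum int)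
  show "(\<integral>z. ln \<bar>lin_det (cyc n z)\<bar> \<partial>(\<Omega> \<Otimes>\<^sub>M \<mu>)) = real n * (\<integral>z. ln \<bar>lin_det (gen z)\<bar> \<partial>(\<Omega> \<Otimes>\<^sub>M \<mu>))"
    unfolding sum
    by (subst Bochner_Integration.integral_sum[OF int])
      (simp_all add: integral_skew_pow[OF borel_measurable_integrable[OF integrable_ln_det_gen]])
qed

end

subsection \<open>Growth along invariant lines\<close>

lemma norm_ratio_bounds:
  fixes B :: "'e::euclidean_space \<Rightarrow> 'e"
  assumes "linear B" "bij B" "w \<noteq> 0"
  shows "0 < norm (B w) / norm w" "ln (norm (B w) / norm w) \<le> ln (onorm B)"
    "- ln (onorm (inv B)) \<le> ln (norm (B w) / norm w)"
proof -
  have "B w \<noteq> 0" using assms by (metis bij_is_inj linear_injective_0)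
  then show pos: "0 < norm (B w) / norm w" using assms by simp
  have "norm (B w) / norm w \<le> onorm B"
    using onorm[OF linear_imp_bounded_linear[OF assms(1)], of w] assms(3) by (simp add: field_simps)
  then show "ln (norm (B w) / norm w) \<le> ln (onorm B)" using pos by (subst ln_le_cancel_iff) auto
  have "1 / onorm (inv B) \<le> norm (B w) / norm w"
    using norm_le_onorm_inv[OF assms(1,2), of w] assms(3) onorm_bij_pos[OF assms(1,2)] by (simp add: field_simps)
  then have "ln (1 / onorm (inv B)) \<le> ln (norm (B w) / norm w)"
    using pos onorm_bij_pos[OF assms(1,2)] by (subst ln_le_cancel_iff) auto
  then show "- ln (onorm (inv B)) \<le> ln (norm (B w) / norm w)"
    using onorm_bij_pos[OF assms(1,2)] by (simp add: ln_div)
qed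

context linear_cocycle
begin

text \<open>A point \<open>y\<close> of the system \<open>G\<close> carries the base point \<open>fst (\<sigma> y)\<close> and the line spanned by
  \<open>snd (\<sigma> y)\<close>. Along an orbit the logarithmic growth of this line is a Birkhoff sum.\<close>

lemma line_growth:
  fixes \<sigma> :: "'z \<Rightarrow> 'a \<times> 'e"
  assumes G: "stationary_system p G \<nu>"
    and \<sigma> [measurable]: "\<sigma> \<in> \<nu> \<rightarrow>\<^sub>M \<mu> \<Otimes>\<^sub>M borel"
    and base: "distr \<nu> \<mu> (\<lambda>y. fst (\<sigma> y)) = \<mu>"
    and nz: "\<And>y. y \<in> space \<nu> \<Longrightarrow> snd (\<sigma> y) \<noteq> 0"
    and equiv: "AE (\<omega>, y) in \<Omega> \<Otimes>\<^sub>M \<nu>. fst (\<sigma> (G (\<omega> 0) y)) = f (\<omega> 0) (fst (\<sigma> y)) \<and>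
        A (\<omega> 0) (fst (\<sigma> y)) (snd (\<sigma> y)) \<in> span {snd (\<sigma> (G (\<omega> 0) y))}"
  defines "h \<equiv> \<lambda>n (\<omega>, y). ln (norm (cyc n (\<omega>, fst (\<sigma> y)) (snd (\<sigma> y))) / norm (snd (\<sigma> y)))"
  defines "I \<equiv> \<integral>(\<omega>, y). ln (norm (A (\<omega> 0) (fst (\<sigma> y)) (snd (\<sigma> y))) / norm (snd (\<sigma> y))) \<partial>(\<Omega> \<Otimes>\<^sub>M \<nu>)"
  shows "integrable (\<Omega> \<Otimes>\<^sub>M \<nu>) (h n)" "(\<integral>y. h n y \<partial>(\<Omega> \<Otimes>\<^sub>M \<nu>)) = real n * I"
    and "integrable (\<Omega> \<Otimes>\<^sub>M \<nu>) (\<lambda>(\<omega>, y). ln (norm (A (\<omega> 0) (fst (\<sigma> y)) (snd (\<sigma> y))) / norm (snd (\<sigma> y))))"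
    and "I \<le> top_exponent" "- inv_exponent \<le> I"
proof -
  interpret L: stationary_system p G \<nu> by (rule G)
  \<comment> \<open>\<open>pr\<close> is a factor map from the lifted skew product to that of the
    base. It preserves the measures because \<nu> projects to \<mu>.\<close>
  define pr where "pr y = (fst y, fst (\<sigma> (snd y)))" for y :: "(nat \<Rightarrow> 't) \<times> 'z"
  define w where "w y = snd (\<sigma> (snd y))" for y :: "(nat \<Rightarrow> 't) \<times> 'z"
  define H where "H y = ln (norm (gen (pr y) (w y)) / norm (w y))" for y
  have [measurable]: "pr \<in> \<Omega> \<Otimes>\<^sub>M \<nu> \<rightarrow>\<^sub>M \<Omega> \<Otimes>\<^sub>M \<mu>" "w \<in> borel_measurable (\<Omega> \<Otimes>\<^sub>M \<nu>)"
    unfolding pr_def w_def by measurable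
  have distr_pr: "distr (\<Omega> \<Otimes>\<^sub>M \<nu>) (\<Omega> \<Otimes>\<^sub>M \<mu>) pr = \<Omega> \<Otimes>\<^sub>M \<mu>"
  proof -
    have "distr \<Omega> \<Omega> (\<lambda>x. x) \<Otimes>\<^sub>M distr \<nu> \<mu> (\<lambda>y. fst (\<sigma> y)) =
        distr (\<Omega> \<Otimes>\<^sub>M \<nu>) (\<Omega> \<Otimes>\<^sub>M \<mu>) (\<lambda>(x, y). (x, fst (\<sigma> y)))"
      by (rule pair_measure_distr) (simp_all add: base N.sigma_finite_measure_axioms)
    then show ?thesis by (simp add: base distr_id pr_def[abs_def] case_prod_unfold)
  qed
  have int_pr: "integrable (\<Omega> \<Otimes>\<^sub>M \<nu>) (\<lambda>y. k (pr y))"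
      "(\<integral>y. k (pr y) \<partial>(\<Omega> \<Otimes>\<^sub>M \<nu>)) = (\<integral>z. k z \<partial>(\<Omega> \<Otimes>\<^sub>M \<mu>))"
    if "integrable (\<Omega> \<Otimes>\<^sub>M \<mu>) k" for k :: "_ \<Rightarrow> real"
    using that integrable_distr[of pr "\<Omega> \<Otimes>\<^sub>M \<nu>" "\<Omega> \<Otimes>\<^sub>M \<mu>" k] integral_distr[of pr "\<Omega> \<Otimes>\<^sub>M \<nu>" "\<Omega> \<Otimes>\<^sub>M \<mu>" k]
    by (simp_all add: distr_pr)
  have wnz: "w y \<noteq> 0" if "y \<in> space (\<Omega> \<Otimes>\<^sub>M \<nu>)" for y
    using that nz by (auto simp: w_def space_pair_measure)
  have meas: "(\<lambda>y. cyc n (pr y) (w y)) \<in> borel_measurable (\<Omega> \<Otimes>\<^sub>M \<nu>)" for n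
    by (rule borel_measurable_linear_apply[OF measurable_compose[OF _ measurable_cyc] linear_cyc]) measurable
  have gen1: "gen z = cyc (Suc 0) z" for z unfolding cyc_simps by simp
  have H_meas: "H \<in> borel_measurable (\<Omega> \<Otimes>\<^sub>M \<nu>)"
  proof -
    have [measurable]: "(\<lambda>y. gen (pr y) (w y)) \<in> borel_measurable (\<Omega> \<Otimes>\<^sub>M \<nu>)"
      by (rule borel_measurable_linear_apply[OF measurable_compose[OF _ measurable_gen] linear_gen]) measurable
    show ?thesis unfolding H_def by measurable
  qed
  have h_eq: "h n y = ln (norm (cyc n (pr y) (w y)) / norm (w y))" for n y
    by (simp add: h_def pr_def w_def case_prod_unfold)
  have h_meas: "h n \<in> borel_measurable (\<Omega> \<Otimes>\<^sub>M \<nu>)" for n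
  proof -
    note [measurable] = meas[of n]
    show ?thesis unfolding h_eq[abs_def] by measurable
  qed
  have int_H: "integrable (\<Omega> \<Otimes>\<^sub>M \<nu>) H"
  proof (rule Bochner_Integration.integrable_bound[OF int_pr(1)[OF integrable_log_size] H_meas])
    show "AE y in \<Omega> \<Otimes>\<^sub>M \<nu>. norm (H y) \<le> norm (log_size (pr y))"
    proof (rule AE_I2)
      fix y assume "y \<in> space (\<Omega> \<Otimes>\<^sub>M \<nu>)"
      from norm_ratio_bounds[OF linear_gen bij_gen wnz[OF this], of "pr y"]
      show "norm (H y) \<le> norm (log_size (pr y))"
        using ln_onorm_cyc_le[of "Suc 0" "pr y"] log_size_nonneg[of "pr y"]
        unfolding H_def gen1 by simp
    qed
  qed
  \<comment> \<open>Equivariance holds off a null set at time zero. Invariance under the skew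
    product extends it to all times at once, off one null set.\<close>
  have good: "AE y in \<Omega> \<Otimes>\<^sub>M \<nu>. \<forall>n. pr (L.skew ((L.skew ^^ n) y)) = skew (pr ((L.skew ^^ n) y)) \<and>
      gen (pr ((L.skew ^^ n) y)) (w ((L.skew ^^ n) y)) \<in> span {w (L.skew ((L.skew ^^ n) y))} \<and>
      w ((L.skew ^^ n) y) \<noteq> 0"
  proof (rule L.AE_skew_pow)
    show "AE y in \<Omega> \<Otimes>\<^sub>M \<nu>. pr (L.skew y) = skew (pr y) \<and> gen (pr y) (w y) \<in> span {w (L.skew y)} \<and> w y \<noteq> 0"
      using equiv AE_space
    proof eventually_elim
      case (elim y)
      then show ?case
        using wnz[of y] by (auto simp: pr_def L.skew_def skew_def gen_def w_def case_prod_unfold)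
    qed
  qed
  have sum: "AE y in \<Omega> \<Otimes>\<^sub>M \<nu>. \<forall>n. h n y = (\<Sum>k<n. H ((L.skew ^^ k) y))"
    using good
  proof eventually_elim
    case (elim y)
    have pr: "pr ((L.skew ^^ n) y) = (skew ^^ n) (pr y)" for n
      by (induction n) (use elim in auto)
    \<comment> \<open>The vector A^n w and the vector that represents the line at time n agree only
      up to a scalar c. The rate \<open>H\<close> is invariant under scaling, so the quotients
      telescope all the same.\<close>
    have "(\<exists>c. c \<noteq> 0 \<and> cyc n (pr y) (w y) = c *\<^sub>R w ((L.skew ^^ n) y)) \<and> h n y = (\<Sum>k<n. H ((L.skew ^^ k) y))" for n
    proof (induction n)
      case 0
      have "cyc 0 (pr y) (w y) = w y" unfolding cyc_simps by simp
      moreover have "w y \<noteq> 0" using elim[rule_format, of 0] by simp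
      ultimately show ?case by (auto simp: h_eq intro: exI[of _ 1])
    next
      case (Suc n)
      define y' where "y' = (L.skew ^^ n) y"
      obtain c where c: "c \<noteq> 0" "cyc n (pr y) (w y) = c *\<^sub>R w y'" using Suc unfolding y'_def by blast
      have wy: "w y' \<noteq> 0" "w y \<noteq> 0" using elim[rule_format, of n] elim[rule_format, of 0] by (auto simp: y'_def)
      have step: "cyc (Suc n) (pr y) (w y) = c *\<^sub>R gen (pr y') (w y')"
        unfolding cyc_simps comp_apply c(2) linear_scale[OF linear_gen] y'_def pr ..
      obtain d where d: "gen (pr y') (w y') = d *\<^sub>R w (L.skew y')"
        using elim[rule_format, of n] by (auto simp: y'_def span_singleton)
      have gnz: "gen (pr y') (w y') \<noteq> 0"
        using wy linear_gen bij_gen by (metis bij_is_inj linear_injective_0)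
      then have "d \<noteq> 0" using d by auto
      have "norm (cyc (Suc n) (pr y) (w y)) / norm (w y) =
          (norm (gen (pr y') (w y')) / norm (w y')) * (norm (cyc n (pr y) (w y)) / norm (w y))"
        unfolding step c(2) using wy by simp
      then have "h (Suc n) y = H y' + h n y"
        unfolding h_eq H_def using gnz wy c by (subst ln_mult_pos[symmetric]) auto
      then show ?case
        using Suc c d \<open>d \<noteq> 0\<close> unfolding step by (auto simp: y'_def intro!: exI[of _ "c * d"])
    qed
    then show ?case by blast
  qed
  have int_sum: "integrable (\<Omega> \<Otimes>\<^sub>M \<nu>) (\<lambda>y. \<Sum>k<n. H ((L.skew ^^ k) y))" for n
    by (intro Bochner_Integration.integrable_sum L.integrable_skew_pow int_H)
  show int_h: "integrable (\<Omega> \<Otimes>\<^sub>M \<nu>) (h n)" for n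
    by (rule integrable_cong_AE[THEN iffD2, OF h_meas borel_measurable_integrable[OF int_sum] _ int_sum])
      (use sum in \<open>auto elim: eventually_mono\<close>)
  have I: "I = (\<integral>y. H y \<partial>(\<Omega> \<Otimes>\<^sub>M \<nu>))"
    by (simp add: I_def H_def gen_def pr_def w_def case_prod_unfold)
  show h_int: "(\<integral>y. h n y \<partial>(\<Omega> \<Otimes>\<^sub>M \<nu>)) = real n * I" for n
  proof -
    have "(\<integral>y. h n y \<partial>(\<Omega> \<Otimes>\<^sub>M \<nu>)) = (\<integral>y. (\<Sum>k<n. H ((L.skew ^^ k) y)) \<partial>(\<Omega> \<Otimes>\<^sub>M \<nu>))"
      by (intro integral_cong_AE h_meas borel_measurable_integrable[OF int_sum])
        (use sum in \<open>auto elim: eventually_mono\<close>)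
    also have "\<dots> = real n * I"
      by (subst Bochner_Integration.integral_sum)
        (simp_all add: L.integrable_skew_pow int_H L.integral_skew_pow H_meas I)
    finally show ?thesis .
  qed
  show "integrable (\<Omega> \<Otimes>\<^sub>M \<nu>) (\<lambda>(\<omega>, y). ln (norm (A (\<omega> 0) (fst (\<sigma> y)) (snd (\<sigma> y))) / norm (snd (\<sigma> y))))"
    using int_H by (simp add: H_def[abs_def] gen_def pr_def w_def case_prod_unfold)
  \<comment> \<open>The same number I represents the average growth at every time n, so each n
    yields a bound and the limit inherits it.\<close>
  have upper: "I \<le> 1 / real n * (\<integral>z. ln (onorm (cyc n z)) \<partial>(\<Omega> \<Otimes>\<^sub>M \<mu>))" if "1 \<le> n" for n
  proof -
    have "real n * I \<le> (\<integral>y. ln (onorm (cyc n (pr y))) \<partial>(\<Omega> \<Otimes>\<^sub>M \<nu>))"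
      unfolding h_int[symmetric] using norm_ratio_bounds(2)[OF linear_cyc bij_cyc wnz]
      by (intro integral_mono int_h int_pr integrable_ln_onorm_cyc) (auto simp: h_eq)
    then show ?thesis using that by (simp add: int_pr(2)[OF integrable_ln_onorm_cyc(1)[of n]] field_simps)
  qed
  show "I \<le> top_exponent"
    by (rule LIMSEQ_le_const[OF LIMSEQ_top_exponent]) (use upper in blast)
  have lower: "- I \<le> 1 / real n * (\<integral>z. ln (onorm (inv (cyc n z))) \<partial>(\<Omega> \<Otimes>\<^sub>M \<mu>))" if "1 \<le> n" for n
  proof -
    have "(\<integral>y. - ln (onorm (inv (cyc n (pr y)))) \<partial>(\<Omega> \<Otimes>\<^sub>M \<nu>)) \<le> real n * I"
      unfolding h_int[symmetric] using norm_ratio_bounds(3)[OF linear_cyc bij_cyc wnz]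
      by (intro integral_mono int_h int_pr integrable_minus integrable_ln_onorm_cyc) (auto simp: h_eq)
    then show ?thesis using that by (simp add: int_pr(2)[OF integrable_ln_onorm_cyc(2)[of n]] field_simps)
  qed
  have "- I \<le> inv_exponent"
    by (rule LIMSEQ_le_const[OF LIMSEQ_inv_exponent]) (use lower in blast)
  then show "- inv_exponent \<le> I" by simp
qed

subsection \<open>Growth on invariant subbundles\<close>

text \<open>Composing with the projection onto the fibre expresses the norm of the restricted
  cocycle. Invariance makes it submultiplicative; a nonzero vector in the fibre bounds it below by
  the reciprocal norm of the inverse, so its logarithm is controlled by
  \<open>log_size\<close>.\<close>

lemma subbundle_growth:
  fixes s :: "'a \<Rightarrow> nat \<Rightarrow> 'e"
  assumes s: "\<And>i. (\<lambda>x. s x i) \<in> borel_measurable \<mu>"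
    and inv: "AE z in \<Omega> \<Otimes>\<^sub>M \<mu>. gen z ` span (s (snd z) ` {..<m}) = span (s (snd (skew z)) ` {..<m})"
    and nontrivial: "AE x in \<mu>. span (s x ` {..<m}) \<noteq> {0}"
  defines "\<phi> \<equiv> \<lambda>n z. ln (onorm (cyc n z \<circ> span_projection (s (snd z)) m))"
  shows "integrable (\<Omega> \<Otimes>\<^sub>M \<mu>) (\<phi> n)"
    and "convergent (\<lambda>n. 1 / real n * (\<integral>z. \<phi> n z \<partial>(\<Omega> \<Otimes>\<^sub>M \<mu>)))"
proof -
  define P where "P z = span_projection (s (snd z)) m" for z :: "(nat \<Rightarrow> 't) \<times> 'a"
  define L where "L z = span (s (snd z) ` {..<m})" for z :: "(nat \<Rightarrow> 't) \<times> 'a"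
  have linP: "linear (P z)" for z by (simp add: P_def linear_span_projection)
  have PL: "P z v \<in> L z" for z v by (simp add: P_def L_def span_projection_in_span)
  have Pid: "v \<in> L z \<Longrightarrow> P z v = v" for z v by (simp add: P_def L_def span_projection_id)
  have onP: "onorm (P z) \<le> 1" for z
    by (rule onorm_le) (simp add: P_def norm_span_projection)
  have lin: "linear (cyc n z \<circ> P z)" for n z by (intro linear_compose linP linear_cyc)
  have phi: "\<phi> n z = ln (onorm (cyc n z \<circ> P z))" for n z by (simp add: \<phi>_def P_def)
  have measP: "(\<lambda>z. P z v) \<in> borel_measurable (\<Omega> \<Otimes>\<^sub>M \<mu>)" for v
    unfolding P_def using s by (intro borel_measurable_span_projection) (auto intro: measurable_compose[OF measurable_snd])
  have meas: "\<phi> n \<in> borel_measurable (\<Omega> \<Otimes>\<^sub>M \<mu>)" for n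
  proof -
    have "(\<lambda>z. (cyc n z \<circ> P z) v) \<in> borel_measurable (\<Omega> \<Otimes>\<^sub>M \<mu>)" for v
      unfolding comp_apply by (rule borel_measurable_linear_apply[OF measurable_cyc linear_cyc measP])
    then show ?thesis
      unfolding phi[abs_def] by (intro borel_measurable_ln borel_measurable_onorm lin)
  qed
  have upper: "onorm (cyc n z \<circ> P z) \<le> onorm (cyc n z)" for n z
  proof -
    have "onorm (cyc n z \<circ> P z) \<le> onorm (cyc n z) * onorm (P z)"
      by (intro onorm_compose linear_imp_bounded_linear linear_cyc linP)
    also have "\<dots> \<le> onorm (cyc n z) * 1"
      using onorm_cyc_pos[of n z] by (intro mult_left_mono onP) simp
    finally show ?thesis by simp
  qed
  have lower: "1 / onorm (inv (cyc n z)) \<le> onorm (cyc n z \<circ> P z)" if "L z \<noteq> {0}" for n z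
  proof -
    have "0 \<in> L z" by (simp add: L_def span_zero)
    with that obtain v where v: "v \<in> L z" "v \<noteq> 0" by blast
    have "norm v \<le> onorm (inv (cyc n z)) * norm ((cyc n z \<circ> P z) v)"
      using norm_le_onorm_inv[OF linear_cyc bij_cyc, of v n z] Pid[OF v(1)] by simp
    also have "\<dots> \<le> onorm (inv (cyc n z)) * (onorm (cyc n z \<circ> P z) * norm v)"
      using onorm_cyc_pos[of n z]
      by (intro mult_left_mono onorm linear_imp_bounded_linear lin) simp
    finally have "1 * norm v \<le> (onorm (inv (cyc n z)) * onorm (cyc n z \<circ> P z)) * norm v" by (simp add: mult_ac)
    then have "1 \<le> onorm (inv (cyc n z)) * onorm (cyc n z \<circ> P z)"
      using v(2) by (subst (asm) mult_le_cancel_right_pos) auto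
    then show ?thesis using onorm_cyc_pos[of n z] by (simp add: field_simps)
  qed
  have pos: "0 < onorm (cyc n z \<circ> P z)" if "L z \<noteq> {0}" for n z
    using lower[OF that, of n] onorm_cyc_pos[of n z] by (auto intro: less_le_trans[rotated])
  have bound: "\<bar>\<phi> n z\<bar> \<le> (\<Sum>k<n. log_size ((skew ^^ k) z))" if "L z \<noteq> {0}" for n z
  proof -
    have "\<phi> n z \<le> ln (onorm (cyc n z))"
      unfolding phi using upper[of n z] pos[OF that, of n] onorm_cyc_pos[of n z] by (subst ln_le_cancel_iff) auto
    moreover have "ln (1 / onorm (inv (cyc n z))) \<le> \<phi> n z"
      unfolding phi using lower[OF that, of n] pos[OF that, of n] onorm_cyc_pos[of n z] by (subst ln_le_cancel_iff) auto
    moreover have "ln (1 / onorm (inv (cyc n z))) = - ln (onorm (inv (cyc n z)))"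
      using onorm_cyc_pos[of n z] by (simp add: ln_div)
    ultimately show ?thesis using ln_onorm_cyc_le[of n z] by linarith
  qed
  have nonzero: "AE z in \<Omega> \<Otimes>\<^sub>M \<mu>. L z \<noteq> {0}"
    unfolding L_def using nontrivial by (rule AE_snd)
  have nz: "AE z in \<Omega> \<Otimes>\<^sub>M \<mu>. \<forall>n. L ((skew ^^ n) z) \<noteq> {0}"
    by (rule AE_skew_pow[OF nonzero])
  have inv': "AE z in \<Omega> \<Otimes>\<^sub>M \<mu>. \<forall>n. gen ((skew ^^ n) z) ` L ((skew ^^ n) z) = L (skew ((skew ^^ n) z))"
    by (rule AE_skew_pow) (use inv in \<open>simp add: L_def\<close>)
  have sub: "AE z in \<Omega> \<Otimes>\<^sub>M \<mu>. \<phi> (n + k) z \<le> \<phi> n z + \<phi> k ((skew ^^ n) z)" for n k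
    using nz inv'
  proof eventually_elim
    case (elim z)
    let ?y = "(skew ^^ n) z"
    have img: "cyc j z ` L z = L ((skew ^^ j) z)" for j
    proof (induction j)
      case (Suc j)
      then show ?case unfolding cyc_simps image_comp[symmetric] using elim(2)[rule_format, of j] by simp
    qed (simp add: cyc_simps)
    \<comment> \<open>Invariance puts the vector A^n P v into the fibre over time n, where inserting
      the projection of that fibre changes nothing.\<close>
    have "cyc (n + k) z \<circ> P z = (cyc k ?y \<circ> P ?y) \<circ> (cyc n z \<circ> P z)"
    proof
      fix v
      have "cyc n z (P z v) \<in> L ?y" using img[of n] PL[of z v] by blast
      then show "(cyc (n + k) z \<circ> P z) v = ((cyc k ?y \<circ> P ?y) \<circ> (cyc n z \<circ> P z)) v"
        by (simp add: cyc_add Pid)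
    qed
    then have "onorm (cyc (n + k) z \<circ> P z) \<le> onorm (cyc k ?y \<circ> P ?y) * onorm (cyc n z \<circ> P z)"
      using onorm_compose[OF linear_imp_bounded_linear[OF lin] linear_imp_bounded_linear[OF lin], of k ?y n z] by simp
    moreover have "L z \<noteq> {0}" "L ?y \<noteq> {0}" using elim(1)[rule_format, of 0] elim(1)[rule_format, of n] by auto
    ultimately show ?case
      unfolding phi using pos[of z] pos[of ?y]
      by (subst ln_mult_pos[symmetric]) (auto simp: mult.commute)
  qed
  have AE_bound: "AE z in \<Omega> \<Otimes>\<^sub>M \<mu>. \<bar>\<phi> n z\<bar> \<le> (\<Sum>k<n. log_size ((skew ^^ k) z))" for n
    using nonzero by eventually_elim (rule bound)
  show "integrable (\<Omega> \<Otimes>\<^sub>M \<mu>) (\<phi> n)"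
    by (rule convergent_subadditive(1)[OF meas integrable_log_size AE_bound sub])
  show "convergent (\<lambda>n. 1 / real n * (\<integral>z. \<phi> n z \<partial>(\<Omega> \<Otimes>\<^sub>M \<mu>)))"
    by (rule convergent_subadditive(2)[OF meas integrable_log_size AE_bound sub])
qed

end

text \<open>The normal is the first nonzero residual of a basis vector after projection, normalized.
  If the span is the whole space all residuals vanish, and a basis vector serves as default, so that
  e has norm one everywhere.\<close>

lemma measurable_unit_normal:
  fixes s :: "'a \<Rightarrow> nat \<Rightarrow> 'e::euclidean_space"
  assumes s: "\<And>i. (\<lambda>x. s x i) \<in> borel_measurable M"
  obtains e where "e \<in> borel_measurable M" "\<And>x. norm (e x) = 1"
    "\<And>x. dim (span (s x ` {..<m})) = DIM('e) - 1 \<Longrightarrow> span (s x ` {..<m}) = {\<xi>. \<xi> \<bullet> e x = 0}"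
proof -
  define n where "n x i = (basis_enum i :: 'e) - span_projection (s x) m (basis_enum i)" for x i
  define e where "e x = (if \<exists>i. n x i \<noteq> 0 then sgn (n x (LEAST i. n x i \<noteq> 0)) else basis_enum 0)" for x
  have [measurable]: "(\<lambda>x. n x i) \<in> borel_measurable M" for i
    unfolding n_def by (intro borel_measurable_diff borel_measurable_span_projection s) auto
  have [measurable]: "(\<lambda>x. n x (LEAST i. n x i \<noteq> 0)) \<in> borel_measurable M"
    by (rule measurable_compose_countable[where f = "\<lambda>i x. n x i"]) measurable
  have "e \<in> borel_measurable M" unfolding e_def[abs_def] sgn_div_norm by measurable
  moreover have "norm (e x) = 1" for x
  proof (cases "\<exists>i. n x i \<noteq> 0")
    case True
    then have "n x (LEAST i. n x i \<noteq> 0) \<noteq> 0" by (rule LeastI_ex)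
    then show ?thesis using True by (simp add: e_def norm_sgn)
  next
    case False
    then show ?thesis by (simp add: e_def basis_enum_in_Basis[OF DIM_positive])
  qed
  moreover have "span (s x ` {..<m}) = {\<xi>. \<xi> \<bullet> e x = 0}"
    if dim: "dim (span (s x ` {..<m})) = DIM('e) - 1" for x
  proof -
    have "\<exists>i. n x i \<noteq> 0"
    proof (rule ccontr)
      assume "\<not> (\<exists>i. n x i \<noteq> 0)"
      then have *: "basis_enum i \<in> span (s x ` {..<m})" for i
        using span_projection_in_span[of "s x" m "basis_enum i"] by (auto simp: n_def)
      have "Basis \<subseteq> span (s x ` {..<m})"
      proof
        fix b :: 'e assume "b \<in> Basis"
        then obtain i where "b = basis_enum i"
          using bij_betw_imp_surj_on[OF bij_betw_basis_enum] by blast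
        then show "b \<in> span (s x ` {..<m})" using * by simp
      qed
      then have "span (s x ` {..<m}) = UNIV"
        using span_minimal[of Basis "span (s x ` {..<m})"] by (auto simp: span_Basis)
      then have "dim (span (s x ` {..<m})) = DIM('e)" by simp
      then show False using dim DIM_positive[where 'a = 'e] by linarith
    qed
    then have nz: "n x (LEAST i. n x i \<noteq> 0) \<noteq> 0" by (rule LeastI_ex)
    have ex: "e x = sgn (n x (LEAST i. n x i \<noteq> 0))" using \<open>\<exists>i. n x i \<noteq> 0\<close> by (simp add: e_def)
    show ?thesis
    proof (rule subspace_dim_equal)
      show "subspace {\<xi>. \<xi> \<bullet> e x = 0}" using subspace_hyperplane[of "e x"] by (simp add: inner_commute)
      show "span (s x ` {..<m}) \<subseteq> {\<xi>. \<xi> \<bullet> e x = 0}"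
      proof
        fix \<xi> assume \<xi>: "\<xi> \<in> span (s x ` {..<m})"
        have "n x i \<bullet> \<xi> = 0" for i unfolding n_def by (rule span_projection_orthogonal[OF \<xi>])
        then show "\<xi> \<in> {\<xi>. \<xi> \<bullet> e x = 0}" by (simp add: ex sgn_div_norm inner_commute)
      qed
      have "e x \<noteq> 0" using nz by (simp add: ex sgn_zero_iff)
      then have "dim {\<xi>. \<xi> \<bullet> e x = 0} = DIM('e) - 1"
        using dim_hyperplane[of "e x"] by (simp add: inner_commute)
      then show "dim {\<xi>. \<xi> \<bullet> e x = 0} \<le> dim (span (s x ` {..<m}))" using dim by simp
    qed simp
  qed
  ultimately show ?thesis by (rule that)
qed

subsection \<open>The contragredient cocycle\<close>

locale cocycle_pair = linear_cocycle p f \<mu> A + D: linear_cocycle p f \<mu> B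
  for p :: "'t measure" and f :: "'t \<Rightarrow> 'a \<Rightarrow> 'a" and \<mu> :: "'a measure"
    and A B :: "'t \<Rightarrow> 'a \<Rightarrow> 'e::euclidean_space \<Rightarrow> 'e" +
  assumes dual: "B t x = adjoint (inv (A t x))"
begin

lemma D_gen: "D.gen z = adjoint (inv (gen z))"
  by (simp add: D.gen_def gen_def dual)

lemma D_cyc: "D.cyc n z = adjoint (inv (cyc n z))"
proof (induction n)
  case (Suc n)
  show ?case
    unfolding cyc_simps D.cyc_simps o_inv_distrib[OF bij_gen bij_cyc]
      adjoint_comp[OF linear_inv_cyc linear_inv_gen] Suc D_gen ..
next
  case 0
  have "adjoint (id :: 'e \<Rightarrow> 'e) = id" by (rule adjoint_unique) simp
  then show ?case unfolding cyc_simps D.cyc_simps inv_id by (rule sym)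
qed

lemma inv_D_cyc: "inv (D.cyc n z) = adjoint (cyc n z)"
  unfolding D_cyc
  by (simp add: bij_adjoint(2)[OF linear_inv_cyc bij_imp_bij_inv[OF bij_cyc]] inv_inv_eq[OF bij_cyc])

text \<open>A linear map and its adjoint have the same norm, so passing to the contragredient
  cocycle exchanges the two exponents.\<close>

lemma D_exponents: "D.top_exponent = inv_exponent" "D.inv_exponent = top_exponent"
  unfolding D.top_exponent_def D.inv_exponent_def top_exponent_def inv_exponent_def inv_D_cyc
  by (simp_all add: D_cyc onorm_adjoint linear_inv_cyc linear_cyc)

text \<open>The pointwise comparison \<open>onorm_inv_le_annihilator\<close>, integrated along the orbits.\<close>

lemma annihilator_exponents:
  fixes s :: "'a \<Rightarrow> nat \<Rightarrow> 'e"
  assumes dim: "2 \<le> DIM('e)"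
    and s: "\<And>i. (\<lambda>x. s x i) \<in> borel_measurable \<mu>"
    and inv: "AE z in \<Omega> \<Otimes>\<^sub>M \<mu>. D.gen z ` span (s (snd z) ` {..<m}) = span (s (snd (skew z)) ` {..<m})"
    and e: "e \<in> borel_measurable \<mu>" "\<And>x. norm (e x) = 1"
    and normal: "AE x in \<mu>. span (s x ` {..<m}) = {\<xi>. \<xi> \<bullet> e x = 0}"
  defines "\<beta> \<equiv> lim (\<lambda>n. 1 / real n * (\<integral>z. ln (onorm (D.cyc n z \<circ> span_projection (s (snd z)) m)) \<partial>(\<Omega> \<Otimes>\<^sub>M \<mu>)))"
  shows "AE z in \<Omega> \<Otimes>\<^sub>M \<mu>. gen z (e (snd z)) \<in> span {e (snd (skew z))}"
    and "inv_exponent + (\<integral>z. ln (norm (gen z (e (snd z)))) \<partial>(\<Omega> \<Otimes>\<^sub>M \<mu>)) \<le> \<beta> + top_exponent"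
proof -
  define L where "L x = span (s x ` {..<m})" for x
  define P where "P x = span_projection (s x) m" for x
  have normal': "AE z in \<Omega> \<Otimes>\<^sub>M \<mu>. \<forall>n. L (snd ((skew ^^ n) z)) = {\<xi>. \<xi> \<bullet> e (snd ((skew ^^ n) z)) = 0}"
    unfolding L_def by (rule AE_skew_pow) (rule AE_snd[OF normal])
  have inner_D: "D.gen z \<xi> \<bullet> gen z v = \<xi> \<bullet> v" for z \<xi> v
    using bij_gen[of z] by (simp add: D_gen inner_commute[of "adjoint (inv (gen z)) \<xi>"]
        adjoint_works[OF linear_inv_gen] bij_is_inj inv_f_f inner_commute)
  show line: "AE z in \<Omega> \<Otimes>\<^sub>M \<mu>. gen z (e (snd z)) \<in> span {e (snd (skew z))}"
    using inv normal'
  proof eventually_elim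
    case (elim z)
    define e' where "e' = e (snd (skew z))"
    define v where "v = gen z (e (snd z))"
    have L0: "L (snd z) = {\<xi>. \<xi> \<bullet> e (snd z) = 0}" using elim(2)[rule_format, of 0] by simp
    have L1: "L (snd (skew z)) = {\<xi>. \<xi> \<bullet> e' = 0}" using elim(2)[rule_format, of 1] by (simp add: e'_def)
    have e'1: "e' \<bullet> e' = 1" using e(2)[of "snd (skew z)"] by (simp add: e'_def norm_eq_1)
    \<comment> \<open>The hyperplane orthogonal to e' is the image of the hyperplane orthogonal to
      e, and the contragredient map preserves the pairing.\<close>
    have orth: "\<eta> \<bullet> v = 0" if "\<eta> \<bullet> e' = 0" for \<eta>
    proof -
      have "\<eta> \<in> D.gen z ` L (snd z)" using that elim(1) L1 by (simp add: L_def)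
      then show ?thesis using L0 by (auto simp: v_def inner_D)
    qed
    \<comment> \<open>The part of v orthogonal to e' is itself such an \<eta>. It is orthogonal to v
      and to e', hence to itself.\<close>
    have "(v - (v \<bullet> e') *\<^sub>R e') \<bullet> e' = 0" by (simp add: inner_diff_left e'1)
    then have "(v - (v \<bullet> e') *\<^sub>R e') \<bullet> (v - (v \<bullet> e') *\<^sub>R e') = 0"
      using orth by (simp add: inner_diff_right)
    then have "v = (v \<bullet> e') *\<^sub>R e'" by simp
    then show ?case unfolding v_def[symmetric] e'_def[symmetric] by (metis span_base span_scale singletonI)
  qed
  have [measurable]: "(\<lambda>x. (x, e x)) \<in> \<mu> \<rightarrow>\<^sub>M \<mu> \<Otimes>\<^sub>M borel" using e(1) by measurable
  have growth: "integrable (\<Omega> \<Otimes>\<^sub>M \<mu>) (\<lambda>z. ln (norm (cyc n z (e (snd z)))))"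
    "(\<integral>z. ln (norm (cyc n z (e (snd z)))) \<partial>(\<Omega> \<Otimes>\<^sub>M \<mu>)) = real n * (\<integral>z. ln (norm (gen z (e (snd z)))) \<partial>(\<Omega> \<Otimes>\<^sub>M \<mu>))" for n
  proof -
    have "AE (\<omega>, x) in \<Omega> \<Otimes>\<^sub>M \<mu>. fst (f (\<omega> 0) x, e (f (\<omega> 0) x)) = f (\<omega> 0) (fst (x, e x)) \<and>
        A (\<omega> 0) (fst (x, e x)) (snd (x, e x)) \<in> span {snd (f (\<omega> 0) x, e (f (\<omega> 0) x))}"
      using line by eventually_elim (simp add: gen_def skew_def case_prod_unfold)
    moreover have "distr \<mu> \<mu> (\<lambda>y. fst (y, e y)) = \<mu>" by (simp add: distr_id)
    moreover have nz: "snd (x, e x) \<noteq> 0" for x using e(2)[of x] by auto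
    ultimately have *: "integrable (\<Omega> \<Otimes>\<^sub>M \<mu>) (\<lambda>(\<omega>, y). ln (norm (cyc n (\<omega>, y) (e y)) / norm (e y)))"
      "(\<integral>(\<omega>, y). ln (norm (cyc n (\<omega>, y) (e y)) / norm (e y)) \<partial>(\<Omega> \<Otimes>\<^sub>M \<mu>))
        = real n * (\<integral>(\<omega>, y). ln (norm (A (\<omega> 0) y (e y)) / norm (e y)) \<partial>(\<Omega> \<Otimes>\<^sub>M \<mu>))"
      using line_growth(1,2)[where \<sigma> = "\<lambda>x. (x, e x)" and n = n, OF stationary_system_axioms] by simp_all
    show "integrable (\<Omega> \<Otimes>\<^sub>M \<mu>) (\<lambda>z. ln (norm (cyc n z (e (snd z)))))"
      using *(1) by (simp add: e(2) case_prod_unfold)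
    show "(\<integral>z. ln (norm (cyc n z (e (snd z)))) \<partial>(\<Omega> \<Otimes>\<^sub>M \<mu>)) = real n * (\<integral>z. ln (norm (gen z (e (snd z)))) \<partial>(\<Omega> \<Otimes>\<^sub>M \<mu>))"
      using *(2) by (simp add: e(2) case_prod_unfold gen_def)
  qed
  have nontrivial: "AE x in \<mu>. span (s x ` {..<m}) \<noteq> {0}"
    using normal
  proof eventually_elim
    case (elim x)
    obtain \<xi> :: 'e where "\<xi> \<noteq> 0" "orthogonal (e x) \<xi>" using orthogonal_to_vector_exists[OF dim] by blast
    then have "\<xi> \<in> span (s x ` {..<m})" "\<xi> \<noteq> 0" using elim by (auto simp: orthogonal_def inner_commute)
    then show ?case by blast
  qed
  note sub = D.subbundle_growth[OF s inv nontrivial]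
  have lim_\<beta>: "(\<lambda>n. 1 / real n * (\<integral>z. ln (onorm (D.cyc n z \<circ> span_projection (s (snd z)) m)) \<partial>(\<Omega> \<Otimes>\<^sub>M \<mu>))) \<longlonglongrightarrow> \<beta>"
    unfolding \<beta>_def convergent_LIMSEQ_iff[symmetric] by (rule sub(2))
  let ?I = "\<integral>z. ln (norm (gen z (e (snd z)))) \<partial>(\<Omega> \<Otimes>\<^sub>M \<mu>)"
  \<comment> \<open>The integrated growth along e is exactly n times \<open>?I\<close>, so this term
    stays constant after division by n; the others tend to their exponents.\<close>
  have "1 / real n * (\<integral>z. ln (onorm (inv (cyc n z))) \<partial>(\<Omega> \<Otimes>\<^sub>M \<mu>)) + ?I
      \<le> 1 / real n * (\<integral>z. ln (onorm (D.cyc n z \<circ> span_projection (s (snd z)) m)) \<partial>(\<Omega> \<Otimes>\<^sub>M \<mu>))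
        + 1 / real n * (\<integral>z. ln (onorm (cyc n z)) \<partial>(\<Omega> \<Otimes>\<^sub>M \<mu>))" if n: "1 \<le> n" for n
  proof -
    have "(\<integral>z. ln (onorm (inv (cyc n z))) + ln (norm (cyc n z (e (snd z)))) \<partial>(\<Omega> \<Otimes>\<^sub>M \<mu>))
        \<le> (\<integral>z. ln (onorm (D.cyc n z \<circ> span_projection (s (snd z)) m)) + ln (onorm (cyc n z)) \<partial>(\<Omega> \<Otimes>\<^sub>M \<mu>))"
    proof (intro integral_mono_AE Bochner_Integration.integrable_add growth(1) integrable_ln_onorm_cyc sub(1))
      show "AE z in \<Omega> \<Otimes>\<^sub>M \<mu>. ln (onorm (inv (cyc n z))) + ln (norm (cyc n z (e (snd z))))
          \<le> ln (onorm (D.cyc n z \<circ> span_projection (s (snd z)) m)) + ln (onorm (cyc n z))"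
        using normal'
      proof eventually_elim
        case (elim z)
        define t where "t = onorm (D.cyc n z \<circ> P (snd z))"
        have lin: "linear (D.cyc n z \<circ> P (snd z))"
          unfolding P_def by (intro linear_compose linear_span_projection D.linear_cyc)
        have L0: "L (snd z) = {\<xi>. \<xi> \<bullet> e (snd z) = 0}" using elim[rule_format, of 0] by simp
        have "onorm (inv (cyc n z)) * norm (cyc n z (e (snd z))) \<le> t * onorm (cyc n z)"
        proof (rule onorm_inv_le_annihilator[OF linear_cyc bij_cyc e(2) dim])
          fix \<xi> assume "\<xi> \<bullet> e (snd z) = 0"
          then have "P (snd z) \<xi> = \<xi>" using L0 by (auto simp: P_def L_def span_projection_id)
          then show "norm (adjoint (inv (cyc n z)) \<xi>) \<le> t * norm \<xi>"
            using onorm[OF linear_imp_bounded_linear[OF lin], of \<xi>] by (simp add: t_def D_cyc)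
        qed
        \<comment> \<open>The left-hand product is positive and thereby forces t > 0, so the
          logarithms of both products split.\<close>
        moreover have "cyc n z (e (snd z)) \<noteq> 0"
          using e(2)[of "snd z"] linear_cyc bij_cyc by (metis bij_is_inj linear_injective_0 norm_zero zero_neq_one)
        then have "0 < onorm (inv (cyc n z)) * norm (cyc n z (e (snd z)))" using onorm_cyc_pos[of n z] by simp
        ultimately have "ln (onorm (inv (cyc n z)) * norm (cyc n z (e (snd z)))) \<le> ln (t * onorm (cyc n z))" "0 < t"
          using onorm_cyc_pos[of n z] zero_less_mult_pos2[of t "onorm (cyc n z)"]
          by (auto simp: ln_le_cancel_iff)
        then show ?case
          using onorm_cyc_pos[of n z] \<open>cyc n z (e (snd z)) \<noteq> 0\<close> by (simp add: ln_mult_pos t_def P_def)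
      qed
    qed
    then have "(\<integral>z. ln (onorm (inv (cyc n z))) \<partial>(\<Omega> \<Otimes>\<^sub>M \<mu>)) + real n * ?I
        \<le> (\<integral>z. ln (onorm (D.cyc n z \<circ> span_projection (s (snd z)) m)) \<partial>(\<Omega> \<Otimes>\<^sub>M \<mu>)) + (\<integral>z. ln (onorm (cyc n z)) \<partial>(\<Omega> \<Otimes>\<^sub>M \<mu>))"
      by (simp add: growth integrable_ln_onorm_cyc sub(1))
    from divide_right_mono[OF this, of "real n"] show ?thesis using n by (simp add: add_divide_distrib)
  qed
  then show "inv_exponent + ?I \<le> \<beta> + top_exponent"
    by (intro LIMSEQ_le[OF tendsto_add[OF LIMSEQ_inv_exponent tendsto_const] tendsto_add[OF lim_\<beta> LIMSEQ_top_exponent]]) blast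
qed

end

section \<open>Projective bundles in an orthonormal frame\<close>

lemma measurable_fst_borel [measurable]:
  "fst \<in> (borel :: ('a::second_countable_topology \<times> 'b::second_countable_topology) measure) \<rightarrow>\<^sub>M borel"
  by (intro borel_measurable_continuous_onI continuous_on_fst continuous_on_id)

lemma measurable_snd_borel [measurable]:
  "snd \<in> (borel :: ('a::second_countable_topology \<times> 'b::second_countable_topology) measure) \<rightarrow>\<^sub>M borel"
  by (intro borel_measurable_continuous_onI continuous_on_snd continuous_on_id)

lemma measurable_Pair_borel:
  assumes "f \<in> M \<rightarrow>\<^sub>M (borel :: 'a::second_countable_topology measure)"
    "g \<in> M \<rightarrow>\<^sub>M (borel :: 'b::second_countable_topology measure)"
  shows "(\<lambda>x. (f x, g x)) \<in> M \<rightarrow>\<^sub>M borel"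
  using measurable_Pair[OF assms] by (simp add: borel_prod)

lemma dim_1_span:
  fixes l :: "'e::euclidean_space set"
  assumes "subspace l" "dim l = 1"
  obtains v where "v \<noteq> 0" "l = span {v}"
proof -
  obtain B where B: "B \<subseteq> l" "independent B" "l \<subseteq> span B" "card B = dim l"
    using basis_exists by blast
  then obtain v where v: "B = {v}" using assms(2) by (auto simp: card_1_singleton_iff)
  have "v \<noteq> 0" using B(2) v by (metis dependent_zero singletonI)
  moreover have "l = span {v}" using B v span_minimal[OF B(1) assms(1)] by auto
  ultimately show ?thesis using that by blast
qed

lemma span_singleton_nonzeroE:
  assumes "w' \<in> span {w}" "w' \<noteq> 0"
  obtains c where "c \<noteq> 0" "w' = c *\<^sub>R w"
  using assms by (auto simp: span_singleton)

lemma linear_bij_zero_iff: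
  assumes "linear f" "bij (f :: 'e::euclidean_space \<Rightarrow> 'e)"
  shows "f w = 0 \<longleftrightarrow> w = 0"
  using assms by (metis bij_is_inj linear_injective_0 linear_0)

text \<open>\<open>\<Theta> x\<close> is an orthonormal frame of the fibre over \<open>x\<close>, measurable relative to the chart frames
  \<open>\<theta> c x\<close>. In this frame the bundle map \<open>D\<close> is the matrix cocycle \<open>A\<close>, and the norm \<open>N\<close> is the
  Euclidean one. Tangent and cotangent bundle are both instances.\<close>

locale framed_cocycle = linear_cocycle p f \<mu> A
  for p :: "'t measure" and f :: "'t \<Rightarrow> 'a::{t2_space,second_countable_topology} \<Rightarrow> 'a"
    and \<mu> :: "'a measure" and A :: "'t \<Rightarrow> 'a \<Rightarrow> 'e::euclidean_space \<Rightarrow> 'e" +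
  fixes M :: "('a, 'e) rmanifold" and \<theta> :: "('a, 'e) chart \<Rightarrow> 'a \<Rightarrow> 'e \<Rightarrow> 'e"
    and N :: "'a \<Rightarrow> 'e \<Rightarrow> real" and D :: "('a \<Rightarrow> 'a) \<Rightarrow> 'a \<Rightarrow> 'e \<Rightarrow> 'e" and \<Theta> :: "'a \<Rightarrow> 'e \<Rightarrow> 'e"
  assumes sets_mu: "sets \<mu> = sets borel"
    and open_chart: "c \<in> charts M \<Longrightarrow> open (fst c)"
    and charts_cover: "(\<Union>c\<in>charts M. fst c) = UNIV"
    and linear_theta: "c \<in> charts M \<Longrightarrow> x \<in> fst c \<Longrightarrow> linear (\<theta> c x)"
    and bij_theta: "c \<in> charts M \<Longrightarrow> x \<in> fst c \<Longrightarrow> bij (\<theta> c x)"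
    and linear_Theta: "linear (\<Theta> x)" and bij_Theta: "bij (\<Theta> x)"
    and N_Theta: "N x (\<Theta> x v) = norm v"
    and measurable_in: "c \<in> charts M \<Longrightarrow> (\<lambda>x. inv (\<theta> c x) (\<Theta> x v)) \<in> borel_measurable (restrict_space borel (fst c))"
    and measurable_out: "c \<in> charts M \<Longrightarrow> (\<lambda>x. inv (\<Theta> x) (\<theta> c x v)) \<in> borel_measurable (restrict_space borel (fst c))"
    and D_conj: "D (f t) x = \<Theta> (f t x) \<circ> A t x \<circ> inv (\<Theta> x)"
    and D_orbit_0: "D (orbit_map f 0 \<omega>) x = id"
    and D_orbit_Suc: "D (orbit_map f (Suc n) \<omega>) x = D (f (\<omega> n)) (orbit_map f n \<omega> x) \<circ> D (orbit_map f n \<omega>) x"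
begin

lemma sets_pair_mu: "sets (K \<Otimes>\<^sub>M \<mu>) = sets (K \<Otimes>\<^sub>M borel)"
  by (rule sets_pair_measure_cong) (simp_all add: sets_mu)

lemma space_mu [simp]: "space \<mu> = UNIV"
  using sets_eq_imp_space_eq[OF sets_mu] by simp

lemma measurable_mu: "measurable \<mu> K = measurable borel K" "measurable K \<mu> = measurable K borel"
  by (intro measurable_cong_sets sets_mu refl)+

lemma inv_Theta [simp]: "inv (\<Theta> x) (\<Theta> x v) = v" "\<Theta> x (inv (\<Theta> x) v) = v"
  using bij_Theta[of x] by (auto simp: bij_is_inj inv_f_f bij_is_surj surj_f_inv_f)

lemma inv_theta:
  assumes "c \<in> charts M" "x \<in> fst c"
  shows "inv (\<theta> c x) (\<theta> c x v) = v" "\<theta> c x (inv (\<theta> c x) v) = v"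
  using bij_theta[OF assms] by (auto simp: bij_is_inj inv_f_f bij_is_surj surj_f_inv_f)

lemma linear_inv_Theta: "linear (inv (\<Theta> x))"
  by (rule linear_inv_bij[OF linear_Theta bij_Theta])

lemma D_orbit: "D (orbit_map f n \<omega>) x = \<Theta> (orbit_map f n \<omega> x) \<circ> cyc n (\<omega>, x) \<circ> inv (\<Theta> x)"
proof (induction n)
  case 0
  show ?case unfolding D_orbit_0 cyc_simps by (auto simp: fun_eq_iff)
next
  case (Suc n)
  have "gen ((skew ^^ n) (\<omega>, x)) = A (\<omega> n) (orbit_map f n \<omega> x)"
    by (simp add: skew_pow gen_def)
  then show ?case unfolding D_orbit_Suc D_conj Suc cyc_simps by (auto simp: fun_eq_iff)
qed

lemma countable_charts:
  obtains \<C> where "countable \<C>" "\<C> \<subseteq> charts M" "(\<Union>c\<in>\<C>. fst c) = UNIV"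
proof -
  obtain \<F> where F: "\<F> \<subseteq> fst ` charts M" "countable \<F>" "\<Union>\<F> = \<Union>(fst ` charts M)"
    using Lindelof[of "fst ` charts M"] open_chart by blast
  then obtain \<C> where "countable \<C>" "\<C> \<subseteq> charts M" "\<F> = fst ` \<C>"
    using countable_subset_image[of \<F> fst "charts M"] by auto
  then show ?thesis using that F charts_cover by simp
qed

abbreviation cone_space :: "('a, 'e) chart \<Rightarrow> ('a \<times> 'e) measure" where
  "cone_space c \<equiv> restrict_space borel {(x, w). x \<in> fst c}"

lemma open_cone:
  assumes "c \<in> charts M"
  shows "open {(x, w :: 'e). x \<in> fst c}" "open {(x, w :: 'e). x \<in> fst c \<and> w \<noteq> 0}"
proof -
  have "{(x, w :: 'e). x \<in> fst c} = fst c \<times> UNIV" "{(x, w :: 'e). x \<in> fst c \<and> w \<noteq> 0} = fst c \<times> (- {0})" by auto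
  then show "open {(x, w :: 'e). x \<in> fst c}" "open {(x, w :: 'e). x \<in> fst c \<and> w \<noteq> 0}"
    using open_chart[OF assms] by (auto intro: open_Times)
qed

lemma measurable_fst_cone: "fst \<in> cone_space c \<rightarrow>\<^sub>M restrict_space borel (fst c)"
  by (rule measurable_restrict_space3) (auto simp: measurable_fst_borel)

lemma space_cone: "space (cone_space c) = {(x, w). x \<in> fst c}"
  by (simp add: space_restrict_space)

lemma measurable_out_cone:
  assumes c: "c \<in> charts M"
  shows "(\<lambda>y. inv (\<Theta> (fst y)) (\<theta> c (fst y) (snd y))) \<in> borel_measurable (cone_space c)"
proof (rule borel_measurable_linear_apply[where A = "\<lambda>y v. inv (\<Theta> (fst y)) (\<theta> c (fst y) v)"])
  show "(\<lambda>y. inv (\<Theta> (fst y)) (\<theta> c (fst y) v)) \<in> borel_measurable (cone_space c)" for v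
    by (rule measurable_compose[OF measurable_fst_cone measurable_out[OF c]])
  show "linear (\<lambda>v. inv (\<Theta> (fst y)) (\<theta> c (fst y) v))" if "y \<in> space (cone_space c)" for y
    using that linear_compose[OF linear_theta[OF c] linear_inv_Theta, of "fst y"]
    by (auto simp: space_cone comp_def)
  show "snd \<in> borel_measurable (cone_space c)" by (intro measurable_restrict_space1) simp
qed

lemma measurable_in_cone:
  assumes c: "c \<in> charts M"
  shows "(\<lambda>y. inv (\<theta> c (fst y)) (\<Theta> (fst y) (snd y))) \<in> borel_measurable (cone_space c)"
proof (rule borel_measurable_linear_apply[where A = "\<lambda>y v. inv (\<theta> c (fst y)) (\<Theta> (fst y) v)"])
  show "(\<lambda>y. inv (\<theta> c (fst y)) (\<Theta> (fst y) v)) \<in> borel_measurable (cone_space c)" for v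
    by (rule measurable_compose[OF measurable_fst_cone measurable_in[OF c]])
  show "linear (\<lambda>v. inv (\<theta> c (fst y)) (\<Theta> (fst y) v))" if "y \<in> space (cone_space c)" for y
    using that linear_compose[OF linear_Theta linear_inv_bij[OF linear_theta[OF c] bij_theta[OF c]], of "fst y" "fst y"]
    by (auto simp: space_cone comp_def)
  show "snd \<in> borel_measurable (cone_space c)" by (intro measurable_restrict_space1) simp
qed

section \<open>The sigma-algebra of the projective bundle and its coordinates in the frame\<close>

abbreviation PB :: "('a \<times> 'e set) measure" where
  "PB \<equiv> proj_bundle M \<theta>"

abbreviation lines :: "('a \<times> 'e set) set" where
  "lines \<equiv> {(x, l). subspace l \<and> dim l = 1}"

definition chart_cone :: "('a, 'e) chart \<Rightarrow> ('a \<times> 'e set) set \<Rightarrow> ('a \<times> 'e) set" where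
  "chart_cone c B = {(x, w). x \<in> fst c \<and> w \<noteq> 0 \<and> (x, span {\<theta> c x w}) \<in> B}"

lemma theta_zero_iff: "c \<in> charts M \<Longrightarrow> x \<in> fst c \<Longrightarrow> \<theta> c x w = 0 \<longleftrightarrow> w = 0"
  by (rule linear_bij_zero_iff[OF linear_theta bij_theta])

lemma Theta_zero_iff: "\<Theta> x w = 0 \<longleftrightarrow> w = 0"
  by (rule linear_bij_zero_iff[OF linear_Theta bij_Theta])

lemma space_PB: "space PB = lines"
  by (simp add: proj_bundle_def space_measure_of_conv)

text \<open>The generating family is already a sigma-algebra: forming the cone over a chart commutes
  with countable unions and with complements inside the open set of nonzero vectors.\<close>

lemma sets_PB: "sets PB = {B. B \<subseteq> lines \<and> (\<forall>c\<in>charts M. chart_cone c B \<in> sets borel)}"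
proof -
  let ?S = "{B. B \<subseteq> lines \<and> (\<forall>c\<in>charts M. chart_cone c B \<in> sets borel)}"
  have "sigma_algebra lines ?S"
    unfolding sigma_algebra_iff2
  proof (intro conjI ballI allI impI)
    show "?S \<subseteq> Pow lines" by auto
    show "{} \<in> ?S" by (auto simp: chart_cone_def)
    show "lines - B \<in> ?S" if B: "B \<in> ?S" for B
    proof -
      have "chart_cone c (lines - B) = {(x, w). x \<in> fst c \<and> w \<noteq> 0} - chart_cone c B" if "c \<in> charts M" for c
        using that by (auto simp: chart_cone_def dim_singleton theta_zero_iff[OF that])
      then show ?thesis using B open_cone by auto
    qed
    show "(\<Union>i. B i) \<in> ?S" if B: "range B \<subseteq> ?S" for B :: "nat \<Rightarrow> _"
    proof -
      have "chart_cone c (\<Union>i. B i) = (\<Union>i. chart_cone c (B i))" for c by (auto simp: chart_cone_def)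
      moreover have "(\<Union>i. chart_cone c (B i)) \<in> sets borel" if "c \<in> charts M" for c
        using B that by (intro sets.countable_UN) auto
      ultimately show ?thesis using B by auto
    qed
  qed
  moreover have "PB = sigma lines ?S"
    by (simp add: proj_bundle_def chart_cone_def)
  ultimately show ?thesis by (simp add: sigma_algebra.sets_measure_of_eq)
qed

text \<open>A coordinate section inverse to \<open>mk_line\<close>: the base point with a
  distinguished nonzero vector of the line, read in the frame. \<open>line_rep\<close> is invariant
  under scaling, so the result does not depend on the vector picked by \<open>SOME\<close>.\<close>

definition line_vec :: "'a \<times> 'e set \<Rightarrow> 'a \<times> 'e" where
  "line_vec z = (fst z, line_rep (SOME w. w \<noteq> 0 \<and> \<Theta> (fst z) w \<in> snd z))"

definition mk_line :: "'a \<times> 'e \<Rightarrow> 'a \<times> 'e set" where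
  "mk_line y = (fst y, \<Theta> (fst y) ` span {snd y})"

lemma mk_line_eq: "mk_line (x, w) = (x, span {\<Theta> x w})"
  using linear_span_image[OF linear_Theta, of x "{w}"] by (simp add: mk_line_def)

lemma mk_line_scaleR: "c \<noteq> 0 \<Longrightarrow> mk_line (x, c *\<^sub>R w) = mk_line (x, w)"
  by (simp add: mk_line_def span_singleton_scaleR)

lemma line_vec_mk_line:
  assumes "w \<noteq> 0"
  shows "line_vec (mk_line (x, w)) = (x, line_rep w)"
proof -
  let ?P = "\<lambda>w'. w' \<noteq> 0 \<and> \<Theta> x w' \<in> \<Theta> x ` span {w}"
  have "?P (SOME w'. ?P w')" by (rule someI[of _ w]) (use assms in \<open>auto intro: span_base\<close>)
  moreover have "inj (\<Theta> x)" by (rule bij_is_inj[OF bij_Theta])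
  ultimately have "(SOME w'. ?P w') \<in> span {w}" "(SOME w'. ?P w') \<noteq> 0" by (auto dest: injD)
  then obtain c where "c \<noteq> 0" "(SOME w'. ?P w') = c *\<^sub>R w" by (rule span_singleton_nonzeroE)
  then show ?thesis by (simp add: line_vec_def mk_line_def line_rep_scaleR)
qed

lemma lines_cases:
  assumes "z \<in> lines"
  obtains x w where "w \<noteq> 0" "z = mk_line (x, w)"
proof -
  obtain x l where z: "z = (x, l)" "subspace l" "dim l = 1" using assms by auto
  obtain v where v: "v \<noteq> 0" "l = span {v}" using dim_1_span[OF z(2,3)] .
  have "inv (\<Theta> x) v \<noteq> 0" using v(1) linear_0[OF linear_Theta] by (metis inv_Theta(2))
  moreover have "z = mk_line (x, inv (\<Theta> x) v)" by (simp add: mk_line_eq z v)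
  ultimately show ?thesis using that by blast
qed

lemma mk_line_in_lines: "w \<noteq> 0 \<Longrightarrow> mk_line (x, w) \<in> lines"
  by (auto simp: mk_line_eq dim_singleton Theta_zero_iff)

lemma line_vec:
  assumes "z \<in> lines"
  shows "mk_line (line_vec z) = z" "snd (line_vec z) \<noteq> 0" "fst (line_vec z) = fst z"
proof -
  obtain x w where *: "w \<noteq> 0" "z = mk_line (x, w)" using lines_cases[OF assms] .
  then have lv: "line_vec z = (x, line_rep w)" by (simp add: line_vec_mk_line)
  show "mk_line (line_vec z) = z" using * unfolding lv by (simp add: mk_line_def span_line_rep)
  show "snd (line_vec z) \<noteq> 0" "fst (line_vec z) = fst z"
    unfolding lv using * by (simp_all add: line_rep_nonzero mk_line_def)
qed

lemma line_vec_nonzero: "subspace l \<Longrightarrow> dim l = Suc 0 \<Longrightarrow> snd (line_vec (x, l)) \<noteq> 0"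
  using line_vec(2)[of "(x, l)"] by simp

text \<open>On the cone over a chart the map is \<open>line_rep\<close> after the change from chart
  frame to orthonormal frame, which is Borel.\<close>

lemma measurable_line_vec: "line_vec \<in> PB \<rightarrow>\<^sub>M borel"
proof (rule measurableI)
  fix E :: "('a \<times> 'e) set" assume E: "E \<in> sets borel"
  have "chart_cone c (line_vec -` E \<inter> space PB) \<in> sets borel" if c: "c \<in> charts M" for c
  proof -
    let ?h = "\<lambda>y. (fst y, line_rep (inv (\<Theta> (fst y)) (\<theta> c (fst y) (snd y))))"
    have h: "?h \<in> cone_space c \<rightarrow>\<^sub>M borel"
      by (intro measurable_Pair_borel measurable_compose[OF measurable_out_cone[OF c] borel_measurable_line_rep]
          measurable_restrict_space1) simp
    have "chart_cone c (line_vec -` E \<inter> space PB) = (?h -` E \<inter> space (cone_space c)) \<inter> {(x, w). x \<in> fst c \<and> w \<noteq> 0}"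
    proof -
      have "line_vec (x, span {\<theta> c x w}) = ?h (x, w)" if "x \<in> fst c" "w \<noteq> 0" for x w
      proof -
        have "inv (\<Theta> x) (\<theta> c x w) \<noteq> 0"
          using that linear_0[OF linear_Theta] linear_0[OF linear_theta[OF c that(1)]]
          by (metis inv_Theta(2) inv_theta(1)[OF c that(1)])
        then show ?thesis
          using line_vec_mk_line[of "inv (\<Theta> x) (\<theta> c x w)" x] by (simp add: mk_line_eq)
      qed
      then show ?thesis by (auto simp: chart_cone_def space_cone space_PB dim_singleton theta_zero_iff[OF c])
    qed
    moreover have "?h -` E \<inter> space (cone_space c) \<in> sets borel"
      using measurable_sets[OF h E] open_cone(1)[OF c] by (simp add: sets_restrict_space_iff)
    ultimately show ?thesis using open_cone(2)[OF c] by (simp add: sets.Int)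
  qed
  then show "line_vec -` E \<inter> space PB \<in> sets PB" by (auto simp: sets_PB space_PB)
qed simp

text \<open>The measurable sets are described in each chart separately. Second countability leaves
  countably many charts to consider, so the preimage is a countable union of Borel pieces.\<close>

lemma measurable_mk_line: "mk_line \<in> restrict_space borel {y. snd y \<noteq> 0} \<rightarrow>\<^sub>M PB"
proof (rule measurableI)
  show "mk_line y \<in> space PB" if "y \<in> space (restrict_space borel {y. snd y \<noteq> 0})" for y
    using that mk_line_in_lines[of "snd y" "fst y"] by (simp add: space_PB space_restrict_space)
  fix B assume B: "B \<in> sets PB"
  obtain \<C> where C: "countable \<C>" "\<C> \<subseteq> charts M" "(\<Union>c\<in>\<C>. fst c) = UNIV" using countable_charts .
  let ?h = "\<lambda>c y. (fst y, inv (\<theta> c (fst y)) (\<Theta> (fst y) (snd y)))"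
  have eq: "(x, span {\<theta> c x (inv (\<theta> c x) (\<Theta> x w))}) = mk_line (x, w)" if "c \<in> charts M" "x \<in> fst c" for c x w
    by (simp add: inv_theta[OF that] mk_line_eq)
  have nz: "inv (\<theta> c x) (\<Theta> x w) \<noteq> 0" if "c \<in> charts M" "x \<in> fst c" "w \<noteq> 0" for c x w
    using that linear_0[OF linear_inv_Theta] linear_0[OF linear_theta[OF that(1,2)]]
    by (metis inv_Theta(1) inv_theta(2)[OF that(1,2)])
  have open_nz: "open {y :: 'a \<times> 'e. snd y \<noteq> 0}"
  proof -
    have "{y :: 'a \<times> 'e. snd y \<noteq> 0} = UNIV \<times> (- {0})" by auto
    then show ?thesis by (auto intro: open_Times)
  qed
  have "mk_line -` B \<inter> {y. snd y \<noteq> 0} = (\<Union>c\<in>\<C>. (?h c -` chart_cone c B \<inter> space (cone_space c)) \<inter> {y. snd y \<noteq> 0})"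
  proof (intro set_eqI iffI)
    fix y assume y: "y \<in> mk_line -` B \<inter> {y. snd y \<noteq> 0}"
    obtain c where c: "c \<in> \<C>" "fst y \<in> fst c" using C(3) by blast
    then show "y \<in> (\<Union>c\<in>\<C>. (?h c -` chart_cone c B \<inter> space (cone_space c)) \<inter> {y. snd y \<noteq> 0})"
      using y C(2) nz[of c "fst y" "snd y"] eq[of c "fst y" "snd y"]
      by (auto simp: chart_cone_def space_cone intro!: bexI[of _ c])
  next
    fix y assume "y \<in> (\<Union>c\<in>\<C>. (?h c -` chart_cone c B \<inter> space (cone_space c)) \<inter> {y. snd y \<noteq> 0})"
    then obtain c where c: "c \<in> \<C>" "?h c y \<in> chart_cone c B" "fst y \<in> fst c" "snd y \<noteq> 0" by (auto simp: space_cone)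
    then show "y \<in> mk_line -` B \<inter> {y. snd y \<noteq> 0}"
      using C(2) eq[of c "fst y" "snd y"] by (auto simp: chart_cone_def)
  qed
  also have "\<dots> \<in> sets borel"
  proof (rule sets.countable_UN''[OF C(1)])
    fix c assume "c \<in> \<C>"
    then have c: "c \<in> charts M" using C(2) by blast
    have h: "?h c \<in> cone_space c \<rightarrow>\<^sub>M borel"
      by (intro measurable_Pair_borel measurable_in_cone[OF c] measurable_restrict_space1) simp
    have "chart_cone c B \<in> sets borel" using B c by (simp add: sets_PB)
    from measurable_sets[OF h this] have "?h c -` chart_cone c B \<inter> space (cone_space c) \<in> sets borel"
      using open_cone(1)[OF c] by (simp add: sets_restrict_space_iff)
    then show "(?h c -` chart_cone c B \<inter> space (cone_space c)) \<inter> {y. snd y \<noteq> 0} \<in> sets borel"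
      by (rule sets.Int) (use open_nz in auto)
  qed
  finally show "mk_line -` B \<inter> space (restrict_space borel {y. snd y \<noteq> 0}) \<in> sets (restrict_space borel {y. snd y \<noteq> 0})"
    using open_nz by (simp add: sets_restrict_space_iff space_restrict_space)
qed

lemma proj_map_mk_line: "proj_map D (f t) (mk_line (x, w)) = mk_line (f t x, A t x w)"
proof -
  have "D (f t) x ` \<Theta> x ` span {w} = \<Theta> (f t x) ` A t x ` span {w}"
    by (simp add: D_conj image_image)
  also have "A t x ` span {w} = span {A t x w}"
    using linear_span_image[OF linear_A, of t x "{w}"] by simp
  finally show ?thesis by (simp add: mk_line_def proj_map_def)
qed

lemma A_zero_iff: "A t x w = 0 \<longleftrightarrow> w = 0"
  by (rule linear_bij_zero_iff[OF linear_A bij_A])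

lemma measurable_A_apply:
  assumes "sets K = sets PB"
  shows "(\<lambda>y. A (fst y) (fst (line_vec (snd y))) (snd (line_vec (snd y)))) \<in> borel_measurable (p \<Otimes>\<^sub>M K)"
proof (rule borel_measurable_linear_apply[OF _ linear_A])
  have lv: "(\<lambda>y. line_vec (snd y)) \<in> p \<Otimes>\<^sub>M K \<rightarrow>\<^sub>M borel"
    using measurable_line_vec unfolding measurable_cong_sets[OF assms refl, symmetric]
    by (rule measurable_compose[OF measurable_snd])
  then show "(\<lambda>y. snd (line_vec (snd y))) \<in> borel_measurable (p \<Otimes>\<^sub>M K)" by (rule measurable_compose) simp
  have "(\<lambda>y. (fst y, fst (line_vec (snd y)))) \<in> p \<Otimes>\<^sub>M K \<rightarrow>\<^sub>M p \<Otimes>\<^sub>M \<mu>"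
    by (intro measurable_Pair measurable_fst) (simp add: measurable_mu measurable_compose[OF lv measurable_fst_borel])
  from measurable_compose[OF this measurable_A]
  show "(\<lambda>y. A (fst y) (fst (line_vec (snd y))) v) \<in> borel_measurable (p \<Otimes>\<^sub>M K)" for v by simp
qed

text \<open>The projective map factors through vectors: \<open>line_vec\<close>, then the matrix
  cocycle on nonzero vectors, then \<open>mk_line\<close>.\<close>

lemma measurable_proj_map:
  assumes K: "sets K = sets PB"
  shows "(\<lambda>(t, z). proj_map D (f t) z) \<in> p \<Otimes>\<^sub>M K \<rightarrow>\<^sub>M K"
proof -
  have spK: "space K = lines" using sets_eq_imp_space_eq[OF K] by (simp add: space_PB)
  have lv: "line_vec \<in> K \<rightarrow>\<^sub>M borel"
    using measurable_line_vec unfolding measurable_cong_sets[OF K refl, symmetric] .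
  let ?g = "\<lambda>y. (f (fst y) (fst (line_vec (snd y))), A (fst y) (fst (line_vec (snd y))) (snd (line_vec (snd y))))"
  have "(\<lambda>y. fst (line_vec (snd y))) \<in> p \<Otimes>\<^sub>M K \<rightarrow>\<^sub>M \<mu>"
    unfolding measurable_mu by (intro measurable_compose[OF measurable_snd] measurable_compose[OF lv]) simp
  then have "(\<lambda>y. f (fst y) (fst (line_vec (snd y)))) \<in> p \<Otimes>\<^sub>M K \<rightarrow>\<^sub>M \<mu>"
    by (intro measurable_F_apply measurable_fst)
  then have "?g \<in> p \<Otimes>\<^sub>M K \<rightarrow>\<^sub>M restrict_space borel {y. snd y \<noteq> 0}"
    by (intro measurable_restrict_space2 measurable_Pair_borel measurable_A_apply[OF K])
      (auto simp: measurable_mu space_pair_measure spK A_zero_iff line_vec_nonzero)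
  from measurable_compose[OF this measurable_mk_line]
  have "(\<lambda>y. mk_line (?g y)) \<in> p \<Otimes>\<^sub>M K \<rightarrow>\<^sub>M K" using measurable_cong_sets[OF refl K] by auto
  moreover have "mk_line (?g y) = (case y of (t, z) \<Rightarrow> proj_map D (f t) z)" if "y \<in> space (p \<Otimes>\<^sub>M K)" for y
    using that proj_map_mk_line[of "fst y" "fst (line_vec (snd y))" "snd (line_vec (snd y))"] line_vec(1)[of "snd y"]
    by (auto simp: space_pair_measure spK)
  ultimately show ?thesis by (simp cong: measurable_cong)
qed

end

section \<open>Integrals with respect to a completed measure\<close>

lemma borel_measurable_completion_cong_AE:
  fixes g :: "'x \<Rightarrow> 'b::topological_space"
  assumes g: "g \<in> completion M \<rightarrow>\<^sub>M borel" and eq: "AE x in M. f x = g x"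
  shows "f \<in> completion M \<rightarrow>\<^sub>M borel"
proof (rule measurableI)
  fix S :: "'b set" assume "S \<in> sets borel"
  then have "g -` S \<inter> space (completion M) \<in> sets (completion M)" by (rule measurable_sets[OF g])
  then show "f -` S \<inter> space (completion M) \<in> sets (completion M)"
    by (rule completion.in_sets_AE[rotated]) (use AE_completion[OF eq] in \<open>auto elim: eventually_mono\<close>)
qed simp

text \<open>No measurability is assumed: in a complete measure space both functions are measurable
  or neither is, and in the latter case both integrals are 0 by convention.\<close>

lemma integral_completion_cong_AE:
  fixes f g :: "'x \<Rightarrow> real"
  assumes eq: "AE x in M. f x = g x"
  shows "integral\<^sup>L (completion M) f = integral\<^sup>L (completion M) g"
proof (cases "g \<in> borel_measurable (completion M)")
  case True
  then show ?thesis
    by (intro integral_cong_AE borel_measurable_completion_cong_AE[OF True eq] AE_completion[OF eq])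
next
  case False
  have "AE x in M. g x = f x" using eq by (auto elim: eventually_mono)
  from borel_measurable_completion_cong_AE[OF _ this] have "f \<notin> borel_measurable (completion M)"
    using False by blast
  then show ?thesis using False
    by (metis borel_measurable_integrable not_integrable_integral_eq)
qed

lemma integral_completion_AE_eq:
  fixes f g :: "'x \<Rightarrow> real"
  assumes "g \<in> borel_measurable M" "AE x in M. f x = g x"
  shows "integral\<^sup>L (completion M) f = integral\<^sup>L M g"
  using integral_completion_cong_AE[OF assms(2)] integral_completion[OF assms(1)] by simp

section \<open>Lifts, line fields and subbundles in the frame\<close>

context framed_cocycle
begin

lemma measurable_A_coordinate: "(\<lambda>\<omega>. A (\<omega> 0) x w) \<in> borel_measurable \<Omega>"
proof -
  have "(\<lambda>\<omega>. (\<omega> 0, x)) \<in> \<Omega> \<rightarrow>\<^sub>M p \<Otimes>\<^sub>M \<mu>" by measurable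
  from measurable_compose[OF this measurable_A[of w]] show ?thesis by simp
qed

definition rate :: "'t \<Rightarrow> 'a \<times> 'e \<Rightarrow> real" where
  "rate t y = ln (norm (A t (fst y) (snd y)) / norm (snd y))"

lemma rate_scaleR: "c \<noteq> 0 \<Longrightarrow> rate t (x, c *\<^sub>R w) = rate t (x, w)"
  by (simp add: rate_def linear_scale[OF linear_A])

lemma rate_line_rep: "w \<noteq> 0 \<Longrightarrow> rate t (x, line_rep w) = rate t (x, w)"
  using rate_scaleR line_rep_coordinate[of w] by (simp add: line_rep_def)

text \<open>The unit vector picked in \<open>log_growth\<close> is a multiple of the image of
  \<open>line_vec\<close> under the frame, and the rate is invariant under scaling. In coordinates
  the integrand is measurable, so the completion may be dropped.\<close>

lemma log_growth_eq:
  assumes z: "z \<in> lines"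
  shows "log_growth N D p f z = (\<integral>\<omega>. rate (\<omega> 0) (line_vec z) \<partial>\<Omega>)"
proof -
  obtain x w where w: "line_vec z = (x, w)" by (cases "line_vec z")
  have wz: "w \<noteq> 0" "z = mk_line (x, w)" using line_vec[OF z] by (auto simp: w)
  define l where "l = \<Theta> x ` span {w}"
  have zl: "z = (x, l)" by (simp add: wz mk_line_def l_def)
  define v where "v = (SOME v. v \<in> l \<and> N x v = 1)"
  have "v \<in> l \<and> N x v = 1"
    unfolding v_def
  proof (rule someI)
    have "inverse (norm w) *\<^sub>R w \<in> span {w}" by (intro span_scale span_base) simp
    then show "\<Theta> x (inverse (norm w) *\<^sub>R w) \<in> l \<and> N x (\<Theta> x (inverse (norm w) *\<^sub>R w)) = 1"
      using wz by (auto simp: l_def N_Theta)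
  qed
  then obtain c where c: "v = \<Theta> x (c *\<^sub>R w)" "norm (c *\<^sub>R w) = 1"
    by (auto simp: l_def span_singleton N_Theta)
  have "log_growth N D p f z = (\<integral>\<omega>. ln (N (f (\<omega> 0) x) (D (f (\<omega> 0)) x v)) \<partial>completion \<Omega>)"
    by (simp add: log_growth_def zl v_def[symmetric])
  also have "\<dots> = (\<integral>\<omega>. rate (\<omega> 0) (x, w) \<partial>completion \<Omega>)"
  proof (rule Bochner_Integration.integral_cong[OF refl])
    fix \<omega>
    have "c \<noteq> 0" using c(2) by auto
    have "N (f (\<omega> 0) x) (D (f (\<omega> 0)) x v) = norm (A (\<omega> 0) x (c *\<^sub>R w)) / norm (c *\<^sub>R w)"
      unfolding c by (simp add: D_conj N_Theta)
    then have "ln (N (f (\<omega> 0) x) (D (f (\<omega> 0)) x v)) = rate (\<omega> 0) (x, c *\<^sub>R w)"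
      by (simp add: rate_def)
    then show "ln (N (f (\<omega> 0) x) (D (f (\<omega> 0)) x v)) = rate (\<omega> 0) (x, w)"
      by (simp add: rate_scaleR[OF \<open>c \<noteq> 0\<close>])
  qed
  also have "\<dots> = (\<integral>\<omega>. rate (\<omega> 0) (x, w) \<partial>\<Omega>)"
    unfolding rate_def using measurable_A_coordinate
    by (intro integral_completion borel_measurable_ln borel_measurable_divide borel_measurable_norm) auto
  finally show ?thesis by (simp add: w)
qed

abbreviation lifts :: "('a \<times> 'e set) measure set" where
  "lifts \<equiv> stationary_lifts M \<theta> D p f \<mu>"

lemma lift_system: "\<nu> \<in> lifts \<Longrightarrow> stationary_system p (\<lambda>t. proj_map D (f t)) \<nu>"
  unfolding stationary_lifts_def mem_Collect_eq
  by (rule stationary_system.intro[OF prob_p _ measurable_proj_map]) blast+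

text \<open>An application of \<open>line_growth\<close> to the system of projective maps, with
  \<open>line_vec\<close> as vector field. The integrability obtained there also justifies
  interchanging the integrals over \<omega> and over the bundle.\<close>

lemma lift_growth:
  assumes nu: "\<nu> \<in> lifts"
  shows "(\<integral>z. log_growth N D p f z \<partial>\<nu>) = (\<integral>(\<omega>, z). rate (\<omega> 0) (line_vec z) \<partial>(\<Omega> \<Otimes>\<^sub>M \<nu>))"
    and "integrable (\<Omega> \<Otimes>\<^sub>M \<nu>) (\<lambda>(\<omega>, z). rate (\<omega> 0) (line_vec z))"
    and "(\<integral>z. log_growth N D p f z \<partial>\<nu>) \<le> top_exponent"
    and "- inv_exponent \<le> (\<integral>z. log_growth N D p f z \<partial>\<nu>)"
proof -
  have sets: "sets \<nu> = sets PB" and base: "distr \<nu> borel fst = \<mu>"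
    using nu by (auto simp: stationary_lifts_def)
  have sp: "space \<nu> = lines" using sets_eq_imp_space_eq[OF sets] by (simp add: space_PB)
  interpret V: stationary_system p "\<lambda>t. proj_map D (f t)" \<nu> by (rule lift_system[OF nu])
  have lv: "line_vec \<in> \<nu> \<rightarrow>\<^sub>M borel"
    using measurable_line_vec unfolding measurable_cong_sets[OF sets refl, symmetric] .
  have lv': "line_vec \<in> \<nu> \<rightarrow>\<^sub>M \<mu> \<Otimes>\<^sub>M borel"
  proof -
    have "sets (\<mu> \<Otimes>\<^sub>M borel) = sets (borel :: ('a \<times> 'e) measure)"
      unfolding borel_prod[symmetric] by (rule sets_pair_measure_cong) (simp_all add: sets_mu)
    then have "measurable \<nu> (\<mu> \<Otimes>\<^sub>M borel) = measurable \<nu> (borel :: ('a \<times> 'e) measure)"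
      by (rule measurable_cong_sets[OF refl])
    then show ?thesis using lv by blast
  qed
  have "distr \<nu> \<mu> (\<lambda>z. fst (line_vec z)) = distr \<nu> borel fst"
    by (rule distr_cong) (auto simp: sets_mu line_vec_def)
  then have base': "distr \<nu> \<mu> (\<lambda>z. fst (line_vec z)) = \<mu>" using base by simp
  have nz: "snd (line_vec z) \<noteq> 0" if "z \<in> space \<nu>" for z
    using line_vec(2)[of z] that by (simp add: sp)
  have equiv: "AE (\<omega>, z) in \<Omega> \<Otimes>\<^sub>M \<nu>. fst (line_vec (proj_map D (f (\<omega> 0)) z)) = f (\<omega> 0) (fst (line_vec z)) \<and>
      A (\<omega> 0) (fst (line_vec z)) (snd (line_vec z)) \<in> span {snd (line_vec (proj_map D (f (\<omega> 0)) z))}"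
  proof (rule AE_I2, clarify)
    fix \<omega> z assume "(\<omega>, z) \<in> space (\<Omega> \<Otimes>\<^sub>M \<nu>)"
    then have z: "z \<in> lines" by (simp add: space_pair_measure sp)
    obtain x w where w: "line_vec z = (x, w)" by (cases "line_vec z")
    have wz: "w \<noteq> 0" "z = mk_line (x, w)" using line_vec[OF z] by (auto simp: w)
    have "line_vec (proj_map D (f (\<omega> 0)) z) = (f (\<omega> 0) x, line_rep (A (\<omega> 0) x w))"
      unfolding wz(2) proj_map_mk_line by (rule line_vec_mk_line) (simp add: A_zero_iff wz)
    then show "fst (line_vec (proj_map D (f (\<omega> 0)) z)) = f (\<omega> 0) (fst (line_vec z)) \<and>
      A (\<omega> 0) (fst (line_vec z)) (snd (line_vec z)) \<in> span {snd (line_vec (proj_map D (f (\<omega> 0)) z))}"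
      by (simp add: w span_line_rep A_zero_iff wz(1) span_base)
  qed
  note growth = line_growth(3-5)[OF V.stationary_system_axioms lv' base' nz equiv, folded rate_def]
  show int: "integrable (\<Omega> \<Otimes>\<^sub>M \<nu>) (\<lambda>(\<omega>, z). rate (\<omega> 0) (line_vec z))"
    using growth(1) .
  have "(\<integral>z. log_growth N D p f z \<partial>\<nu>) = (\<integral>z. (\<integral>\<omega>. rate (\<omega> 0) (line_vec z) \<partial>\<Omega>) \<partial>\<nu>)"
    by (rule Bochner_Integration.integral_cong) (simp_all add: log_growth_eq sp)
  also have "\<dots> = (\<integral>(\<omega>, z). rate (\<omega> 0) (line_vec z) \<partial>(\<Omega> \<Otimes>\<^sub>M \<nu>))"
    by (rule V.ON.integral_snd[OF int])
  finally show eq: "(\<integral>z. log_growth N D p f z \<partial>\<nu>) = (\<integral>(\<omega>, z). rate (\<omega> 0) (line_vec z) \<partial>(\<Omega> \<Otimes>\<^sub>M \<nu>))" .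
  show "(\<integral>z. log_growth N D p f z \<partial>\<nu>) \<le> top_exponent" "- inv_exponent \<le> (\<integral>z. log_growth N D p f z \<partial>\<nu>)"
    unfolding eq using growth(2,3) by simp_all
qed

lemma nn_integral_skew:
  assumes [measurable]: "h \<in> borel_measurable (\<Omega> \<Otimes>\<^sub>M \<mu>)"
  shows "(\<integral>\<^sup>+z. h (skew z) \<partial>(\<Omega> \<Otimes>\<^sub>M \<mu>)) = (\<integral>\<^sup>+z. h z \<partial>(\<Omega> \<Otimes>\<^sub>M \<mu>))"
  using nn_integral_distr[of skew "\<Omega> \<Otimes>\<^sub>M \<mu>" "\<Omega> \<Otimes>\<^sub>M \<mu>" h] by (simp add: distr_skew)

text \<open>The lift is the image of \<mu> under x \<mapsto> line of e(x). This is how an invariant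
  line field is confronted with quasi-irreducibility, which speaks only of measures.\<close>

lemma line_field_lift:
  assumes e: "e \<in> borel_measurable \<mu>" "\<And>x. norm (e x) = 1"
    and line: "AE z in \<Omega> \<Otimes>\<^sub>M \<mu>. gen z (e (snd z)) \<in> span {e (snd (skew z))}"
  obtains \<nu> where "\<nu> \<in> lifts" "(\<integral>z. log_growth N D p f z \<partial>\<nu>) = (\<integral>z. ln (norm (gen z (e (snd z)))) \<partial>(\<Omega> \<Otimes>\<^sub>M \<mu>))"
proof -
  define g where "g x = mk_line (x, e x)" for x
  have ez: "e x \<noteq> 0" for x using e(2)[of x] by auto
  have g_meas [measurable]: "g \<in> \<mu> \<rightarrow>\<^sub>M PB"
  proof -
    have "(\<lambda>x. (x, e x)) \<in> \<mu> \<rightarrow>\<^sub>M restrict_space borel {y. snd y \<noteq> 0}"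
      using e(1) by (intro measurable_restrict_space2 measurable_Pair_borel) (auto simp: ez measurable_mu)
    from measurable_compose[OF this measurable_mk_line] show ?thesis by (simp add: g_def[abs_def])
  qed
  define \<nu> where "\<nu> = distr \<mu> PB g"
  have sets: "sets \<nu> = sets PB" by (simp add: \<nu>_def)
  have prob: "prob_space \<nu>" unfolding \<nu>_def by (rule N.prob_space_distr) simp
  interpret V: prob_space \<nu> by (rule prob)
  have base: "distr \<nu> borel fst = \<mu>"
  proof -
    have "fst \<in> PB \<rightarrow>\<^sub>M borel"
    proof -
      have "(\<lambda>z. fst (line_vec z)) \<in> PB \<rightarrow>\<^sub>M borel" by (rule measurable_compose[OF measurable_line_vec measurable_fst_borel])
      then show ?thesis by (simp add: line_vec_def)
    qed
    then have "distr \<nu> borel fst = distr \<mu> borel (fst \<circ> g)" unfolding \<nu>_def by (subst distr_distr) auto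
    also have "fst \<circ> g = (\<lambda>x. x)" by (auto simp: g_def mk_line_def)
    also have "distr \<mu> borel (\<lambda>x. x) = \<mu>"
      by (rule measure_eqI) (simp_all add: sets_mu emeasure_distr measurable_mu)
    finally show ?thesis .
  qed
  have stat: "stationary p (\<lambda>t. proj_map D (f t)) \<nu>"
    unfolding stationary_def
  proof
    fix B assume "B \<in> sets \<nu>"
    then have B [measurable]: "B \<in> sets PB" by (simp add: sets)
    have "(\<integral>\<^sup>+\<omega>. emeasure (distr \<nu> \<nu> (proj_map D (f (\<omega> 0)))) B \<partial>\<Omega>) = (\<integral>\<^sup>+\<omega>. (\<integral>\<^sup>+x. indicator B (proj_map D (f (\<omega> 0)) (g x)) \<partial>\<mu>) \<partial>\<Omega>)"
    proof (rule nn_integral_cong)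
      fix \<omega> assume "\<omega> \<in> space \<Omega>"
      then have w0: "\<omega> 0 \<in> space p" using measurable_space[OF measurable_coordinate] by blast
      have F: "proj_map D (f (\<omega> 0)) \<in> PB \<rightarrow>\<^sub>M PB"
        using measurable_compose[OF measurable_Pair1'[OF w0] measurable_proj_map[OF refl]] by simp
      have "emeasure (distr \<nu> \<nu> (proj_map D (f (\<omega> 0)))) B = emeasure (distr \<nu> PB (proj_map D (f (\<omega> 0)))) B"
        by (rule arg_cong[where f = "\<lambda>K. emeasure K B"]) (rule distr_cong, simp_all add: sets)
      also have "\<dots> = emeasure (distr \<mu> PB (proj_map D (f (\<omega> 0)) \<circ> g)) B"
        unfolding \<nu>_def by (subst distr_distr[OF F g_meas]) simp
      also have "\<dots> = (\<integral>\<^sup>+x. indicator B (proj_map D (f (\<omega> 0)) (g x)) \<partial>\<mu>)"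
        using measurable_comp[OF g_meas F]
        by (simp add: nn_integral_indicator[symmetric] nn_integral_distr del: nn_integral_indicator)
      finally show "emeasure (distr \<nu> \<nu> (proj_map D (f (\<omega> 0)))) B = (\<integral>\<^sup>+x. indicator B (proj_map D (f (\<omega> 0)) (g x)) \<partial>\<mu>)" .
    qed
    also have "\<dots> = (\<integral>\<^sup>+z. indicator B (proj_map D (f (fst z 0)) (g (snd z))) \<partial>(\<Omega> \<Otimes>\<^sub>M \<mu>))"
    proof (subst N.nn_integral_fst[symmetric])
      have "(\<lambda>z. (fst z 0, g (snd z))) \<in> \<Omega> \<Otimes>\<^sub>M \<mu> \<rightarrow>\<^sub>M p \<Otimes>\<^sub>M PB" by measurable
      from measurable_compose[OF this measurable_proj_map[OF refl]]
      have "(\<lambda>z. proj_map D (f (fst z 0)) (g (snd z))) \<in> \<Omega> \<Otimes>\<^sub>M \<mu> \<rightarrow>\<^sub>M PB" by simp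
      then show "(\<lambda>z. indicator B (proj_map D (f (fst z 0)) (g (snd z)))) \<in> borel_measurable (\<Omega> \<Otimes>\<^sub>M \<mu>)"
        by (rule measurable_compose) simp
    qed simp
    \<comment> \<open>Invariance of the line field replaces the image of the line over x by the line
      over f x. What remains is the invariance of the base measure under
      \<open>skew\<close>.\<close>
    also have "\<dots> = (\<integral>\<^sup>+z. indicator B (g (snd (skew z))) \<partial>(\<Omega> \<Otimes>\<^sub>M \<mu>))"
    proof (rule nn_integral_cong_AE)
      show "AE z in \<Omega> \<Otimes>\<^sub>M \<mu>. indicator B (proj_map D (f (fst z 0)) (g (snd z))) = indicator B (g (snd (skew z)))"
        using line
      proof eventually_elim
        case (elim z)
        have "gen z (e (snd z)) \<noteq> 0" by (simp add: gen_def A_zero_iff ez)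
        then obtain c where "c \<noteq> 0" "gen z (e (snd z)) = c *\<^sub>R e (snd (skew z))"
          using span_singleton_nonzeroE[OF elim] by blast
        then have "proj_map D (f (fst z 0)) (g (snd z)) = g (snd (skew z))"
          by (simp add: g_def proj_map_mk_line gen_def mk_line_scaleR) (simp add: skew_def)
        then show ?case by simp
      qed
    qed
    also have "\<dots> = (\<integral>\<^sup>+z. indicator B (g (snd z)) \<partial>(\<Omega> \<Otimes>\<^sub>M \<mu>))"
      by (rule nn_integral_skew) measurable
    also have "\<dots> = (\<integral>\<^sup>+\<omega>. (\<integral>\<^sup>+x. indicator B (g x) \<partial>\<mu>) \<partial>\<Omega>)"
      by (subst N.nn_integral_fst[symmetric]) simp_all
    also have "\<dots> = (\<integral>\<^sup>+x. indicator B (g x) \<partial>\<mu>)"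
      by (simp add: O.emeasure_space_1)
    also have "\<dots> = emeasure \<nu> B"
      by (simp add: \<nu>_def nn_integral_indicator[symmetric] nn_integral_distr del: nn_integral_indicator)
    finally show "emeasure \<nu> B = (\<integral>\<^sup>+\<omega>. emeasure (distr \<nu> \<nu> (proj_map D (f (\<omega> 0)))) B \<partial>path_measure p)" by simp
  qed
  have lift: "\<nu> \<in> lifts"
    using sets prob base stat by (simp add: stationary_lifts_def)
  have rate_g: "rate t (line_vec (g x)) = ln (norm (A t x (e x)))" for t x
    by (simp add: g_def line_vec_mk_line ez rate_line_rep) (simp add: rate_def e(2))
  have pm: "\<Omega> \<Otimes>\<^sub>M \<nu> = distr (\<Omega> \<Otimes>\<^sub>M \<mu>) (\<Omega> \<Otimes>\<^sub>M PB) (\<lambda>(\<omega>, x). (\<omega>, g x))"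
  proof -
    have "distr \<Omega> \<Omega> (\<lambda>x. x) \<Otimes>\<^sub>M distr \<mu> PB g = distr (\<Omega> \<Otimes>\<^sub>M \<mu>) (\<Omega> \<Otimes>\<^sub>M PB) (\<lambda>(x, y). (x, g y))"
      by (rule pair_measure_distr) (use V.sigma_finite_measure_axioms in \<open>simp_all add: \<nu>_def\<close>)
    then show ?thesis by (simp add: distr_id \<nu>_def)
  qed
  have "(\<integral>z. log_growth N D p f z \<partial>\<nu>) = (\<integral>(\<omega>, z). rate (\<omega> 0) (line_vec z) \<partial>(\<Omega> \<Otimes>\<^sub>M \<nu>))"
    by (rule lift_growth(1)[OF lift])
  also have "\<dots> = (\<integral>z. ln (norm (gen z (e (snd z)))) \<partial>(\<Omega> \<Otimes>\<^sub>M \<mu>))"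
  proof -
    have "(\<lambda>(\<omega>, z). rate (\<omega> 0) (line_vec z)) \<in> borel_measurable (\<Omega> \<Otimes>\<^sub>M PB)"
      using borel_measurable_integrable[OF lift_growth(2)[OF lift]]
        measurable_cong_sets[OF sets_pair_measure_cong[OF refl sets] refl] by blast
    then show ?thesis
      unfolding pm by (subst integral_distr) (auto simp: case_prod_unfold rate_g gen_def)
  qed
  finally show ?thesis using lift that by blast
qed

lemma opnorm_on_orbit:
  assumes "inv (\<Theta> x) ` L = span (s ` {..<m})"
  shows "opnorm_on L (N x) (N (orbit_map f n \<omega> x)) (D (orbit_map f n \<omega>) x)
    = onorm (cyc n (\<omega>, x) \<circ> span_projection s m)"
proof -
  have "opnorm_on L (N x) (N (orbit_map f n \<omega> x)) (D (orbit_map f n \<omega>) x) =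
      opnorm_on (inv (\<Theta> x) ` L) norm norm (inv (\<Theta> (orbit_map f n \<omega> x)) \<circ> D (orbit_map f n \<omega>) x \<circ> \<Theta> x)"
    by (rule opnorm_on_frame) (auto simp: bij_Theta N_Theta)
  also have "inv (\<Theta> (orbit_map f n \<omega> x)) \<circ> D (orbit_map f n \<omega>) x \<circ> \<Theta> x = cyc n (\<omega>, x)"
    unfolding D_orbit by (auto simp: fun_eq_iff)
  also have "opnorm_on (inv (\<Theta> x) ` L) norm norm (cyc n (\<omega>, x)) = onorm (cyc n (\<omega>, x) \<circ> span_projection s m)"
    unfolding assms
    by (rule opnorm_on_projection[OF linear_cyc linear_span_projection span_projection_in_span span_projection_id norm_span_projection])
  finally show ?thesis .
qed

text \<open>Translates a subbundle into the setting of \<open>subbundle_growth\<close>. Its spanning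
  sections become Borel maps s into 'e, pieced together over countably many charts. Outside X, a
  null set, L is unrelated to s, which is why the exponents are compared only almost
  everywhere.\<close>

lemma subbundle_coordinates:
  assumes L: "measurable_subbundle M \<theta> X L" and X: "AE x in \<mu>. x \<in> X"
    and invL: "invariant_subbundle D p f \<mu> L"
  obtains s where "\<And>i. (\<lambda>x. s x i) \<in> borel_measurable \<mu>"
    "\<And>x. x \<in> X \<Longrightarrow> inv (\<Theta> x) ` L x = span (s x ` {..<DIM('e)})"
    "\<And>x. x \<in> X \<Longrightarrow> dim (span (s x ` {..<DIM('e)})) = dim (L x)"
    "AE z in \<Omega> \<Otimes>\<^sub>M \<mu>. gen z ` span (s (snd z) ` {..<DIM('e)}) = span (s (snd (skew z)) ` {..<DIM('e)})"
    "\<not> (AE x in \<mu>. L x = {0}) \<Longrightarrow> subbundle_exponent N D p f \<mu> L =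
      ereal (lim (\<lambda>n. 1 / real n * (\<integral>z. ln (onorm (cyc n z \<circ> span_projection (s (snd z)) DIM('e))) \<partial>(\<Omega> \<Otimes>\<^sub>M \<mu>))))"
proof -
  obtain r :: "nat \<Rightarrow> 'a \<Rightarrow> 'e" where r: "\<And>i. measurable_section M \<theta> (r i)"
      "\<And>x. x \<in> X \<Longrightarrow> L x = span ((\<lambda>i. r i x) ` {..<DIM('e)})"
    using L by (auto simp: measurable_subbundle_def)
  define s where "s x i = inv (\<Theta> x) (r i x)" for x i
  have s_meas: "(\<lambda>x. s x i) \<in> borel_measurable \<mu>" for i
  proof -
    obtain \<C> where C: "countable \<C>" "\<C> \<subseteq> charts M" "(\<Union>c\<in>\<C>. fst c) = UNIV" using countable_charts .
    have "(\<lambda>x. s x i) \<in> borel_measurable borel"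
    proof (rule measurable_piecewise_restrict[of "fst ` \<C>"])
      show "countable (fst ` \<C>)" using C(1) by simp
      show "space borel \<subseteq> \<Union> (fst ` \<C>)" using C(3) by simp
      fix U assume "U \<in> fst ` \<C>"
      then obtain c where c: "c \<in> charts M" "U = fst c" using C(2) by blast
      show "U \<inter> space borel \<in> sets borel" using open_chart[OF c(1)] c(2) by simp
      have "(\<lambda>x. inv (\<Theta> x) (\<theta> c x (inv (\<theta> c x) (r i x)))) \<in> borel_measurable (restrict_space borel (fst c))"
      proof (rule borel_measurable_linear_apply[where A = "\<lambda>x v. inv (\<Theta> x) (\<theta> c x v)"])
        show "(\<lambda>x. inv (\<Theta> x) (\<theta> c x v)) \<in> borel_measurable (restrict_space borel (fst c))" for v
          by (rule measurable_out[OF c(1)])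
        show "linear (\<lambda>v. inv (\<Theta> x) (\<theta> c x v))" if "x \<in> space (restrict_space borel (fst c))" for x
          using that linear_compose[OF linear_theta[OF c(1)] linear_inv_Theta, of x]
          by (auto simp: space_restrict_space comp_def)
        show "(\<lambda>x. inv (\<theta> c x) (r i x)) \<in> borel_measurable (restrict_space borel (fst c))"
          using r(1)[of i] c(1) by (simp add: measurable_section_def)
      qed
      then show "(\<lambda>x. s x i) \<in> borel_measurable (restrict_space borel U)"
        unfolding c(2) by (rule measurable_cong[THEN iffD1, rotated]) (simp add: s_def inv_theta[OF c(1)] space_restrict_space)
    qed
    then show ?thesis by (simp add: measurable_mu)
  qed
  have sL: "inv (\<Theta> x) ` L x = span (s x ` {..<DIM('e)})" if "x \<in> X" for x
    using linear_span_image[OF linear_inv_Theta, of x "(\<lambda>i. r i x) ` {..<DIM('e)}"]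
    by (simp add: r(2)[OF that] image_image s_def)
  have dim: "dim (span (s x ` {..<DIM('e)})) = dim (L x)" if "x \<in> X" for x
    unfolding sL[OF that, symmetric]
    by (rule dim_image_eq[OF linear_inv_Theta inj_on_subset[OF bij_is_inj[OF bij_imp_bij_inv[OF bij_Theta]] subset_UNIV]])
  have inX: "AE z in \<Omega> \<Otimes>\<^sub>M \<mu>. \<forall>n. snd ((skew ^^ n) z) \<in> X"
    by (rule AE_skew_pow[OF AE_snd[OF X]])
  have invar: "AE z in \<Omega> \<Otimes>\<^sub>M \<mu>. gen z ` span (s (snd z) ` {..<DIM('e)}) = span (s (snd (skew z)) ` {..<DIM('e)})"
    using invL[unfolded invariant_subbundle_def] inX
  proof eventually_elim
    case (elim z)
    obtain \<omega> x where z: "z = (\<omega>, x)" by (cases z)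
    have x: "x \<in> X" using elim(2)[rule_format, of 0] by (simp add: z)
    have fx: "f (\<omega> 0) x \<in> X" using elim(2)[rule_format, of 1] by (simp add: z skew_def)
    have "gen z ` span (s (snd z) ` {..<DIM('e)}) = A (\<omega> 0) x ` inv (\<Theta> x) ` L x"
      by (simp add: z gen_def sL[OF x])
    also have "\<dots> = inv (\<Theta> (f (\<omega> 0) x)) ` (D (f (\<omega> 0)) x ` L x)"
      by (simp add: D_conj image_image)
    also have "D (f (\<omega> 0)) x ` L x = L (f (\<omega> 0) x)" using elim(1) by (simp add: z)
    also have "inv (\<Theta> (f (\<omega> 0) x)) ` L (f (\<omega> 0) x) = span (s (snd (skew z)) ` {..<DIM('e)})"
      by (simp add: z skew_def sL[OF fx])
    finally show ?case .
  qed
  have exponent: "subbundle_exponent N D p f \<mu> L =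
      ereal (lim (\<lambda>n. 1 / real n * (\<integral>z. ln (onorm (cyc n z \<circ> span_projection (s (snd z)) DIM('e))) \<partial>(\<Omega> \<Otimes>\<^sub>M \<mu>))))"
    if nz: "\<not> (AE x in \<mu>. L x = {0})"
  proof -
    have "(\<integral>(\<omega>, x). ln (opnorm_on (L x) (N x) (N (orbit_map f n \<omega> x)) (D (orbit_map f n \<omega>) x)) \<partial>completion (\<Omega> \<Otimes>\<^sub>M \<mu>))
      = (\<integral>z. ln (onorm (cyc n z \<circ> span_projection (s (snd z)) DIM('e))) \<partial>(\<Omega> \<Otimes>\<^sub>M \<mu>))" for n
    proof (rule integral_completion_AE_eq)
      have "(\<lambda>z. span_projection (s (snd z)) DIM('e) v) \<in> borel_measurable (\<Omega> \<Otimes>\<^sub>M \<mu>)" for v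
        using s_meas by (intro borel_measurable_span_projection) (auto intro: measurable_compose[OF measurable_snd])
      then have "(\<lambda>z. (cyc n z \<circ> span_projection (s (snd z)) DIM('e)) v) \<in> borel_measurable (\<Omega> \<Otimes>\<^sub>M \<mu>)" for v
        unfolding comp_apply by (rule borel_measurable_linear_apply[OF measurable_cyc linear_cyc])
      then show "(\<lambda>z. ln (onorm (cyc n z \<circ> span_projection (s (snd z)) DIM('e)))) \<in> borel_measurable (\<Omega> \<Otimes>\<^sub>M \<mu>)"
        by (intro borel_measurable_ln borel_measurable_onorm linear_compose linear_cyc linear_span_projection)
      show "AE z in \<Omega> \<Otimes>\<^sub>M \<mu>. (case z of (\<omega>, x) \<Rightarrow> ln (opnorm_on (L x) (N x) (N (orbit_map f n \<omega> x)) (D (orbit_map f n \<omega>) x)))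
          = ln (onorm (cyc n z \<circ> span_projection (s (snd z)) DIM('e)))"
        using AE_snd[OF X] by eventually_elim (auto simp: opnorm_on_orbit[OF sL])
    qed
    then show ?thesis using nz by (simp add: subbundle_exponent_def)
  qed
  show ?thesis by (rule that[OF s_meas sL dim invar exponent])
qed

end

section \<open>Duality between the tangent and the cotangent bundle\<close>

lemma lin_det_adjoint:
  assumes "linear (A :: 'e::euclidean_space \<Rightarrow> 'e)"
  shows "lin_det (adjoint A) = lin_det A"
proof -
  have "lin_det (adjoint A) = nat_det DIM('e) (\<lambda>i j. A (basis_enum j) \<bullet> basis_enum i)"
    by (simp add: lin_det_def vol_def inner_commute[of "adjoint A _"] adjoint_works[OF assms])
  also have "\<dots> = lin_det A"
    by (simp add: lin_det_def vol_def nat_det_transpose[of _ "\<lambda>i j. A (basis_enum i) \<bullet> basis_enum j"])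
  finally show ?thesis .
qed

lemma lin_det_inv:
  assumes "linear A" "bij (A :: 'e::euclidean_space \<Rightarrow> 'e)"
  shows "lin_det A * lin_det (inv A) = 1"
  using lin_det_comp[OF assms(1) linear_inv_bij[OF assms]] assms(2) by (metis bij_is_surj lin_det_id surj_iff)

lemma inv_adjoint_inv:
  assumes "linear C" "bij (C :: 'e::euclidean_space \<Rightarrow> 'e)"
  shows "inv (adjoint (inv C)) = adjoint C"
  by (simp add: bij_adjoint(2)[OF linear_inv_bij[OF assms] bij_imp_bij_inv[OF assms(2)]] inv_inv_eq[OF assms(2)])

lemma linear_bij_adjoint_inv:
  assumes "linear C" "bij (C :: 'e::euclidean_space \<Rightarrow> 'e)"
  shows "linear (adjoint (inv C))" "bij (adjoint (inv C))"
  by (intro adjoint_linear bij_adjoint(1) linear_inv_bij[OF assms] bij_imp_bij_inv[OF assms(2)])+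

locale dual_framed = F1: framed_cocycle p f \<mu> A M \<theta>\<^sub>1 N\<^sub>1 D\<^sub>1 \<Theta>\<^sub>1 + F2: framed_cocycle p f \<mu> B M \<theta>\<^sub>2 N\<^sub>2 D\<^sub>2 \<Theta>\<^sub>2
  for p :: "'t measure" and f :: "'t \<Rightarrow> 'a::{t2_space,second_countable_topology} \<Rightarrow> 'a"
    and \<mu> :: "'a measure" and A B :: "'t \<Rightarrow> 'a \<Rightarrow> 'e::euclidean_space \<Rightarrow> 'e" and M :: "('a, 'e) rmanifold"
    and \<theta>\<^sub>1 \<theta>\<^sub>2 N\<^sub>1 N\<^sub>2 D\<^sub>1 D\<^sub>2 \<Theta>\<^sub>1 \<Theta>\<^sub>2 +
  assumes dual_A: "B t x = adjoint (inv (A t x))"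
    and dual_Theta: "\<Theta>\<^sub>2 x = adjoint (inv (\<Theta>\<^sub>1 x))"
begin

text \<open>Taking the contragredient twice gives the map back, so every result on the pair (A, B)
  also holds for (B, A).\<close>

lemma dual_swap: "dual_framed p f \<mu> B A M \<theta>\<^sub>2 \<theta>\<^sub>1 N\<^sub>2 N\<^sub>1 D\<^sub>2 D\<^sub>1 \<Theta>\<^sub>2 \<Theta>\<^sub>1"
proof (intro dual_framed.intro F1.framed_cocycle_axioms F2.framed_cocycle_axioms dual_framed_axioms.intro)
  have *: "C = adjoint (inv (adjoint (inv C)))" if "linear C" "bij C" for C :: "'e \<Rightarrow> 'e"
    using that by (simp add: inv_adjoint_inv adjoint_adjoint)
  show "A t x = adjoint (inv (B t x))" for t x unfolding dual_A by (rule *[OF F1.linear_A F1.bij_A])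
  show "\<Theta>\<^sub>1 x = adjoint (inv (\<Theta>\<^sub>2 x))" for x unfolding dual_Theta by (rule *[OF F1.linear_Theta F1.bij_Theta])
qed

lemma pair: "cocycle_pair p f \<mu> A B"
  by (intro cocycle_pair.intro F1.linear_cocycle_axioms F2.linear_cocycle_axioms cocycle_pair_axioms.intro dual_A)

abbreviation log_det :: real where
  "log_det \<equiv> \<integral>z. ln \<bar>lin_det (F1.gen z)\<bar> \<partial>(F1.\<Omega> \<Otimes>\<^sub>M \<mu>)"

text \<open>In dimension two a rotation by a right angle intertwines a linear map with its contragredient,
  up to the determinant. It therefore maps lines to lines equivariantly.\<close>

lemma rot_lift:
  assumes dim2: "DIM('e) = 2" and nu: "\<nu> \<in> F1.lifts"
  obtains \<nu>' where "\<nu>' \<in> F2.lifts"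
    "(\<integral>z. log_growth N\<^sub>2 D\<^sub>2 p f z \<partial>\<nu>') = (\<integral>z. log_growth N\<^sub>1 D\<^sub>1 p f z \<partial>\<nu>) - log_det"
proof -
  \<comment> \<open>Turns each line by a right angle, measured in the frame. Scalars such as the
    determinant disappear on lines, so the map is equivariant.\<close>
  define \<Phi> where "\<Phi> z = F2.mk_line (fst (F1.line_vec z), rot (snd (F1.line_vec z)))" for z
  have rot0: "rot w = 0 \<longleftrightarrow> w = 0" for w :: 'e by (metis dim2 norm_eq_zero norm_rot)
  have rot_A: "rot (A t x w) = lin_det (A t x) *\<^sub>R B t x (rot w)" for t x w
    unfolding dual_A by (rule rot_linear[OF dim2 F1.linear_A F1.bij_A])
  have det: "lin_det (A t x) \<noteq> 0" for t x by (rule lin_det_nonzero[OF F1.linear_A F1.bij_A])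
  have line_rep_rot: "F2.mk_line (x, rot (line_rep w)) = F2.mk_line (x, rot w)" if "w \<noteq> 0" for x w
    using line_rep_coordinate[OF that]
    by (simp add: line_rep_def linear_scale[OF linear_rot[OF dim2]] F2.mk_line_scaleR)
  have Phi: "\<Phi> (F1.mk_line (x, w)) = F2.mk_line (x, rot w)" if "w \<noteq> 0" for x w
    by (simp add: \<Phi>_def F1.line_vec_mk_line that line_rep_rot)
  have equiv: "\<Phi> (proj_map D\<^sub>1 (f t) z) = proj_map D\<^sub>2 (f t) (\<Phi> z)" if z: "z \<in> F1.lines" for t z
  proof -
    obtain x w where w: "w \<noteq> 0" "z = F1.mk_line (x, w)" using F1.lines_cases[OF z] .
    have "\<Phi> (proj_map D\<^sub>1 (f t) z) = F2.mk_line (f t x, lin_det (A t x) *\<^sub>R B t x (rot w))"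
      using w by (simp add: F1.proj_map_mk_line Phi F1.A_zero_iff flip: rot_A)
    then show ?thesis by (simp add: F2.mk_line_scaleR det w Phi F2.proj_map_mk_line)
  qed
  have sets: "sets \<nu> = sets F1.PB" and base: "distr \<nu> borel fst = \<mu>" and prob: "prob_space \<nu>"
    and stat: "stationary p (\<lambda>t. proj_map D\<^sub>1 (f t)) \<nu>"
    using nu by (auto simp: stationary_lifts_def)
  have sp: "space \<nu> = F1.lines" using sets_eq_imp_space_eq[OF sets] by (simp add: F1.space_PB)
  interpret V: stationary_system p "\<lambda>t. proj_map D\<^sub>1 (f t)" \<nu> by (rule F1.lift_system[OF nu])
  have lv: "F1.line_vec \<in> \<nu> \<rightarrow>\<^sub>M borel"
    using F1.measurable_line_vec unfolding measurable_cong_sets[OF sets refl, symmetric] .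
  have Phi_meas: "\<Phi> \<in> \<nu> \<rightarrow>\<^sub>M F2.PB"
  proof -
    have "rot \<in> borel_measurable (borel :: 'e measure)"
      by (intro borel_measurable_continuous_onI linear_continuous_on linear_imp_bounded_linear linear_rot[OF dim2])
    then have "(\<lambda>z. (fst (F1.line_vec z), rot (snd (F1.line_vec z)))) \<in> \<nu> \<rightarrow>\<^sub>M restrict_space borel {y. snd y \<noteq> 0}"
      by (intro measurable_restrict_space2 measurable_Pair_borel measurable_compose[OF lv measurable_fst_borel]
          measurable_compose[OF measurable_compose[OF lv measurable_snd_borel]])
        (auto simp: sp rot0 F1.line_vec_nonzero)
    from measurable_compose[OF this F2.measurable_mk_line] show ?thesis by (simp add: \<Phi>_def[abs_def])
  qed
  define \<nu>' where "\<nu>' = distr \<nu> F2.PB \<Phi>"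
  have sets': "sets \<nu>' = sets F2.PB" by (simp add: \<nu>'_def)
  have prob': "prob_space \<nu>'" unfolding \<nu>'_def by (rule V.N.prob_space_distr[OF Phi_meas])
  interpret V': prob_space \<nu>' by (rule prob')
  have fst_Phi: "fst (\<Phi> z) = fst z" if "z \<in> F1.lines" for z
    using F1.line_vec(3)[OF that] by (simp add: \<Phi>_def F2.mk_line_def)
  have fst_PB: "fst \<in> F2.PB \<rightarrow>\<^sub>M borel"
  proof -
    have "(\<lambda>z. fst (F2.line_vec z)) \<in> F2.PB \<rightarrow>\<^sub>M borel" by (rule measurable_compose[OF F2.measurable_line_vec measurable_fst_borel])
    then show ?thesis by (simp add: F2.line_vec_def)
  qed
  have fst_nu: "fst \<in> \<nu> \<rightarrow>\<^sub>M borel"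
  proof -
    have "(\<lambda>z. fst (F1.line_vec z)) \<in> \<nu> \<rightarrow>\<^sub>M borel" by (rule measurable_compose[OF lv measurable_fst_borel])
    then show ?thesis by (simp add: F1.line_vec_def)
  qed
  have base': "distr \<nu>' borel fst = \<mu>"
  proof -
    have "distr \<nu>' borel fst = distr \<nu> borel (fst \<circ> \<Phi>)" unfolding \<nu>'_def by (rule distr_distr[OF fst_PB Phi_meas])
    also have "\<dots> = distr \<nu> borel fst" by (rule distr_cong) (auto simp: sp fst_Phi)
    finally show ?thesis using base by simp
  qed
  have stat': "stationary p (\<lambda>t. proj_map D\<^sub>2 (f t)) \<nu>'"
    unfolding stationary_def
  proof
    fix E assume "E \<in> sets \<nu>'"
    then have E: "E \<in> sets F2.PB" by (simp add: sets')
    have PE: "\<Phi> -` E \<inter> space \<nu> \<in> sets \<nu>" by (rule measurable_sets[OF Phi_meas E])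
    have "emeasure \<nu>' E = emeasure \<nu> (\<Phi> -` E \<inter> space \<nu>)"
      unfolding \<nu>'_def by (rule emeasure_distr[OF Phi_meas E])
    also have "\<dots> = (\<integral>\<^sup>+\<omega>. emeasure (distr \<nu> \<nu> (proj_map D\<^sub>1 (f (\<omega> 0)))) (\<Phi> -` E \<inter> space \<nu>) \<partial>F1.\<Omega>)"
      using stat PE by (simp add: stationary_def)
    also have "\<dots> = (\<integral>\<^sup>+\<omega>. emeasure (distr \<nu>' \<nu>' (proj_map D\<^sub>2 (f (\<omega> 0)))) E \<partial>F1.\<Omega>)"
    proof (rule nn_integral_cong)
      fix \<omega> assume "\<omega> \<in> space F1.\<Omega>"
      then have w0: "\<omega> 0 \<in> space p" using measurable_space[OF F1.measurable_coordinate] by blast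
      have G1: "proj_map D\<^sub>1 (f (\<omega> 0)) \<in> \<nu> \<rightarrow>\<^sub>M \<nu>"
        using measurable_compose[OF measurable_Pair1'[OF w0] F1.measurable_proj_map[OF sets]] by (simp only: prod.case)
      have G2: "proj_map D\<^sub>2 (f (\<omega> 0)) \<in> \<nu>' \<rightarrow>\<^sub>M \<nu>'"
        using measurable_compose[OF measurable_Pair1'[OF w0] F2.measurable_proj_map[OF sets']] by (simp only: prod.case)
      have G2': "proj_map D\<^sub>2 (f (\<omega> 0)) -` E \<inter> space \<nu>' \<in> sets F2.PB"
        using measurable_sets[OF G2, of E] E sets' by simp
      have "emeasure (distr \<nu> \<nu> (proj_map D\<^sub>1 (f (\<omega> 0)))) (\<Phi> -` E \<inter> space \<nu>)
          = emeasure \<nu> (proj_map D\<^sub>1 (f (\<omega> 0)) -` (\<Phi> -` E \<inter> space \<nu>) \<inter> space \<nu>)"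
        by (rule emeasure_distr[OF G1 PE])
      \<comment> \<open>Equivariance of \<Phi> exchanges the order of the two preimages.\<close>
      also have "proj_map D\<^sub>1 (f (\<omega> 0)) -` (\<Phi> -` E \<inter> space \<nu>) \<inter> space \<nu>
          = \<Phi> -` (proj_map D\<^sub>2 (f (\<omega> 0)) -` E \<inter> space \<nu>') \<inter> space \<nu>"
      proof (rule Collect_cong[of "\<lambda>z. z \<in> _" "\<lambda>z. z \<in> _", unfolded Collect_mem_eq])
        fix z
        show "z \<in> proj_map D\<^sub>1 (f (\<omega> 0)) -` (\<Phi> -` E \<inter> space \<nu>) \<inter> space \<nu> \<longleftrightarrow>
            z \<in> \<Phi> -` (proj_map D\<^sub>2 (f (\<omega> 0)) -` E \<inter> space \<nu>') \<inter> space \<nu>"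
        proof (cases "z \<in> space \<nu>")
          case True
          then have "proj_map D\<^sub>1 (f (\<omega> 0)) z \<in> space \<nu>" "\<Phi> z \<in> space \<nu>'"
            using measurable_space[OF G1] measurable_space[OF Phi_meas] by (simp_all add: \<nu>'_def)
          then show ?thesis using True equiv[of z "\<omega> 0"] by (simp add: sp)
        qed simp
      qed
      also have "emeasure \<nu> \<dots> = emeasure \<nu>' (proj_map D\<^sub>2 (f (\<omega> 0)) -` E \<inter> space \<nu>')"
        unfolding \<nu>'_def by (rule emeasure_distr[OF Phi_meas, symmetric]) (use G2' in \<open>simp add: \<nu>'_def\<close>)
      also have "\<dots> = emeasure (distr \<nu>' \<nu>' (proj_map D\<^sub>2 (f (\<omega> 0)))) E"
        by (rule emeasure_distr[OF G2, symmetric]) (simp add: sets' E)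
      finally show "emeasure (distr \<nu> \<nu> (proj_map D\<^sub>1 (f (\<omega> 0)))) (\<Phi> -` E \<inter> space \<nu>)
          = emeasure (distr \<nu>' \<nu>' (proj_map D\<^sub>2 (f (\<omega> 0)))) E" .
    qed
    finally show "emeasure \<nu>' E = (\<integral>\<^sup>+\<omega>. emeasure (distr \<nu>' \<nu>' (proj_map D\<^sub>2 (f (\<omega> 0)))) E \<partial>F1.\<Omega>)" .
  qed
  have lift': "\<nu>' \<in> F2.lifts" using sets' prob' base' stat' by (simp add: stationary_lifts_def)
  \<comment> \<open>The rotation preserves lengths, so only the determinant in \<open>rot_A\<close>
    changes the rate. Integration turns this into the shift by \<open>log_det\<close>.\<close>
  have rate: "F2.rate t (F2.line_vec (\<Phi> z)) = F1.rate t (F1.line_vec z) - ln \<bar>lin_det (A t (fst z))\<bar>"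
    if z: "z \<in> F1.lines" for t z
  proof -
    obtain x w where lv: "F1.line_vec z = (x, w)" by (cases "F1.line_vec z")
    have w: "w \<noteq> 0" "x = fst z" using F1.line_vec[OF z] by (auto simp: lv)
    have "F2.rate t (F2.line_vec (\<Phi> z)) = F2.rate t (x, rot w)"
      by (simp add: \<Phi>_def lv F2.line_vec_mk_line rot0 w(1) F2.rate_line_rep)
    also have "\<dots> = ln (norm (A t x w) / norm w / \<bar>lin_det (A t x)\<bar>)"
    proof -
      have "norm (A t x w) = \<bar>lin_det (A t x)\<bar> * norm (B t x (rot w))"
        using arg_cong[OF rot_A[of t x w], of norm] by (simp add: norm_rot[OF dim2])
      then show ?thesis using det[of t x] by (simp add: F2.rate_def norm_rot[OF dim2])
    qed
    also have "\<dots> = F1.rate t (x, w) - ln \<bar>lin_det (A t x)\<bar>"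
      using det[of t x] w F1.A_zero_iff[of t x w] by (simp add: ln_div ln_mult_pos F1.rate_def)
    finally show ?thesis by (simp add: lv w(2))
  qed
  have pm: "F1.\<Omega> \<Otimes>\<^sub>M distr \<nu> K h = distr (F1.\<Omega> \<Otimes>\<^sub>M \<nu>) (F1.\<Omega> \<Otimes>\<^sub>M K) (\<lambda>(\<omega>, z). (\<omega>, h z))"
    if h: "h \<in> \<nu> \<rightarrow>\<^sub>M K" for K and h :: "_ \<Rightarrow> 'c"
  proof -
    interpret H: prob_space "distr \<nu> K h" by (rule V.N.prob_space_distr[OF h])
    have "distr F1.\<Omega> F1.\<Omega> (\<lambda>x. x) \<Otimes>\<^sub>M distr \<nu> K h = distr (F1.\<Omega> \<Otimes>\<^sub>M \<nu>) (F1.\<Omega> \<Otimes>\<^sub>M K) (\<lambda>(x, y). (x, h y))"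
      by (rule pair_measure_distr[OF _ h H.sigma_finite_measure_axioms]) simp
    then show ?thesis by (simp add: distr_id)
  qed
  have pr: "(\<lambda>(\<omega>, z). (\<omega>, fst z)) \<in> F1.\<Omega> \<Otimes>\<^sub>M \<nu> \<rightarrow>\<^sub>M F1.\<Omega> \<Otimes>\<^sub>M borel"
    using fst_nu by measurable
  have mu: "F1.\<Omega> \<Otimes>\<^sub>M \<mu> = distr (F1.\<Omega> \<Otimes>\<^sub>M \<nu>) (F1.\<Omega> \<Otimes>\<^sub>M borel) (\<lambda>(\<omega>, z). (\<omega>, fst z))"
    using pm[OF fst_nu] by (simp add: base)
  have det_int: "integrable (F1.\<Omega> \<Otimes>\<^sub>M \<mu>) (\<lambda>z. ln \<bar>lin_det (F1.gen z)\<bar>)" by (rule F1.integrable_ln_det_gen)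
  have det_meas: "(\<lambda>z. ln \<bar>lin_det (F1.gen z)\<bar>) \<in> borel_measurable (F1.\<Omega> \<Otimes>\<^sub>M borel)"
    using borel_measurable_integrable[OF det_int] measurable_cong_sets[OF F1.sets_pair_mu refl] by blast
  have det_int': "integrable (F1.\<Omega> \<Otimes>\<^sub>M \<nu>) (\<lambda>(\<omega>, z). ln \<bar>lin_det (A (\<omega> 0) (fst z))\<bar>)"
    using det_int integrable_distr_eq[OF pr det_meas] unfolding mu by (simp add: F1.gen_def case_prod_unfold)
  have det_eq: "(\<integral>(\<omega>, z). ln \<bar>lin_det (A (\<omega> 0) (fst z))\<bar> \<partial>(F1.\<Omega> \<Otimes>\<^sub>M \<nu>)) = log_det"
    unfolding mu using integral_distr[OF pr det_meas] by (simp add: F1.gen_def case_prod_unfold)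
  have rate_meas: "(\<lambda>(\<omega>, z). F2.rate (\<omega> 0) (F2.line_vec z)) \<in> borel_measurable (F1.\<Omega> \<Otimes>\<^sub>M F2.PB)"
    using borel_measurable_integrable[OF F2.lift_growth(2)[OF lift']]
      measurable_cong_sets[OF sets_pair_measure_cong[OF refl sets'] refl] by blast
  have "(\<integral>z. log_growth N\<^sub>2 D\<^sub>2 p f z \<partial>\<nu>') = (\<integral>(\<omega>, z). F2.rate (\<omega> 0) (F2.line_vec z) \<partial>(F1.\<Omega> \<Otimes>\<^sub>M \<nu>'))"
    by (rule F2.lift_growth(1)[OF lift'])
  also have "\<dots> = (\<integral>(\<omega>, z). F2.rate (\<omega> 0) (F2.line_vec (\<Phi> z)) \<partial>(F1.\<Omega> \<Otimes>\<^sub>M \<nu>))"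
  proof -
    have "(\<lambda>(\<omega>, z). (\<omega>, \<Phi> z)) \<in> F1.\<Omega> \<Otimes>\<^sub>M \<nu> \<rightarrow>\<^sub>M F1.\<Omega> \<Otimes>\<^sub>M F2.PB" using Phi_meas by measurable
    from integral_distr[OF this rate_meas] show ?thesis
      unfolding \<nu>'_def pm[OF Phi_meas] by (simp add: case_prod_unfold)
  qed
  also have "\<dots> = (\<integral>(\<omega>, z). F1.rate (\<omega> 0) (F1.line_vec z) - ln \<bar>lin_det (A (\<omega> 0) (fst z))\<bar> \<partial>(F1.\<Omega> \<Otimes>\<^sub>M \<nu>))"
    by (rule Bochner_Integration.integral_cong[OF refl]) (auto simp: space_pair_measure sp rate)
  also have "\<dots> = (\<integral>(\<omega>, z). F1.rate (\<omega> 0) (F1.line_vec z) \<partial>(F1.\<Omega> \<Otimes>\<^sub>M \<nu>)) - log_det"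
    using Bochner_Integration.integral_diff[OF F1.lift_growth(2)[OF nu] det_int'] det_eq
    by (simp add: case_prod_unfold)
  finally show ?thesis using that[OF lift'] F1.lift_growth(1)[OF nu] by simp
qed

lemma dual_log_det: "(\<integral>z. ln \<bar>lin_det (F2.gen z)\<bar> \<partial>(F1.\<Omega> \<Otimes>\<^sub>M \<mu>)) = - log_det"
proof -
  have "ln \<bar>lin_det (F2.gen z)\<bar> = - ln \<bar>lin_det (F1.gen z)\<bar>" for z
  proof -
    have "lin_det (F1.gen z) * lin_det (F2.gen z) = 1"
      using lin_det_inv[OF F1.linear_gen F1.bij_gen]
      by (simp add: F2.gen_def F1.gen_def dual_A lin_det_adjoint[OF linear_inv_bij[OF F1.linear_A F1.bij_A]])
    then have "\<bar>lin_det (F2.gen z)\<bar> = inverse \<bar>lin_det (F1.gen z)\<bar>"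
      by (metis abs_inverse inverse_unique)
    then show ?thesis using lin_det_nonzero[OF F1.linear_gen F1.bij_gen, of z] by (simp add: ln_inverse)
  qed
  then show ?thesis by simp
qed

end

section \<open>The comparison of irreducibility properties\<close>

locale riemannian_cocycle =
  dual_framed p f \<mu> A B M "tangent_frame M" "cotangent_frame M" "tnorm M" "conorm M" "tderiv M" "coderiv M" \<Theta> \<Theta>'
  for p :: "'t measure" and f :: "'t \<Rightarrow> 'a::{t2_space,second_countable_topology} \<Rightarrow> 'a"
    and \<mu> :: "'a measure" and A B :: "'t \<Rightarrow> 'a \<Rightarrow> 'e::euclidean_space \<Rightarrow> 'e" and M :: "('a, 'e) rmanifold"
    and \<Theta> \<Theta>' +
  assumes metric_Theta: "metric M x (\<Theta> x v) (\<Theta> x w) = v \<bullet> w"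
begin

lemma wedge_opnorm_orbit:
  "wedge_opnorm k (metric M x) (metric M (orbit_map f n \<omega> x)) (tderiv M (orbit_map f n \<omega>) x)
    = wedge_opnorm k (\<bullet>) (\<bullet>) (F1.cyc n (\<omega>, x))"
proof -
  have "inv (\<Theta> (orbit_map f n \<omega> x)) \<circ> tderiv M (orbit_map f n \<omega>) x \<circ> \<Theta> x = F1.cyc n (\<omega>, x)"
    unfolding F1.D_orbit by (auto simp: fun_eq_iff)
  then show ?thesis
    using wedge_opnorm_frame[where F = "\<Theta> x" and F' = "\<Theta> (orbit_map f n \<omega> x)" and k = k,
        OF F1.bij_Theta metric_Theta metric_Theta F1.bij_Theta]
    by simp
qed

lemma lyap_sum_eq:
  assumes "\<And>z n. ln (wedge_opnorm k (\<bullet>) (\<bullet>) (F1.cyc n z)) = h n z"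
    and "\<And>n. h n \<in> borel_measurable (F1.\<Omega> \<Otimes>\<^sub>M \<mu>)"
  shows "lyap_sum M p f \<mu> k = lim (\<lambda>n. 1 / real n * (\<integral>z. h n z \<partial>(F1.\<Omega> \<Otimes>\<^sub>M \<mu>)))"
proof -
  have "(\<integral>(\<omega>, x). ln (wedge_opnorm k (metric M x) (metric M (orbit_map f n \<omega> x)) (tderiv M (orbit_map f n \<omega>) x))
      \<partial>completion (F1.\<Omega> \<Otimes>\<^sub>M \<mu>)) = (\<integral>z. h n z \<partial>(F1.\<Omega> \<Otimes>\<^sub>M \<mu>))" for n
    by (rule integral_completion_AE_eq[OF assms(2)]) (auto simp: wedge_opnorm_orbit assms(1))
  then show ?thesis by (simp add: lyap_sum_def)
qed

lemma lyap_sum_0: "lyap_sum M p f \<mu> 0 = 0"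
  by (subst lyap_sum_eq[where h = "\<lambda>_ _. 0"]) (simp_all add: wedge_opnorm_0)

lemma lyap_sum_1: "lyap_sum M p f \<mu> 1 = F1.top_exponent"
  unfolding F1.top_exponent_def
  by (rule lyap_sum_eq) (simp_all add: wedge_opnorm_1[OF F1.linear_cyc] F1.measurable_ln_onorm_cyc)

lemma LIMSEQ_log_det: "(\<lambda>n. 1 / real n * (real n * log_det)) \<longlonglongrightarrow> log_det"
  by (rule tendsto_eventually) (auto simp: eventually_sequentially intro!: exI[of _ 1])

lemma lyap_sum_top: "lyap_sum M p f \<mu> DIM('e) = log_det"
proof -
  have "lyap_sum M p f \<mu> DIM('e) = lim (\<lambda>n. 1 / real n * (\<integral>z. ln \<bar>lin_det (F1.cyc n z)\<bar> \<partial>(F1.\<Omega> \<Otimes>\<^sub>M \<mu>)))"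
    by (rule lyap_sum_eq) (simp_all add: wedge_opnorm_top[OF F1.linear_cyc] F1.measurable_ln_det_cyc)
  also have "\<dots> = log_det"
    unfolding F1.ln_det_cyc(2) by (rule limI[OF LIMSEQ_log_det])
  finally show ?thesis .
qed

text \<open>By the cofactor formula the norm splits into determinant and norm of the inverse. The
  determinant is multiplicative along orbits and contributes the constant \<open>log_det\<close> for
  n \<ge> 1; only the second factor involves a genuine limit.\<close>

lemma lyap_sum_cotop: "lyap_sum M p f \<mu> (DIM('e) - 1) = log_det + F1.inv_exponent"
proof -
  have "lyap_sum M p f \<mu> (DIM('e) - 1) =
      lim (\<lambda>n. 1 / real n * (\<integral>z. ln \<bar>lin_det (F1.cyc n z)\<bar> + ln (onorm (inv (F1.cyc n z))) \<partial>(F1.\<Omega> \<Otimes>\<^sub>M \<mu>)))"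
  proof (rule lyap_sum_eq)
    show "ln (wedge_opnorm (DIM('e) - 1) (\<bullet>) (\<bullet>) (F1.cyc n z)) = ln \<bar>lin_det (F1.cyc n z)\<bar> + ln (onorm (inv (F1.cyc n z)))" for n z
      unfolding wedge_opnorm_cotop[OF F1.linear_cyc F1.bij_cyc]
      using lin_det_nonzero[OF F1.linear_cyc F1.bij_cyc, of n z] F1.onorm_cyc_pos[of n z] by (simp add: ln_mult_pos)
    show "(\<lambda>z. ln \<bar>lin_det (F1.cyc n z)\<bar> + ln (onorm (inv (F1.cyc n z)))) \<in> borel_measurable (F1.\<Omega> \<Otimes>\<^sub>M \<mu>)" for n
      by (intro borel_measurable_add F1.measurable_ln_det_cyc F1.measurable_ln_onorm_cyc)
  qed
  also have "\<dots> = log_det + F1.inv_exponent"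
  proof (rule limI)
    have "(\<lambda>n. 1 / real n * (real n * log_det) + 1 / real n * (\<integral>z. ln (onorm (inv (F1.cyc n z))) \<partial>(F1.\<Omega> \<Otimes>\<^sub>M \<mu>)))
        \<longlonglongrightarrow> log_det + F1.inv_exponent"
      by (intro tendsto_add LIMSEQ_log_det F1.LIMSEQ_inv_exponent)
    then show "(\<lambda>n. 1 / real n * (\<integral>z. ln \<bar>lin_det (F1.cyc n z)\<bar> + ln (onorm (inv (F1.cyc n z))) \<partial>(F1.\<Omega> \<Otimes>\<^sub>M \<mu>)))
        \<longlonglongrightarrow> log_det + F1.inv_exponent"
      by (simp add: F1.ln_det_cyc F1.integrable_ln_onorm_cyc distrib_left del: times_divide_eq_left)
  qed
  finally show ?thesis .
qed

lemma lyapunov_top: "lyapunov M p f \<mu> 1 = F1.top_exponent"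
  unfolding lyapunov_def diff_self_eq_0 lyap_sum_0 lyap_sum_1 by simp

lemma lyapunov_bottom: "lyapunov M p f \<mu> DIM('e) = - F1.inv_exponent"
  unfolding lyapunov_def lyap_sum_top lyap_sum_cotop by simp

lemmas dual_exponents = cocycle_pair.D_exponents[OF pair]

lemma irreducible_if_conformal:
  assumes "lyapunov M p f \<mu> 1 = lyapunov M p f \<mu> DIM('e)"
  shows "quasi_irreducible M p f \<mu>" "coquasi_irreducible M p f \<mu>"
proof -
  have eq: "F1.top_exponent = - F1.inv_exponent"
    using assms unfolding lyapunov_top lyapunov_bottom .
  show "quasi_irreducible M p f \<mu>"
    unfolding quasi_irreducible_def lyapunov_top
    using F1.lift_growth(3,4) eq by (auto intro!: antisym)
  show "coquasi_irreducible M p f \<mu>"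
    unfolding coquasi_irreducible_def lyapunov_bottom
    using F2.lift_growth(3,4) eq by (auto intro!: antisym simp: dual_exponents)
qed

lemma irreducible_iff_dim2:
  assumes dim2: "DIM('e) = 2"
  shows "quasi_irreducible M p f \<mu> \<longleftrightarrow> coquasi_irreducible M p f \<mu>"
proof -
  \<comment> \<open>For m = 2 the exterior powers of order 1 and m - 1 coincide. Equating their two
    evaluations says that \<lambda>_1 + \<lambda>_2 is the mean logarithm of the
    determinant.\<close>
  have top: "F1.top_exponent = log_det + F1.inv_exponent"
    using lyap_sum_1 lyap_sum_cotop dim2 by simp
  interpret dual: dual_framed p f \<mu> B A M "cotangent_frame M" "tangent_frame M" "conorm M" "tnorm M" "coderiv M" "tderiv M" \<Theta>' \<Theta>
    by (rule dual_swap)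
  show ?thesis
  proof
    assume q: "quasi_irreducible M p f \<mu>"
    show "coquasi_irreducible M p f \<mu>"
      unfolding coquasi_irreducible_def lyapunov_bottom
    proof
      fix \<nu> assume "\<nu> \<in> F2.lifts"
      then obtain \<nu>' where "\<nu>' \<in> F1.lifts"
        "(\<integral>z. log_growth (tnorm M) (tderiv M) p f z \<partial>\<nu>') = (\<integral>z. log_growth (conorm M) (coderiv M) p f z \<partial>\<nu>) + log_det"
        using dual.rot_lift[OF dim2, of \<nu>] unfolding dual_log_det by auto
      then show "(\<integral>z. log_growth (conorm M) (coderiv M) p f z \<partial>\<nu>) = - (- F1.inv_exponent)"
        using q top unfolding quasi_irreducible_def lyapunov_top by force
    qed
  next
    assume q: "coquasi_irreducible M p f \<mu>"
    show "quasi_irreducible M p f \<mu>"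
      unfolding quasi_irreducible_def lyapunov_top
    proof
      fix \<nu> assume "\<nu> \<in> F1.lifts"
      then obtain \<nu>' where "\<nu>' \<in> F2.lifts"
        "(\<integral>z. log_growth (conorm M) (coderiv M) p f z \<partial>\<nu>') = (\<integral>z. log_growth (tnorm M) (tderiv M) p f z \<partial>\<nu>) - log_det"
        using rot_lift[OF dim2, of \<nu>] by auto
      then show "(\<integral>z. log_growth (tnorm M) (tderiv M) p f z \<partial>\<nu>) = F1.top_exponent"
        using q top unfolding coquasi_irreducible_def lyapunov_bottom by force
    qed
  qed
qed

end

text \<open>If the contragredient cocycle preserves a hyperplane bundle \<open>L\<close> of exponent smaller than its
  top exponent, then the annihilator of \<open>L\<close> is an invariant line field. By \<open>annihilator_exponents\<close>
  its growth cannot attain the top exponent.\<close>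

context dual_framed
begin

lemma slow_hyperplane_bundle:
  assumes dim: "2 \<le> DIM('e)" and X: "AE x in \<mu>. x \<in> X"
    and maximal: "\<And>\<nu>. \<nu> \<in> F1.lifts \<Longrightarrow> (\<integral>z. log_growth N\<^sub>1 D\<^sub>1 p f z \<partial>\<nu>) = F1.top_exponent"
    and slow: "slow_subbundle M \<theta>\<^sub>2 N\<^sub>2 D\<^sub>2 p f X \<mu> F1.inv_exponent L"
    and hyp: "AE x in \<mu>. dim (L x) = DIM('e) - 1"
  shows False
proof -
  interpret pair: cocycle_pair p f \<mu> A B by (rule pair)
  have L: "measurable_subbundle M \<theta>\<^sub>2 X L" "invariant_subbundle D\<^sub>2 p f \<mu> L"
    and expo: "subbundle_exponent N\<^sub>2 D\<^sub>2 p f \<mu> L < ereal F1.inv_exponent"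
    using slow by (auto simp: slow_subbundle_def)
  obtain s where s: "\<And>i. (\<lambda>x. s x i) \<in> borel_measurable \<mu>"
      "\<And>x. x \<in> X \<Longrightarrow> inv (\<Theta>\<^sub>2 x) ` L x = span (s x ` {..<DIM('e)})"
      "\<And>x. x \<in> X \<Longrightarrow> dim (span (s x ` {..<DIM('e)})) = dim (L x)"
      "AE z in F1.\<Omega> \<Otimes>\<^sub>M \<mu>. F2.gen z ` span (s (snd z) ` {..<DIM('e)}) = span (s (snd (F1.skew z)) ` {..<DIM('e)})"
      "\<not> (AE x in \<mu>. L x = {0}) \<Longrightarrow> subbundle_exponent N\<^sub>2 D\<^sub>2 p f \<mu> L =
        ereal (lim (\<lambda>n. 1 / real n * (\<integral>z. ln (onorm (F2.cyc n z \<circ> span_projection (s (snd z)) DIM('e))) \<partial>(F1.\<Omega> \<Otimes>\<^sub>M \<mu>))))"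
    using F2.subbundle_coordinates[OF L(1) X L(2)] by blast
  obtain e where e: "e \<in> borel_measurable \<mu>" "\<And>x. norm (e x) = 1"
      "\<And>x. dim (span (s x ` {..<DIM('e)})) = DIM('e) - 1 \<Longrightarrow> span (s x ` {..<DIM('e)}) = {\<xi>. \<xi> \<bullet> e x = 0}"
    using measurable_unit_normal[of s \<mu> "DIM('e)", OF s(1)] by blast
  have normal: "AE x in \<mu>. span (s x ` {..<DIM('e)}) = {\<xi>. \<xi> \<bullet> e x = 0}"
    using X hyp by eventually_elim (metis e(3) s(3))
  \<comment> \<open>The fibres have dimension m - 1 \<ge> 1, so the exponent of L is an actual limit
    and not the conventional value -\<infinity>.\<close>
  have nonzero: "\<not> (AE x in \<mu>. L x = {0})"
  proof
    assume "AE x in \<mu>. L x = {0}"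
    then have "AE x in \<mu>. False" using hyp by eventually_elim (use dim in simp)
    then show False by simp
  qed
  note ann = pair.annihilator_exponents[OF dim s(1) s(4) e(1,2) normal]
  obtain \<nu> where nu: "\<nu> \<in> F1.lifts"
      "(\<integral>z. log_growth N\<^sub>1 D\<^sub>1 p f z \<partial>\<nu>) = (\<integral>z. ln (norm (F1.gen z (e (snd z)))) \<partial>(F1.\<Omega> \<Otimes>\<^sub>M \<mu>))"
    using F1.line_field_lift[OF e(1,2) ann(1)] by blast
  \<comment> \<open>By maximality the growth of the line field equals \<open>F1.top_exponent\<close>
    and cancels in \<open>ann(2)\<close>. This leaves \<open>F1.inv_exponent\<close> as a lower
    bound for the exponent of L, against slowness.\<close>
  show False
    using ann(2) maximal[OF nu(1)] nu(2) expo s(5)[OF nonzero] by simp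
qed

end

context riemannian_cocycle
begin

lemma no_coequator:
  assumes "2 \<le> DIM('e)" "AE x in \<mu>. x \<in> X" "quasi_irreducible M p f \<mu>" "is_coequator M p f X \<mu> L"
    "AE x in \<mu>. dim (L x) = DIM('e) - 1"
  shows False
proof (rule slow_hyperplane_bundle[OF assms(1,2) _ _ assms(5)])
  show "slow_subbundle M (cotangent_frame M) (conorm M) (coderiv M) p f X \<mu> F1.inv_exponent L"
    using assms(4) by (simp add: is_coequator_def Let_def lyapunov_bottom)
qed (use assms(3) in \<open>simp add: quasi_irreducible_def lyapunov_top[unfolded One_nat_def]\<close>)

lemma no_equator:
  assumes "2 \<le> DIM('e)" "AE x in \<mu>. x \<in> X" "coquasi_irreducible M p f \<mu>" "is_equator M p f X \<mu> L"
    "AE x in \<mu>. dim (L x) = DIM('e) - 1"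
  shows False
\<comment> \<open>With the roles exchanged, the inverse exponent of the contragredient cocycle is
  the top exponent of the tangent cocycle.\<close>
proof (rule dual_framed.slow_hyperplane_bundle[OF dual_swap assms(1,2) _ _ assms(5)])
  show "slow_subbundle M (tangent_frame M) (tnorm M) (tderiv M) p f X \<mu> F2.inv_exponent L"
    using assms(4) by (simp add: is_equator_def Let_def lyapunov_top[unfolded One_nat_def] dual_exponents)
qed (use assms(3) in \<open>simp add: coquasi_irreducible_def lyapunov_bottom dual_exponents\<close>)

end

section \<open>Differentials in charts\<close>

definition chart_deriv :: "('a \<Rightarrow> 'a) \<Rightarrow> ('a, 'e::euclidean_space) chart \<Rightarrow> ('a, 'e) chart \<Rightarrow> 'a \<Rightarrow> 'e \<Rightarrow> 'e" where
  "chart_deriv h c d x = frechet_derivative (snd d \<circ> h \<circ> chart_inv c) (at (snd c x))"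

text \<open>Continuity is part of the notion because the expression of h in charts carries no
  information about nearby points that h maps outside the domain of d. Quantifying over all charts
  makes the notion independent of charts by definition.\<close>

definition mdiff :: "('a::t2_space, 'e::euclidean_space) rmanifold \<Rightarrow> ('a \<Rightarrow> 'a) \<Rightarrow> 'a \<Rightarrow> bool" where
  "mdiff M h x \<longleftrightarrow> isCont h x \<and> (\<forall>c\<in>charts M. \<forall>d\<in>charts M. x \<in> fst c \<longrightarrow> h x \<in> fst d \<longrightarrow>
     (snd d \<circ> h \<circ> chart_inv c) differentiable (at (snd c x)))"

text \<open>Transition maps are chart expressions of the identity, so a single chain rule governs
  derivatives and changes of coordinates alike.\<close>

lemma coord_change_eq_chart_deriv: "coord_change c d x = chart_deriv id c d x"
  by (simp add: coord_change_def chart_deriv_def)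

lemma tderiv_eq_chart_deriv: "tderiv M h x = chart_deriv h (chart_at M x) (chart_at M (h x)) x"
  by (simp add: tderiv_def chart_deriv_def)

lemma mdiffD:
  "mdiff M h x \<Longrightarrow> isCont h x"
  "mdiff M h x \<Longrightarrow> c \<in> charts M \<Longrightarrow> d \<in> charts M \<Longrightarrow> x \<in> fst c \<Longrightarrow> h x \<in> fst d \<Longrightarrow>
     ((snd d \<circ> h \<circ> chart_inv c) has_derivative chart_deriv h c d x) (at (snd c x))"
  by (auto simp: mdiff_def chart_deriv_def frechet_derivative_works[symmetric])

lemma linear_chart_deriv:
  "mdiff M h x \<Longrightarrow> c \<in> charts M \<Longrightarrow> d \<in> charts M \<Longrightarrow> x \<in> fst c \<Longrightarrow> h x \<in> fst d \<Longrightarrow> linear (chart_deriv h c d x)"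
  by (rule has_derivative_linear[OF mdiffD(2)])

context
  fixes M :: "('a::{t2_space,second_countable_topology}, 'e::euclidean_space) rmanifold"
  assumes M: "smooth_atlas (charts M)"
begin

lemma chart_open: "c \<in> charts M \<Longrightarrow> open (fst c)" "c \<in> charts M \<Longrightarrow> open (snd c ` fst c)"
  using M by (auto simp: smooth_atlas_def is_chart_def)

lemma chart_cont:
  "c \<in> charts M \<Longrightarrow> continuous_on (fst c) (snd c)"
  "c \<in> charts M \<Longrightarrow> continuous_on (snd c ` fst c) (chart_inv c)"
  using M by (auto simp: smooth_atlas_def is_chart_def homeomorphism_def)

lemma chart_inv [simp]: "c \<in> charts M \<Longrightarrow> x \<in> fst c \<Longrightarrow> chart_inv c (snd c x) = x"
  using M by (auto simp: smooth_atlas_def is_chart_def homeomorphism_def)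

lemma chart_at: "chart_at M x \<in> charts M" "x \<in> fst (chart_at M x)"
proof -
  have "x \<in> (\<Union>c\<in>charts M. fst c)" using M unfolding smooth_atlas_def by blast
  then have "\<exists>c. c \<in> charts M \<and> x \<in> fst c" by blast
  then have "chart_at M x \<in> charts M \<and> x \<in> fst (chart_at M x)" unfolding chart_at_def by (rule someI_ex)
  then show "chart_at M x \<in> charts M" "x \<in> fst (chart_at M x)" by auto
qed

lemma isCont_chart_inv: "c \<in> charts M \<Longrightarrow> x \<in> fst c \<Longrightarrow> isCont (chart_inv c) (snd c x)"
  using chart_cont(2) chart_open(2) by (simp add: continuous_on_eq_continuous_at)

lemma eventually_chart_inv:
  assumes c: "c \<in> charts M" "x \<in> fst c" and ev: "\<forall>\<^sub>F z in nhds x. Q z"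
  shows "\<forall>\<^sub>F y in nhds (snd c x). Q (chart_inv c y)"
proof -
  have "filterlim (chart_inv c) (nhds x) (nhds (snd c x))"
    using isCont_chart_inv[OF c] c by (simp add: tendsto_nhds_iff isCont_def tendsto_at_iff_tendsto_nhds)
  then show ?thesis using ev by (auto simp: filterlim_iff)
qed

lemma mdiff_id: "mdiff M id x"
proof -
  have "(snd d \<circ> id \<circ> chart_inv c) differentiable (at (snd c x))"
    if "c \<in> charts M" "d \<in> charts M" "x \<in> fst c" "x \<in> fst d" for c d
  proof -
    have "C_k_on (Suc 0) (snd c ` (fst c \<inter> fst d)) (snd d \<circ> chart_inv c)"
      using M that unfolding smooth_atlas_def by blast
    then show ?thesis using that by auto
  qed
  then show ?thesis by (simp add: mdiff_def)
qed

text \<open>The composite of the chart expressions agrees with the chart expression of the composite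
  only near the point, where h stays in the domain of the intermediate chart. This is enough for
  derivatives.\<close>

lemma chart_deriv_comp_has_derivative:
  assumes h: "mdiff M h x" and k: "mdiff M k (h x)"
    and c: "c \<in> charts M" "x \<in> fst c" and d: "d \<in> charts M" "h x \<in> fst d" and e: "e \<in> charts M" "k (h x) \<in> fst e"
  shows "((snd e \<circ> (k \<circ> h) \<circ> chart_inv c) has_derivative (chart_deriv k d e (h x) \<circ> chart_deriv h c d x)) (at (snd c x))"
proof -
  have 1: "((snd e \<circ> k \<circ> chart_inv d) \<circ> (snd d \<circ> h \<circ> chart_inv c) has_derivative
      (chart_deriv k d e (h x) \<circ> chart_deriv h c d x)) (at (snd c x))"
    using mdiffD(2)[OF h c(1) d(1) c(2) d(2)] mdiffD(2)[OF k d(1) e(1) d(2) e(2)] c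
    by (intro diff_chain_at) (simp_all add: comp_def)
  have "\<forall>\<^sub>F z in nhds x. h z \<in> fst d"
    using mdiffD(1)[OF h] d chart_open(1)[OF d(1)]
    by (simp add: isCont_def tendsto_at_iff_tendsto_nhds topological_tendstoD)
  then have "\<forall>\<^sub>F y in nhds (snd c x). h (chart_inv c y) \<in> fst d" by (rule eventually_chart_inv[OF c])
  then have ev: "\<forall>\<^sub>F y in nhds (snd c x). ((snd e \<circ> k \<circ> chart_inv d) \<circ> (snd d \<circ> h \<circ> chart_inv c)) y = (snd e \<circ> (k \<circ> h) \<circ> chart_inv c) y"
    by eventually_elim (simp add: d)
  show ?thesis
    by (rule has_derivative_transform_eventually[OF 1])
      (use ev eventually_nhds_x_imp_x[OF ev] in \<open>auto simp: eventually_at_filter elim: eventually_mono\<close>)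
qed

lemma mdiff_comp:
  assumes h: "mdiff M h x" and k: "mdiff M k (h x)"
  shows "mdiff M (k \<circ> h) x"
  unfolding mdiff_def
proof (intro conjI ballI impI)
  show "isCont (k \<circ> h) x" using mdiffD(1)[OF h] mdiffD(1)[OF k] unfolding comp_def by (rule isCont_o2)
  show "(snd e \<circ> (k \<circ> h) \<circ> chart_inv c) differentiable at (snd c x)"
    if "c \<in> charts M" "e \<in> charts M" "x \<in> fst c" "(k \<circ> h) x \<in> fst e" for c e
    using chart_deriv_comp_has_derivative[OF h k that(1,3) chart_at(1,2) that(2)] that(4)
    by (auto simp: differentiable_def)
qed

lemma chart_deriv_comp:
  assumes "mdiff M h x" "mdiff M k (h x)"
    and "c \<in> charts M" "x \<in> fst c" "d \<in> charts M" "h x \<in> fst d" "e \<in> charts M" "k (h x) \<in> fst e"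
  shows "chart_deriv (k \<circ> h) c e x = chart_deriv k d e (h x) \<circ> chart_deriv h c d x"
  unfolding chart_deriv_def[of "k \<circ> h"]
  by (rule frechet_derivative_at[OF chart_deriv_comp_has_derivative[OF assms], symmetric])

text \<open>Both chart expressions have the same derivatives, if any, and
  \<open>frechet_derivative\<close> selects one from them. The equality thus holds without assuming
  differentiability.\<close>

lemma chart_deriv_local:
  assumes "open U" "x \<in> U" "\<And>z. z \<in> U \<Longrightarrow> h z = k z" and c: "c \<in> charts M" "x \<in> fst c"
  shows "chart_deriv h c d x = chart_deriv k c d x"
proof -
  have "\<forall>\<^sub>F z in nhds x. z \<in> U" using assms by (simp add: eventually_nhds_in_open)
  then have "\<forall>\<^sub>F y in nhds (snd c x). chart_inv c y \<in> U" by (rule eventually_chart_inv[OF c])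
  then have ev: "\<forall>\<^sub>F y in nhds (snd c x). (snd d \<circ> h \<circ> chart_inv c) y = (snd d \<circ> k \<circ> chart_inv c) y"
    by eventually_elim (simp add: assms(3))
  then have ev': "\<forall>\<^sub>F y in at (snd c x). (snd d \<circ> h \<circ> chart_inv c) y = (snd d \<circ> k \<circ> chart_inv c) y"
    by (auto simp: eventually_at_filter elim: eventually_mono)
  note x = eventually_nhds_x_imp_x[OF ev]
  have "((snd d \<circ> h \<circ> chart_inv c) has_derivative D) (at (snd c x)) \<longleftrightarrow> ((snd d \<circ> k \<circ> chart_inv c) has_derivative D) (at (snd c x))" for D
  proof
    assume "((snd d \<circ> h \<circ> chart_inv c) has_derivative D) (at (snd c x))"
    then show "((snd d \<circ> k \<circ> chart_inv c) has_derivative D) (at (snd c x))"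
      by (rule has_derivative_transform_eventually) (use ev' x in auto)
  next
    assume "((snd d \<circ> k \<circ> chart_inv c) has_derivative D) (at (snd c x))"
    then show "((snd d \<circ> h \<circ> chart_inv c) has_derivative D) (at (snd c x))"
      by (rule has_derivative_transform_eventually) (use ev' x in \<open>auto elim: eventually_mono\<close>)
  qed
  then show ?thesis by (simp add: chart_deriv_def frechet_derivative_def)
qed

lemma chart_deriv_id:
  assumes "c \<in> charts M" "x \<in> fst c"
  shows "chart_deriv id c c x = id"
proof -
  have "\<forall>\<^sub>F z in nhds (snd c x). z \<in> snd c ` fst c"
    using assms chart_open(2) by (intro eventually_nhds_in_open) auto
  then have ev: "\<forall>\<^sub>F y in nhds (snd c x). y = (snd c \<circ> id \<circ> chart_inv c) y"
    by eventually_elim (use assms in auto)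
  have "((snd c \<circ> id \<circ> chart_inv c) has_derivative id) (at (snd c x))"
    by (rule has_derivative_transform_eventually[OF has_derivative_ident[unfolded id_def[symmetric]]])
      (use ev eventually_nhds_x_imp_x[OF ev] in \<open>auto simp: eventually_at_filter id_def elim: eventually_mono\<close>)
  then show ?thesis unfolding chart_deriv_def by (rule frechet_derivative_at[symmetric])
qed

lemma chart_deriv_inverse:
  assumes h: "mdiff M h x" and k: "mdiff M k (h x)"
    and U: "open U" "x \<in> U" "\<And>z. z \<in> U \<Longrightarrow> k (h z) = z"
    and c: "c \<in> charts M" "x \<in> fst c" and d: "d \<in> charts M" "h x \<in> fst d"
  shows "chart_deriv k d c (h x) \<circ> chart_deriv h c d x = id"
proof -
  have "chart_deriv (k \<circ> h) c c x = chart_deriv id c c x"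
    by (rule chart_deriv_local[OF U(1,2) _ c]) (simp add: U)
  then show ?thesis using chart_deriv_comp[OF h k c d c(1)] U c by (simp add: chart_deriv_id)
qed

lemma coord_change:
  assumes "c \<in> charts M" "x \<in> fst c" "d \<in> charts M" "x \<in> fst d"
  shows "linear (coord_change c d x)" "bij (coord_change c d x)"
    "e \<in> charts M \<Longrightarrow> x \<in> fst e \<Longrightarrow> coord_change d e x \<circ> coord_change c d x = coord_change c e x"
    "inv (coord_change c d x) = coord_change d c x"
proof -
  show "linear (coord_change c d x)"
    unfolding coord_change_eq_chart_deriv using assms by (intro linear_chart_deriv[OF mdiff_id]) auto
  show "coord_change d e x \<circ> coord_change c d x = coord_change c e x"
    if "e \<in> charts M" "x \<in> fst e" for e
    unfolding coord_change_eq_chart_deriv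
    using chart_deriv_comp[OF mdiff_id, of id x c d e] mdiff_id assms that by simp
  have *: "coord_change d c x \<circ> coord_change c d x = id" "coord_change c d x \<circ> coord_change d c x = id"
    unfolding coord_change_eq_chart_deriv
    using chart_deriv_inverse[OF mdiff_id, of id x UNIV] mdiff_id assms by simp_all
  then show "bij (coord_change c d x)" by (rule o_bij)
  show "inv (coord_change c d x) = coord_change d c x"
    using * by (intro inv_equality) (auto simp: fun_eq_iff)
qed

lemma tangent_frame:
  assumes "c \<in> charts M" "x \<in> fst c"
  shows "linear (tangent_frame M c x)" "bij (tangent_frame M c x)"
  unfolding tangent_frame_def using assms chart_at by (auto intro!: coord_change)

lemma inv_tangent_frame:
  assumes "c \<in> charts M" "x \<in> fst c" "d \<in> charts M" "x \<in> fst d"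
  shows "inv (tangent_frame M c x) \<circ> tangent_frame M d x = coord_change d c x"
  unfolding tangent_frame_def coord_change(4)[OF assms(1,2) chart_at]
  by (rule coord_change(3)[OF assms(3,4) chart_at assms(1,2)])

lemma tderiv_tangent_frame:
  assumes h: "mdiff M h x" and c: "c \<in> charts M" "x \<in> fst c" and d: "d \<in> charts M" "h x \<in> fst d"
  shows "tderiv M h x \<circ> tangent_frame M c x = tangent_frame M d (h x) \<circ> chart_deriv h c d x"
proof -
  have h': "mdiff M h (id x)" and x: "id x \<in> fst (chart_at M x)"
    and hx: "h (id x) \<in> fst (chart_at M (h x))" "id (h x) \<in> fst (chart_at M (h x))"
    using h by (simp_all add: chart_at)
  show ?thesis
    using chart_deriv_comp[OF mdiff_id h' c chart_at(1) x chart_at(1) hx(1)]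
      chart_deriv_comp[OF h mdiff_id c d chart_at(1) hx(2)]
    unfolding tderiv_eq_chart_deriv tangent_frame_def coord_change_eq_chart_deriv id_comp comp_id
    unfolding id_apply
    by (rule trans[OF sym])
qed

lemma linear_tderiv: "mdiff M h x \<Longrightarrow> linear (tderiv M h x)"
  unfolding tderiv_eq_chart_deriv
  by (rule linear_chart_deriv[OF _ chart_at(1) chart_at(1) chart_at(2) chart_at(2)])

lemma tderiv_comp:
  assumes "mdiff M h x" "mdiff M k (h x)"
  shows "tderiv M (k \<circ> h) x = tderiv M k (h x) \<circ> tderiv M h x"
  using chart_deriv_comp[OF assms chart_at chart_at, of "chart_at M (k (h x))"] chart_at
  by (simp add: tderiv_eq_chart_deriv)

lemma tderiv_id: "tderiv M id x = id"
  using chart_deriv_id[OF chart_at] by (simp add: tderiv_eq_chart_deriv)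

lemma tderiv_inverse:
  assumes "mdiff M h x" "mdiff M k (h x)" "open U" "x \<in> U" "\<And>z. z \<in> U \<Longrightarrow> k (h z) = z"
  shows "tderiv M k (h x) \<circ> tderiv M h x = id"
  using chart_deriv_inverse[OF assms chart_at chart_at] assms(4,5)
  by (simp add: tderiv_eq_chart_deriv)

lemma C1_map_on_mdiff:
  assumes "C1_map_on M U h" "open U" "x \<in> U"
  shows "mdiff M h x"
  unfolding mdiff_def
proof (intro conjI ballI impI)
  show "isCont h x" using assms by (auto simp: C1_map_on_def continuous_on_eq_continuous_at)
  fix c d assume "c \<in> charts M" "d \<in> charts M" "x \<in> fst c" "h x \<in> fst d"
  then have "C_k_on 1 (snd c ` (U \<inter> fst c \<inter> h -` fst d)) (snd d \<circ> h \<circ> chart_inv c)"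
    "snd c x \<in> snd c ` (U \<inter> fst c \<inter> h -` fst d)"
    using assms by (auto simp: C1_map_on_def)
  then show "(snd d \<circ> h \<circ> chart_inv c) differentiable at (snd c x)" by auto
qed

lemma continuous_on_chart_deriv:
  assumes "C1_map_on M U h" "open U" "c \<in> charts M" "d \<in> charts M"
  shows "continuous_on (U \<inter> fst c \<inter> h -` fst d) (\<lambda>x. chart_deriv h c d x v)"
proof -
  have "C_k_on 1 (snd c ` (U \<inter> fst c \<inter> h -` fst d)) (snd d \<circ> h \<circ> chart_inv c)"
    using assms by (auto simp: C1_map_on_def)
  then have "continuous_on (snd c ` (U \<inter> fst c \<inter> h -` fst d)) (\<lambda>y. frechet_derivative (snd d \<circ> h \<circ> chart_inv c) (at y) v)"
    by simp
  moreover have "continuous_on (U \<inter> fst c \<inter> h -` fst d) (snd c)"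
    using chart_cont(1)[OF assms(3)] by (rule continuous_on_subset) auto
  ultimately show ?thesis
    unfolding chart_deriv_def by (rule continuous_on_compose2) auto
qed

lemma C1_map_on_id: "C1_map_on M UNIV id"
proof -
  have "C_k_on 1 (snd c ` (fst c \<inter> fst d)) (snd d \<circ> chart_inv c)" if "c \<in> charts M" "d \<in> charts M" for c d
    using M that unfolding smooth_atlas_def by blast
  then show ?thesis by (simp add: C1_map_on_def)
qed

lemma C1_local_diffeo_id: "C1_local_diffeo M id"
  unfolding C1_local_diffeo_def
proof
  fix x
  have "inv_into UNIV (id :: 'a \<Rightarrow> 'a) = id" by (rule inv_id)
  then show "\<exists>U. open U \<and> x \<in> U \<and> open (id ` U) \<and> inj_on id U \<and> C1_map_on M U id \<and> C1_map_on M (id ` U) (inv_into U id)"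
    using C1_map_on_id by (intro exI[of _ UNIV]) simp
qed

lemma C1_local_diffeoE:
  assumes "C1_local_diffeo M h"
  obtains U where "open U" "x \<in> U" "open (h ` U)" "C1_map_on M U h" "C1_map_on M (h ` U) (inv_into U h)"
    "\<And>z. z \<in> U \<Longrightarrow> mdiff M h z" "\<And>z. z \<in> U \<Longrightarrow> mdiff M (inv_into U h) (h z)"
    "\<And>z. z \<in> U \<Longrightarrow> linear (tderiv M h z)" "\<And>z. z \<in> U \<Longrightarrow> bij (tderiv M h z)"
    "\<And>z. z \<in> U \<Longrightarrow> inv (tderiv M h z) = tderiv M (inv_into U h) (h z)"
proof -
  obtain U where U: "open U" "x \<in> U" "open (h ` U)" "inj_on h U" "C1_map_on M U h" "C1_map_on M (h ` U) (inv_into U h)"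
    using assms unfolding C1_local_diffeo_def by blast
  have h: "mdiff M h z" if "z \<in> U" for z by (rule C1_map_on_mdiff[OF U(5,1) that])
  have k: "mdiff M (inv_into U h) (h z)" if "z \<in> U" for z by (rule C1_map_on_mdiff[OF U(6,3)]) (use that in auto)
  have *: "tderiv M (inv_into U h) (h z) \<circ> tderiv M h z = id" "tderiv M h z \<circ> tderiv M (inv_into U h) (h z) = id"
    if z: "z \<in> U" for z
  proof -
    show "tderiv M (inv_into U h) (h z) \<circ> tderiv M h z = id"
      by (rule tderiv_inverse[OF h[OF z] k[OF z] U(1) z]) (simp add: U(4))
    have zz: "inv_into U h (h z) = z" using U(4) z by simp
    have "tderiv M h (inv_into U h (h z)) \<circ> tderiv M (inv_into U h) (h z) = id"
      by (rule tderiv_inverse[OF k[OF z] _ U(3)]) (use h[OF z] zz z in \<open>auto simp: f_inv_into_f\<close>)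
    then show "tderiv M h z \<circ> tderiv M (inv_into U h) (h z) = id" by (simp add: zz)
  qed
  have "bij (tderiv M h z)" "inv (tderiv M h z) = tderiv M (inv_into U h) (h z)" if "z \<in> U" for z
    by (rule o_bij[OF *[OF that]], rule inv_unique_comp[OF *(2,1)[OF that]])
  then show ?thesis using that[OF U(1,2,3,5,6) h k linear_tderiv[OF h]] by blast
qed

lemma C1_local_diffeo_tderiv:
  assumes "C1_local_diffeo M h"
  shows "mdiff M h x" "linear (tderiv M h x)" "bij (tderiv M h x)"
  by (rule C1_local_diffeoE[OF assms, of x]; blast)+

lemma orbit_tderiv:
  assumes f: "\<And>t. C1_local_diffeo M (f t)"
  shows "mdiff M (orbit_map f n \<omega>) x" "bij (tderiv M (orbit_map f n \<omega>) x)"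
    "tderiv M (orbit_map f (Suc n) \<omega>) x = tderiv M (f (\<omega> n)) (orbit_map f n \<omega> x) \<circ> tderiv M (orbit_map f n \<omega>) x"
proof -
  have 1: "mdiff M (orbit_map f n \<omega>) x" for n
  proof (induction n)
    case (Suc n)
    show ?case unfolding orbit_map.simps by (rule mdiff_comp[OF Suc C1_local_diffeo_tderiv(1)[OF f]])
  qed (unfold orbit_map.simps, rule mdiff_id)
  then show "mdiff M (orbit_map f n \<omega>) x" .
  have 2: "tderiv M (orbit_map f (Suc n) \<omega>) x = tderiv M (f (\<omega> n)) (orbit_map f n \<omega> x) \<circ> tderiv M (orbit_map f n \<omega>) x" for n
    unfolding orbit_map.simps by (rule tderiv_comp[OF 1 C1_local_diffeo_tderiv(1)[OF f]])
  then show "tderiv M (orbit_map f (Suc n) \<omega>) x = tderiv M (f (\<omega> n)) (orbit_map f n \<omega> x) \<circ> tderiv M (orbit_map f n \<omega>) x" .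
  show "bij (tderiv M (orbit_map f n \<omega>) x)"
  proof (induction n)
    case 0
    show ?case unfolding orbit_map.simps tderiv_id by (rule bij_id)
  next
    case (Suc n)
    show ?case unfolding 2 by (rule bij_comp[OF Suc C1_local_diffeo_tderiv(3)[OF f]])
  qed
qed

end

section \<open>Orthonormal frames over charts\<close>

lemma continuous_on_linear_apply:
  fixes A :: "'x::topological_space \<Rightarrow> 'e::euclidean_space \<Rightarrow> 'b::real_normed_vector"
  assumes "\<And>v. continuous_on S (\<lambda>x. A x v)" "\<And>x. x \<in> S \<Longrightarrow> linear (A x)" "continuous_on S h"
  shows "continuous_on S (\<lambda>x. A x (h x))"
proof -
  have "continuous_on S (\<lambda>x. \<Sum>i<DIM('e). (h x \<bullet> basis_enum i) *\<^sub>R A x (basis_enum i))"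
    by (intro continuous_intros assms)
  then show ?thesis
    by (rule continuous_on_cong[THEN iffD1, rotated 2])
      (simp_all add: linear_basis_enum_expansion[OF assms(2), symmetric])
qed

lemma continuous_on_inner_product:
  fixes G :: "'x::topological_space \<Rightarrow> 'e::euclidean_space \<Rightarrow> 'e \<Rightarrow> real"
  assumes "\<And>v w. continuous_on S (\<lambda>x. G x v w)" "\<And>x. x \<in> S \<Longrightarrow> inner_product (G x)"
    "continuous_on S h" "continuous_on S k"
  shows "continuous_on S (\<lambda>x. G x (h x) (k x))"
proof (rule continuous_on_linear_apply[where A = "\<lambda>x v. G x v (k x)", OF _ _ assms(3)])
  show "continuous_on S (\<lambda>x. G x v (k x))" for v
    by (rule continuous_on_linear_apply[where A = "\<lambda>x. G x v", OF assms(1) inner_product_linear(1)[OF assms(2)] assms(4)])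
  show "linear (\<lambda>v. G x v (k x))" if "x \<in> S" for x by (rule inner_product_linear(2)[OF assms(2)[OF that]])
qed

lemma continuous_on_gram_schmidt:
  fixes G :: "'x::topological_space \<Rightarrow> 'e::euclidean_space \<Rightarrow> 'e \<Rightarrow> real"
  assumes G: "\<And>v w. continuous_on S (\<lambda>x. G x v w)" "\<And>x. x \<in> S \<Longrightarrow> inner_product (G x)"
  shows "k < DIM('e) \<Longrightarrow> continuous_on S (\<lambda>x. gram_schmidt (G x) basis_enum k)"
proof (induction k rule: less_induct)
  case (less k)
  define u where "u x = basis_enum k - (\<Sum>j<k. G x (basis_enum k) (gram_schmidt (G x) basis_enum j) *\<^sub>R gram_schmidt (G x) basis_enum j)" for x
  have u: "continuous_on S u"
    unfolding u_def using less
    by (intro continuous_intros continuous_on_inner_product[OF G]) auto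
  have "u x \<noteq> 0" if "x \<in> S" for x
    unfolding u_def by (rule gram_schmidt_basis_nonzero(2)[OF G(2)[OF that] less.prems])
  then have "G x (u x) (u x) \<noteq> 0" if "x \<in> S" for x
    using G(2)[OF that] that by (force simp: inner_product_def)
  then have "continuous_on S (\<lambda>x. u x /\<^sub>R sqrt (G x (u x) (u x)))"
    by (intro continuous_intros continuous_on_inner_product[OF G] u) auto
  then show ?case by (subst gram_schmidt.simps) (simp add: Let_def u_def)
qed

text \<open>Local boundedness replaces continuity here: it can be verified near each point with a
  pair of charts adapted to that point.\<close>

lemma locally_bounded_imp_bounded_on_compact:
  fixes \<phi> :: "'x::topological_space \<Rightarrow> real"
  assumes "compact X" and loc: "\<And>x. x \<in> X \<Longrightarrow> \<exists>V K. open V \<and> x \<in> V \<and> (\<forall>y\<in>V. \<phi> y \<le> K)"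
  shows "bdd_above (\<phi> ` X)"
proof -
  obtain V K where V: "\<And>x. x \<in> X \<Longrightarrow> open (V x) \<and> x \<in> V x \<and> (\<forall>y\<in>V x. \<phi> y \<le> K x)"
    using loc by metis
  have "X \<subseteq> (\<Union>x\<in>X. V x)" using V by blast
  then obtain C where C: "C \<subseteq> X" "finite C" "X \<subseteq> (\<Union>x\<in>C. V x)"
    using compactE_image[OF assms(1), of X V] V by metis
  have "\<phi> y \<le> (\<Sum>x\<in>C. \<bar>K x\<bar>)" if y: "y \<in> X" for y
  proof -
    obtain x where x: "x \<in> C" "y \<in> V x" using C(3) y by blast
    have "\<phi> y \<le> \<bar>K x\<bar>" using V[of x] x C(1) by force
    also have "\<dots> \<le> (\<Sum>x\<in>C. \<bar>K x\<bar>)" using x(1) C(2) by (intro member_le_sum) auto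
    finally show ?thesis .
  qed
  then show ?thesis by (auto simp: bdd_above_def)
qed

lemma onorm_le_sum_basis:
  fixes A :: "'e::euclidean_space \<Rightarrow> 'b::real_normed_vector"
  assumes "linear A"
  shows "onorm A \<le> (\<Sum>i<DIM('e). norm (A (basis_enum i)))"
proof (rule onorm_le)
  fix v
  have "norm (A v) \<le> (\<Sum>i<DIM('e). norm ((v \<bullet> basis_enum i) *\<^sub>R A (basis_enum i)))"
    by (subst linear_basis_enum_expansion[OF assms]) (rule norm_sum)
  also have "\<dots> \<le> (\<Sum>i<DIM('e). norm v * norm (A (basis_enum i)))"
  proof (intro sum_mono)
    fix i assume "i \<in> {..<DIM('e)}"
    then have "\<bar>v \<bullet> basis_enum i\<bar> \<le> norm v"
      using Cauchy_Schwarz_ineq2[of v "basis_enum i"] by (simp add: basis_enum_in_Basis)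
    then show "norm ((v \<bullet> basis_enum i) *\<^sub>R A (basis_enum i)) \<le> norm v * norm (A (basis_enum i))"
      by (simp add: mult_right_mono)
  qed
  finally show "norm (A v) \<le> (\<Sum>i<DIM('e). norm (A (basis_enum i))) * norm v"
    by (simp add: sum_distrib_left mult.commute)
qed

text \<open>Coordinates with respect to an orthonormal frame are inner products with the frame
  vectors, so the inverse inherits continuity and measurability from the metric and the
  frame.\<close>

lemma inv_orthonormal_frame:
  assumes g: "inner_product g"
  shows "inv (orthonormal_frame g) u = (\<Sum>i<DIM('e). g u (orthonormal_frame g (basis_enum i)) *\<^sub>R (basis_enum i :: 'e::euclidean_space))"
proof -
  have "g u (orthonormal_frame g b) = inv (orthonormal_frame g) u \<bullet> b" for b
    using orthonormal_frame[OF g, of "inv (orthonormal_frame g) u" b] bij_orthonormal_frame[OF g]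
    by (simp add: bij_is_surj surj_f_inv_f)
  then show ?thesis using basis_enum_expansion[of "inv (orthonormal_frame g) u"] by simp
qed

definition chart_metric :: "('a, 'e::euclidean_space) rmanifold \<Rightarrow> ('a, 'e) chart \<Rightarrow> 'a \<Rightarrow> 'e \<Rightarrow> 'e \<Rightarrow> real" where
  "chart_metric M c x v w = metric M x (tangent_frame M c x v) (tangent_frame M c x w)"

definition chart_frame :: "('a, 'e::euclidean_space) rmanifold \<Rightarrow> ('a, 'e) chart \<Rightarrow> 'a \<Rightarrow> 'e \<Rightarrow> 'e" where
  "chart_frame M c x = orthonormal_frame (chart_metric M c x)"

definition metric_frame :: "('a, 'e::euclidean_space) rmanifold \<Rightarrow> ('a, 'e) chart \<Rightarrow> 'a \<Rightarrow> 'e \<Rightarrow> 'e" where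
  "metric_frame M c x = tangent_frame M c x \<circ> chart_frame M c x"

context
  fixes M :: "('a::{t2_space,second_countable_topology}, 'e::euclidean_space) rmanifold"
  assumes M: "riemannian_manifold M"
begin

lemma riemannian_atlas: "smooth_atlas (charts M)"
  using M by (simp add: riemannian_manifold_def)

lemma inner_product_metric: "inner_product (metric M x)"
  using M by (simp add: riemannian_manifold_def)

lemma inner_product_chart_metric:
  assumes "c \<in> charts M" "x \<in> fst c"
  shows "inner_product (chart_metric M c x)"
proof -
  note tf = tangent_frame[OF riemannian_atlas assms]
  note g = inner_product_metric[of x]
  have "linear (\<lambda>w. chart_metric M c x v w)" "linear (\<lambda>v. chart_metric M c x v w)" for v w
    using linear_compose[OF tf(1) inner_product_linear(1)[OF g]] linear_compose[OF tf(1) inner_product_linear(2)[OF g]]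
    by (auto simp: chart_metric_def comp_def)
  moreover have "chart_metric M c x v v > 0" if "v \<noteq> 0" for v
    using g that linear_bij_zero_iff[OF tf] by (simp add: chart_metric_def inner_product_def)
  moreover have "chart_metric M c x v w = chart_metric M c x w v" for v w
    using g by (simp add: chart_metric_def inner_product_def)
  ultimately show ?thesis by (simp add: inner_product_def bilinear_def)
qed

lemma continuous_on_chart_metric:
  assumes c: "c \<in> charts M"
  shows "continuous_on (fst c) (\<lambda>x. chart_metric M c x v w)"
proof -
  have "C_k_on 0 (snd c ` fst c) (\<lambda>y. let x = chart_inv c y in metric M x (tangent_frame M c x v) (tangent_frame M c x w))"
    using M c unfolding riemannian_manifold_def by blast
  then have "continuous_on (snd c ` fst c) (\<lambda>y. chart_metric M c (chart_inv c y) v w)"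
    by (simp add: chart_metric_def Let_def)
  then have "continuous_on (fst c) (\<lambda>x. chart_metric M c (chart_inv c (snd c x)) v w)"
    by (rule continuous_on_compose2[OF _ chart_cont(1)[OF riemannian_atlas c]]) auto
  then show ?thesis
    by (rule continuous_on_cong[THEN iffD1, rotated 2]) (simp_all add: chart_inv[OF riemannian_atlas c])
qed

lemma chart_frame:
  assumes "c \<in> charts M" "x \<in> fst c"
  shows "linear (chart_frame M c x)" "bij (chart_frame M c x)"
    "chart_metric M c x (chart_frame M c x v) (chart_frame M c x w) = v \<bullet> w"
  unfolding chart_frame_def
  by (intro linear_orthonormal_frame bij_orthonormal_frame orthonormal_frame inner_product_chart_metric assms)+

lemma continuous_on_chart_frame:
  assumes c: "c \<in> charts M"
  shows "continuous_on (fst c) (\<lambda>x. chart_frame M c x v)"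
  unfolding chart_frame_def orthonormal_frame_def
  by (intro continuous_intros continuous_on_gram_schmidt[OF continuous_on_chart_metric[OF c] inner_product_chart_metric[OF c]]) auto

lemma metric_frame:
  assumes "c \<in> charts M" "x \<in> fst c"
  shows "linear (metric_frame M c x)" "bij (metric_frame M c x)"
    "metric M x (metric_frame M c x v) (metric_frame M c x w) = v \<bullet> w"
    "tnorm M x (metric_frame M c x v) = norm v"
proof -
  show "linear (metric_frame M c x)" "bij (metric_frame M c x)"
    unfolding metric_frame_def
    by (intro linear_compose bij_comp chart_frame tangent_frame[OF riemannian_atlas] assms)+
  show *: "metric M x (metric_frame M c x v) (metric_frame M c x w) = v \<bullet> w" for v w
    using chart_frame(3)[OF assms] by (simp add: metric_frame_def chart_metric_def)
  show "tnorm M x (metric_frame M c x v) = norm v"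
    by (simp add: tnorm_def * norm_eq_sqrt_inner)
qed

text \<open>The arbitrary identifications through \<open>chart_at\<close> cancel. What remains lives
  in the fixed charts c and d, so that regularity arguments can reach it.\<close>

lemma metric_frame_tderiv:
  assumes h: "mdiff M h x" and c: "c \<in> charts M" "x \<in> fst c" and d: "d \<in> charts M" "h x \<in> fst d"
  shows "inv (metric_frame M d (h x)) \<circ> tderiv M h x \<circ> metric_frame M c x
    = inv (chart_frame M d (h x)) \<circ> chart_deriv h c d x \<circ> chart_frame M c x"
proof -
  have "inv (metric_frame M d (h x)) = inv (chart_frame M d (h x)) \<circ> inv (tangent_frame M d (h x))"
    unfolding metric_frame_def by (rule o_inv_distrib[OF tangent_frame(2)[OF riemannian_atlas d] chart_frame(2)[OF d]])
  moreover have "inv (tangent_frame M d (h x)) \<circ> (tderiv M h x \<circ> tangent_frame M c x) = chart_deriv h c d x"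
    unfolding tderiv_tangent_frame[OF riemannian_atlas h c d]
    using tangent_frame(2)[OF riemannian_atlas d] by (simp add: fun_eq_iff bij_is_inj inv_f_f)
  ultimately show ?thesis by (simp add: metric_frame_def fun_eq_iff)
qed

text \<open>The norm does not depend on the orthonormal frames in which it is computed. Near the
  given point the frames of two fixed charts are available, and in these the derivative is a
  continuous matrix.\<close>

lemma opnorm_locally_bounded:
  assumes h: "C1_map_on M U h" and U: "open U" "x\<^sub>0 \<in> U"
  obtains V K where "open V" "x\<^sub>0 \<in> V" "V \<subseteq> U"
    "\<And>x. x \<in> V \<Longrightarrow> opnorm_on UNIV (tnorm M x) (tnorm M (h x)) (tderiv M h x) \<le> K"
proof -
  define c where "c = chart_at M x\<^sub>0"
  define d where "d = chart_at M (h x\<^sub>0)"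
  have c: "c \<in> charts M" "x\<^sub>0 \<in> fst c" and d: "d \<in> charts M" "h x\<^sub>0 \<in> fst d"
    using chart_at[OF riemannian_atlas] by (auto simp: c_def d_def)
  define W where "W = U \<inter> fst c \<inter> h -` fst d"
  have cont_h: "continuous_on U h" using h by (simp add: C1_map_on_def)
  have "open (U \<inter> h -` fst d)"
    by (rule continuous_open_preimage[OF cont_h U(1) chart_open(1)[OF riemannian_atlas d(1)]])
  then have "open ((U \<inter> h -` fst d) \<inter> fst c)" using chart_open(1)[OF riemannian_atlas c(1)] by (rule open_Int)
  then have W: "open W" "x\<^sub>0 \<in> W" using U c d by (auto simp: W_def Int_ac)
  define E where "E x v = inv (chart_frame M d (h x)) (chart_deriv h c d x (chart_frame M c x v))" for x v
  have mdiff: "mdiff M h x" if "x \<in> W" for x using C1_map_on_mdiff[OF riemannian_atlas h U(1)] that by (simp add: W_def)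
  have E: "inv (metric_frame M d (h x)) \<circ> tderiv M h x \<circ> metric_frame M c x = E x" if "x \<in> W" for x
    using metric_frame_tderiv[OF mdiff[OF that] c(1) _ d(1)] that by (simp add: W_def E_def fun_eq_iff)
  have lin: "linear (E x)" if "x \<in> W" for x
    unfolding E[OF that, symmetric] using that c d
    by (intro linear_compose linear_inv_bij metric_frame linear_tderiv[OF riemannian_atlas mdiff]) (auto simp: W_def)
  have cont_E: "continuous_on W (\<lambda>x. E x v)" for v
  proof -
    have sub: "continuous_on W (\<lambda>x. k (h x))" if "continuous_on (fst d) k" for k :: "'a \<Rightarrow> 'z::topological_space"
      by (rule continuous_on_compose2[OF that continuous_on_subset[OF cont_h]]) (auto simp: W_def)
    have fr: "continuous_on W (\<lambda>x. chart_frame M c x v)"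
      by (rule continuous_on_subset[OF continuous_on_chart_frame[OF c(1)]]) (auto simp: W_def)
    have cd: "continuous_on W (\<lambda>x. chart_deriv h c d x (chart_frame M c x v))"
    proof (rule continuous_on_linear_apply[OF _ _ fr])
      show "continuous_on W (\<lambda>x. chart_deriv h c d x v)" for v
        unfolding W_def by (rule continuous_on_chart_deriv[OF riemannian_atlas h U(1) c(1) d(1)])
      show "linear (chart_deriv h c d x)" if "x \<in> W" for x
        by (rule linear_chart_deriv[OF mdiff[OF that] c(1) d(1)]) (use that in \<open>auto simp: W_def\<close>)
    qed
    have "continuous_on W (\<lambda>x. \<Sum>i<DIM('e). chart_metric M d (h x) (chart_deriv h c d x (chart_frame M c x v))
        (chart_frame M d (h x) (basis_enum i)) *\<^sub>R (basis_enum i :: 'e))"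
    proof (intro continuous_on_sum continuous_on_scaleR continuous_on_const)
      show "continuous_on W (\<lambda>x. chart_metric M d (h x) (chart_deriv h c d x (chart_frame M c x v))
          (chart_frame M d (h x) (basis_enum i)))" for i
      proof (rule continuous_on_inner_product[where G = "\<lambda>x. chart_metric M d (h x)", OF _ _ cd])
        show "continuous_on W (\<lambda>x. chart_metric M d (h x) v w)" for v w
          by (rule sub[OF continuous_on_chart_metric[OF d(1)]])
        show "continuous_on W (\<lambda>x. chart_frame M d (h x) (basis_enum i))"
          by (rule sub[OF continuous_on_chart_frame[OF d(1)]])
        show "inner_product (chart_metric M d (h x))" if "x \<in> W" for x
          by (rule inner_product_chart_metric[OF d(1)]) (use that in \<open>simp add: W_def\<close>)
      qed
    qed
    then show ?thesis
    proof (rule continuous_on_cong[THEN iffD1, rotated 2])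
      fix x assume "x \<in> W"
      then have "h x \<in> fst d" by (simp add: W_def)
      from inv_orthonormal_frame[OF inner_product_chart_metric[OF d(1) this]]
      show "(\<Sum>i<DIM('e). chart_metric M d (h x) (chart_deriv h c d x (chart_frame M c x v))
        (chart_frame M d (h x) (basis_enum i)) *\<^sub>R (basis_enum i :: 'e)) = E x v"
        by (simp add: E_def chart_frame_def)
    qed simp
  qed
  \<comment> \<open>s is continuous and dominates the norm, so the set where it stays below its
    value at the centre plus one is a suitable neighbourhood.\<close>
  define s where "s x = (\<Sum>i<DIM('e). norm (E x (basis_enum i)))" for x
  have "continuous_on W s" unfolding s_def by (intro continuous_intros cont_E)
  then have "open (W \<inter> s -` {..<s x\<^sub>0 + 1})" by (rule continuous_open_preimage[OF _ W(1)]) simp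
  moreover have "opnorm_on UNIV (tnorm M x) (tnorm M (h x)) (tderiv M h x) \<le> s x\<^sub>0 + 1"
    if x: "x \<in> W \<inter> s -` {..<s x\<^sub>0 + 1}" for x
  proof -
    have xW: "x \<in> W" "x \<in> fst c" "h x \<in> fst d" using x by (auto simp: W_def)
    have "opnorm_on UNIV (tnorm M x) (tnorm M (h x)) (tderiv M h x) = opnorm_on UNIV norm norm (E x)"
      using opnorm_on_frame[OF metric_frame(2)[OF c(1) xW(2)] metric_frame(4)[OF c(1) xW(2)]
          metric_frame(4)[OF d(1) xW(3)] metric_frame(2)[OF d(1) xW(3)], of UNIV "tderiv M h x"]
        bij_imp_bij_inv[OF metric_frame(2)[OF c(1) xW(2)]]
      by (simp add: E[OF xW(1)] bij_is_surj)
    also have "\<dots> \<le> s x" unfolding s_def opnorm_on_UNIV[OF lin[OF xW(1)]] by (rule onorm_le_sum_basis[OF lin[OF xW(1)]])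
    finally show ?thesis using x by simp
  qed
  ultimately show ?thesis
    using that[of "W \<inter> s -` {..<s x\<^sub>0 + 1}"] W by (auto simp: W_def)
qed

text \<open>The suprema in \<open>deriv_sup\<close> and \<open>deriv_inv_sup\<close> dominate the
  norms on X only if they are taken over bounded sets. This is where compactness of X enters. For
  the inverse, the bound for the local inverse near the image point is pulled back by h.\<close>

lemma bdd_above_opnorm:
  assumes h: "C1_local_diffeo M h" and X: "compact X"
  shows "bdd_above ((\<lambda>x. opnorm_on UNIV (tnorm M x) (tnorm M (h x)) (tderiv M h x)) ` X)"
    and "bdd_above ((\<lambda>x. opnorm_on UNIV (tnorm M (h x)) (tnorm M x) (inv (tderiv M h x))) ` X)"
proof -
  show "bdd_above ((\<lambda>x. opnorm_on UNIV (tnorm M x) (tnorm M (h x)) (tderiv M h x)) ` X)"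
  proof (rule locally_bounded_imp_bounded_on_compact[OF X])
    fix x\<^sub>0
    obtain U where U: "open U" "x\<^sub>0 \<in> U" "C1_map_on M U h" using C1_local_diffeoE[OF riemannian_atlas h] by metis
    obtain V K where "open V" "x\<^sub>0 \<in> V" "V \<subseteq> U"
      "\<And>x. x \<in> V \<Longrightarrow> opnorm_on UNIV (tnorm M x) (tnorm M (h x)) (tderiv M h x) \<le> K"
      by (rule opnorm_locally_bounded[OF U(3,1,2)]; rule that; assumption)
    then show "\<exists>V K. open V \<and> x\<^sub>0 \<in> V \<and> (\<forall>x\<in>V. opnorm_on UNIV (tnorm M x) (tnorm M (h x)) (tderiv M h x) \<le> K)"
      by blast
  qed
  show "bdd_above ((\<lambda>x. opnorm_on UNIV (tnorm M (h x)) (tnorm M x) (inv (tderiv M h x))) ` X)"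
  proof (rule locally_bounded_imp_bounded_on_compact[OF X])
    fix x\<^sub>0
    obtain U where U: "open U" "x\<^sub>0 \<in> U" "open (h ` U)" "C1_map_on M U h" "C1_map_on M (h ` U) (inv_into U h)"
      "\<And>z. z \<in> U \<Longrightarrow> inv (tderiv M h z) = tderiv M (inv_into U h) (h z)"
      "inj_on h U"
    proof -
      obtain U where U: "open U" "x\<^sub>0 \<in> U" "open (h ` U)" "inj_on h U" "C1_map_on M U h" "C1_map_on M (h ` U) (inv_into U h)"
        using h unfolding C1_local_diffeo_def by blast
      show ?thesis
      proof (rule that[OF U(1-3,5,6) _ U(4)])
        fix z assume z: "z \<in> U"
        have hz: "mdiff M h z" "mdiff M (inv_into U h) (h z)"
          using C1_map_on_mdiff[OF riemannian_atlas U(5,1) z] C1_map_on_mdiff[OF riemannian_atlas U(6,3), of "h z"] z by auto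
        have "tderiv M (inv_into U h) (h z) \<circ> tderiv M h z = id"
          by (rule tderiv_inverse[OF riemannian_atlas hz U(1) z]) (simp add: U(4))
        moreover have "bij (tderiv M h z)" by (rule C1_local_diffeo_tderiv(3)[OF riemannian_atlas h])
        ultimately show "inv (tderiv M h z) = tderiv M (inv_into U h) (h z)"
          by (metis bij_is_surj comp_id fun.map_comp id_comp surj_iff)
      qed
    qed
    obtain V K where V: "open V" "h x\<^sub>0 \<in> V" "V \<subseteq> h ` U"
      "\<And>y. y \<in> V \<Longrightarrow> opnorm_on UNIV (tnorm M y) (tnorm M (inv_into U h y)) (tderiv M (inv_into U h) y) \<le> K"
      by (rule opnorm_locally_bounded[OF U(5,3) imageI[OF U(2)]]; rule that; assumption)
    have "continuous_on U h" using U(4) by (simp add: C1_map_on_def)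
    then have "open (U \<inter> h -` V)" by (rule continuous_open_preimage[OF _ U(1) V(1)])
    moreover have "opnorm_on UNIV (tnorm M (h x)) (tnorm M x) (inv (tderiv M h x)) \<le> K" if "x \<in> U \<inter> h -` V" for x
      using V(4)[of "h x"] U(6)[of x] U(7) that by simp
    ultimately show "\<exists>V K. open V \<and> x\<^sub>0 \<in> V \<and> (\<forall>x\<in>V. opnorm_on UNIV (tnorm M (h x)) (tnorm M x) (inv (tderiv M h x)) \<le> K)"
      using U(2) V(2) by (intro exI[of _ "U \<inter> h -` V"] exI[of _ K]) auto
  qed
qed

end

section \<open>Measurability of the derivative cocycle\<close>

lemma borel_measurable_if_open:
  fixes g :: "'x::topological_space \<Rightarrow> 'b::topological_space"
  assumes "open S" "open T" "continuous_on (S \<inter> T) g"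
  shows "(\<lambda>x. if x \<in> T then g x else a) \<in> restrict_space borel S \<rightarrow>\<^sub>M borel"
proof -
  have "{x \<in> space (restrict_space borel S). x \<in> T} = S \<inter> T" by (auto simp: space_restrict_space)
  then have T: "{x \<in> space (restrict_space borel S). x \<in> T} \<in> sets (restrict_space borel S)"
    unfolding sets_restrict_space by (metis image_eqI borel_open[OF assms(2)])
  have "restrict_space (restrict_space borel S) {x. x \<in> T} = restrict_space borel (S \<inter> T)"
    using assms(1,2) by (subst restrict_restrict_space) auto
  then have "g \<in> restrict_space (restrict_space borel S) {x. x \<in> T} \<rightarrow>\<^sub>M borel"
    using borel_measurable_continuous_on_restrict[OF assms(3)] by metis
  then show ?thesis
    by (intro measurable_If_restrict_space_iff[OF T, THEN iffD2] conjI measurable_const) simp_all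
qed

lemma borel_measurable_if_open':
  fixes g :: "'x::topological_space \<Rightarrow> 'b::topological_space"
  assumes "open T" "continuous_on T g"
  shows "(\<lambda>x. if x \<in> T then g x else a) \<in> borel \<rightarrow>\<^sub>M borel"
  using borel_measurable_if_open[of UNIV T g a] assms by (simp add: restrict_UNIV)

text \<open>Writes the derivative as a sequential limit of difference quotients, which makes it
  measurable jointly in the parameter t and the point.\<close>

lemma has_derivative_LIMSEQ:
  fixes g :: "'e::euclidean_space \<Rightarrow> 'b::real_normed_vector"
  assumes "(g has_derivative D) (at y)"
  shows "(\<lambda>n. real (Suc n) *\<^sub>R (g (y + v /\<^sub>R real (Suc n)) - g y)) \<longlonglongrightarrow> D v"
proof (cases "v = 0")
  case True
  then show ?thesis using linear_0[OF has_derivative_linear[OF assms]] by simp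
next
  case False
  have lin: "linear D" by (rule has_derivative_linear[OF assms])
  have D: "((\<lambda>h. norm (g (y + h) - g y - D h) / norm h) \<longlongrightarrow> 0) (at 0)"
    using assms by (simp add: has_derivative_at)
  have "(\<lambda>n. v /\<^sub>R real (Suc n)) \<longlonglongrightarrow> 0"
    using tendsto_scaleR[OF LIMSEQ_inverse_real_of_nat tendsto_const[of v]] by simp
  then have "filterlim (\<lambda>n. v /\<^sub>R real (Suc n)) (at 0) sequentially"
    using False by (simp add: filterlim_at)
  from filterlim_compose[OF D this]
  have "(\<lambda>n. norm v * (norm (g (y + v /\<^sub>R real (Suc n)) - g y - D (v /\<^sub>R real (Suc n))) / norm (v /\<^sub>R real (Suc n)))) \<longlonglongrightarrow> norm v * 0"
    by (intro tendsto_mult tendsto_const) simp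
  moreover have "norm v * (norm (g (y + v /\<^sub>R real (Suc n)) - g y - D (v /\<^sub>R real (Suc n))) / norm (v /\<^sub>R real (Suc n)))
      = norm (real (Suc n) *\<^sub>R (g (y + v /\<^sub>R real (Suc n)) - g y) - D v)" for n
  proof -
    have "real (Suc n) *\<^sub>R (g (y + v /\<^sub>R real (Suc n)) - g y) - D v
        = real (Suc n) *\<^sub>R (g (y + v /\<^sub>R real (Suc n)) - g y - D (v /\<^sub>R real (Suc n)))"
      by (simp add: linear_scale[OF lin] scaleR_diff_right)
    moreover have "norm (v /\<^sub>R real (Suc n)) = norm v / real (Suc n)"
      by (simp add: divide_inverse mult.commute del: of_nat_Suc)
    ultimately show ?thesis using False by (simp del: of_nat_Suc)
  qed
  ultimately show ?thesis by (simp add: tendsto_iff dist_norm del: of_nat_Suc)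
qed

text \<open>Every \<open>f t\<close> is a local diffeomorphism. The theorem, which grants this only
  almost surely, is reduced to this case by a change on a null set.\<close>

locale random_diffeos =
  fixes M :: "('a::{t2_space,second_countable_topology}, 'e::euclidean_space) rmanifold"
    and p :: "'t measure" and f :: "'t \<Rightarrow> 'a \<Rightarrow> 'a" and X :: "'a set" and \<mu> :: "'a measure"
  assumes M: "riemannian_manifold M" and prob_p: "prob_space p"
    and measurable_f: "(\<lambda>(t, x). f t x) \<in> p \<Otimes>\<^sub>M borel \<rightarrow>\<^sub>M borel"
    and diffeo: "C1_local_diffeo M (f t)"
    and compact_X: "compact X"
    and log_bound: "(\<integral>\<^sup>+\<omega>. ennreal (log_plus (deriv_sup M X (f (\<omega> 0))) + log_plus (deriv_inv_sup M X (f (\<omega> 0))))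
        \<partial>path_measure p) < \<infinity>"
    and prob_mu: "prob_space \<mu>" and sets_mu: "sets \<mu> = sets borel"
    and mu_X: "emeasure \<mu> X = 1" and stationary_mu: "stationary p f \<mu>"
begin

lemma sm: "smooth_atlas (charts M)"
  by (rule riemannian_atlas[OF M])

lemma sets_pair_mu: "sets (K \<Otimes>\<^sub>M \<mu>) = sets (K \<Otimes>\<^sub>M borel)"
  by (rule sets_pair_measure_cong) (simp_all add: sets_mu)

lemma system: "stationary_system p f \<mu>"
proof (rule stationary_system.intro[OF prob_p prob_mu _ stationary_mu])
  show "(\<lambda>(t, x). f t x) \<in> p \<Otimes>\<^sub>M \<mu> \<rightarrow>\<^sub>M \<mu>"
    using measurable_f measurable_cong_sets[OF sets_pair_mu sets_mu] by blast
qed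

text \<open>Together with \<open>chart_idx\<close> this replaces the arbitrary choice
  \<open>chart_at\<close> by a Borel one: each point uses the first chart of a countable cover that
  contains it.\<close>

definition chart_seq :: "nat \<Rightarrow> ('a, 'e) chart" where
  "chart_seq = (SOME cc. range cc \<subseteq> charts M \<and> (\<Union>n. fst (cc n)) = UNIV)"

lemma chart_seq: "chart_seq n \<in> charts M" "(\<Union>n. fst (chart_seq n)) = UNIV"
proof -
  obtain \<F> where F: "\<F> \<subseteq> fst ` charts M" "countable \<F>" "\<Union>\<F> = \<Union>(fst ` charts M)"
    using Lindelof[of "fst ` charts M"] chart_open(1)[OF sm] by blast
  then obtain \<C> where C: "countable \<C>" "\<C> \<subseteq> charts M" "\<F> = fst ` \<C>"
    using countable_subset_image[of \<F> fst "charts M"] by auto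
  have cov: "(\<Union>c\<in>\<C>. fst c) = UNIV" using F(3) C(3) sm by (simp add: smooth_atlas_def)
  then have "\<C> \<noteq> {}" by auto
  then have r: "range (from_nat_into \<C>) = \<C>" using C(1) by (rule range_from_nat_into)
  then have "range (from_nat_into \<C>) \<subseteq> charts M \<and> (\<Union>n. fst (from_nat_into \<C> n)) = UNIV"
    using C(2) cov by (metis image_image)
  then have "range chart_seq \<subseteq> charts M \<and> (\<Union>n. fst (chart_seq n)) = UNIV"
    unfolding chart_seq_def
    by (rule someI[where P = "\<lambda>cc. range cc \<subseteq> charts M \<and> (\<Union>n. fst (cc n)) = UNIV"])
  then show "chart_seq n \<in> charts M" "(\<Union>n. fst (chart_seq n)) = UNIV" by auto
qed

definition chart_idx :: "'a \<Rightarrow> nat" where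
  "chart_idx x = (LEAST n. x \<in> fst (chart_seq n))"

lemma chart_idx: "x \<in> fst (chart_seq (chart_idx x))"
proof -
  have "\<exists>n. x \<in> fst (chart_seq n)" using chart_seq(2) by blast
  then show ?thesis unfolding chart_idx_def by (rule LeastI_ex)
qed

lemma measurable_chart_idx [measurable]: "chart_idx \<in> borel \<rightarrow>\<^sub>M count_space UNIV"
proof -
  have [measurable]: "fst (chart_seq n) \<in> sets borel" for n
    using chart_open(1)[OF sm chart_seq(1)] by simp
  show ?thesis unfolding chart_idx_def by measurable
qed

definition \<Theta> :: "'a \<Rightarrow> 'e \<Rightarrow> 'e" where
  "\<Theta> x = metric_frame M (chart_seq (chart_idx x)) x"

lemma Theta: "linear (\<Theta> x)" "bij (\<Theta> x)" "metric M x (\<Theta> x v) (\<Theta> x w) = v \<bullet> w" "tnorm M x (\<Theta> x v) = norm v"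
  unfolding \<Theta>_def by (rule metric_frame[OF M chart_seq(1) chart_idx])+

lemma inv_Theta_eq: "inv (\<Theta> x) u = (\<Sum>i<DIM('e). metric M x u (\<Theta> x (basis_enum i)) *\<^sub>R (basis_enum i :: 'e))"
proof -
  have "metric M x u (\<Theta> x b) = inv (\<Theta> x) u \<bullet> b" for b
    using Theta(3)[of x "inv (\<Theta> x) u" b] Theta(2)[of x] by (simp add: bij_is_surj surj_f_inv_f)
  then show ?thesis using basis_enum_expansion[of "inv (\<Theta> x) u"] by simp
qed

lemma continuous_on_coord_change:
  assumes "c \<in> charts M" "d \<in> charts M"
  shows "continuous_on (fst c \<inter> fst d) (\<lambda>x. coord_change c d x v)"
  using continuous_on_chart_deriv[OF sm C1_map_on_id[OF sm] open_UNIV assms, of v]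
  by (simp add: coord_change_eq_chart_deriv)

text \<open>Where the chart index is i, the tangent frames combine to a coordinate change applied to
  the frame of the i-th chart, which is continuous on the overlap. Countably many such pieces make
  up the function.\<close>

lemma measurable_Theta_in:
  assumes c: "c \<in> charts M"
  shows "(\<lambda>x. inv (tangent_frame M c x) (\<Theta> x v)) \<in> borel_measurable (restrict_space borel (fst c))"
proof -
  let ?K = "restrict_space borel (fst c)"
  let ?g = "\<lambda>i x. if x \<in> fst (chart_seq i) then coord_change (chart_seq i) c x (chart_frame M (chart_seq i) x v) else 0"
  have "?g i \<in> borel_measurable ?K" for i
  proof (rule borel_measurable_if_open[OF chart_open(1)[OF sm c] chart_open(1)[OF sm chart_seq(1)]])
    show "continuous_on (fst c \<inter> fst (chart_seq i)) (\<lambda>x. coord_change (chart_seq i) c x (chart_frame M (chart_seq i) x v))"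
    proof (rule continuous_on_linear_apply[where A = "\<lambda>x. coord_change (chart_seq i) c x"])
      show "continuous_on (fst c \<inter> fst (chart_seq i)) (\<lambda>x. coord_change (chart_seq i) c x v)" for v
        using continuous_on_coord_change[OF chart_seq(1) c] by (simp add: Int_commute)
      show "linear (coord_change (chart_seq i) c x)" if "x \<in> fst c \<inter> fst (chart_seq i)" for x
        using that by (intro coord_change(1)[OF sm chart_seq(1) _ c]) auto
      show "continuous_on (fst c \<inter> fst (chart_seq i)) (\<lambda>x. chart_frame M (chart_seq i) x v)"
        by (rule continuous_on_subset[OF continuous_on_chart_frame[OF M chart_seq(1)]]) auto
    qed
  qed
  then have "(\<lambda>x. ?g (chart_idx x) x) \<in> borel_measurable ?K"
    by (rule measurable_compose_countable) (intro measurable_restrict_space1 measurable_chart_idx)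
  then show ?thesis
  proof (rule measurable_cong[THEN iffD1, rotated])
    fix x assume "x \<in> space ?K"
    then have x: "x \<in> fst c" by (simp add: space_restrict_space)
    show "?g (chart_idx x) x = inv (tangent_frame M c x) (\<Theta> x v)"
      using inv_tangent_frame[OF sm c x chart_seq(1) chart_idx, unfolded fun_eq_iff] chart_idx
      by (simp add: \<Theta>_def metric_frame_def)
  qed
qed

lemma measurable_Theta_out:
  assumes c: "c \<in> charts M"
  shows "(\<lambda>x. inv (\<Theta> x) (tangent_frame M c x v)) \<in> borel_measurable (restrict_space borel (fst c))"
proof -
  let ?K = "restrict_space borel (fst c)"
  have "(\<lambda>x. \<Sum>i<DIM('e). chart_metric M c x v (inv (tangent_frame M c x) (\<Theta> x (basis_enum i))) *\<^sub>R (basis_enum i :: 'e)) \<in> borel_measurable ?K"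
  proof (intro borel_measurable_sum borel_measurable_scaleR borel_measurable_const)
    show "(\<lambda>x. chart_metric M c x v (inv (tangent_frame M c x) (\<Theta> x (basis_enum i)))) \<in> borel_measurable ?K" for i
    proof (rule borel_measurable_linear_apply[OF _ _ measurable_Theta_in[OF c]])
      show "(\<lambda>x. chart_metric M c x v w) \<in> borel_measurable ?K" for w
        by (rule borel_measurable_continuous_on_restrict[OF continuous_on_chart_metric[OF M c]])
      show "linear (chart_metric M c x v)" if "x \<in> space ?K" for x
        using that by (intro inner_product_linear(1) inner_product_chart_metric[OF M c]) (simp add: space_restrict_space)
    qed
  qed
  then show ?thesis
  proof (rule measurable_cong[THEN iffD1, rotated])
    fix x assume "x \<in> space ?K"
    then have "x \<in> fst c" by (simp add: space_restrict_space)
    from tangent_frame(2)[OF sm c this]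
    show "(\<Sum>i<DIM('e). chart_metric M c x v (inv (tangent_frame M c x) (\<Theta> x (basis_enum i))) *\<^sub>R (basis_enum i :: 'e))
        = inv (\<Theta> x) (tangent_frame M c x v)"
      by (simp add: inv_Theta_eq chart_metric_def bij_is_surj surj_f_inv_f)
  qed
qed

subsection \<open>The cocycle in the frame\<close>

definition A :: "'t \<Rightarrow> 'a \<Rightarrow> 'e \<Rightarrow> 'e" where
  "A t x = inv (\<Theta> (f t x)) \<circ> tderiv M (f t) x \<circ> \<Theta> x"

lemma linear_A: "linear (A t x)" and bij_A: "bij (A t x)"
  unfolding A_def
  by (intro linear_compose linear_inv_bij Theta C1_local_diffeo_tderiv[OF sm diffeo] bij_comp bij_imp_bij_inv)+

definition dom_space :: "('a, 'e) chart \<Rightarrow> ('a, 'e) chart \<Rightarrow> ('t \<times> 'a) measure" where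
  "dom_space c d = restrict_space (p \<Otimes>\<^sub>M borel) {z. snd z \<in> fst c \<and> f (fst z) (snd z) \<in> fst d}"

lemma measurable_f_fst_snd: "(\<lambda>z. f (fst z) (snd z)) \<in> p \<Otimes>\<^sub>M borel \<rightarrow>\<^sub>M borel"
  using measurable_f by (simp add: case_prod_unfold)

lemma measurable_dom_space:
  "snd \<in> dom_space c d \<rightarrow>\<^sub>M restrict_space borel (fst c)"
  "(\<lambda>z. f (fst z) (snd z)) \<in> dom_space c d \<rightarrow>\<^sub>M restrict_space borel (fst d)"
  unfolding dom_space_def by (intro measurable_restrict_space3 measurable_f_fst_snd; auto)+

lemma measurable_chart_deriv:
  assumes c: "c \<in> charts M" and d: "d \<in> charts M"
  shows "(\<lambda>z. chart_deriv (f (fst z)) c d (snd z) v) \<in> borel_measurable (dom_space c d)"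
proof -
  \<comment> \<open>The chart maps are extended by constants to Borel maps on the whole space. A
    difference quotient with a large step may leave the chart and be meaningless, but eventually it
    stays inside.\<close>
  define sc where "sc x = (if x \<in> fst c then snd c x else 0)" for x
  define ci where "ci y = (if y \<in> snd c ` fst c then chart_inv c y else undefined)" for y
  define sd where "sd x = (if x \<in> fst d then snd d x else 0)" for x
  have [measurable]: "sc \<in> borel \<rightarrow>\<^sub>M borel" "ci \<in> borel \<rightarrow>\<^sub>M borel" "sd \<in> borel \<rightarrow>\<^sub>M borel"
    unfolding sc_def ci_def sd_def
    by (intro borel_measurable_if_open' chart_open[OF sm] chart_cont[OF sm] c d)+
  have [measurable]: "(\<lambda>z. f (fst z) (h z)) \<in> p \<Otimes>\<^sub>M borel \<rightarrow>\<^sub>M borel" if "h \<in> p \<Otimes>\<^sub>M borel \<rightarrow>\<^sub>M borel" for h :: "'t \<times> 'a \<Rightarrow> 'a"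
    using measurable_compose[OF measurable_Pair[OF measurable_fst that] measurable_f] by simp
  define F where "F z y = sd (f (fst z) (ci y))" for z :: "'t \<times> 'a" and y
  have F [measurable]: "(\<lambda>z. F z (h z)) \<in> borel_measurable (p \<Otimes>\<^sub>M borel)" if [measurable]: "h \<in> borel_measurable (p \<Otimes>\<^sub>M borel)" for h :: "'t \<times> 'a \<Rightarrow> 'e"
    unfolding F_def by measurable
  define q where "q n z = real (Suc n) *\<^sub>R (F z (sc (snd z) + v /\<^sub>R real (Suc n)) - F z (sc (snd z)))" for n z
  have "q n \<in> borel_measurable (dom_space c d)" for n
    unfolding dom_space_def q_def[abs_def] by (intro measurable_restrict_space1) measurable
  moreover have "(\<lambda>n. q n z) \<longlonglongrightarrow> chart_deriv (f (fst z)) c d (snd z) v" if "z \<in> space (dom_space c d)" for z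
  proof -
    define t x where "t = fst z" and "x = snd z"
    have x: "x \<in> fst c" "f t x \<in> fst d" using that by (auto simp: dom_space_def space_restrict_space t_def x_def)
    define g where "g = snd d \<circ> f t \<circ> chart_inv c"
    have md: "mdiff M (f t) x" by (rule C1_local_diffeo_tderiv(1)[OF sm diffeo])
    have "\<forall>\<^sub>F z in nhds x. f t z \<in> fst d"
      using mdiffD(1)[OF md] x(2) chart_open(1)[OF sm d]
      by (simp add: isCont_def tendsto_at_iff_tendsto_nhds topological_tendstoD)
    then have "\<forall>\<^sub>F y in nhds (snd c x). f t (chart_inv c y) \<in> fst d" by (rule eventually_chart_inv[OF sm c x(1)])
    moreover have "\<forall>\<^sub>F y in nhds (snd c x). y \<in> snd c ` fst c"
      using chart_open(2)[OF sm c] x(1) by (intro eventually_nhds_in_open) auto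
    ultimately have ev: "\<forall>\<^sub>F y in nhds (snd c x). F z y = g y"
      by eventually_elim (simp add: F_def g_def ci_def sd_def t_def)
    have "(\<lambda>n. snd c x + v /\<^sub>R real (Suc n)) \<longlonglongrightarrow> snd c x + 0 *\<^sub>R v"
      by (intro tendsto_add tendsto_const tendsto_scaleR LIMSEQ_inverse_real_of_nat)
    then have "filterlim (\<lambda>n. snd c x + v /\<^sub>R real (Suc n)) (nhds (snd c x)) sequentially" by simp
    then have "\<forall>\<^sub>F n in sequentially. F z (snd c x + v /\<^sub>R real (Suc n)) = g (snd c x + v /\<^sub>R real (Suc n))"
      using ev by (auto simp: filterlim_iff)
    then have "\<forall>\<^sub>F n in sequentially. real (Suc n) *\<^sub>R (g (snd c x + v /\<^sub>R real (Suc n)) - g (snd c x)) = q n z"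
      by eventually_elim (use x eventually_nhds_x_imp_x[OF ev] in \<open>simp add: q_def sc_def del: of_nat_Suc flip: x_def\<close>)
    then show ?thesis
      using has_derivative_LIMSEQ[OF mdiffD(2)[OF md c d x], of v]
      unfolding g_def[symmetric] t_def[symmetric] x_def[symmetric] by (blast intro: Lim_transform_eventually)
  qed
  ultimately show ?thesis by (rule borel_measurable_LIMSEQ_metric)
qed

text \<open>The frames at x and at f t x come from fixed charts n and m on each set of the countable
  measurable partition by the two chart indices. There \<open>measurable_chart_deriv\<close> and the
  continuity of the chart frames apply.\<close>

lemma measurable_A: "(\<lambda>(t, x). A t x v) \<in> borel_measurable (p \<Otimes>\<^sub>M borel)"
proof -
  define E where "E n m z = inv (chart_frame M (chart_seq m) (f (fst z) (snd z)))
      (chart_deriv (f (fst z)) (chart_seq n) (chart_seq m) (snd z) (chart_frame M (chart_seq n) (snd z) v))" for n m z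
  have E_meas: "E n m \<in> borel_measurable (dom_space (chart_seq n) (chart_seq m))" for n m
  proof -
    define c d where "c = chart_seq n" and "d = chart_seq m"
    have c: "c \<in> charts M" and d: "d \<in> charts M" by (simp_all add: c_def d_def chart_seq(1))
    let ?K = "dom_space c d"
    have dom: "snd z \<in> fst c" "f (fst z) (snd z) \<in> fst d" if "z \<in> space ?K" for z
      using that by (auto simp: dom_space_def space_restrict_space)
    have cd: "(\<lambda>z. chart_deriv (f (fst z)) c d (snd z) (chart_frame M c (snd z) v)) \<in> borel_measurable ?K"
    proof (rule borel_measurable_linear_apply[OF measurable_chart_deriv[OF c d]])
      show "linear (chart_deriv (f (fst z)) c d (snd z))" if "z \<in> space ?K" for z
        by (rule linear_chart_deriv[OF C1_local_diffeo_tderiv(1)[OF sm diffeo] c d dom[OF that]])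
      show "(\<lambda>z. chart_frame M c (snd z) v) \<in> borel_measurable ?K"
        by (rule measurable_compose[OF measurable_dom_space(1)
            borel_measurable_continuous_on_restrict[OF continuous_on_chart_frame[OF M c]]])
    qed
    have fr: "(\<lambda>z. chart_frame M d (f (fst z) (snd z)) w) \<in> borel_measurable ?K" for w
      by (rule measurable_compose[OF measurable_dom_space(2)
          borel_measurable_continuous_on_restrict[OF continuous_on_chart_frame[OF M d]]])
    have "(\<lambda>z. chart_metric M d (f (fst z) (snd z)) (chart_deriv (f (fst z)) c d (snd z) (chart_frame M c (snd z) v))
        (chart_frame M d (f (fst z) (snd z)) w)) \<in> borel_measurable ?K" for w
    proof (rule borel_measurable_linear_apply[where A = "\<lambda>z u. chart_metric M d (f (fst z) (snd z)) u (chart_frame M d (f (fst z) (snd z)) w)", OF _ _ cd])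
      show "linear (\<lambda>u. chart_metric M d (f (fst z) (snd z)) u (chart_frame M d (f (fst z) (snd z)) w))" if "z \<in> space ?K" for z
        by (rule inner_product_linear(2)[OF inner_product_chart_metric[OF M d dom(2)[OF that]]])
      show "(\<lambda>z. chart_metric M d (f (fst z) (snd z)) u (chart_frame M d (f (fst z) (snd z)) w)) \<in> borel_measurable ?K" for u
      proof (rule borel_measurable_linear_apply[where A = "\<lambda>z. chart_metric M d (f (fst z) (snd z)) u", OF _ _ fr])
        show "(\<lambda>z. chart_metric M d (f (fst z) (snd z)) u w) \<in> borel_measurable ?K" for w
          by (rule measurable_compose[OF measurable_dom_space(2)
              borel_measurable_continuous_on_restrict[OF continuous_on_chart_metric[OF M d]]])
        show "linear (chart_metric M d (f (fst z) (snd z)) u)" if "z \<in> space ?K" for z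
          by (rule inner_product_linear(1)[OF inner_product_chart_metric[OF M d dom(2)[OF that]]])
      qed
    qed
    then have "(\<lambda>z. \<Sum>i<DIM('e). chart_metric M d (f (fst z) (snd z)) (chart_deriv (f (fst z)) c d (snd z) (chart_frame M c (snd z) v))
        (chart_frame M d (f (fst z) (snd z)) (basis_enum i)) *\<^sub>R (basis_enum i :: 'e)) \<in> borel_measurable ?K"
      by (intro borel_measurable_sum borel_measurable_scaleR borel_measurable_const)
    then have "E n m \<in> borel_measurable ?K"
    proof (rule measurable_cong[THEN iffD1, rotated])
      fix z assume "z \<in> space ?K"
      from inv_orthonormal_frame[OF inner_product_chart_metric[OF M d dom(2)[OF this]]]
      show "(\<Sum>i<DIM('e). chart_metric M d (f (fst z) (snd z)) (chart_deriv (f (fst z)) c d (snd z) (chart_frame M c (snd z) v))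
        (chart_frame M d (f (fst z) (snd z)) (basis_enum i)) *\<^sub>R (basis_enum i :: 'e)) = E n m z"
        by (simp add: E_def chart_frame_def c_def d_def)
    qed
    then show ?thesis by (simp add: c_def d_def)
  qed
  define G where "G n m = {z. chart_idx (snd z) = n \<and> chart_idx (f (fst z) (snd z)) = m}" for n m
  have "(\<lambda>z. A (fst z) (snd z) v) \<in> borel_measurable (p \<Otimes>\<^sub>M borel)"
  proof (rule measurable_piecewise_restrict[of "range (\<lambda>(n, m). G n m)"])
    show "countable (range (\<lambda>(n, m). G n m))" by simp
    show "space (p \<Otimes>\<^sub>M borel) \<subseteq> \<Union> (range (\<lambda>(n, m). G n m))" by (auto simp: G_def)
    fix W assume "W \<in> range (\<lambda>(n, m). G n m)"
    then obtain n m where W: "W = G n m" by auto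
    note [measurable] = measurable_f_fst_snd
    have "{z \<in> space (p \<Otimes>\<^sub>M borel). chart_idx (snd z) = n \<and> chart_idx (f (fst z) (snd z)) = m} \<in> sets (p \<Otimes>\<^sub>M borel)"
      by measurable
    then show "W \<inter> space (p \<Otimes>\<^sub>M borel) \<in> sets (p \<Otimes>\<^sub>M borel)"
      by (simp add: W G_def Collect_conj_eq Int_ac)
    have sub: "G n m \<subseteq> {z. snd z \<in> fst (chart_seq n) \<and> f (fst z) (snd z) \<in> fst (chart_seq m)}"
      using chart_idx by (auto simp: G_def)
    have "E n m \<in> borel_measurable (restrict_space (p \<Otimes>\<^sub>M borel) W)"
      unfolding W using E_meas[of n m] sub unfolding dom_space_def by (rule measurable_restrict_mono)
    then show "(\<lambda>z. A (fst z) (snd z) v) \<in> borel_measurable (restrict_space (p \<Otimes>\<^sub>M borel) W)"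
    proof (rule measurable_cong[THEN iffD1, rotated])
      fix z assume "z \<in> space (restrict_space (p \<Otimes>\<^sub>M borel) W)"
      then have z: "chart_idx (snd z) = n" "chart_idx (f (fst z) (snd z)) = m"
        by (auto simp: W G_def space_restrict_space)
      show "E n m z = A (fst z) (snd z) v"
        using metric_frame_tderiv[OF M C1_local_diffeo_tderiv(1)[OF sm diffeo] chart_seq(1) chart_idx chart_seq(1) chart_idx,
            of "fst z" "snd z", unfolded fun_eq_iff]
        by (simp add: E_def A_def \<Theta>_def z)
    qed
  qed
  then show ?thesis by (simp add: case_prod_unfold)
qed

end

section \<open>Integrability from the suprema over X, and the contragredient cocycle of the
  derivative\<close>

lemma log_plus_mono: "0 < a \<Longrightarrow> a \<le> b \<Longrightarrow> log_plus a \<le> log_plus b"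
  by (auto simp: log_plus_def max_def)

lemma onorm_inner: "onorm (\<lambda>u. \<xi> \<bullet> u) = norm (\<xi> :: 'e::euclidean_space)"
proof (rule antisym)
  show "onorm (\<lambda>u. \<xi> \<bullet> u) \<le> norm \<xi>"
    by (rule onorm_le) (simp add: Cauchy_Schwarz_ineq2)
  have "norm (\<xi> \<bullet> \<xi>) \<le> onorm (\<lambda>u. \<xi> \<bullet> u) * norm \<xi>" by (rule onorm) (rule bounded_linear_inner_right)
  then have "norm \<xi> * norm \<xi> \<le> onorm (\<lambda>u. \<xi> \<bullet> u) * norm \<xi>"
    by (simp add: power2_norm_eq_inner[symmetric] power2_eq_square)
  then show "norm \<xi> \<le> onorm (\<lambda>u. \<xi> \<bullet> u)"
    by (cases "\<xi> = 0") (auto simp: onorm_pos_le bounded_linear_inner_right)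
qed

context random_diffeos
begin

lemma onorm_A:
  "opnorm_on UNIV (tnorm M x) (tnorm M (f t x)) (tderiv M (f t) x) = onorm (A t x)"
  "opnorm_on UNIV (tnorm M (f t x)) (tnorm M x) (inv (tderiv M (f t) x)) = onorm (inv (A t x))"
proof -
  have surj: "inv (\<Theta> y) ` UNIV = UNIV" for y
    using bij_imp_bij_inv[OF Theta(2)] by (simp add: bij_is_surj)
  have frame: "opnorm_on UNIV (tnorm M y) (tnorm M z) C = opnorm_on UNIV norm norm (inv (\<Theta> z) \<circ> C \<circ> \<Theta> y)" for y z C
    using opnorm_on_frame[where F = "\<Theta> y" and F' = "\<Theta> z" and N = "tnorm M y" and N' = "tnorm M z" and L = UNIV and A = C,
        OF Theta(2) Theta(4) Theta(4) Theta(2)]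
    by (simp add: surj)
  show "opnorm_on UNIV (tnorm M x) (tnorm M (f t x)) (tderiv M (f t) x) = onorm (A t x)"
    unfolding frame A_def[symmetric] by (rule opnorm_on_UNIV[OF linear_A])
  have i: "inv (A t x) = inv (\<Theta> x) \<circ> inv (tderiv M (f t) x) \<circ> \<Theta> (f t x)"
    unfolding A_def
    using C1_local_diffeo_tderiv(3)[OF sm diffeo] Theta(2)
    by (simp add: o_inv_distrib bij_comp bij_imp_bij_inv inv_inv_eq comp_assoc)
  show "opnorm_on UNIV (tnorm M (f t x)) (tnorm M x) (inv (tderiv M (f t) x)) = onorm (inv (A t x))"
    unfolding frame i[symmetric] by (rule opnorm_on_UNIV[OF linear_inv_bij[OF linear_A bij_A]])
qed

lemma onorm_A_le:
  assumes "x \<in> X"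
  shows "onorm (A t x) \<le> deriv_sup M X (f t)" "onorm (inv (A t x)) \<le> deriv_inv_sup M X (f t)"
  using bdd_above_opnorm[OF M diffeo compact_X] assms
  by (auto simp: deriv_sup_def deriv_inv_sup_def onorm_A intro!: cSUP_upper2[OF _ _ order_refl])

definition B :: "'t \<Rightarrow> 'a \<Rightarrow> 'e \<Rightarrow> 'e" where
  "B t x = adjoint (inv (A t x))"

definition \<Theta>' :: "'a \<Rightarrow> 'e \<Rightarrow> 'e" where
  "\<Theta>' x = adjoint (inv (\<Theta> x))"

lemma measurable_A_mu: "(\<lambda>(t, x). A t x v) \<in> borel_measurable (p \<Otimes>\<^sub>M \<mu>)"
  using measurable_A measurable_cong_sets[OF sets_pair_mu refl] by blast

lemma measurable_inv_A: "(\<lambda>(t, x). inv (A t x) v) \<in> borel_measurable (p \<Otimes>\<^sub>M \<mu>)"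
  using borel_measurable_linear_inv[of "\<lambda>z. A (fst z) (snd z)" "p \<Otimes>\<^sub>M \<mu>" v] measurable_A_mu
  by (simp add: case_prod_unfold linear_A bij_A)

lemma AE_X: "AE x in \<mu>. x \<in> X"
proof -
  interpret prob_space \<mu> by (rule prob_mu)
  show ?thesis by (rule AE_prob_1) (simp add: measure_def mu_X)
qed

text \<open>The bound passes through the integrals over \<open>\<omega>\<close> at fixed \<open>x\<close>, by monotonicity. The suprema
  over \<open>X\<close> are not known to be measurable, so they must not be integrated jointly in \<open>\<omega>\<close> and \<open>x\<close>.\<close>

lemma log_integrable:
  "(\<integral>\<^sup>+z. ennreal (case z of (t, x) \<Rightarrow> log_plus (onorm (A t x)) + log_plus (onorm (inv (A t x)))) \<partial>(p \<Otimes>\<^sub>M \<mu>)) < \<infinity>"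
proof -
  interpret S: stationary_system p f \<mu> by (rule system)
  let ?k = "\<lambda>z. ennreal (log_plus (onorm (A (fst z) (snd z))) + log_plus (onorm (inv (A (fst z) (snd z)))))"
  have [measurable]: "(\<lambda>z. onorm (A (fst z) (snd z))) \<in> borel_measurable (p \<Otimes>\<^sub>M \<mu>)"
      "(\<lambda>z. onorm (inv (A (fst z) (snd z)))) \<in> borel_measurable (p \<Otimes>\<^sub>M \<mu>)"
    using measurable_A_mu measurable_inv_A
    by (auto intro!: borel_measurable_onorm linear_inv_bij simp: case_prod_unfold linear_A bij_A)
  have k [measurable]: "?k \<in> borel_measurable (p \<Otimes>\<^sub>M \<mu>)" unfolding log_plus_def by measurable
  let ?K = "\<integral>\<^sup>+\<omega>. ennreal (log_plus (deriv_sup M X (f (\<omega> 0))) + log_plus (deriv_inv_sup M X (f (\<omega> 0)))) \<partial>path_measure p"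
  have "(\<integral>\<^sup>+z. ?k z \<partial>(p \<Otimes>\<^sub>M \<mu>)) = (\<integral>\<^sup>+x. (\<integral>\<^sup>+t. ?k (t, x) \<partial>p) \<partial>\<mu>)"
    by (rule S.PN.nn_integral_snd[symmetric]) (rule k)
  also have "\<dots> \<le> (\<integral>\<^sup>+x. ?K \<partial>\<mu>)"
  proof (rule nn_integral_mono_AE)
    show "AE x in \<mu>. (\<integral>\<^sup>+t. ?k (t, x) \<partial>p) \<le> ?K"
      using AE_X AE_space
    proof eventually_elim
      case (elim x)
      have "(\<lambda>t. ?k (t, x)) \<in> borel_measurable p"
        by (rule measurable_compose[OF _ k]) (use elim(2) in measurable)
      from S.nn_integral_coordinate[OF this, of 0]
      have "(\<integral>\<^sup>+t. ?k (t, x) \<partial>p) = (\<integral>\<^sup>+\<omega>. ?k (\<omega> 0, x) \<partial>path_measure p)" by simp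
      also have "\<dots> \<le> ?K"
        using onorm_A_le[OF elim(1)]
        by (intro nn_integral_mono ennreal_leI add_mono)
          (auto intro!: log_plus_mono onorm_bij_pos linear_A bij_A)
      finally show ?case .
    qed
  qed
  also have "\<dots> = ?K" by (simp add: S.N.emeasure_space_1)
  also have "\<dots> < \<infinity>" by (rule log_bound)
  finally show ?thesis by (simp add: case_prod_unfold)
qed

lemma cocycle_A: "linear_cocycle p f \<mu> A"
  by (intro linear_cocycle.intro system linear_cocycle_axioms.intro linear_A bij_A measurable_A_mu log_integrable)

lemma cocycle_B: "linear_cocycle p f \<mu> B"
proof (intro linear_cocycle.intro system linear_cocycle_axioms.intro)
  show "linear (B t x)" "bij (B t x)" for t x
    unfolding B_def by (intro linear_bij_adjoint_inv linear_A bij_A)+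
  show "(\<lambda>(t, x). B t x v) \<in> borel_measurable (p \<Otimes>\<^sub>M \<mu>)" for v
    using borel_measurable_adjoint[of "\<lambda>z. inv (A (fst z) (snd z))" "p \<Otimes>\<^sub>M \<mu>" v] measurable_inv_A
    by (simp add: case_prod_unfold B_def linear_inv_bij linear_A bij_A)
  have "onorm (B t x) = onorm (inv (A t x))" "onorm (inv (B t x)) = onorm (A t x)" for t x
    by (simp_all add: B_def inv_adjoint_inv linear_A bij_A linear_inv_bij onorm_adjoint)
  then show "(\<integral>\<^sup>+z. ennreal (case z of (t, x) \<Rightarrow> log_plus (onorm (B t x)) + log_plus (onorm (inv (B t x)))) \<partial>(p \<Otimes>\<^sub>M \<mu>)) < \<infinity>"
    using log_integrable by (simp add: add.commute)
qed

lemma framed_A: "framed_cocycle p f \<mu> A M (tangent_frame M) (tnorm M) (tderiv M) \<Theta>"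
proof (intro framed_cocycle.intro cocycle_A framed_cocycle_axioms.intro sets_mu chart_open(1)[OF sm]
    tangent_frame[OF sm] Theta measurable_Theta_in measurable_Theta_out)
  show "(\<Union>c\<in>charts M. fst c) = UNIV" using sm by (simp add: smooth_atlas_def)
  show "tderiv M (f t) x = \<Theta> (f t x) \<circ> A t x \<circ> inv (\<Theta> x)" for t x
    using Theta(2) by (auto simp: A_def fun_eq_iff bij_is_surj surj_f_inv_f)
  show "tderiv M (orbit_map f 0 \<omega>) x = id" for \<omega> x
    unfolding orbit_map.simps by (rule tderiv_id[OF sm])
  show "tderiv M (orbit_map f (Suc n) \<omega>) x = tderiv M (f (\<omega> n)) (orbit_map f n \<omega> x) \<circ> tderiv M (orbit_map f n \<omega>) x" for n \<omega> x
    by (rule orbit_tderiv(3)[OF sm diffeo])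
qed

lemma Theta': "linear (\<Theta>' x)" "bij (\<Theta>' x)" "inv (\<Theta>' x) = adjoint (\<Theta> x)" "conorm M x (\<Theta>' x \<xi>) = norm \<xi>"
proof -
  show "linear (\<Theta>' x)" "bij (\<Theta>' x)"
    unfolding \<Theta>'_def by (intro linear_bij_adjoint_inv Theta)+
  show "inv (\<Theta>' x) = adjoint (\<Theta> x)" unfolding \<Theta>'_def by (rule inv_adjoint_inv[OF Theta(1,2)])
  have inner: "\<Theta>' x \<xi> \<bullet> \<Theta> x u = \<xi> \<bullet> u" for u
    using Theta(2)[of x]
    by (simp add: \<Theta>'_def inner_commute[of "adjoint (inv (\<Theta> x)) \<xi>"] adjoint_works[OF linear_inv_bij[OF Theta(1,2)]]
        bij_is_inj inv_f_f inner_commute)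
  have ball: "{v. tnorm M x v \<le> 1} = \<Theta> x ` {u. norm u \<le> 1}"
  proof (intro equalityI subsetI)
    fix v assume v: "v \<in> {v. tnorm M x v \<le> 1}"
    obtain u where "v = \<Theta> x u" using bij_is_surj[OF Theta(2)] by (rule surjE)
    then show "v \<in> \<Theta> x ` {u. norm u \<le> 1}" using v by (simp add: Theta(4))
  qed (auto simp: Theta(4))
  have "conorm M x (\<Theta>' x \<xi>) = (SUP u\<in>{u. norm u \<le> 1}. norm (\<xi> \<bullet> u))"
    by (simp add: conorm_def ball image_image inner)
  also have "\<dots> = norm \<xi>"
    using SUP_unit_ball_onorm[of "\<lambda>u. \<xi> \<bullet> u"] onorm_inner[of \<xi>] bounded_linear_inner_right[of \<xi>]
    by (simp add: bounded_linear.linear)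
  finally show "conorm M x (\<Theta>' x \<xi>) = norm \<xi>" .
qed

text \<open>All properties are inherited from the tangent side. Inversion and adjunction each
  reverse the order of composition, so the contragredient preserves it.\<close>

lemma framed_B: "framed_cocycle p f \<mu> B M (cotangent_frame M) (conorm M) (coderiv M) \<Theta>'"
proof (intro framed_cocycle.intro cocycle_B framed_cocycle_axioms.intro sets_mu chart_open(1)[OF sm] Theta'(1,2,4))
  show "(\<Union>c\<in>charts M. fst c) = UNIV" using sm by (simp add: smooth_atlas_def)
  show "linear (cotangent_frame M c x)" "bij (cotangent_frame M c x)" if "c \<in> charts M" "x \<in> fst c" for c x
    unfolding cotangent_frame_def by (intro linear_bij_adjoint_inv tangent_frame[OF sm that])+
  fix c v assume c: "c \<in> charts M"
  have "(\<lambda>x. adjoint (inv (\<Theta> x) \<circ> tangent_frame M c x) v) \<in> borel_measurable (restrict_space borel (fst c))"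
    using measurable_Theta_out[OF c]
    by (intro borel_measurable_adjoint) (auto intro!: linear_compose linear_inv_bij Theta tangent_frame[OF sm c] simp: space_restrict_space)
  then show "(\<lambda>x. inv (cotangent_frame M c x) (\<Theta>' x v)) \<in> borel_measurable (restrict_space borel (fst c))"
  proof (rule measurable_cong[THEN iffD1, rotated])
    fix x assume "x \<in> space (restrict_space borel (fst c))"
    then have "x \<in> fst c" by (simp add: space_restrict_space)
    note tf = tangent_frame[OF sm c this]
    show "adjoint (inv (\<Theta> x) \<circ> tangent_frame M c x) v = inv (cotangent_frame M c x) (\<Theta>' x v)"
      unfolding cotangent_frame_def inv_adjoint_inv[OF tf] adjoint_comp[OF linear_inv_bij[OF Theta(1,2)] tf(1)]
      by (simp add: \<Theta>'_def)
  qed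
next
  fix c v assume c: "c \<in> charts M"
  have "(\<lambda>x. adjoint (inv (tangent_frame M c x) \<circ> \<Theta> x) v) \<in> borel_measurable (restrict_space borel (fst c))"
    using measurable_Theta_in[OF c]
    by (intro borel_measurable_adjoint) (auto intro!: linear_compose linear_inv_bij Theta tangent_frame[OF sm c] simp: space_restrict_space)
  then show "(\<lambda>x. inv (\<Theta>' x) (cotangent_frame M c x v)) \<in> borel_measurable (restrict_space borel (fst c))"
  proof (rule measurable_cong[THEN iffD1, rotated])
    fix x assume "x \<in> space (restrict_space borel (fst c))"
    then have "x \<in> fst c" by (simp add: space_restrict_space)
    note tf = tangent_frame[OF sm c this]
    show "adjoint (inv (tangent_frame M c x) \<circ> \<Theta> x) v = inv (\<Theta>' x) (cotangent_frame M c x v)"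
      unfolding cotangent_frame_def Theta'(3) adjoint_comp[OF linear_inv_bij[OF tf] Theta(1)] by simp
  qed
next
  fix t x
  note td = C1_local_diffeo_tderiv(2,3)[OF sm diffeo, of t x]
  have "inv (tderiv M (f t) x) = \<Theta> x \<circ> (inv (A t x) \<circ> inv (\<Theta> (f t x)))"
  proof -
    have "tderiv M (f t) x = \<Theta> (f t x) \<circ> (A t x \<circ> inv (\<Theta> x))"
      using Theta(2) by (auto simp: A_def fun_eq_iff bij_is_surj surj_f_inv_f)
    then show ?thesis
      by (simp add: o_inv_distrib bij_comp bij_A Theta(2) bij_imp_bij_inv inv_inv_eq comp_assoc)
  qed
  then show "coderiv M (f t) x = \<Theta>' (f t x) \<circ> B t x \<circ> inv (\<Theta>' x)"
    by (simp add: coderiv_def inv_adjoint_inv B_def \<Theta>'_def adjoint_comp linear_compose linear_inv_bij Theta linear_A bij_A comp_assoc)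
next
  fix \<omega> x
  have "adjoint (id :: 'e \<Rightarrow> 'e) = id" by (rule adjoint_unique) simp
  then show "coderiv M (orbit_map f 0 \<omega>) x = id"
    unfolding coderiv_def orbit_map.simps tderiv_id[OF sm] inv_id .
  fix n
  let ?o = "orbit_map f n \<omega>"
  note o = orbit_tderiv[where f = f, OF sm diffeo, of n \<omega> x]
  note td = C1_local_diffeo_tderiv(2,3)[OF sm diffeo, of "\<omega> n" "?o x"]
  show "coderiv M (orbit_map f (Suc n) \<omega>) x = coderiv M (f (\<omega> n)) (?o x) \<circ> coderiv M ?o x"
    unfolding coderiv_def o(3) o_inv_distrib[OF td(2) o(2)]
    by (rule adjoint_comp[OF linear_inv_bij[OF linear_tderiv[OF sm o(1)] o(2)] linear_inv_bij[OF td]])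
qed

lemma riemannian: "riemannian_cocycle p f \<mu> A B M \<Theta> \<Theta>'"
  by (intro riemannian_cocycle.intro dual_framed.intro framed_A framed_B dual_framed_axioms.intro
      riemannian_cocycle_axioms.intro B_def \<Theta>'_def Theta(3))

end

section \<open>Modifying the random map on a null set\<close>

text \<open>Q may be non-measurable, as is the case for the property of being a local diffeomorphism
  in general. The first part therefore splits off the initial coordinate and takes sections of a
  null set; the second pulls null sets back along each coordinate.\<close>

lemma AE_path_coordinate_iff:
  assumes p: "prob_space p"
  shows "(AE \<omega> in path_measure p. Q (\<omega> 0)) \<Longrightarrow> (AE t in p. Q t)"
    and "(AE t in p. Q t) \<Longrightarrow> (AE \<omega> in path_measure p. \<forall>n. Q (\<omega> n))"
proof -
  interpret P: prob_space p by (rule p)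
  interpret S: sequence_space p by unfold_locales
  interpret O: prob_space "path_measure p"
    unfolding path_measure_def by (rule S.P.prob_space_axioms)
  interpret PO: pair_prob_space p "path_measure p" ..
  have iter: "path_measure p = distr (p \<Otimes>\<^sub>M path_measure p) (path_measure p) (\<lambda>(s, \<omega>). case_nat s \<omega>)"
    using S.PiM_iter by (simp add: path_measure_def)
  have meas: "(\<lambda>(s, \<omega>). case_nat s \<omega>) \<in> p \<Otimes>\<^sub>M path_measure p \<rightarrow>\<^sub>M path_measure p"
    unfolding path_measure_def by measurable
  show "AE t in p. Q t" if "AE \<omega> in path_measure p. Q (\<omega> 0)"
  proof -
    have "AE \<omega> in distr (p \<Otimes>\<^sub>M path_measure p) (path_measure p) (\<lambda>(s, \<omega>). case_nat s \<omega>). Q (\<omega> 0)"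
      unfolding iter[symmetric] by (rule that)
    from AE_distrD[OF meas this] have "AE z in p \<Otimes>\<^sub>M path_measure p. Q (fst z)"
      by (simp add: case_prod_unfold)
    from PO.AE_pair[OF this] show ?thesis by simp
  qed
  show "AE \<omega> in path_measure p. \<forall>n. Q (\<omega> n)" if "AE t in p. Q t"
  proof (rule AE_all_countable[THEN iffD2], rule allI)
    fix n
    have d: "distr (path_measure p) p (\<lambda>\<omega>. \<omega> n) = p"
      using S.PiM_component[of n] by (simp add: path_measure_def)
    have "AE t in distr (path_measure p) p (\<lambda>\<omega>. \<omega> n). Q t" unfolding d by (rule that)
    then show "AE \<omega> in path_measure p. Q (\<omega> n)"
      by (rule AE_distrD[rotated]) (simp add: path_measure_def)
  qed
qed

lemma orbit_map_cong: "(\<And>n. f (\<omega> n) = g (\<omega> n)) \<Longrightarrow> orbit_map f n \<omega> = orbit_map g n \<omega>"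
proof (induction n)
  case (Suc n)
  show ?case unfolding orbit_map.simps Suc.IH[OF Suc.prems] Suc.prems ..
qed (unfold orbit_map.simps, rule refl)

text \<open>The notions of the theorem see a random map only through its almost sure values along
  sequences: exponents, lifts, growth functions, equators and coequators all coincide for f and g.
  Integrals over completed measures tolerate the change even where the integrands are not known to
  be measurable.\<close>

locale ae_equal_maps =
  fixes p :: "'t measure" and f g :: "'t \<Rightarrow> 'a::{t2_space,second_countable_topology} \<Rightarrow> 'a" and \<mu> :: "'a measure"
  assumes prob_p: "prob_space p" and prob_mu: "prob_space \<mu>"
    and eq: "AE \<omega> in path_measure p. \<forall>n. f (\<omega> n) = g (\<omega> n)"
begin

lemma AE_eq_0: "AE \<omega> in path_measure p. f (\<omega> 0) = g (\<omega> 0)"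
  using eq by eventually_elim blast

lemma AE_pair_eq: "AE z in path_measure p \<Otimes>\<^sub>M \<mu>. \<forall>n. f (fst z n) = g (fst z n)"
proof -
  interpret P: prob_space p by (rule prob_p)
  interpret N: prob_space \<mu> by (rule prob_mu)
  interpret S: sequence_space p by unfold_locales
  interpret O: prob_space "path_measure p"
    unfolding path_measure_def by (rule S.P.prob_space_axioms)
  obtain Z where Z: "{\<omega> \<in> space (path_measure p). \<not> (\<forall>n. f (\<omega> n) = g (\<omega> n))} \<subseteq> Z" "Z \<in> null_sets (path_measure p)"
    using eq unfolding eventually_ae_filter by auto
  have "Z \<times> space \<mu> \<in> null_sets (path_measure p \<Otimes>\<^sub>M \<mu>)"
  proof (rule null_setsI)
    have "emeasure (path_measure p \<Otimes>\<^sub>M \<mu>) (Z \<times> space \<mu>) = emeasure (path_measure p) Z * emeasure \<mu> (space \<mu>)"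
      using Z(2) by (intro N.emeasure_pair_measure_Times sets.top null_setsD2)
    then show "emeasure (path_measure p \<Otimes>\<^sub>M \<mu>) (Z \<times> space \<mu>) = 0" using null_setsD1[OF Z(2)] by simp
  qed (use Z(2) in \<open>intro pair_measureI sets.top null_setsD2\<close>)
  moreover have "{z \<in> space (path_measure p \<Otimes>\<^sub>M \<mu>). \<not> (\<forall>n. f (fst z n) = g (fst z n))} \<subseteq> Z \<times> space \<mu>"
    using Z(1) unfolding space_pair_measure by force
  ultimately show ?thesis by (rule AE_I')
qed

lemma stationary_cong: "stationary p (\<lambda>t. G (f t)) \<nu> \<longleftrightarrow> stationary p (\<lambda>t. G (g t)) \<nu>"
proof -
  have "(\<integral>\<^sup>+\<omega>. emeasure (distr \<nu> \<nu> (G (f (\<omega> 0)))) E \<partial>path_measure p)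
      = (\<integral>\<^sup>+\<omega>. emeasure (distr \<nu> \<nu> (G (g (\<omega> 0)))) E \<partial>path_measure p)" for E
    by (rule nn_integral_cong_AE) (use AE_eq_0 in eventually_elim, simp)
  then show ?thesis by (simp add: stationary_def)
qed

lemma lyapunov_cong: "lyapunov M p f \<mu> i = lyapunov M p g \<mu> i"
proof -
  have "(\<integral>(\<omega>, x). ln (wedge_opnorm k (metric M x) (metric M (orbit_map f n \<omega> x)) (tderiv M (orbit_map f n \<omega>) x))
      \<partial>completion (path_measure p \<Otimes>\<^sub>M \<mu>))
    = (\<integral>(\<omega>, x). ln (wedge_opnorm k (metric M x) (metric M (orbit_map g n \<omega> x)) (tderiv M (orbit_map g n \<omega>) x))
      \<partial>completion (path_measure p \<Otimes>\<^sub>M \<mu>))" for k n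
  proof (rule integral_completion_cong_AE)
    show "AE z in path_measure p \<Otimes>\<^sub>M \<mu>.
        (case z of (\<omega>, x) \<Rightarrow> ln (wedge_opnorm k (metric M x) (metric M (orbit_map f n \<omega> x)) (tderiv M (orbit_map f n \<omega>) x)))
      = (case z of (\<omega>, x) \<Rightarrow> ln (wedge_opnorm k (metric M x) (metric M (orbit_map g n \<omega> x)) (tderiv M (orbit_map g n \<omega>) x)))"
      using AE_pair_eq
    proof eventually_elim
      case (elim z)
      then have "orbit_map f n (fst z) = orbit_map g n (fst z)" by (intro orbit_map_cong) blast
      then show ?case by (simp add: case_prod_unfold)
    qed
  qed
  then show ?thesis by (simp add: lyapunov_def lyap_sum_def)
qed

lemma log_growth_cong: "log_growth N D p f = log_growth N D p g"
proof -
  have "(\<integral>\<omega>. ln (N (f (\<omega> 0) x) (D (f (\<omega> 0)) x v)) \<partial>completion (path_measure p))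
      = (\<integral>\<omega>. ln (N (g (\<omega> 0) x) (D (g (\<omega> 0)) x v)) \<partial>completion (path_measure p))" for x v
    by (rule integral_completion_cong_AE) (use AE_eq_0 in eventually_elim, simp)
  then show ?thesis by (simp add: log_growth_def fun_eq_iff Let_def)
qed

lemma stationary_lifts_cong: "stationary_lifts M \<theta> D p f \<mu> = stationary_lifts M \<theta> D p g \<mu>"
  using stationary_cong[of "proj_map D"] by (simp add: stationary_lifts_def)

lemma irreducible_cong:
  "quasi_irreducible M p f \<mu> \<longleftrightarrow> quasi_irreducible M p g \<mu>"
  "coquasi_irreducible M p f \<mu> \<longleftrightarrow> coquasi_irreducible M p g \<mu>"
  unfolding quasi_irreducible_def coquasi_irreducible_def stationary_lifts_cong log_growth_cong lyapunov_cong[symmetric]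
  by (rule refl)+

lemma invariant_subbundle_cong: "invariant_subbundle D p f \<mu> L \<longleftrightarrow> invariant_subbundle D p g \<mu> L"
proof -
  have "AE z in path_measure p \<Otimes>\<^sub>M \<mu>. (case z of (\<omega>, x) \<Rightarrow> D (f (\<omega> 0)) x ` L x = L (f (\<omega> 0) x))
      \<longleftrightarrow> (case z of (\<omega>, x) \<Rightarrow> D (g (\<omega> 0)) x ` L x = L (g (\<omega> 0) x))"
    using AE_pair_eq by eventually_elim (simp add: case_prod_unfold)
  then show ?thesis unfolding invariant_subbundle_def by (rule eventually_subst)
qed

lemma subbundle_exponent_cong: "subbundle_exponent N D p f \<mu> L = subbundle_exponent N D p g \<mu> L"
proof -
  have "(\<integral>(\<omega>, x). ln (opnorm_on (L x) (N x) (N (orbit_map f n \<omega> x)) (D (orbit_map f n \<omega>) x))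
      \<partial>completion (path_measure p \<Otimes>\<^sub>M \<mu>))
    = (\<integral>(\<omega>, x). ln (opnorm_on (L x) (N x) (N (orbit_map g n \<omega> x)) (D (orbit_map g n \<omega>) x))
      \<partial>completion (path_measure p \<Otimes>\<^sub>M \<mu>))" for n
  proof (rule integral_completion_cong_AE)
    show "AE z in path_measure p \<Otimes>\<^sub>M \<mu>.
        (case z of (\<omega>, x) \<Rightarrow> ln (opnorm_on (L x) (N x) (N (orbit_map f n \<omega> x)) (D (orbit_map f n \<omega>) x)))
      = (case z of (\<omega>, x) \<Rightarrow> ln (opnorm_on (L x) (N x) (N (orbit_map g n \<omega> x)) (D (orbit_map g n \<omega>) x)))"
      using AE_pair_eq
    proof eventually_elim
      case (elim z)
      then have "orbit_map f n (fst z) = orbit_map g n (fst z)" by (intro orbit_map_cong) blast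
      then show ?case by (simp add: case_prod_unfold)
    qed
  qed
  then show ?thesis by (simp add: subbundle_exponent_def)
qed

lemma equator_cong:
  "is_equator M p f X \<mu> L \<longleftrightarrow> is_equator M p g X \<mu> L"
  "is_coequator M p f X \<mu> L \<longleftrightarrow> is_coequator M p g X \<mu> L"
  unfolding is_equator_def is_coequator_def slow_subbundle_def invariant_subbundle_cong subbundle_exponent_cong lyapunov_cong
  by (rule refl)+

end

theorem proposition3:
  fixes M :: "('a::{t2_space,second_countable_topology}, 'e::euclidean_space) rmanifold"
    and p :: "'t measure" and f :: "'t \<Rightarrow> 'a \<Rightarrow> 'a" and X :: "'a set" and \<mu> :: "'a measure"
  assumes "riemannian_manifold M"
    and "prob_space p"
    and "C1_random_map M p f"
    and "compact X"
    and "AE \<omega> in path_measure p. f (\<omega> 0) ` X \<subseteq> X"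
    and "(\<integral>\<^sup>+\<omega>. ennreal (log_plus (deriv_sup M X (f (\<omega> 0))) + log_plus (deriv_inv_sup M X (f (\<omega> 0))))
            \<partial>path_measure p) < \<infinity>"
    and "ergodic_on p f X \<mu>"
  shows "(lyapunov M p f \<mu> 1 = lyapunov M p f \<mu> DIM('e) \<longrightarrow>
            quasi_irreducible M p f \<mu> \<and> coquasi_irreducible M p f \<mu>) \<and>
         (2 \<le> DIM('e) \<and> quasi_irreducible M p f \<mu> \<longrightarrow>
            \<not> (\<exists>L. is_coequator M p f X \<mu> L \<and> (AE x in \<mu>. dim (L x) = DIM('e) - 1))) \<and>
         (2 \<le> DIM('e) \<and> coquasi_irreducible M p f \<mu> \<longrightarrow>
            \<not> (\<exists>L. is_equator M p f X \<mu> L \<and> (AE x in \<mu>. dim (L x) = DIM('e) - 1))) \<and>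
         (DIM('e) = 2 \<longrightarrow> (quasi_irreducible M p f \<mu> \<longleftrightarrow> coquasi_irreducible M p f \<mu>))"
proof -
  have atlas: "smooth_atlas (charts M)" using assms(1) by (simp add: riemannian_manifold_def)
  have f_meas: "case_prod f \<in> p \<Otimes>\<^sub>M borel \<rightarrow>\<^sub>M borel"
    and diffeo: "AE \<omega> in path_measure p. C1_local_diffeo M (f (\<omega> 0))"
    using assms(3) by (auto simp: C1_random_map_def)
  have mu: "sets \<mu> = sets borel" "prob_space \<mu>" "emeasure \<mu> X = 1" "stationary p f \<mu>"
    using assms(7) by (auto simp: ergodic_on_def stationary_on_def)
  have "AE t in p. C1_local_diffeo M (f t)" by (rule AE_path_coordinate_iff(1)[OF assms(2) diffeo])
  then obtain Z where Z: "{t \<in> space p. \<not> C1_local_diffeo M (f t)} \<subseteq> Z" "Z \<in> null_sets p"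
    unfolding eventually_ae_filter by auto
  \<comment> \<open>Z is measurable, so g stays jointly measurable. Parameters outside the space of
    p are also sent to the identity, because the locale asks for a local diffeomorphism at every t
    of the type.\<close>
  define g where "g t = (if t \<in> space p - Z then f t else id)" for t
  have "AE t in p. f t = g t"
    using AE_not_in[OF Z(2)] AE_space by eventually_elim (simp add: g_def)
  then have eq: "AE \<omega> in path_measure p. \<forall>n. f (\<omega> n) = g (\<omega> n)"
    by (rule AE_path_coordinate_iff(2)[OF assms(2)])
  interpret E: ae_equal_maps p f g \<mu>
    by (rule ae_equal_maps.intro[OF assms(2) mu(2) eq])
  interpret R: random_diffeos M p g X \<mu>
  proof (rule random_diffeos.intro[OF assms(1,2) _ _ assms(4) _ mu(2,1,3)])
    have [measurable]: "Z \<in> sets p" using Z(2) by blast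
    have [measurable]: "(\<lambda>z. f (fst z) (snd z)) \<in> p \<Otimes>\<^sub>M borel \<rightarrow>\<^sub>M borel"
      using f_meas by (simp add: case_prod_unfold)
    have "(\<lambda>z. if fst z \<in> space p - Z then f (fst z) (snd z) else snd z) \<in> p \<Otimes>\<^sub>M borel \<rightarrow>\<^sub>M borel"
      by measurable
    then show "(\<lambda>(t, x). g t x) \<in> p \<Otimes>\<^sub>M borel \<rightarrow>\<^sub>M borel"
      by (rule measurable_cong[THEN iffD1, rotated]) (auto simp: g_def)
    show "C1_local_diffeo M (g t)" for t
      using Z(1) C1_local_diffeo_id[OF atlas] by (auto simp: g_def)
    have "(\<integral>\<^sup>+\<omega>. ennreal (log_plus (deriv_sup M X (g (\<omega> 0))) + log_plus (deriv_inv_sup M X (g (\<omega> 0)))) \<partial>path_measure p)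
        = (\<integral>\<^sup>+\<omega>. ennreal (log_plus (deriv_sup M X (f (\<omega> 0))) + log_plus (deriv_inv_sup M X (f (\<omega> 0)))) \<partial>path_measure p)"
      by (rule nn_integral_cong_AE) (use E.AE_eq_0 in eventually_elim, simp)
    then show "(\<integral>\<^sup>+\<omega>. ennreal (log_plus (deriv_sup M X (g (\<omega> 0))) + log_plus (deriv_inv_sup M X (g (\<omega> 0)))) \<partial>path_measure p) < \<infinity>"
      using assms(6) by simp
    show "stationary p g \<mu>" using mu(4) E.stationary_cong[of "\<lambda>h. h" \<mu>] by simp
  qed
  interpret C: riemannian_cocycle p g \<mu> R.A R.B M R.\<Theta> R.\<Theta>' by (rule R.riemannian)
  show ?thesis
    unfolding E.irreducible_cong E.equator_cong E.lyapunov_cong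
    using C.irreducible_if_conformal C.irreducible_iff_dim2 C.no_coequator[OF _ R.AE_X] C.no_equator[OF _ R.AE_X]
    by blast
qed

end
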